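(* Suppose that the Lévy process satisfies, for some $\varepsilon>0$: (a) $\int \max(|x|,|x|^{2+\varepsilon})\,\nu(dx)<\infty$; (b) $x\nu$ has a bounded Lebesgue density and $|\mathcal F[x\nu](u)|\lesssim(1+|u|)^{-1}$; (c) $(1+|u|)^{-1+\varepsilon}\varphi^{-1}(u)\in L^2(\mathbb R)$. Let $\zeta>0$. The centered Gaussian process $\{\mathbb G^\varphi(t)\}_{t:|t|\ge\zeta}$ with covariance $$\Sigma_{t,s}=(i\Delta)^{-2}\int_{\mathbb R}h_t(x)h_s(x)\,P(dx),$$ $$h_t(x)=\mathcal F^{-1}[\varphi^{-1}(-u)\mathcal Fg_t(u)](x)\,ix+\mathcal F^{-1}[(\varphi^{-1})'(-u)\mathcal Fg_t(u)](x),$$ admits a version, still denoted by $\mathbb G^\varphi$, which has almost surely uniformly continuous sample paths for the intrinsic covariance metric of $\mathbb G^\varphi$, and which satisfies $\sup_{t:|t|\ge\zeta}|\mathbb G^\varphi(t)|<\infty$ almost surely.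
   Context: Setting. $(L_t)_{t\ge0}$ is a real-valued Lévy process, $\Delta>0$ is fixed, $P$ is the law of $L_\Delta$ and $\varphi(u)=E[e^{iuL_\Delta}]=e^{\Delta\psi(u)}$ with $\psi(u)=i\gamma u+\int_{\mathbb R\setminus\{0\}}(e^{iux}-1)\,\nu(dx)$, where $\gamma\in\mathbb R$ is the drift and $\nu$ the Lévy measure, $\int(|x|\wedge1)\,\nu(dx)<\infty$. $x\nu$ is the signed measure $x\,\nu(dx)$ and $\varphi^{-1}=1/\varphi$. $\mathcal Ff(u)=\int e^{iux}f(x)\,dx$ (similarly for finite measures; Plancherel extension on $L^2$), $\mathcal F^{-1}$ its inverse. $A\lesssim B$ means $A\le CB$ with a uniform constant. $g_t(x)=x^{-1}\mathbf 1_{(-\infty,t]}(x)$ for $t<0$ and $g_t(x)=x^{-1}\mathbf 1_{[t,\infty)}(x)$ for $t>0$. $i^{-1}h_t$ is real-valued, and $h_t$ is defined Lebesgue-a.e. If $\nu(\mathbb R)=\infty$ then $P$ is absolutely continuous. If $\nu(\mathbb R)<\infty$ then $P$ also has an atom at $\gamma\Delta$, where $h_t(\gamma\Delta)$ is understood as $\frac1{2\pi}\int(\varphi_0^{-1})'(-u)\mathcal Fg_t(u)\,du$ with $\varphi_0(u)=e^{-i\gamma\Delta u}\varphi(u)$. The intrinsic covariance metric of a Gaussian process $\mathbb G$ on an index set $T$ is $d(s,t)=(E(\mathbb G(s)-\mathbb G(t))^2)^{1/2}$. *)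

theory Defs
  imports "HOL-Probability.Probability"
begin

section \<open>The Fourier transform on \<open>L\<^sup>2(\<real>)\<close>\<close>

definition fourier :: "(real \<Rightarrow> complex) \<Rightarrow> real \<Rightarrow> complex" where
  "fourier f u = (\<integral>x. iexp (u * x) * f x \<partial>lborel)"

definition square_integrable :: "(real \<Rightarrow> complex) \<Rightarrow> bool" where
  "square_integrable f \<longleftrightarrow>
     f \<in> borel_measurable lborel \<and> integrable lborel (\<lambda>x. (cmod (f x))\<^sup>2)"

(* Stated with the nonnegative integral, so that a difference outside L2 counts as infinite
   instead of getting the default value 0 of the Bochner integral. *)
definition tendsto_L2 :: "(nat \<Rightarrow> real \<Rightarrow> complex) \<Rightarrow> (real \<Rightarrow> complex) \<Rightarrow> bool" where
  "tendsto_L2 f g \<longleftrightarrow>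
     (\<lambda>n. \<integral>\<^sup>+x. ennreal ((cmod (f n x - g x))\<^sup>2) \<partial>lborel) \<longlonglongrightarrow> 0"

(* Plancherel extension: the closure, in L2 x L2, of the graph of the Fourier transform on the
   intersection of L1 and L2.  F is determined by f up to Lebesgue null sets, and vice versa. *)
definition is_L2_fourier :: "(real \<Rightarrow> complex) \<Rightarrow> (real \<Rightarrow> complex) \<Rightarrow> bool" where
  "is_L2_fourier f F \<longleftrightarrow> square_integrable f \<and> square_integrable F \<and>
     (\<exists>fn. (\<forall>n. integrable lborel (fn n) \<and> square_integrable (fn n)) \<and>
           tendsto_L2 fn f \<and> tendsto_L2 (\<lambda>n. fourier (fn n)) F)"

(* Both functions below select an arbitrary representative of an almost-everywhere class. *)
definition L2_fourier :: "(real \<Rightarrow> complex) \<Rightarrow> real \<Rightarrow> complex" where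
  "L2_fourier f = (SOME F. is_L2_fourier f F)"

definition L2_fourier_inv :: "(real \<Rightarrow> complex) \<Rightarrow> real \<Rightarrow> complex" where
  "L2_fourier_inv F = (SOME f. is_L2_fourier f F)"

section \<open>Levy processes and Levy measures\<close>

(* Cadlag paths are not required; stochastic continuity is. *)
definition levy_process :: "'a measure \<Rightarrow> (real \<Rightarrow> 'a \<Rightarrow> real) \<Rightarrow> bool" where
  "levy_process \<Omega> L \<longleftrightarrow>
     prob_space \<Omega> \<and>
     (\<forall>t\<ge>0. L t \<in> borel_measurable \<Omega>) \<and>
     (AE \<omega> in \<Omega>. L 0 \<omega> = 0) \<and>
     (\<forall>(n::nat) (\<tau>::nat \<Rightarrow> real). 0 \<le> \<tau> 0 \<and> (\<forall>i<n. \<tau> i \<le> \<tau> (Suc i)) \<longrightarrow>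
        prob_space.indep_vars \<Omega> (\<lambda>_. borel) (\<lambda>i \<omega>. L (\<tau> (Suc i)) \<omega> - L (\<tau> i) \<omega>) {..<n}) \<and>
     (\<forall>s\<ge>0. \<forall>t\<ge>0. distr \<Omega> borel (\<lambda>\<omega>. L (s + t) \<omega> - L s \<omega>) = distr \<Omega> borel (L t)) \<and>
     (\<forall>s\<ge>0. \<forall>e>0.
        ((\<lambda>t. measure \<Omega> {\<omega> \<in> space \<Omega>. e < \<bar>L t \<omega> - L s \<omega>\<bar>}) \<longlongrightarrow> 0) (at s within {0..}))"

(* A Levy measure lives on the punctured line, encoded as a Borel measure on the whole line
   without mass at 0. *)
definition levy_measure_fv :: "real measure \<Rightarrow> bool" where
  "levy_measure_fv \<nu> \<longleftrightarrow>
     sets \<nu> = sets borel \<and> emeasure \<nu> {0} = 0 \<and> integrable \<nu> (\<lambda>x. min \<bar>x\<bar> 1)"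

definition levy_exponent :: "real \<Rightarrow> real measure \<Rightarrow> real \<Rightarrow> complex" where
  "levy_exponent \<gamma> \<nu> u = \<i> * \<gamma> * u + (\<integral>x. (iexp (u * x) - 1) \<partial>\<nu>)"

(* k is a Lebesgue density of the finite signed measure x \<nu>(dx). *)
definition xnu_density :: "real measure \<Rightarrow> (real \<Rightarrow> real) \<Rightarrow> bool" where
  "xnu_density \<nu> k \<longleftrightarrow> integrable lborel k \<and>
     (\<forall>A\<in>sets borel. (\<integral>x\<in>A. x \<partial>\<nu>) = (\<integral>x\<in>A. k x \<partial>lborel))"

definition fourier_xnu :: "real measure \<Rightarrow> real \<Rightarrow> complex" where
  "fourier_xnu \<nu> u = (\<integral>x. iexp (u * x) * complex_of_real x \<partial>\<nu>)"

section \<open>The functions defining the covariance\<close>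

definition g_fun :: "real \<Rightarrow> real \<Rightarrow> complex" where
  "g_fun t x = (if t < 0 then complex_of_real (indicator {..t} x / x)
                else if t > 0 then complex_of_real (indicator {t..} x / x) else 0)"

definition inv_char :: "real measure \<Rightarrow> real \<Rightarrow> complex" where
  "inv_char P u = inverse (char P u)"

(* Reciprocal of the characteristic function of P translated by -a. *)
definition inv_char_shift :: "real measure \<Rightarrow> real \<Rightarrow> real \<Rightarrow> complex" where
  "inv_char_shift P a u = inverse (iexp (- a * u) * char P u)"

definition cderiv :: "(real \<Rightarrow> complex) \<Rightarrow> real \<Rightarrow> complex" where
  "cderiv f u = vector_derivative f (at u)"

(* For finite \<nu> the law P has an atom at \<gamma> \<Delta>, so there the value is fixed explicitly; elsewhere
   only the almost-everywhere class matters, P being absolutely continuous off that atom. *)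
definition h_fun :: "real measure \<Rightarrow> real \<Rightarrow> real \<Rightarrow> real measure \<Rightarrow> real \<Rightarrow> real \<Rightarrow> complex" where
  "h_fun P \<Delta> \<gamma> \<nu> t x =
     (if emeasure \<nu> UNIV < \<infinity> \<and> x = \<gamma> * \<Delta>
      then 1 / (2 * pi) *
           (\<integral>u. cderiv (inv_char_shift P (\<gamma> * \<Delta>)) (- u) * L2_fourier (g_fun t) u \<partial>lborel)
      else L2_fourier_inv (\<lambda>u. inv_char P (- u) * L2_fourier (g_fun t) u) x * (\<i> * x)
           + L2_fourier_inv (\<lambda>u. cderiv (inv_char P) (- u) * L2_fourier (g_fun t) u) x)"

definition Sigma_cov ::
    "real measure \<Rightarrow> real \<Rightarrow> real \<Rightarrow> real measure \<Rightarrow> real \<Rightarrow> real \<Rightarrow> complex" where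
  "Sigma_cov P \<Delta> \<gamma> \<nu> t s =
     inverse ((\<i> * \<Delta>)\<^sup>2) * (\<integral>x. h_fun P \<Delta> \<gamma> \<nu> t x * h_fun P \<Delta> \<gamma> \<nu> s x \<partial>P)"

section \<open>Gaussian processes\<close>

(* Zero variance is allowed: normal_density with \<sigma> = 0 is not a Dirac mass. *)
definition gaussian_law :: "real \<Rightarrow> real \<Rightarrow> real measure" where
  "gaussian_law \<mu> \<sigma> =
     (if \<sigma> = 0 then return borel \<mu> else density lborel (\<lambda>x. ennreal (normal_density \<mu> \<sigma> x)))"

definition centered_gaussian_process ::
    "'b measure \<Rightarrow> 'i set \<Rightarrow> ('i \<Rightarrow> 'b \<Rightarrow> real) \<Rightarrow> bool" where
  "centered_gaussian_process M T G \<longleftrightarrow>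
     prob_space M \<and>
     (\<forall>t\<in>T. G t \<in> borel_measurable M) \<and>
     (\<forall>J c. finite J \<and> J \<subseteq> T \<longrightarrow>
        (\<exists>\<mu> \<sigma>. 0 \<le> \<sigma> \<and> distr M borel (\<lambda>\<omega>. \<Sum>j\<in>J. c j * G j \<omega>) = gaussian_law \<mu> \<sigma>)) \<and>
     (\<forall>t\<in>T. (\<integral>\<omega>. G t \<omega> \<partial>M) = 0)"

definition version_of ::
    "'b measure \<Rightarrow> 'i set \<Rightarrow> ('i \<Rightarrow> 'b \<Rightarrow> real) \<Rightarrow> ('i \<Rightarrow> 'b \<Rightarrow> real) \<Rightarrow> bool" where
  "version_of M T G G' \<longleftrightarrow>
     (\<forall>t\<in>T. G' t \<in> borel_measurable M \<and> (AE \<omega> in M. G' t \<omega> = G t \<omega>))"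

definition intrinsic_dist :: "'b measure \<Rightarrow> ('i \<Rightarrow> 'b \<Rightarrow> real) \<Rightarrow> 'i \<Rightarrow> 'i \<Rightarrow> real" where
  "intrinsic_dist M G s t = sqrt (\<integral>\<omega>. (G s \<omega> - G t \<omega>)\<^sup>2 \<partial>M)"

(* d is only a pseudometric in general, so the library's metric spaces do not apply. *)
definition unif_cont_wrt :: "('i \<Rightarrow> 'i \<Rightarrow> real) \<Rightarrow> 'i set \<Rightarrow> ('i \<Rightarrow> real) \<Rightarrow> bool" where
  "unif_cont_wrt d T f \<longleftrightarrow>
     (\<forall>e>0. \<exists>\<delta>>0. \<forall>s\<in>T. \<forall>t\<in>T. d s t < \<delta> \<longrightarrow> \<bar>f s - f t\<bar> < e)"

end

theory Submission imports Defs
begin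

text \<open>
  Let \<open>P\<^sub>0\<close> and \<open>\<phi>\<^sub>0\<close> be \<open>P\<close> translated by \<open>- \<gamma> \<Delta>\<close> and its characteristic function, and
  \<open>m(u) = 1 / \<phi>\<^sub>0(-u)\<close>. Since \<open>x g\<^sub>t(x)\<close> is an indicator, an integration by parts on the Fourier side
  gives \<open>h\<^sub>t(y + \<gamma> \<Delta>) = i y g\<^sub>t(y) - sgn t Q(y - t)\<close> for almost every \<open>y\<close>, where \<open>Q\<close> is the
  inverse transform of \<open>q(u) = (m(u) - 1) / u\<close>. As \<open>q\<close> is square integrable with the weight
  \<open>(1 + |u|)\<^sup>a\<close> for small \<open>a\<close>, the translates of \<open>Q\<close> are Hoelder continuous in the
  \<open>L\<^sup>2\<close> norm, and as \<open>q'\<close> is integrable, \<open>y Q(y)\<close> is bounded.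

  The identity \<open>\<phi>\<^sub>0' = i \<Delta> F[x \<nu>] \<phi>\<^sub>0\<close> says that \<open>x P\<^sub>0(dx)\<close> is \<open>\<Delta>\<close> times the convolution of
  \<open>x \<nu>(dx)\<close> and \<open>P\<^sub>0\<close>, so \<open>P\<^sub>0\<close> has a bounded density away from the origin; near the origin
  \<open>Q(y - t)\<close> is small and smooth because \<open>|t| \<ge> \<zeta>\<close>. Hence the increment over \<open>[s, t]\<close> has
  variance of order \<open>|t - s|\<^sup>2\<^sup>a\<close>, and the variance at \<open>t\<close> is of order \<open>1 / |t|\<close>. In the coordinate
  \<open>1 / t\<close>, in which the two points at infinity become one, both bounds combine to a Hoelder condition
  on a compact interval. Kolmogorov's chaining argument yields a continuous version, and
  compactness turns this into uniform continuity for the intrinsic metric.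
\<close>


section \<open>The Plancherel theorem\<close>

text \<open>The translation is there because a drift c would add to (1/phi)' a term of the size of
  1/phi, without decay. That term cancels against the part i c of i x = i (y + c); what remains is
  m', which gains a factor 1 / (1 + |u|) from the decay of F[x nu]. Since g_t is not integrable, its
  transform is only an L2 class, so the integration by parts is done with g_t cut off at n and
  frequencies cut off at U, letting n and then U tend to infinity. The constant 1 is subtracted from
  m to remove the pole of m(u) / u at 0; its own contribution is g_t. The origin is the obstacle.
  P_0 may have an atom there, or an unbounded density, so near 0 an L2 bound on Q says nothing and a
  pointwise bound must replace it, which is what the integrability of q' provides. As h_t has a
  prescribed value at the atom, Q must be a concrete function and not a class. The exponent a is at
  most 1/4 because the coordinate 1/t turns |t - s|^(2a) near infinity into the power 2a(1 - 2a) of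
  |1/t - 1/s|, and this is at least a only for such a.\<close>

lemma integrable_translate:
  fixes f :: "real \<Rightarrow> 'b::{banach,second_countable_topology}"
  assumes "integrable lborel f"
  shows "integrable lborel (\<lambda>x. f (x + h))"
  using lborel_integrable_real_affine[OF assms, of 1 h] by (simp add: add.commute)

lemma integral_translate:
  fixes f :: "real \<Rightarrow> 'b::{banach,second_countable_topology}"
  shows "(\<integral>x. f (x + h) \<partial>lborel) = (\<integral>x. f x \<partial>lborel)"
  using lborel_integral_real_affine[of 1 f h] by (simp add: add.commute)

(* Scheffe's argument: both translates have the same mass, and the positive part of the
   difference is dominated by the indicator itself. *)
lemma L1_continuous_translation_open:
  fixes U :: "real set" and c :: "'b::{banach,second_countable_topology}"
  assumes U: "open U" "emeasure lborel U < \<infinity>" and h: "h \<longlonglongrightarrow> (0::real)"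
  shows "(\<lambda>n. \<integral>x. \<bar>indicator U (x + h n) - indicator U x :: real\<bar> \<partial>lborel) \<longlonglongrightarrow> 0"
proof -
  let ?i = "indicator U :: real \<Rightarrow> real"
  have [measurable]: "U \<in> sets borel" using U by auto
  have int: "integrable lborel ?i" using U by simp
  have inth: "integrable lborel (\<lambda>x. ?i (x + k))" for k by (rule integrable_translate[OF int])
  have "(\<lambda>n. \<integral>x. max 0 (?i x - ?i (x + h n)) \<partial>lborel) \<longlonglongrightarrow> (\<integral>x. 0 \<partial>(lborel::real measure))"
  proof (rule integral_dominated_convergence[where w = ?i])
    show "AE x in lborel. (\<lambda>n. max 0 (?i x - ?i (x + h n))) \<longlonglongrightarrow> 0"
    proof (rule AE_I2)
      fix x :: real
      show "(\<lambda>n. max 0 (?i x - ?i (x + h n))) \<longlonglongrightarrow> 0"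
      proof (cases "x \<in> U")
        case True
        have "(\<lambda>n. x + h n) \<longlonglongrightarrow> x" using tendsto_add[OF tendsto_const h, of x] by simp
        then have "eventually (\<lambda>n. x + h n \<in> U) sequentially"
          using U(1) True by (rule topological_tendstoD)
        then have "eventually (\<lambda>n. max 0 (?i x - ?i (x + h n)) = 0) sequentially"
          by eventually_elim (simp add: True)
        then show ?thesis by (rule tendsto_eventually)
      next
        case False
        then have "max 0 (?i x - ?i (x + h n)) = 0" for n by (simp add: max_def indicator_def)
        then show ?thesis by simp
      qed
    qed
  qed (use int in \<open>auto simp: indicator_def\<close>)
  moreover have "(\<integral>x. \<bar>?i (x + h n) - ?i x\<bar> \<partial>lborel) = 2 * (\<integral>x. max 0 (?i x - ?i (x + h n)) \<partial>lborel)" for n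
  proof -
    have m: "integrable lborel (\<lambda>x. max 0 (?i x - ?i (x + h n)))"
      using int inth by (intro integrable_max) auto
    have "(\<integral>x. \<bar>?i (x + h n) - ?i x\<bar> \<partial>lborel) =
      (\<integral>x. 2 * max 0 (?i x - ?i (x + h n)) + (?i (x + h n) - ?i x) \<partial>lborel)"
      by (rule Bochner_Integration.integral_cong) (auto simp: max_def abs_if)
    also have "\<dots> = 2 * (\<integral>x. max 0 (?i x - ?i (x + h n)) \<partial>lborel)"
      using m int inth integral_translate[of ?i "h n"] by simp
    finally show ?thesis .
  qed
  ultimately show ?thesis using tendsto_mult[OF tendsto_const, of _ 0 _ 2] by fastforce
qed

lemma L1_translate_triangle:
  fixes f g :: "real \<Rightarrow> 'b::{banach,second_countable_topology}"
  assumes f: "integrable lborel f" and g: "integrable lborel g"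
  shows "(\<integral>x. norm (f (x + h) - f x) \<partial>lborel) \<le>
    2 * (\<integral>x. norm (f x - g x) \<partial>lborel) + (\<integral>x. norm (g (x + h) - g x) \<partial>lborel)"
proof -
  have i: "integrable lborel (\<lambda>x. norm (f x - g x))" "integrable lborel (\<lambda>x. norm (g (x + h) - g x))"
     "integrable lborel (\<lambda>x. norm (f (x + h) - g (x + h)))"
     "integrable lborel (\<lambda>x. norm (f (x + h) - f x))"
    using f g by (auto intro!: integrable_norm Bochner_Integration.integrable_diff integrable_translate)
  have "(\<integral>x. norm (f (x + h) - f x) \<partial>lborel) \<le>
     (\<integral>x. norm (f (x + h) - g (x + h)) + norm (f x - g x) + norm (g (x + h) - g x) \<partial>lborel)"
  proof (rule integral_mono)
    fix x
    have "f (x + h) - f x = (f (x + h) - g (x + h)) - (f x - g x) + (g (x + h) - g x)" by simp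
    then have "norm (f (x + h) - f x) \<le> norm ((f (x + h) - g (x + h)) - (f x - g x)) + norm (g (x + h) - g x)"
      using norm_triangle_ineq[of "(f (x + h) - g (x + h)) - (f x - g x)" "g (x + h) - g x"] by simp
    then show "norm (f (x + h) - f x) \<le> norm (f (x + h) - g (x + h)) + norm (f x - g x) + norm (g (x + h) - g x)"
      using norm_triangle_ineq4[of "f (x + h) - g (x + h)" "f x - g x"] by linarith
  qed (use i in auto)
  also have "\<dots> = (\<integral>x. norm (f (x + h) - g (x + h)) \<partial>lborel) + (\<integral>x. norm (f x - g x) \<partial>lborel) + (\<integral>x. norm (g (x + h) - g x) \<partial>lborel)"
    using i by simp
  also have "(\<integral>x. norm (f (x + h) - g (x + h)) \<partial>lborel) = (\<integral>x. norm (f x - g x) \<partial>lborel)"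
    by (rule integral_translate[of "\<lambda>x. norm (f x - g x)"])
  finally show ?thesis by simp
qed

text \<open>Translation preserves the L1 norm, so a translate is exactly as far from its approximant
  as the function itself. Hence the functions whose translates along the fixed sequence
  \<open>h\<close> return to them form a closed set in L1.\<close>

lemma L1_translation_approx:
  fixes f :: "real \<Rightarrow> 'b::{banach,second_countable_topology}"
  assumes f: "integrable lborel f"
    and app: "\<And>e. e > 0 \<Longrightarrow> \<exists>g. integrable lborel g \<and> (\<integral>x. norm (f x - g x) \<partial>lborel) < e \<and>
          (\<lambda>n. \<integral>x. norm (g (x + h n) - g x) \<partial>lborel) \<longlonglongrightarrow> 0"
  shows "(\<lambda>n. \<integral>x. norm (f (x + h n) - f x) \<partial>lborel) \<longlonglongrightarrow> 0"
proof (rule LIMSEQ_I)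
  fix e :: real assume e: "e > 0"
  then obtain g where g: "integrable lborel g" "(\<integral>x. norm (f x - g x) \<partial>lborel) < e / 3"
    "(\<lambda>n. \<integral>x. norm (g (x + h n) - g x) \<partial>lborel) \<longlonglongrightarrow> 0" using app[of "e/3"] by auto
  obtain N where N: "\<And>n. n \<ge> N \<Longrightarrow> norm ((\<integral>x. norm (g (x + h n) - g x) \<partial>lborel) - 0) < e / 3"
    using LIMSEQ_D[OF g(3), of "e/3"] e by auto
  have "norm ((\<integral>x. norm (f (x + h n) - f x) \<partial>lborel) - 0) < e" if "n \<ge> N" for n
    using L1_translate_triangle[OF f g(1), of "h n"] N[OF that] g(2) by simp
  then show "\<exists>N. \<forall>n\<ge>N. norm ((\<integral>x. norm (f (x + h n) - f x) \<partial>lborel) - 0) < e" by blast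
qed

text \<open>Induction over integrable functions: measurable sets are reduced to open supersets by
  outer regularity, sums to the triangle inequality, and limits to the closedness in L1 shown
  above.\<close>

lemma L1_continuous_translation:
  fixes f :: "real \<Rightarrow> 'b::{banach,second_countable_topology}"
  assumes f: "integrable lborel f" and h: "h \<longlonglongrightarrow> (0::real)"
  shows "(\<lambda>n. \<integral>x. norm (f (x + h n) - f x) \<partial>lborel) \<longlonglongrightarrow> 0"
  using f
proof (induction rule: integrable_induct)
  case (base A c)
  then have [measurable]: "A \<in> sets borel" by simp
  have intA: "integrable lborel (indicator A :: real \<Rightarrow> real)" using base by simp
  have "(\<lambda>n. \<integral>x. norm (indicator A (x + h n) - indicator A x :: real) \<partial>lborel) \<longlonglongrightarrow> 0"
  proof (rule L1_translation_approx[OF intA])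
    fix e :: real assume "e > 0"
    obtain U where U: "open U" "A \<subseteq> U" "emeasure lborel (U - A) < ennreal e"
      using outer_regular_lborel[of A e] \<open>e > 0\<close> by auto
    have [measurable]: "U \<in> sets borel" using U by auto
    have "emeasure lborel U \<le> emeasure lborel A + emeasure lborel (U - A)"
      by (rule order_trans[OF emeasure_mono[of U "A \<union> (U - A)"] emeasure_subadditive]) auto
    also have "\<dots> < \<infinity>" using base order_less_trans[OF U(3) ennreal_less_top] by simp
    finally have fU: "emeasure lborel U < \<infinity>" .
    have "(\<integral>x. norm (indicator A x - indicator U x :: real) \<partial>lborel) = (\<integral>x. indicator (U - A) x \<partial>lborel)"
      by (rule Bochner_Integration.integral_cong) (use U(2) in \<open>auto simp: indicator_def\<close>)
    also have "\<dots> = measure lborel (U - A)" by simp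
    also have "\<dots> < e" using U(3) \<open>e > 0\<close> by (cases "emeasure lborel (U - A)") (auto simp: measure_def ennreal_less_iff)
    finally show "\<exists>g. integrable lborel g \<and> (\<integral>x. norm (indicator A x - g x :: real) \<partial>lborel) < e \<and>
          (\<lambda>n. \<integral>x. norm (g (x + h n) - g x) \<partial>lborel) \<longlonglongrightarrow> 0"
      using L1_continuous_translation_open[OF U(1) fU h] fU
      by (intro exI[of _ "indicator U"]) auto
  qed
  then have "(\<lambda>n. (\<integral>x. norm (indicator A (x + h n) - indicator A x :: real) \<partial>lborel) * norm c) \<longlonglongrightarrow> 0"
    by (rule tendsto_mult_left_zero)
  then show ?case
    by (simp flip: scaleR_diff_left)
next
  case (add f g)
  have "(\<lambda>n. (\<integral>x. norm (f (x + h n) - f x) \<partial>lborel) + (\<integral>x. norm (g (x + h n) - g x) \<partial>lborel)) \<longlonglongrightarrow> 0"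
    by (intro tendsto_add_zero add.IH)
  then show ?case
  proof (rule Lim_null_comparison[rotated])
    have "(\<integral>x. norm (f (x + h n) + g (x + h n) - (f x + g x)) \<partial>lborel) \<le>
       (\<integral>x. norm (f (x + h n) - f x) + norm (g (x + h n) - g x) \<partial>lborel)" for n
      using add by (intro integral_mono)
        (auto intro!: integrable_norm Bochner_Integration.integrable_add Bochner_Integration.integrable_diff integrable_translate norm_diff_triangle_ineq)
    also have "(\<integral>x. norm (f (x + h n) - f x) + norm (g (x + h n) - g x) \<partial>lborel) = 
       (\<integral>x. norm (f (x + h n) - f x) \<partial>lborel) + (\<integral>x. norm (g (x + h n) - g x) \<partial>lborel)" for n
      using add by (intro Bochner_Integration.integral_add)
        (auto intro!: integrable_norm Bochner_Integration.integrable_diff integrable_translate)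
    finally show "\<forall>\<^sub>F n in sequentially. norm (\<integral>x. norm (f (x + h n) + g (x + h n) - (f x + g x)) \<partial>lborel)
       \<le> (\<integral>x. norm (f (x + h n) - f x) \<partial>lborel) + (\<integral>x. norm (g (x + h n) - g x) \<partial>lborel)" by simp
  qed
next
  case (lim f s)
  show ?case
  proof (rule L1_translation_approx)
    show "integrable lborel f" by fact
    fix e :: real assume "e > 0"
    have "(\<lambda>n. \<integral>x. norm (f x - s n x) \<partial>lborel) \<longlonglongrightarrow> (\<integral>x. 0 \<partial>(lborel::real measure))"
    \<comment> \<open>The induction rule provides approximants with \<open>norm (s n x)\<close> at
      most \<open>2 * norm (f x)\<close>, hence the factor 3.\<close>
    proof (rule integral_dominated_convergence[where w = "\<lambda>x. 3 * norm (f x)"])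
      show "AE x in lborel. (\<lambda>n. norm (f x - s n x)) \<longlonglongrightarrow> 0"
      proof (rule AE_I2)
        fix x :: real
        have "(\<lambda>n. norm (f x - s n x)) \<longlonglongrightarrow> norm (f x - f x)"
          using lim.hyps(2)[of x] by (intro tendsto_intros) auto
        then show "(\<lambda>n. norm (f x - s n x)) \<longlonglongrightarrow> 0" by simp
      qed
      show "AE x in lborel. norm (norm (f x - s n x)) \<le> 3 * norm (f x)" for n
      proof (rule AE_I2)
        fix x :: real
        show "norm (norm (f x - s n x)) \<le> 3 * norm (f x)"
          using lim.hyps(3)[of x n] norm_triangle_ineq4[of "f x" "s n x"] by simp
      qed
    qed (use lim in auto)
    then have "eventually (\<lambda>n. (\<integral>x. norm (f x - s n x) \<partial>lborel) < e) sequentially"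
      using \<open>e > 0\<close> by (intro order_tendstoD(2)[of _ 0]) auto
    then obtain n where "(\<integral>x. norm (f x - s n x) \<partial>lborel) < e"
      by (auto simp: eventually_sequentially)
    then show "\<exists>g. integrable lborel g \<and> (\<integral>x. norm (f x - g x) \<partial>lborel) < e \<and>
          (\<lambda>n. \<integral>x. norm (g (x + h n) - g x) \<partial>lborel) \<longlonglongrightarrow> 0"
      using lim.hyps(1)[of n] lim.IH[of n] by (intro exI[of _ "s n"]) auto
  qed
qed

section \<open>Cauchy-Schwarz inequality and square integrable functions\<close>

lemma borel_measurable_cnj [measurable]: "cnj \<in> borel_measurable borel"
  by (intro borel_measurable_continuous_onI continuous_intros)

lemma Cauchy_Schwarz_integral:
  fixes f g :: "'a \<Rightarrow> complex"
  assumes [measurable]: "f \<in> borel_measurable M" "g \<in> borel_measurable M"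
    and f: "integrable M (\<lambda>x. (cmod (f x))\<^sup>2)" and g: "integrable M (\<lambda>x. (cmod (g x))\<^sup>2)"
  shows "integrable M (\<lambda>x. f x * g x)"
    and "(\<integral>x. cmod (f x * g x) \<partial>M)\<^sup>2 \<le> (\<integral>x. (cmod (f x))\<^sup>2 \<partial>M) * (\<integral>x. (cmod (g x))\<^sup>2 \<partial>M)"
    and "(cmod (\<integral>x. f x * g x \<partial>M))\<^sup>2 \<le> (\<integral>x. (cmod (f x))\<^sup>2 \<partial>M) * (\<integral>x. (cmod (g x))\<^sup>2 \<partial>M)"
proof -
  show i: "integrable M (\<lambda>x. f x * g x)"
  proof (rule Bochner_Integration.integrable_bound)
    show "integrable M (\<lambda>x. (cmod (f x))\<^sup>2 + (cmod (g x))\<^sup>2)" using f g by simp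
    show "AE x in M. norm (f x * g x) \<le> norm ((cmod (f x))\<^sup>2 + (cmod (g x))\<^sup>2)"
    proof (rule AE_I2)
      fix x
      have "2 * (cmod (f x) * cmod (g x)) \<le> (cmod (f x))\<^sup>2 + (cmod (g x))\<^sup>2"
        using sum_squares_bound[of "cmod (f x)" "cmod (g x)"] by (simp add: mult.assoc)
      moreover have "0 \<le> cmod (f x) * cmod (g x)" by simp
      ultimately have "cmod (f x) * cmod (g x) \<le> (cmod (f x))\<^sup>2 + (cmod (g x))\<^sup>2" by linarith
      then show "norm (f x * g x) \<le> norm ((cmod (f x))\<^sup>2 + (cmod (g x))\<^sup>2)" by (simp add: norm_mult)
    qed
  qed simp
  define A where "A = (\<integral>x. (cmod (f x))\<^sup>2 \<partial>M)"
  define B where "B = (\<integral>x. (cmod (g x))\<^sup>2 \<partial>M)"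
  define C where "C = (\<integral>x. cmod (f x) * cmod (g x) \<partial>M)"
  have iC: "integrable M (\<lambda>x. cmod (f x) * cmod (g x))"
    using integrable_norm[OF i] by (simp add: norm_mult)
  have "C\<^sup>2 \<le> A * B"
  proof (cases "A = 0")
    case True
    then have "AE x in M. (cmod (f x))\<^sup>2 = 0"
      using integral_nonneg_eq_0_iff_AE[OF f] by (simp add: A_def)
    then have "AE x in M. cmod (f x) * cmod (g x) = 0" by eventually_elim simp
    then have "C = 0" unfolding C_def by (rule integral_eq_zero_AE)
    then show ?thesis using True by simp
  next
    case False
    then have A: "A > 0" unfolding A_def by (simp add: order_less_le)
    \<comment> \<open>The discriminant argument without division: the expansion is A times (A B -
      C^2), and A is positive in this case.\<close>
    have "0 \<le> (\<integral>x. (A * cmod (g x) - C * cmod (f x))\<^sup>2 \<partial>M)" by simp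
    also have "\<dots> = (\<integral>x. A\<^sup>2 * (cmod (g x))\<^sup>2 - 2 * A * C * (cmod (f x) * cmod (g x)) + C\<^sup>2 * (cmod (f x))\<^sup>2 \<partial>M)"
      by (rule Bochner_Integration.integral_cong) (auto simp: power2_eq_square algebra_simps)
    also have "\<dots> = A\<^sup>2 * B - 2 * A * C * C + C\<^sup>2 * A"
      using f g iC by (simp add: A_def B_def C_def)
    finally have "0 \<le> A * (A * B - C\<^sup>2)" by (simp add: power2_eq_square algebra_simps)
    then show ?thesis using A by (simp add: zero_le_mult_iff)
  qed
  then show 1: "(\<integral>x. cmod (f x * g x) \<partial>M)\<^sup>2 \<le> (\<integral>x. (cmod (f x))\<^sup>2 \<partial>M) * (\<integral>x. (cmod (g x))\<^sup>2 \<partial>M)"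
    by (simp add: A_def B_def C_def norm_mult)
  have "(cmod (\<integral>x. f x * g x \<partial>M))\<^sup>2 \<le> (\<integral>x. cmod (f x * g x) \<partial>M)\<^sup>2"
    by (intro power_mono integral_norm_bound) auto
  then show "(cmod (\<integral>x. f x * g x \<partial>M))\<^sup>2 \<le> (\<integral>x. (cmod (f x))\<^sup>2 \<partial>M) * (\<integral>x. (cmod (g x))\<^sup>2 \<partial>M)"
    using 1 by linarith
qed

lemma cmod_diff_sq: "(cmod (a - b))\<^sup>2 \<le> 2 * (cmod a)\<^sup>2 + 2 * (cmod b)\<^sup>2"
proof -
  have "(cmod (a - b))\<^sup>2 \<le> (cmod a + cmod b)\<^sup>2" by (intro power_mono norm_triangle_ineq4) auto
  also have "\<dots> \<le> 2 * (cmod a)\<^sup>2 + 2 * (cmod b)\<^sup>2"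
    using sum_squares_bound[of "cmod a" "cmod b"] by (simp add: power2_sum)
  finally show ?thesis .
qed

lemma square_integrable_diff:
  assumes "square_integrable f" "square_integrable g"
  shows "square_integrable (\<lambda>x. f x - g x)"
proof -
  have m: "f \<in> borel_measurable lborel" "g \<in> borel_measurable lborel"
    using assms by (auto simp: square_integrable_def)
  have "integrable lborel (\<lambda>x. (cmod (f x - g x))\<^sup>2)"
  proof (rule Bochner_Integration.integrable_bound)
    show "integrable lborel (\<lambda>x. 2 * (cmod (f x))\<^sup>2 + 2 * (cmod (g x))\<^sup>2)"
      using assms by (simp add: square_integrable_def)
  qed (use m cmod_diff_sq in \<open>auto\<close>)
  then show ?thesis using m by (auto simp: square_integrable_def)
qed

lemma square_integrable_cmult:
  assumes "square_integrable f"
  shows "square_integrable (\<lambda>x. c * f x)"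
  using assms by (auto simp: square_integrable_def norm_mult power_mult_distrib)

lemma square_integrable_add:
  assumes "square_integrable f" "square_integrable g"
  shows "square_integrable (\<lambda>x. f x + g x)"
  using square_integrable_diff[OF assms(1) square_integrable_cmult[OF assms(2), of "-1"]] by simp

lemma square_integrable_affine:
  assumes "square_integrable f" "c \<noteq> 0"
  shows "square_integrable (\<lambda>x. f (t + c * x))"
  using assms lborel_integrable_real_affine[of "\<lambda>x. (cmod (f x))\<^sup>2" c t]
  by (auto simp: square_integrable_def)

lemma square_integrable_cnj: "square_integrable f \<Longrightarrow> square_integrable (\<lambda>x. cnj (f x))"
  by (auto simp: square_integrable_def intro: measurable_compose[OF _ borel_measurable_cnj])

section \<open>The Plancherel identity on the intersection of L1 and L2\<close>

lemma borel_measurable_fourier [measurable]: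
  assumes [measurable]: "f \<in> borel_measurable lborel"
  shows "fourier f \<in> borel_measurable borel"
  unfolding fourier_def by measurable

lemma cmod_fourier_le:
  shows "cmod (fourier f u) \<le> (\<integral>x. cmod (f x) \<partial>lborel)"
  unfolding fourier_def by (rule order_trans[OF integral_norm_bound]) (simp add: norm_mult)

text \<open>On the product of a probability measure with Lebesgue measure a bounded kernel times an
  integrable function is integrable. It is applied with the Gaussian weight as probability measure,
  which is what makes the oscillating double integrals absolutely convergent.\<close>

lemma integral_swap_bounded_kernel:
  fixes K :: "'a \<Rightarrow> real \<Rightarrow> complex" and f :: "real \<Rightarrow> complex"
  assumes "prob_space \<gamma>" and [measurable]: "(\<lambda>(v, x). K v x) \<in> borel_measurable (\<gamma> \<Otimes>\<^sub>M lborel)"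
    and f: "integrable lborel f" and K: "\<And>v x. cmod (K v x) \<le> c"
  shows "(\<integral>v. (\<integral>x. K v x * f x \<partial>lborel) \<partial>\<gamma>) = (\<integral>x. f x * (\<integral>v. K v x \<partial>\<gamma>) \<partial>lborel)"
proof -
  interpret prob_space \<gamma> by fact
  interpret pair_sigma_finite \<gamma> lborel ..
  have [measurable]: "f \<in> borel_measurable lborel" using f by auto
  have c: "c \<ge> 0" using K[of undefined undefined] norm_ge_zero order_trans by blast
  have b: "cmod (K v x * f x) \<le> c * cmod (f x)" for v x
    using mult_right_mono[OF K[of v x], of "cmod (f x)"] by (simp add: norm_mult)
  have ix: "integrable lborel (\<lambda>x. K v x * f x)" if "v \<in> space \<gamma>" for v
  proof (rule Bochner_Integration.integrable_bound[of _ "\<lambda>x. c * cmod (f x)"])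
    have "(\<lambda>x. K v x) \<in> borel_measurable lborel"
      using measurable_Pair2[OF assms(2) that] by simp
    then show "(\<lambda>x. K v x * f x) \<in> borel_measurable lborel" by measurable
  qed (use f b c in \<open>auto\<close>)
  have "integrable (\<gamma> \<Otimes>\<^sub>M lborel) (\<lambda>(v, x). K v x * f x)"
  proof (rule Fubini_integrable)
    show "integrable \<gamma> (\<lambda>v. \<integral>x. norm (case (v, x) of (v, x) \<Rightarrow> K v x * f x) \<partial>lborel)"
    proof (rule Bochner_Integration.integrable_bound[of _ "\<lambda>v. c * (\<integral>x. cmod (f x) \<partial>lborel)"])
      show "AE v in \<gamma>. norm (\<integral>x. norm (case (v, x) of (v, x) \<Rightarrow> K v x * f x) \<partial>lborel) \<le> norm (c * (\<integral>x. cmod (f x) \<partial>lborel))"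
      proof (rule AE_I2)
        fix v assume v: "v \<in> space \<gamma>"
        have "(\<integral>x. norm (K v x * f x) \<partial>lborel) \<le> (\<integral>x. c * cmod (f x) \<partial>lborel)"
          using ix[OF v] f b by (intro integral_mono) auto
        then show "norm (\<integral>x. norm (case (v, x) of (v, x) \<Rightarrow> K v x * f x) \<partial>lborel) \<le> norm (c * (\<integral>x. cmod (f x) \<partial>lborel))"
          using c by (simp add: abs_of_nonneg)
      qed
    qed auto
  qed (use ix in auto)
  from Fubini_integral[OF this]
  have "(\<integral>v. (\<integral>x. K v x * f x \<partial>lborel) \<partial>\<gamma>) = (\<integral>x. (\<integral>v. K v x * f x \<partial>\<gamma>) \<partial>lborel)" by simp
  then show ?thesis by (simp add: mult.commute)
qed

text \<open>Only continuity of translations in L1 is at hand, so f is split at height N: against the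
  bounded part the difference of translates is small in L1, and the unbounded part is small in L2
  and is paired with that difference by Cauchy-Schwarz.\<close>

lemma autocorrelation_tendsto:
  assumes f: "integrable lborel f" "square_integrable f" and h: "h \<longlonglongrightarrow> 0"
  shows "(\<lambda>n. \<integral>x. f x * cnj (f (x + h n)) \<partial>lborel) \<longlonglongrightarrow> (\<integral>x. f x * cnj (f x) \<partial>lborel)"
proof -
  have [measurable]: "f \<in> borel_measurable lborel" using f by auto
  have f2: "integrable lborel (\<lambda>x. (cmod (f x))\<^sup>2)" using f by (simp add: square_integrable_def)
  define A where "A = (\<integral>x. (cmod (f x))\<^sup>2 \<partial>lborel)"
  have A0: "A \<ge> 0" unfolding A_def by simp
  define fN where "fN N x = (if cmod (f x) \<le> real N then f x else 0)" for N :: nat and x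
  have [measurable]: "fN N \<in> borel_measurable lborel" for N unfolding fN_def by measurable
  have sN: "(cmod (f x - fN N x))\<^sup>2 \<le> (cmod (f x))\<^sup>2" for N x by (auto simp: fN_def)
  have iN: "integrable lborel (\<lambda>x. (cmod (f x - fN N x))\<^sup>2)" for N
    by (rule Bochner_Integration.integrable_bound[OF f2]) (use sN in auto)
  have "(\<lambda>N. \<integral>x. (cmod (f x - fN N x))\<^sup>2 \<partial>lborel) \<longlonglongrightarrow> (\<integral>x. 0 \<partial>(lborel::real measure))"
  proof (rule integral_dominated_convergence[OF _ _ f2])
    show "AE x in lborel. (\<lambda>N. (cmod (f x - fN N x))\<^sup>2) \<longlonglongrightarrow> 0"
    proof (rule AE_I2)
      fix x
      obtain N0 where "cmod (f x) \<le> real N0" using real_arch_simple by blast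
      then have "eventually (\<lambda>N. (cmod (f x - fN N x))\<^sup>2 = 0) sequentially"
        by (intro eventually_sequentiallyI[of N0]) (auto simp: fN_def)
      then show "(\<lambda>N. (cmod (f x - fN N x))\<^sup>2) \<longlonglongrightarrow> 0" by (rule tendsto_eventually)
    qed
  qed (use sN in auto)
  then have limN: "(\<lambda>N. \<integral>x. (cmod (f x - fN N x))\<^sup>2 \<partial>lborel) \<longlonglongrightarrow> 0" by simp
  have ft: "integrable lborel (\<lambda>x. f (x + k))" "(\<lambda>x. f (x + k)) \<in> borel_measurable lborel" for k
    using integrable_translate[OF f(1), of k] by auto
  have ft2: "integrable lborel (\<lambda>x. (cmod (f (x + k)))\<^sup>2)" for k
    using integrable_translate[OF f2, of k] .
  show ?thesis
  proof (rule LIMSEQ_I)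
    fix e :: real assume e: "e > 0"
    \<comment> \<open>The squared L2 norm of a difference of translates is at most 4 A; the added 1
      keeps the denominator positive.\<close>
    have "eventually (\<lambda>N. (\<integral>x. (cmod (f x - fN N x))\<^sup>2 \<partial>lborel) < (e/2)\<^sup>2 / (4 * A + 1)) sequentially"
      using limN e A0 by (intro order_tendstoD(2)[of _ 0]) auto
    then obtain N where N: "(\<integral>x. (cmod (f x - fN N x))\<^sup>2 \<partial>lborel) < (e/2)\<^sup>2 / (4 * A + 1)"
      by (auto simp: eventually_sequentially)
    have "eventually (\<lambda>n. (\<integral>x. norm (f (x + h n) - f x) \<partial>lborel) < e / 2 / (real N + 1)) sequentially"
      using L1_continuous_translation[OF f(1) h] e by (intro order_tendstoD(2)[of _ 0]) auto
    then obtain n0 where n0: "\<And>n. n \<ge> n0 \<Longrightarrow> (\<integral>x. norm (f (x + h n) - f x) \<partial>lborel) < e / 2 / (real N + 1)"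
      by (auto simp: eventually_sequentially)
    have "norm ((\<integral>x. f x * cnj (f (x + h n)) \<partial>lborel) - (\<integral>x. f x * cnj (f x) \<partial>lborel)) < e" if n: "n \<ge> n0" for n
    proof -
      let ?d = "\<lambda>x. f (x + h n) - f x"
      have d1: "integrable lborel ?d" using ft f by auto
      have m1: "integrable lborel (\<lambda>x. (cmod (?d x))\<^sup>2)"
        by (rule Bochner_Integration.integrable_bound[of _ "\<lambda>x. 2 * (cmod (f (x + h n)))\<^sup>2 + 2 * (cmod (f x))\<^sup>2"])
           (use ft2 f2 ft cmod_diff_sq in auto)
      have "(\<integral>x. (cmod (?d x))\<^sup>2 \<partial>lborel) \<le> (\<integral>x. 2 * (cmod (f (x + h n)))\<^sup>2 + 2 * (cmod (f x))\<^sup>2 \<partial>lborel)"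
        using m1 ft2 f2 cmod_diff_sq by (intro integral_mono) auto
      also have "\<dots> = 4 * A"
        using ft2 f2 integral_translate[of "\<lambda>x. (cmod (f x))\<^sup>2" "h n"] by (simp add: A_def)
      finally have dA: "(\<integral>x. (cmod (?d x))\<^sup>2 \<partial>lborel) \<le> 4 * A" .
      have ip: "integrable lborel (\<lambda>x. f x * cnj (f (x + h n)))" "integrable lborel (\<lambda>x. f x * cnj (f x))"
        using ft2 f2 by (intro Cauchy_Schwarz_integral(1); measurable | simp)+
      have i1: "integrable lborel (\<lambda>x. (f x - fN N x) * cnj (?d x))"
        using m1 iN ft by (intro Cauchy_Schwarz_integral(1)) (auto simp del: complex_cnj_diff)
      have i2: "integrable lborel (\<lambda>x. fN N x * cnj (?d x))"
        by (rule Bochner_Integration.integrable_bound[of _ "\<lambda>x. real N * cmod (?d x)"])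
           (use d1 ft in \<open>auto simp: norm_mult fN_def simp del: complex_cnj_diff intro!: AE_I2 mult_right_mono\<close>)
      have "(\<integral>x. f x * cnj (f (x + h n)) \<partial>lborel) - (\<integral>x. f x * cnj (f x) \<partial>lborel) = (\<integral>x. f x * cnj (?d x) \<partial>lborel)"
        using ip by (simp add: right_diff_distrib)
      also have "\<dots> = (\<integral>x. (f x - fN N x) * cnj (?d x) + fN N x * cnj (?d x) \<partial>lborel)"
        by (simp add: algebra_simps)
      also have "\<dots> = (\<integral>x. (f x - fN N x) * cnj (?d x) \<partial>lborel) + (\<integral>x. fN N x * cnj (?d x) \<partial>lborel)"
        using i1 i2 by (rule Bochner_Integration.integral_add)
      finally have eq: "(\<integral>x. f x * cnj (f (x + h n)) \<partial>lborel) - (\<integral>x. f x * cnj (f x) \<partial>lborel) = \<dots>" .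
      have "(cmod (\<integral>x. (f x - fN N x) * cnj (?d x) \<partial>lborel))\<^sup>2 \<le> (\<integral>x. (cmod (f x - fN N x))\<^sup>2 \<partial>lborel) * (\<integral>x. (cmod (cnj (?d x)))\<^sup>2 \<partial>lborel)"
        using m1 iN ft by (intro Cauchy_Schwarz_integral(3)) (auto simp del: complex_cnj_diff)
      also have "\<dots> \<le> (\<integral>x. (cmod (f x - fN N x))\<^sup>2 \<partial>lborel) * (4 * A + 1)"
        using dA unfolding complex_mod_cnj by (intro mult_left_mono) auto
      also have "\<dots> < (e / 2)\<^sup>2"
        using N A0 by (simp add: pos_less_divide_eq)
      finally have b1: "cmod (\<integral>x. (f x - fN N x) * cnj (?d x) \<partial>lborel) < e / 2"
        using e by (meson power2_less_imp_less half_gt_zero less_imp_le)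
      have "cmod (\<integral>x. fN N x * cnj (?d x) \<partial>lborel) \<le> (\<integral>x. cmod (fN N x * cnj (?d x)) \<partial>lborel)" by (rule integral_norm_bound)
      also have "\<dots> \<le> (\<integral>x. (real N + 1) * cmod (?d x) \<partial>lborel)"
      proof (rule integral_mono)
        show "integrable lborel (\<lambda>x. cmod (fN N x * cnj (?d x)))" by (rule integrable_norm[OF i2])
        show "integrable lborel (\<lambda>x. (real N + 1) * cmod (?d x))" using d1 by simp
        show "cmod (fN N x * cnj (?d x)) \<le> (real N + 1) * cmod (?d x)" for x
          unfolding norm_mult complex_mod_cnj by (intro mult_right_mono) (auto simp: fN_def)
      qed
      also have "\<dots> = (real N + 1) * (\<integral>x. cmod (?d x) \<partial>lborel)" by (rule integral_mult_right_zero)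
      also have "\<dots> < e / 2" using n0[OF n] by (simp add: pos_less_divide_eq algebra_simps)
      finally have b2: "cmod (\<integral>x. fN N x * cnj (?d x) \<partial>lborel) < e / 2" .
      show ?thesis unfolding eq using norm_triangle_ineq b1 b2
        by (smt (verit) field_sum_of_halves)
    qed
    then show "\<exists>n0. \<forall>n\<ge>n0. norm ((\<integral>x. f x * cnj (f (x + h n)) \<partial>lborel) - (\<integral>x. f x * cnj (f x) \<partial>lborel)) < e" by blast
  qed
qed

lemma integral_std_normal:
  fixes g :: "real \<Rightarrow> complex"
  assumes [measurable]: "g \<in> borel_measurable borel" and n: "(n::real) > 0"
  shows "(\<integral>w. g (w / n) \<partial>std_normal_distribution) = n / sqrt (2 * pi) * (\<integral>y. complex_of_real (exp (- (n * y)\<^sup>2 / 2)) * g y \<partial>lborel)"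
proof -
  have "(\<integral>w. g (w / n) \<partial>std_normal_distribution) = (\<integral>w. std_normal_density w *\<^sub>R g (w / n) \<partial>lborel)"
    by (subst integral_density) (auto simp: normal_density_nonneg)
  also have "\<dots> = n *\<^sub>R (\<integral>y. std_normal_density (n * y) *\<^sub>R g y \<partial>lborel)"
    using n by (subst lborel_integral_real_affine[of n _ 0]) auto
  also have "(\<integral>y. std_normal_density (n * y) *\<^sub>R g y \<partial>lborel) = (\<integral>y. (1 / sqrt (2 * pi)) * (complex_of_real (exp (- (n * y)\<^sup>2 / 2)) * g y) \<partial>lborel)"
    by (rule Bochner_Integration.integral_cong) (auto simp: std_normal_density_def scaleR_conv_of_real)
  finally show ?thesis by (simp add: scaleR_conv_of_real)
qed

lemma integral_std_normal_iexp:
  "(\<integral>v. iexp (a * v) \<partial>std_normal_distribution) = complex_of_real (exp (- a\<^sup>2 / 2))"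
  using fun_cong[OF char_std_normal_distribution, of a] unfolding char_def by simp

lemma cmod_sq_cnj: "complex_of_real ((cmod z)\<^sup>2) = z * cnj z"
  by (rule complex_norm_square)

(* Weighting |F f|^2 with a Gaussian makes Fubini applicable; the weight is removed by
   monotone convergence. *)
lemma fourier_gauss_weighted:
  assumes f: "integrable lborel f" "square_integrable f" and n: "(n::real) > 0"
  shows "(\<integral>u. complex_of_real (exp (- (u / n)\<^sup>2 / 2)) * complex_of_real ((cmod (fourier f u))\<^sup>2) \<partial>lborel) =
    2 * pi * (\<integral>w. (\<integral>x. f x * cnj (f (x + w / n)) \<partial>lborel) \<partial>std_normal_distribution)"
proof -
  interpret G: prob_space std_normal_distribution by (rule prob_space_normal_density) simp
  have [measurable]: "f \<in> borel_measurable lborel" using f by auto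
  have f2: "integrable lborel (\<lambda>x. (cmod (f x))\<^sup>2)" using f by (simp add: square_integrable_def)
  let ?F = "fourier f" and ?N = "std_normal_distribution"
  have s2: "sqrt (2 * pi) > 0" by simp
  have "(\<integral>v. ?F (n * v) * cnj (?F (n * v)) \<partial>?N) = (\<integral>v. (\<integral>x. (iexp (n * v * x) * cnj (?F (n * v))) * f x \<partial>lborel) \<partial>?N)"
  proof (rule Bochner_Integration.integral_cong[OF refl])
    fix v
    have "?F (n * v) * cnj (?F (n * v)) = (\<integral>x. iexp (n * v * x) * f x * cnj (?F (n * v)) \<partial>lborel)"
      unfolding fourier_def[of f "n * v"] by simp
    then show "?F (n * v) * cnj (?F (n * v)) = (\<integral>x. (iexp (n * v * x) * cnj (?F (n * v))) * f x \<partial>lborel)"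
      by (simp only: ac_simps)
  qed
  also have "\<dots> = (\<integral>x. f x * (\<integral>v. iexp (n * v * x) * cnj (?F (n * v)) \<partial>?N) \<partial>lborel)"
    by (rule integral_swap_bounded_kernel[where c = "\<integral>x. cmod (f x) \<partial>lborel"])
       (auto intro!: f G.prob_space_axioms simp: norm_mult cmod_fourier_le)
  \<comment> \<open>The Gaussian is its own transform: averaging e^(i n v (x - y)) over v gives
    exp(-(n (x - y))^2 / 2), and integrating this against the conjugate of f(y) is, up to scaling, a
    Gaussian average of translates of that conjugate.\<close>
  also have "\<dots> = (\<integral>x. f x * (\<integral>w. cnj (f (x + w / n)) \<partial>?N) * sqrt (2 * pi) / n \<partial>lborel)"
  proof (rule Bochner_Integration.integral_cong[OF refl])
    fix x
    have "(\<integral>v. iexp (n * v * x) * cnj (?F (n * v)) \<partial>?N) = (\<integral>v. (\<integral>y. iexp (n * v * (x - y)) * cnj (f y) \<partial>lborel) \<partial>?N)"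
    proof (rule Bochner_Integration.integral_cong[OF refl])
      fix v
      have "iexp (n * v * x) * cnj (?F (n * v)) = iexp (n * v * x) * (\<integral>y. cnj (iexp (n * v * y) * f y) \<partial>lborel)"
        unfolding fourier_def
        by (simp only: Bochner_Integration.integral_cnj[of lborel "\<lambda>y. iexp (n * v * y) * f y", symmetric])
      also have "\<dots> = (\<integral>y. iexp (n * v * x) * cnj (iexp (n * v * y) * f y) \<partial>lborel)"
        by simp
      also have "\<dots> = (\<integral>y. iexp (n * v * (x - y)) * cnj (f y) \<partial>lborel)"
        by (rule Bochner_Integration.integral_cong) (auto simp: exp_cnj exp_diff exp_minus field_simps simp flip: exp_add)
      finally show "iexp (n * v * x) * cnj (?F (n * v)) = (\<integral>y. iexp (n * v * (x - y)) * cnj (f y) \<partial>lborel)" .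
    qed
    also have "\<dots> = (\<integral>y. cnj (f y) * (\<integral>v. iexp (n * v * (x - y)) \<partial>?N) \<partial>lborel)"
      by (rule integral_swap_bounded_kernel[where c = 1]) (auto intro!: f G.prob_space_axioms)
    also have "\<dots> = (\<integral>y. cnj (f y) * complex_of_real (exp (- (n * (x - y))\<^sup>2 / 2)) \<partial>lborel)"
    proof (rule Bochner_Integration.integral_cong[OF refl])
      fix y
      have "(\<integral>v. iexp (n * v * (x - y)) \<partial>?N) = (\<integral>v. iexp ((n * (x - y)) * v) \<partial>?N)"
        by (simp only: ac_simps)
      then show "cnj (f y) * (\<integral>v. iexp (n * v * (x - y)) \<partial>?N) = cnj (f y) * complex_of_real (exp (- (n * (x - y))\<^sup>2 / 2))"
        using integral_std_normal_iexp[of "n * (x - y)"] by simp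
    qed
    also have "\<dots> = (\<integral>y. cnj (f (x + y)) * complex_of_real (exp (- (n * y)\<^sup>2 / 2)) \<partial>lborel)"
      using lborel_integral_real_affine[of 1 "\<lambda>y. cnj (f y) * complex_of_real (exp (- (n * (x - y))\<^sup>2 / 2))" x]
      by (simp add: power2_eq_square)
    also have "\<dots> = (\<integral>w. cnj (f (x + w / n)) \<partial>?N) * sqrt (2 * pi) / n"
      using integral_std_normal[of "\<lambda>y. cnj (f (x + y))" n] n by (simp add: mult.commute)
    finally show "f x * (\<integral>v. iexp (n * v * x) * cnj (?F (n * v)) \<partial>?N) = f x * (\<integral>w. cnj (f (x + w / n)) \<partial>?N) * sqrt (2 * pi) / n"
      by simp
  qed
  also have "\<dots> = (\<integral>x. (\<integral>w. f x * cnj (f (x + w / n)) \<partial>?N) \<partial>lborel) * sqrt (2 * pi) / n"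
    by simp
  also have "(\<integral>x. (\<integral>w. f x * cnj (f (x + w / n)) \<partial>?N) \<partial>lborel) = (\<integral>w. (\<integral>x. f x * cnj (f (x + w / n)) \<partial>lborel) \<partial>?N)"
  proof -
    interpret pair_sigma_finite ?N "lborel :: real measure" ..
    have ip: "integrable lborel (\<lambda>x. f x * cnj (f (x + k)))" for k
      using f2 integrable_translate[OF f2, of k] by (intro Cauchy_Schwarz_integral(1); measurable | simp)+
    have bd: "(\<integral>x. cmod (f x * cnj (f (x + k))) \<partial>lborel) \<le> (\<integral>x. (cmod (f x))\<^sup>2 \<partial>lborel)" for k
    proof -
      have "(\<integral>x. cmod (f x * cnj (f (x + k))) \<partial>lborel) \<le> (\<integral>x. ((cmod (f x))\<^sup>2 + (cmod (f (x + k)))\<^sup>2) / 2 \<partial>lborel)"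
      proof (rule integral_mono)
        show "cmod (f x * cnj (f (x + k))) \<le> ((cmod (f x))\<^sup>2 + (cmod (f (x + k)))\<^sup>2) / 2" for x
          using sum_squares_bound[of "cmod (f x)" "cmod (f (x + k))"] by (simp add: norm_mult)
      qed (use ip f2 integrable_translate[OF f2, of k] in auto)
      also have "\<dots> = (\<integral>x. (cmod (f x))\<^sup>2 \<partial>lborel)"
        using f2 integrable_translate[OF f2, of k] integral_translate[of "\<lambda>x. (cmod (f x))\<^sup>2" k] by simp
      finally show ?thesis .
    qed
    have "integrable (?N \<Otimes>\<^sub>M lborel) (\<lambda>(w, x). f x * cnj (f (x + w / n)))"
    proof (rule Fubini_integrable)
      show "integrable ?N (\<lambda>w. \<integral>x. norm (case (w, x) of (w, x) \<Rightarrow> f x * cnj (f (x + w / n))) \<partial>lborel)"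
        by (rule G.integrable_const_bound[of _ "\<integral>x. (cmod (f x))\<^sup>2 \<partial>lborel"]) (use bd in auto)
    qed (use ip in auto)
    from Fubini_integral[OF this] show ?thesis by simp
  qed
  finally have 1: "(\<integral>v. ?F (n * v) * cnj (?F (n * v)) \<partial>?N) = (\<integral>w. (\<integral>x. f x * cnj (f (x + w / n)) \<partial>lborel) \<partial>?N) * sqrt (2 * pi) / n" .
  have 2: "(\<integral>v. ?F (n * v) * cnj (?F (n * v)) \<partial>?N) = 1 / complex_of_real n / complex_of_real (sqrt (2 * pi)) * (\<integral>u. complex_of_real (exp (- (u / n)\<^sup>2 / 2)) * (?F u * cnj (?F u)) \<partial>lborel)"
    using integral_std_normal[of "\<lambda>u. ?F u * cnj (?F u)" "1 / n"] n by (simp add: mult.commute)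
  have alg: "U = s * s * W" if "A = W * s / k" "A = 1 / k / s * U" "k \<noteq> 0" "s \<noteq> 0" for A U s W k :: complex
    using that by (simp add: field_simps)
  have "(\<integral>u. complex_of_real (exp (- (u / n)\<^sup>2 / 2)) * (?F u * cnj (?F u)) \<partial>lborel) = (complex_of_real (sqrt (2 * pi)) * complex_of_real (sqrt (2 * pi))) * (\<integral>w. (\<integral>x. f x * cnj (f (x + w / n)) \<partial>lborel) \<partial>?N)"
    by (rule alg[OF 1 2]) (use n s2 in auto)
  also have "complex_of_real (sqrt (2 * pi)) * complex_of_real (sqrt (2 * pi)) = 2 * pi"
    by (simp flip: of_real_mult)
  finally show ?thesis unfolding cmod_sq_cnj .
qed

text \<open>As the Gaussian weights increase to 1, monotone convergence on the frequency side gives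
  the integrability of |F f|^2 together with its integral, while on the other side the Gaussian
  average of the autocorrelation concentrates at its value at 0, the squared norm of f.\<close>

theorem Plancherel_L1_L2:
  assumes f: "integrable lborel f" "square_integrable f"
  shows "square_integrable (fourier f)"
    and "(\<integral>u. (cmod (fourier f u))\<^sup>2 \<partial>lborel) = 2 * pi * (\<integral>x. (cmod (f x))\<^sup>2 \<partial>lborel)"
proof -
  interpret G: prob_space std_normal_distribution by (rule prob_space_normal_density) simp
  have [measurable]: "f \<in> borel_measurable lborel" using f by auto
  have f2: "integrable lborel (\<lambda>x. (cmod (f x))\<^sup>2)" using f by (simp add: square_integrable_def)
  let ?F = "fourier f" and ?N = "std_normal_distribution"
  define c where "c k = (\<integral>x. f x * cnj (f (x + k)) \<partial>lborel)" for k
  have [measurable]: "c \<in> borel_measurable borel" unfolding c_def by measurable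
  have cb: "cmod (c k) \<le> (\<integral>x. (cmod (f x))\<^sup>2 \<partial>lborel)" for k
  proof -
    have m: "(\<lambda>x. cnj (f (x + k))) \<in> borel_measurable lborel" by measurable
    have "(cmod (c k))\<^sup>2 \<le> (\<integral>x. (cmod (f x))\<^sup>2 \<partial>lborel) * (\<integral>x. (cmod (cnj (f (x + k))))\<^sup>2 \<partial>lborel)"
      unfolding c_def using f2 integrable_translate[OF f2, of k] m by (intro Cauchy_Schwarz_integral(3)) auto
    also have "\<dots> = (\<integral>x. (cmod (f x))\<^sup>2 \<partial>lborel)\<^sup>2"
      using integral_translate[of "\<lambda>x. (cmod (f x))\<^sup>2" k] by (simp add: power2_eq_square)
    finally show ?thesis by (rule power2_le_imp_le) simp
  qed
  define n where "n i = real (Suc i)" for i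
  have n: "n i > 0" for i by (simp add: n_def)
  have n_inv: "(\<lambda>i. w / n i) \<longlonglongrightarrow> 0" for w
    unfolding n_def by (rule LIMSEQ_Suc[OF lim_const_over_n])
  have lim: "(\<lambda>i. \<integral>w. c (w / n i) \<partial>?N) \<longlonglongrightarrow> (\<integral>w. c 0 \<partial>?N)"
  proof (rule integral_dominated_convergence[where w = "\<lambda>_. \<integral>x. (cmod (f x))\<^sup>2 \<partial>lborel"])
    show "AE w in ?N. (\<lambda>i. c (w / n i)) \<longlonglongrightarrow> c 0"
      unfolding c_def using autocorrelation_tendsto[OF f n_inv] by simp
  qed (use cb in auto)
  define W where "W i u = exp (- (u / n i)\<^sup>2 / 2) * (cmod (?F u))\<^sup>2" for i u
  have [measurable]: "(\<lambda>u. W i u) \<in> borel_measurable borel" for i unfolding W_def by measurable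
  have intW: "integrable lborel (W i)" for i
  proof (rule Bochner_Integration.integrable_bound)
    show "integrable lborel (\<lambda>u. (\<integral>x. cmod (f x) \<partial>lborel)\<^sup>2 * sqrt (2 * pi * (n i)\<^sup>2) * normal_density 0 (n i) u)"
      using n[of i] by (intro integrable_mult_right integrable_normal_density) auto
    have "norm (W i u) \<le> norm ((\<integral>x. cmod (f x) \<partial>lborel)\<^sup>2 * sqrt (2 * pi * (n i)\<^sup>2) * normal_density 0 (n i) u)" for u
    proof -
      have "norm (W i u) \<le> exp (- (u / n i)\<^sup>2 / 2) * (\<integral>x. cmod (f x) \<partial>lborel)\<^sup>2"
        using cmod_fourier_le[of f u] by (auto simp: W_def intro!: mult_left_mono power_mono)
      then show ?thesis using n[of i] by (simp add: normal_density_def abs_mult power_divide mult.commute)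
    qed
    then show "AE u in lborel. norm (W i u) \<le> norm ((\<integral>x. cmod (f x) \<partial>lborel)\<^sup>2 * sqrt (2 * pi * (n i)\<^sup>2) * normal_density 0 (n i) u)" by simp
  qed measurable
  have WI: "complex_of_real (\<integral>u. W i u \<partial>lborel) = 2 * pi * (\<integral>w. c (w / n i) \<partial>?N)" for i
  proof -
    have "complex_of_real (\<integral>u. W i u \<partial>lborel) = (\<integral>u. complex_of_real (W i u) \<partial>lborel)"
      by (rule integral_of_real[OF intW, symmetric])
    then show ?thesis using fourier_gauss_weighted[OF f n[of i]] unfolding c_def W_def by simp
  qed
  have "(\<lambda>i. complex_of_real (\<integral>u. W i u \<partial>lborel)) \<longlonglongrightarrow> 2 * pi * c 0"
    unfolding WI using lim G.prob_space by (auto intro!: tendsto_intros)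
  moreover have "c 0 = complex_of_real (\<integral>x. (cmod (f x))\<^sup>2 \<partial>lborel)"
    using integral_of_real[OF f2, where 'a = complex] unfolding c_def cmod_sq_cnj by simp
  ultimately have Wlim: "(\<lambda>i. \<integral>u. W i u \<partial>lborel) \<longlonglongrightarrow> 2 * pi * (\<integral>x. (cmod (f x))\<^sup>2 \<partial>lborel)"
    using tendsto_Re by fastforce
  have mono: "mono (\<lambda>i. W i u)" for u
  proof (rule incseq_SucI)
    fix i
    have "u\<^sup>2 / (n (Suc i))\<^sup>2 \<le> u\<^sup>2 / (n i)\<^sup>2"
      by (intro divide_left_mono power_mono) (auto simp: n_def)
    then show "W i u \<le> W (Suc i) u"
      unfolding W_def by (intro mult_right_mono) (auto simp: power_divide)
  qed
  have Wpt: "(\<lambda>i. W i u) \<longlonglongrightarrow> (cmod (?F u))\<^sup>2" for u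
  proof -
    have "(\<lambda>i. exp (- (u / n i)\<^sup>2 / 2) * (cmod (?F u))\<^sup>2) \<longlonglongrightarrow> exp (- 0\<^sup>2 / 2) * (cmod (?F u))\<^sup>2"
      by (intro tendsto_intros n_inv) simp
    then show ?thesis by (simp add: W_def)
  qed
  have i: "integrable lborel (\<lambda>u. (cmod (?F u))\<^sup>2)"
    by (rule integrable_monotone_convergence[OF intW _ _ Wlim]) (use mono Wpt in auto)
  then show "square_integrable (fourier f)" by (simp add: square_integrable_def)
  show "(\<integral>u. (cmod (fourier f u))\<^sup>2 \<partial>lborel) = 2 * pi * (\<integral>x. (cmod (f x))\<^sup>2 \<partial>lborel)"
    by (rule integral_monotone_convergence[OF intW _ _ Wlim]) (use mono Wpt in auto)
qed

section \<open>Convergence and completeness in L2\<close>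

definition L2sq :: "(real \<Rightarrow> complex) \<Rightarrow> real" where
  "L2sq f = (\<integral>x. (cmod (f x))\<^sup>2 \<partial>lborel)"

lemma L2sq_nonneg: "0 \<le> L2sq f"
  by (simp add: L2sq_def)

lemma square_integrableD:
  assumes "square_integrable f"
  shows "f \<in> borel_measurable borel" "integrable lborel (\<lambda>x. (cmod (f x))\<^sup>2)"
  using assms by (auto simp: square_integrable_def)

lemma square_integrable_0: "square_integrable (\<lambda>x. 0)"
  by (simp add: square_integrable_def)

text \<open>\<open>tendsto_L2\<close> counts a difference outside L2 as infinite, whereas
  \<open>L2sq\<close> has the default value 0 there. Membership of all functions in L2 is what makes
  the two notions of convergence agree.\<close>

lemma tendsto_L2_iff:
  assumes "\<And>n. square_integrable (fn n)" "square_integrable f"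
  shows "tendsto_L2 fn f \<longleftrightarrow> (\<lambda>n. L2sq (\<lambda>x. fn n x - f x)) \<longlonglongrightarrow> 0"
proof -
  have "(\<integral>\<^sup>+x. ennreal ((cmod (fn n x - f x))\<^sup>2) \<partial>lborel) = ennreal (L2sq (\<lambda>x. fn n x - f x))" for n
    unfolding L2sq_def
    by (rule nn_integral_eq_integral) (use square_integrableD(2)[OF square_integrable_diff[OF assms]] in auto)
  then show ?thesis
    unfolding tendsto_L2_def by (simp add: tendsto_ennreal_iff[of _ _ 0, simplified] L2sq_nonneg)
qed

lemma L2sq_diff_le:
  assumes "square_integrable f" "square_integrable g"
  shows "L2sq (\<lambda>x. f x - g x) \<le> 2 * L2sq f + 2 * L2sq g"
proof -
  have "L2sq (\<lambda>x. f x - g x) \<le> (\<integral>x. 2 * (cmod (f x))\<^sup>2 + 2 * (cmod (g x))\<^sup>2 \<partial>lborel)"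
    unfolding L2sq_def using assms square_integrable_diff[OF assms] cmod_diff_sq
    by (intro integral_mono) (auto simp: square_integrable_def)
  then show ?thesis using assms by (simp add: L2sq_def square_integrable_def)
qed

lemma L2sq_triangle:
  assumes "square_integrable f" "square_integrable g" "square_integrable h"
  shows "L2sq (\<lambda>x. f x - h x) \<le> 2 * L2sq (\<lambda>x. f x - g x) + 2 * L2sq (\<lambda>x. g x - h x)"
  using L2sq_diff_le[OF square_integrable_diff[OF assms(1,2)] square_integrable_diff[OF assms(3,2)]]
  by (simp add: L2sq_def norm_minus_commute)

lemma L2sq_eq_0_AE:
  assumes "square_integrable (\<lambda>x. f x - g x)" "L2sq (\<lambda>x. f x - g x) = 0"
  shows "AE x in lborel. f x = g x"
proof -
  have "AE x in lborel. (cmod (f x - g x))\<^sup>2 = 0"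
    using integral_nonneg_eq_0_iff_AE[OF square_integrableD(2)[OF assms(1)]] assms(2)
    by (simp add: L2sq_def)
  then show ?thesis by eventually_elim simp
qed

lemma L2_product_integrable:
  assumes "square_integrable f" "square_integrable g"
  shows "integrable lborel (\<lambda>x. f x * g x)"
    and "(cmod (\<integral>x. f x * g x \<partial>lborel))\<^sup>2 \<le> L2sq f * L2sq g"
  using Cauchy_Schwarz_integral(1,3)[of f lborel g] assms by (auto simp: square_integrable_def L2sq_def)

lemma tendsto_of_sq_tendsto_0:
  assumes "\<And>n. (cmod (a n))\<^sup>2 \<le> b n" "b \<longlonglongrightarrow> 0"
  shows "a \<longlonglongrightarrow> 0"
proof (rule tendsto_norm_zero_cancel)
  have "(\<lambda>n. sqrt (b n)) \<longlonglongrightarrow> sqrt 0" by (intro tendsto_intros assms)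
  then have "(\<lambda>n. sqrt (b n)) \<longlonglongrightarrow> 0" by simp
  moreover have "norm (cmod (a n)) \<le> sqrt (b n)" for n using real_le_rsqrt[OF assms(1)[of n]] by simp
  ultimately show "(\<lambda>n. cmod (a n)) \<longlonglongrightarrow> 0"
    using Lim_null_comparison[OF always_eventually, of "\<lambda>n. cmod (a n)" "\<lambda>n. sqrt (b n)"] by simp
qed

text \<open>The difference of the pairings is split as (f_n - f) g_n + f (g_n - g); the first term
  needs the norms of g_n bounded, which follows from their convergence.\<close>

lemma tendsto_L2_product:
  assumes f: "\<And>n. square_integrable (fn n)" "square_integrable f" "(\<lambda>n. L2sq (\<lambda>x. fn n x - f x)) \<longlonglongrightarrow> 0"
    and g: "\<And>n. square_integrable (gn n)" "square_integrable g" "(\<lambda>n. L2sq (\<lambda>x. gn n x - g x)) \<longlonglongrightarrow> 0"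
  shows "(\<lambda>n. \<integral>x. fn n x * gn n x \<partial>lborel) \<longlonglongrightarrow> (\<integral>x. f x * g x \<partial>lborel)"
proof -
  note d = square_integrable_diff
  have 1: "(\<lambda>n. \<integral>x. (fn n x - f x) * gn n x \<partial>lborel) \<longlonglongrightarrow> 0"
  proof (rule tendsto_of_sq_tendsto_0)
    show "(cmod (\<integral>x. (fn n x - f x) * gn n x \<partial>lborel))\<^sup>2 \<le>
      L2sq (\<lambda>x. fn n x - f x) * (2 * L2sq (\<lambda>x. gn n x - g x) + 2 * L2sq g)" for n
    proof -
      have "L2sq (gn n) \<le> 2 * L2sq (\<lambda>x. gn n x - g x) + 2 * L2sq g"
        using L2sq_triangle[OF g(1)[of n] g(2) square_integrable_0] by simp
      then show ?thesis
        by (intro order_trans[OF L2_product_integrable(2)[OF d[OF f(1)[of n] f(2)] g(1)[of n]]] mult_left_mono L2sq_nonneg)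
    qed
    show "(\<lambda>n. L2sq (\<lambda>x. fn n x - f x) * (2 * L2sq (\<lambda>x. gn n x - g x) + 2 * L2sq g)) \<longlonglongrightarrow> 0"
      by (rule tendsto_eq_intros f(3) g(3) refl | simp)+
  qed
  have 2: "(\<lambda>n. \<integral>x. f x * (gn n x - g x) \<partial>lborel) \<longlonglongrightarrow> 0"
  proof (rule tendsto_of_sq_tendsto_0)
    show "(cmod (\<integral>x. f x * (gn n x - g x) \<partial>lborel))\<^sup>2 \<le> L2sq f * L2sq (\<lambda>x. gn n x - g x)" for n
      by (rule L2_product_integrable(2)[OF f(2) d[OF g(1,2)]])
    show "(\<lambda>n. L2sq f * L2sq (\<lambda>x. gn n x - g x)) \<longlonglongrightarrow> 0"
      by (rule tendsto_eq_intros g(3) refl | simp)+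
  qed
  have eq: "(\<integral>x. fn n x * gn n x \<partial>lborel) = (\<integral>x. f x * g x \<partial>lborel) +
     ((\<integral>x. (fn n x - f x) * gn n x \<partial>lborel) + (\<integral>x. f x * (gn n x - g x) \<partial>lborel))" for n
  proof -
    have "(\<integral>x. f x * g x \<partial>lborel) + ((\<integral>x. (fn n x - f x) * gn n x \<partial>lborel) + (\<integral>x. f x * (gn n x - g x) \<partial>lborel)) =
       (\<integral>x. f x * g x + ((fn n x - f x) * gn n x + f x * (gn n x - g x)) \<partial>lborel)"
      using L2_product_integrable(1)[OF f(2) g(2)] L2_product_integrable(1)[OF d[OF f(1)[of n] f(2)] g(1)[of n]]
        L2_product_integrable(1)[OF f(2) d[OF g(1)[of n] g(2)]] by simp
    also have "\<dots> = (\<integral>x. fn n x * gn n x \<partial>lborel)"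
      by (rule Bochner_Integration.integral_cong) (auto simp: algebra_simps)
    finally show ?thesis by simp
  qed
  show ?thesis unfolding eq using tendsto_add[OF tendsto_const tendsto_add[OF 1 2]] by simp
qed

lemma L2sq_eq_product: "square_integrable f \<Longrightarrow> complex_of_real (L2sq f) = (\<integral>x. f x * cnj (f x) \<partial>lborel)"
  using integral_of_real[OF square_integrableD(2), of f, where 'a = complex]
  unfolding cmod_sq_cnj L2sq_def by simp

lemma tendsto_L2sq:
  assumes f: "\<And>n. square_integrable (fn n)" "square_integrable f" "(\<lambda>n. L2sq (\<lambda>x. fn n x - f x)) \<longlonglongrightarrow> 0"
  shows "(\<lambda>n. L2sq (fn n)) \<longlonglongrightarrow> L2sq f"
proof -
  have "(\<lambda>n. L2sq (\<lambda>x. cnj (fn n x) - cnj (f x))) \<longlonglongrightarrow> 0"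
    using f(3) unfolding L2sq_def by (simp flip: complex_cnj_diff)
  from tendsto_L2_product[OF f square_integrable_cnj[OF f(1)] square_integrable_cnj[OF f(2)] this]
  have "(\<lambda>n. complex_of_real (L2sq (fn n))) \<longlonglongrightarrow> complex_of_real (L2sq f)"
    using f by (simp add: L2sq_eq_product)
  then show ?thesis using tendsto_Re by fastforce
qed

text \<open>The Riesz-Fischer argument: a fast subsequence converges almost everywhere by
  Borel-Cantelli, and Fatou's lemma identifies its pointwise limit as the L2 limit of the whole
  sequence.\<close>

lemma L2_complete:
  assumes f: "\<And>n. square_integrable (fn n)"
    and C: "\<And>e. e > 0 \<Longrightarrow> \<exists>N. \<forall>m\<ge>N. \<forall>n\<ge>N. L2sq (\<lambda>x. fn m x - fn n x) < e"
  shows "\<exists>f. square_integrable f \<and> (\<lambda>n. L2sq (\<lambda>x. fn n x - f x)) \<longlonglongrightarrow> 0"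
proof -
  have [measurable]: "fn n \<in> borel_measurable borel" for n using square_integrableD[OF f] by auto
  \<comment> \<open>The squared distances are at most 8^-k, so by Markov's inequality the set where
    the squared increment reaches 4^-k has measure at most 2^-k; outside these sets the increments
    are at most 2^-k. Both series converge.\<close>
  obtain N where N: "\<And>k m n. m \<ge> N k \<Longrightarrow> n \<ge> N k \<Longrightarrow> L2sq (\<lambda>x. fn m x - fn n x) < (1/8) ^ k"
  proof -
    have "\<forall>k. \<exists>N. \<forall>m\<ge>N. \<forall>n\<ge>N. L2sq (\<lambda>x. fn m x - fn n x) < (1/8) ^ k"
      using C by simp
    then show ?thesis using that by (auto dest!: choice)
  qed
  define r where "r k = (\<Sum>j\<le>k. N j) + k" for k
  have rN: "r k \<ge> N k" and rS: "r (Suc k) \<ge> N k" and rk: "r k \<ge> k" for k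
    unfolding r_def using member_le_sum[of k "{..k}" N] member_le_sum[of k "{..Suc k}" N] by auto
  define D where "D k = {x \<in> space lborel. (cmod (fn (r (Suc k)) x - fn (r k) x))\<^sup>2 \<ge> (1/4) ^ k}" for k
  have De: "emeasure lborel (D k) \<le> ennreal ((1/2) ^ k)" for k
  proof -
    have i: "integrable lborel (\<lambda>x. (cmod (fn (r (Suc k)) x - fn (r k) x))\<^sup>2)"
      using square_integrableD(2)[OF square_integrable_diff[OF f f]] .
    have "emeasure lborel (D k) \<le> ennreal (1 / (1/4) ^ k * (\<integral>x. (cmod (fn (r (Suc k)) x - fn (r k) x))\<^sup>2 \<partial>lborel))"
      using integral_Markov_inequality[OF i, of "(1/4)^k"] unfolding D_def by simp
    also have "\<dots> \<le> ennreal (1 / (1/4) ^ k * (1/8) ^ k)"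
      using N[OF rS rN, of k] by (intro ennreal_leI mult_left_mono) (auto simp: L2sq_def)
    also have "1 / (1/4) ^ k * (1/8) ^ k = (1/2::real) ^ k"
    proof -
      have "(1/8::real) ^ k = (1/4) ^ k * (1/2) ^ k" by (subst power_mult_distrib[symmetric]) simp
      then show ?thesis by simp
    qed
    finally show ?thesis .
  qed
  have Dm: "D k \<in> sets lborel" for k unfolding D_def by measurable
  have "AE x in lborel. eventually (\<lambda>k. x \<in> space lborel - D k) sequentially"
  proof (rule borel_cantelli_AE1[OF Dm])
    show "emeasure lborel (D k) < \<infinity>" for k using De[of k] by (simp add: order_le_less_trans[OF _ ennreal_less_top])
    show "summable (\<lambda>k. measure lborel (D k))"
    proof (rule summable_comparison_test[OF _ summable_geometric[of "1/2::real"]])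
      have "measure lborel (D k) \<le> (1/2) ^ k" for k
        using De[of k] by (simp add: measure_def enn2real_leI)
      then show "\<exists>N. \<forall>n\<ge>N. norm (measure lborel (D n)) \<le> (1/2) ^ n" by auto
    qed simp
  qed
  then have conv: "AE x in lborel. convergent (\<lambda>k. fn (r k) x)"
  proof eventually_elim
    case (elim x)
    then have "eventually (\<lambda>k. norm (fn (r (Suc k)) x - fn (r k) x) \<le> (1/2) ^ k) sequentially"
    proof eventually_elim
      case (elim k)
      then have "(cmod (fn (r (Suc k)) x - fn (r k) x))\<^sup>2 \<le> ((1/2) ^ k)\<^sup>2"
      proof -
        have "((1/2::real) ^ k)\<^sup>2 = (1/4) ^ k" by (subst power2_eq_square, subst power_mult_distrib[symmetric]) simp
        then show ?thesis using elim by (simp add: D_def)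
      qed
      then show ?case by (rule power2_le_imp_le) simp
    qed
    then have "summable (\<lambda>k. fn (r (Suc k)) x - fn (r k) x)"
      by (rule summable_comparison_test_ev) simp
    then have "(\<lambda>k. (\<Sum>j<k. fn (r (Suc j)) x - fn (r j) x) + fn (r 0) x) \<longlonglongrightarrow> suminf (\<lambda>k. fn (r (Suc k)) x - fn (r k) x) + fn (r 0) x"
      by (intro tendsto_add tendsto_const summable_LIMSEQ)
    then show ?case
      unfolding convergent_def sum_lessThan_telescope[of "\<lambda>k. fn (r k) x"] by auto
  qed
  define g where "g x = lim (\<lambda>k. fn (r k) x)" for x
  have [measurable]: "g \<in> borel_measurable borel" unfolding g_def by (rule borel_measurable_lim_metric) simp
  have gl: "AE x in lborel. (\<lambda>k. fn (r k) x) \<longlonglongrightarrow> g x"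
    using conv by eventually_elim (simp add: g_def convergent_LIMSEQ_iff)
  \<comment> \<open>Fatou's lemma along the subsequence carries a Cauchy bound over to the limit. It
    is used twice: once to see that \<open>g\<close> lies in L2, once for the convergence.\<close>
  have Fa: "(\<integral>\<^sup>+x. ennreal ((cmod (fn m x - g x))\<^sup>2) \<partial>lborel) \<le> ennreal e"
    if "\<And>n. n \<ge> M \<Longrightarrow> L2sq (\<lambda>x. fn m x - fn n x) \<le> e" for m M e
  proof -
    have "(\<integral>\<^sup>+x. ennreal ((cmod (fn m x - g x))\<^sup>2) \<partial>lborel) = (\<integral>\<^sup>+x. liminf (\<lambda>k. ennreal ((cmod (fn m x - fn (r k) x))\<^sup>2)) \<partial>lborel)"
    proof (rule nn_integral_cong_AE)
      show "AE x in lborel. ennreal ((cmod (fn m x - g x))\<^sup>2) = liminf (\<lambda>k. ennreal ((cmod (fn m x - fn (r k) x))\<^sup>2))"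
        using gl
      proof eventually_elim
        case (elim x)
        have "(\<lambda>k. ennreal ((cmod (fn m x - fn (r k) x))\<^sup>2)) \<longlonglongrightarrow> ennreal ((cmod (fn m x - g x))\<^sup>2)"
          by (intro tendsto_ennrealI tendsto_intros elim)
        from lim_imp_Liminf[OF _ this] show ?case by simp
      qed
    qed
    also have "\<dots> \<le> liminf (\<lambda>k. \<integral>\<^sup>+x. ennreal ((cmod (fn m x - fn (r k) x))\<^sup>2) \<partial>lborel)"
      by (rule nn_integral_liminf) simp
    also have "\<dots> = liminf (\<lambda>k. ennreal (L2sq (\<lambda>x. fn m x - fn (r k) x)))"
      unfolding L2sq_def using square_integrableD(2)[OF square_integrable_diff[OF f f]]
      by (subst nn_integral_eq_integral) auto
    also have "\<dots> \<le> ennreal e"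
    proof -
      have "liminf (\<lambda>k. ennreal (L2sq (\<lambda>x. fn m x - fn (r k) x))) \<le> liminf (\<lambda>k::nat. ennreal e)"
        using that rk by (intro Liminf_mono eventually_sequentiallyI[of M]) (auto intro!: ennreal_leI intro: order_trans)
      then show ?thesis by (simp add: Liminf_const)
    qed
    finally show ?thesis .
  qed
  obtain M1 where M1: "\<And>m n. m \<ge> M1 \<Longrightarrow> n \<ge> M1 \<Longrightarrow> L2sq (\<lambda>x. fn m x - fn n x) < 1" using C[OF zero_less_one] by blast
  have "(\<integral>\<^sup>+x. ennreal ((cmod (fn M1 x - g x))\<^sup>2) \<partial>lborel) \<le> ennreal 1"
    by (rule Fa[of M1]) (use M1 in \<open>auto intro: less_imp_le\<close>)
  then have "integrable lborel (\<lambda>x. (cmod (fn M1 x - g x))\<^sup>2)"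
    by (intro integrableI_bounded) (auto intro: le_less_trans[OF _ ennreal_one_less_top])
  then have "square_integrable (\<lambda>x. fn M1 x - g x)" by (simp add: square_integrable_def)
  from square_integrable_diff[OF f[of M1] this] have g: "square_integrable g" by simp
  have "(\<lambda>n. L2sq (\<lambda>x. fn n x - g x)) \<longlonglongrightarrow> 0"
  proof (rule LIMSEQ_I)
    fix e :: real assume "e > 0"
    then have "e / 2 > 0" by simp
    then obtain M where M: "\<And>m n. m \<ge> M \<Longrightarrow> n \<ge> M \<Longrightarrow> L2sq (\<lambda>x. fn m x - fn n x) < e / 2" using C by blast
    have "norm (L2sq (\<lambda>x. fn m x - g x) - 0) < e" if "m \<ge> M" for m
    proof -
      have "(\<integral>\<^sup>+x. ennreal ((cmod (fn m x - g x))\<^sup>2) \<partial>lborel) \<le> ennreal (e/2)"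
        by (rule Fa[of M]) (use M[OF that] in \<open>auto intro: less_imp_le\<close>)
      moreover have "(\<integral>\<^sup>+x. ennreal ((cmod (fn m x - g x))\<^sup>2) \<partial>lborel) = ennreal (L2sq (\<lambda>x. fn m x - g x))"
        unfolding L2sq_def by (rule nn_integral_eq_integral) (use square_integrableD(2)[OF square_integrable_diff[OF f[of m] g]] in auto)
      ultimately show ?thesis using \<open>e > 0\<close> by (simp add: L2sq_nonneg)
    qed
    then show "\<exists>no. \<forall>n\<ge>no. norm (L2sq (\<lambda>x. fn n x - g x) - 0) < e" by blast
  qed
  with g show ?thesis by blast
qed

lemma L2sq_minus_commute: "L2sq (\<lambda>x. f x - g x) = L2sq (\<lambda>x. g x - f x)"
  by (simp add: L2sq_def norm_minus_commute)

lemma L2sq_cong_AE: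
  assumes "f \<in> borel_measurable borel" "g \<in> borel_measurable borel" "AE x in lborel. f x = g x"
  shows "L2sq f = L2sq g"
  unfolding L2sq_def by (rule integral_cong_AE) (use assms in auto)

lemma square_integrable_mono:
  assumes "square_integrable g" "f \<in> borel_measurable borel" "AE x in lborel. cmod (f x) \<le> C * cmod (g x)"
  shows "square_integrable f"
proof -
  have "integrable lborel (\<lambda>x. (cmod (f x))\<^sup>2)"
  proof (rule Bochner_Integration.integrable_bound)
    show "integrable lborel (\<lambda>x. C\<^sup>2 * (cmod (g x))\<^sup>2)" using square_integrableD[OF assms(1)] by simp
    show "AE x in lborel. norm ((cmod (f x))\<^sup>2) \<le> norm (C\<^sup>2 * (cmod (g x))\<^sup>2)"
      using assms(3)
    proof eventually_elim
      case (elim x)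
      then have "(cmod (f x))\<^sup>2 \<le> (C * cmod (g x))\<^sup>2" by (intro power_mono) auto
      then show ?case by (simp add: power_mult_distrib)
    qed
  qed (use assms in auto)
  then show ?thesis using assms(2) by (simp add: square_integrable_def)
qed

text \<open>Sharp truncation, used both in space and in frequency. It turns an L2 function into one
  that is also integrable, as the approximants in the definition of the L2 transform must
  be.\<close>

definition cutoff :: "real \<Rightarrow> (real \<Rightarrow> complex) \<Rightarrow> real \<Rightarrow> complex" where
  "cutoff a f x = indicator {-a..a} x * f x"

lemma borel_measurable_cutoff [measurable]:
  "f \<in> borel_measurable borel \<Longrightarrow> cutoff a f \<in> borel_measurable borel"
  unfolding cutoff_def[abs_def] by measurable

lemma square_integrable_cutoff:
  assumes "square_integrable f"
  shows "square_integrable (cutoff a f)"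
  by (rule square_integrable_mono[OF assms, of _ 1])
     (use square_integrableD[OF assms] in \<open>auto simp: cutoff_def indicator_def\<close>)

lemma integrable_cutoff:
  assumes "square_integrable f"
  shows "integrable lborel (cutoff a f)"
proof -
  have "square_integrable (\<lambda>x. indicator {-a..a} x)"
  proof -
    have "(\<lambda>x. (cmod (indicator {-a..a} x))\<^sup>2) = (indicator {-a..a} :: real \<Rightarrow> real)"
      by (auto simp: indicator_def fun_eq_iff)
    moreover have "integrable lborel (indicator {-a..a} :: real \<Rightarrow> real)"
      by (intro integrable_real_indicator) (auto simp: emeasure_lborel_Icc_eq)
    ultimately show ?thesis by (simp add: square_integrable_def)
  qed
  from L2_product_integrable(1)[OF this assms] show ?thesis by (simp add: cutoff_def[abs_def])
qed

lemma cutoff_tendsto_L2: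
  assumes f: "square_integrable f" and a: "filterlim a at_top sequentially"
  shows "(\<lambda>n. L2sq (\<lambda>x. cutoff (a n) f x - f x)) \<longlonglongrightarrow> 0"
proof -
  have [measurable]: "f \<in> borel_measurable borel" by (rule square_integrableD[OF f])
  have "(\<lambda>n. \<integral>x. (cmod (cutoff (a n) f x - f x))\<^sup>2 \<partial>lborel) \<longlonglongrightarrow> (\<integral>x. 0 \<partial>(lborel :: real measure))"
  proof (rule integral_dominated_convergence[OF _ _ square_integrableD(2)[OF f]])
    show "AE x in lborel. (\<lambda>n. (cmod (cutoff (a n) f x - f x))\<^sup>2) \<longlonglongrightarrow> 0"
    proof (rule AE_I2)
      fix x :: real
      have "eventually (\<lambda>n. \<bar>x\<bar> \<le> a n) sequentially" using a unfolding filterlim_at_top by blast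
      then have "eventually (\<lambda>n. (cmod (cutoff (a n) f x - f x))\<^sup>2 = 0) sequentially"
        by eventually_elim (auto simp: cutoff_def indicator_def)
      then show "(\<lambda>n. (cmod (cutoff (a n) f x - f x))\<^sup>2) \<longlonglongrightarrow> 0" by (rule tendsto_eventually)
    qed
  qed (auto simp: cutoff_def indicator_def)
  then show ?thesis by (simp add: L2sq_def)
qed

section \<open>The Fourier transform on L2 and its inversion\<close>

lemma is_L2_fourier_square_integrable:
  assumes "is_L2_fourier f F" shows "square_integrable f" "square_integrable F"
  using assms by (auto simp: is_L2_fourier_def)

lemma is_L2_fourierE:
  assumes "is_L2_fourier f F"
  obtains fn where "\<And>n. integrable lborel (fn n)" "\<And>n. square_integrable (fn n)"
    "(\<lambda>n. L2sq (\<lambda>x. fn n x - f x)) \<longlonglongrightarrow> 0" "(\<lambda>n. L2sq (\<lambda>u. fourier (fn n) u - F u)) \<longlonglongrightarrow> 0"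
proof -
  from assms obtain fn where fn: "\<And>n. integrable lborel (fn n)" "\<And>n. square_integrable (fn n)"
    "tendsto_L2 fn f" "tendsto_L2 (\<lambda>n. fourier (fn n)) F"
    unfolding is_L2_fourier_def by blast
  then show ?thesis
    using that[of fn] is_L2_fourier_square_integrable[OF assms] Plancherel_L1_L2(1) by (simp add: tendsto_L2_iff)
qed

lemma is_L2_fourierI:
  assumes "square_integrable f" "square_integrable F" "\<And>n. integrable lborel (fn n)" "\<And>n. square_integrable (fn n)"
    "(\<lambda>n. L2sq (\<lambda>x. fn n x - f x)) \<longlonglongrightarrow> 0" "(\<lambda>n. L2sq (\<lambda>u. fourier (fn n) u - F u)) \<longlonglongrightarrow> 0"
  shows "is_L2_fourier f F"
proof -
  have "tendsto_L2 fn f" "tendsto_L2 (\<lambda>n. fourier (fn n)) F"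
    using assms Plancherel_L1_L2(1) by (simp_all add: tendsto_L2_iff)
  with assms show ?thesis unfolding is_L2_fourier_def by blast
qed

lemma is_L2_fourier_L1:
  assumes "integrable lborel f" "square_integrable f"
  shows "is_L2_fourier f (fourier f)"
  by (rule is_L2_fourierI[where fn = "\<lambda>_. f"]) (use assms Plancherel_L1_L2(1) in \<open>auto simp: L2sq_def\<close>)

lemma fourier_diff:
  assumes "integrable lborel f" "integrable lborel g"
  shows "fourier (\<lambda>x. f x - g x) u = fourier f u - fourier g u"
proof -
  have "integrable lborel (\<lambda>x. iexp (u * x) * h x)" if "integrable lborel h" for h :: "real \<Rightarrow> complex"
    by (rule Bochner_Integration.integrable_bound[OF that]) (use that in \<open>auto simp: norm_mult\<close>)
  then show ?thesis using assms unfolding fourier_def by (simp add: right_diff_distrib)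
qed

text \<open>Both squared norms are continuous under L2 convergence, so the identity passes from the
  approximants to the limit. Applied to a difference it also shows that the transform is unique up
  to null sets.\<close>

lemma is_L2_fourier_isometry:
  assumes "is_L2_fourier f F"
  shows "L2sq F = 2 * pi * L2sq f"
proof -
  obtain fn where fn: "\<And>n. integrable lborel (fn n)" "\<And>n. square_integrable (fn n)"
    "(\<lambda>n. L2sq (\<lambda>x. fn n x - f x)) \<longlonglongrightarrow> 0" "(\<lambda>n. L2sq (\<lambda>u. fourier (fn n) u - F u)) \<longlonglongrightarrow> 0"
    by (rule is_L2_fourierE[OF assms]) (rule that)
  note sq = is_L2_fourier_square_integrable[OF assms]
  have "L2sq (fourier (fn n)) = 2 * pi * L2sq (fn n)" for n
    unfolding L2sq_def by (rule Plancherel_L1_L2(2)[OF fn(1,2)])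
  moreover have "(\<lambda>n. L2sq (fourier (fn n))) \<longlonglongrightarrow> L2sq F"
    by (rule tendsto_L2sq[OF Plancherel_L1_L2(1)[OF fn(1,2)] sq(2) fn(4)])
  moreover have "(\<lambda>n. 2 * pi * L2sq (fn n)) \<longlonglongrightarrow> 2 * pi * L2sq f"
    by (intro tendsto_mult tendsto_const tendsto_L2sq[OF fn(2) sq(1) fn(3)])
  ultimately show ?thesis by (simp add: LIMSEQ_unique)
qed

lemma is_L2_fourier_diff:
  assumes "is_L2_fourier f F" "is_L2_fourier g G"
  shows "is_L2_fourier (\<lambda>x. f x - g x) (\<lambda>u. F u - G u)"
proof -
  obtain fn where fn: "\<And>n. integrable lborel (fn n)" "\<And>n. square_integrable (fn n)"
    "(\<lambda>n. L2sq (\<lambda>x. fn n x - f x)) \<longlonglongrightarrow> 0" "(\<lambda>n. L2sq (\<lambda>u. fourier (fn n) u - F u)) \<longlonglongrightarrow> 0"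
    by (rule is_L2_fourierE[OF assms(1)]) (rule that)
  obtain gn where gn: "\<And>n. integrable lborel (gn n)" "\<And>n. square_integrable (gn n)"
    "(\<lambda>n. L2sq (\<lambda>x. gn n x - g x)) \<longlonglongrightarrow> 0" "(\<lambda>n. L2sq (\<lambda>u. fourier (gn n) u - G u)) \<longlonglongrightarrow> 0"
    by (rule is_L2_fourierE[OF assms(2)]) (rule that)
  note sq = is_L2_fourier_square_integrable[OF assms(1)] is_L2_fourier_square_integrable[OF assms(2)]
  have lim: "(\<lambda>n. L2sq (\<lambda>x. (pn n x - qn n x) - (p x - q x))) \<longlonglongrightarrow> 0"
    if "\<And>n. square_integrable (pn n)" "\<And>n. square_integrable (qn n)" "square_integrable p" "square_integrable q"
      "(\<lambda>n. L2sq (\<lambda>x. pn n x - p x)) \<longlonglongrightarrow> 0" "(\<lambda>n. L2sq (\<lambda>x. qn n x - q x)) \<longlonglongrightarrow> 0" for pn qn p q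
  proof (rule Lim_null_comparison)
    show "(\<lambda>n. 2 * L2sq (\<lambda>x. pn n x - p x) + 2 * L2sq (\<lambda>x. qn n x - q x)) \<longlonglongrightarrow> 0"
      by (rule tendsto_eq_intros that(5,6) refl | simp)+
    have "L2sq (\<lambda>x. (pn n x - qn n x) - (p x - q x)) \<le> 2 * L2sq (\<lambda>x. pn n x - p x) + 2 * L2sq (\<lambda>x. qn n x - q x)" for n
      using L2sq_diff_le[OF square_integrable_diff[OF that(1)[of n] that(3)] square_integrable_diff[OF that(2)[of n] that(4)]]
      by (simp add: algebra_simps)
    then show "\<forall>\<^sub>F n in sequentially. norm (L2sq (\<lambda>x. (pn n x - qn n x) - (p x - q x))) \<le> 2 * L2sq (\<lambda>x. pn n x - p x) + 2 * L2sq (\<lambda>x. qn n x - q x)"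
      by (simp add: L2sq_nonneg)
  qed
  show ?thesis
  proof (rule is_L2_fourierI[where fn = "\<lambda>n x. fn n x - gn n x"])
    show "(\<lambda>n. L2sq (\<lambda>x. fn n x - gn n x - (f x - g x))) \<longlonglongrightarrow> 0"
      by (rule lim[OF fn(2) gn(2) sq(1,3) fn(3) gn(3)])
    show "(\<lambda>n. L2sq (\<lambda>u. fourier (\<lambda>x. fn n x - gn n x) u - (F u - G u))) \<longlonglongrightarrow> 0"
      unfolding fourier_diff[OF fn(1) gn(1)]
      by (rule lim[OF Plancherel_L1_L2(1)[OF fn(1,2)] Plancherel_L1_L2(1)[OF gn(1,2)] sq(2,4) fn(4) gn(4)])
  qed (use fn gn sq in \<open>auto intro: square_integrable_diff\<close>)
qed

lemma is_L2_fourier_cong_AE: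
  assumes "is_L2_fourier f F" and f: "f' \<in> borel_measurable borel" "AE x in lborel. f' x = f x"
    and F: "F' \<in> borel_measurable borel" "AE x in lborel. F' x = F x"
  shows "is_L2_fourier f' F'"
proof -
  obtain fn where fn: "\<And>n. integrable lborel (fn n)" "\<And>n. square_integrable (fn n)"
    "(\<lambda>n. L2sq (\<lambda>x. fn n x - f x)) \<longlonglongrightarrow> 0" "(\<lambda>n. L2sq (\<lambda>u. fourier (fn n) u - F u)) \<longlonglongrightarrow> 0"
    by (rule is_L2_fourierE[OF assms(1)]) (rule that)
  note sq = is_L2_fourier_square_integrable[OF assms(1)]
  have cong: "L2sq (\<lambda>x. p x - q' x) = L2sq (\<lambda>x. p x - q x)"
    if "square_integrable p" "square_integrable q" "q' \<in> borel_measurable borel" "AE x in lborel. q' x = q x" for p q q'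
  proof (rule L2sq_cong_AE)
    show "AE x in lborel. p x - q' x = p x - q x" using that(4) by eventually_elim simp
  qed (use that square_integrableD in auto)
  have sq': "square_integrable f'" "square_integrable F'"
    by (rule square_integrable_mono[OF sq(1) f(1), of 1], use f(2) in auto)
       (rule square_integrable_mono[OF sq(2) F(1), of 1], use F(2) in auto)
  show ?thesis
    by (rule is_L2_fourierI[where fn = fn])
       (use fn sq' cong[OF fn(2) sq(1) f] cong[OF Plancherel_L1_L2(1)[OF fn(1,2)] sq(2) F] in auto)
qed

text \<open>The cutoffs of f converge in L2; by the isometry their transforms form a Cauchy
  sequence, and completeness supplies the limit.\<close>

lemma is_L2_fourier_ex:
  assumes f: "square_integrable f"
  shows "\<exists>F. is_L2_fourier f F"
proof -
  define fn where "fn n = cutoff (real n) f" for n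
  have fn: "integrable lborel (fn n)" "square_integrable (fn n)" for n
    unfolding fn_def by (rule integrable_cutoff[OF f], rule square_integrable_cutoff[OF f])
  have lim: "(\<lambda>n. L2sq (\<lambda>x. fn n x - f x)) \<longlonglongrightarrow> 0"
    unfolding fn_def by (rule cutoff_tendsto_L2[OF f filterlim_real_sequentially])
  have iso: "L2sq (\<lambda>u. fourier (fn m) u - fourier (fn n) u) = 2 * pi * L2sq (\<lambda>x. fn m x - fn n x)" for m n
    by (rule is_L2_fourier_isometry[OF is_L2_fourier_diff[OF is_L2_fourier_L1[OF fn] is_L2_fourier_L1[OF fn]]])
  have "\<exists>F. square_integrable F \<and> (\<lambda>n. L2sq (\<lambda>u. fourier (fn n) u - F u)) \<longlonglongrightarrow> 0"
  proof (rule L2_complete)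
    show "square_integrable (fourier (fn n))" for n by (rule Plancherel_L1_L2(1)[OF fn])
    fix e :: real assume e: "e > 0"
    have "eventually (\<lambda>n. L2sq (\<lambda>x. fn n x - f x) < e / (16 * pi)) sequentially"
      using lim e by (intro order_tendstoD(2)[of _ 0]) auto
    then obtain N where N: "\<And>n. n \<ge> N \<Longrightarrow> L2sq (\<lambda>x. fn n x - f x) < e / (16 * pi)"
      by (auto simp: eventually_sequentially)
    have "L2sq (\<lambda>u. fourier (fn m) u - fourier (fn n) u) < e" if "m \<ge> N" "n \<ge> N" for m n
    proof -
      have "L2sq (\<lambda>x. fn m x - fn n x) \<le> 2 * L2sq (\<lambda>x. fn m x - f x) + 2 * L2sq (\<lambda>x. f x - fn n x)"
        by (rule L2sq_triangle[OF fn(2) f fn(2)])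
      also have "\<dots> < e / (4 * pi)"
        using N[OF that(1)] N[OF that(2)] by (simp add: L2sq_minus_commute[of f])
      finally have "2 * pi * L2sq (\<lambda>x. fn m x - fn n x) < 2 * pi * (e / (4 * pi))" by (intro mult_strict_left_mono) auto
      also have "\<dots> \<le> e" using e by simp
      finally show ?thesis unfolding iso .
    qed
    then show "\<exists>N. \<forall>m\<ge>N. \<forall>n\<ge>N. L2sq (\<lambda>u. fourier (fn m) u - fourier (fn n) u) < e" by blast
  qed
  then obtain F where "square_integrable F" "(\<lambda>n. L2sq (\<lambda>u. fourier (fn n) u - F u)) \<longlonglongrightarrow> 0" by blast
  then have "is_L2_fourier f F" by (intro is_L2_fourierI[OF f _ fn lim])
  then show ?thesis by blast
qed

text \<open>The double integral of e^(i u x) f(x) g(u) is symmetric in the two functions. Extended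
  to L2 below, this symmetry is the input from which inversion is derived.\<close>

lemma fourier_multiplication_formula:
  assumes f: "integrable lborel f" and g: "integrable lborel g"
  shows "(\<integral>u. fourier f u * g u \<partial>lborel) = (\<integral>x. f x * fourier g x \<partial>lborel)"
proof -
  interpret lborel_pair: pair_sigma_finite "lborel :: real measure" "lborel :: real measure" ..
  have [measurable]: "f \<in> borel_measurable borel" "g \<in> borel_measurable borel" using f g by auto
  have ex: "integrable lborel (\<lambda>x. iexp (u * x) * h x)" if "integrable lborel h" for u and h :: "real \<Rightarrow> complex"
    by (rule Bochner_Integration.integrable_bound[OF that]) (use that in \<open>auto simp: norm_mult\<close>)
  have "integrable (lborel \<Otimes>\<^sub>M lborel) (\<lambda>(u, x). iexp (u * x) * f x * g u)"
  proof (rule lborel_pair.Fubini_integrable)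
    have "(\<integral>x. norm (case (u, x) of (u, x) \<Rightarrow> iexp (u * x) * f x * g u) \<partial>lborel) = (\<integral>x. cmod (f x) \<partial>lborel) * cmod (g u)" for u
      by (simp add: norm_mult)
    then show "integrable lborel (\<lambda>u. \<integral>x. norm (case (u, x) of (u, x) \<Rightarrow> iexp (u * x) * f x * g u) \<partial>lborel)"
      using g by simp
    show "AE u in lborel. integrable lborel (\<lambda>x. case (u, x) of (u, x) \<Rightarrow> iexp (u * x) * f x * g u)"
      using ex[OF f] by simp
  qed measurable
  from lborel_pair.Fubini_integral[OF this]
  have "(\<integral>u. (\<integral>x. iexp (u * x) * f x * g u \<partial>lborel) \<partial>lborel) = (\<integral>x. (\<integral>u. iexp (u * x) * f x * g u \<partial>lborel) \<partial>lborel)"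
    by simp
  also have "(\<lambda>x. \<integral>u. iexp (u * x) * f x * g u \<partial>lborel) = (\<lambda>x. f x * fourier g x)"
  proof
    fix x
    have "(\<integral>u. iexp (u * x) * f x * g u \<partial>lborel) = (\<integral>u. f x * (iexp (x * u) * g u) \<partial>lborel)"
      by (simp only: ac_simps)
    then show "(\<integral>u. iexp (u * x) * f x * g u \<partial>lborel) = f x * fourier g x" by (simp add: fourier_def)
  qed
  finally show ?thesis by (simp add: fourier_def)
qed

lemma is_L2_fourier_multiplication_formula:
  assumes "is_L2_fourier f F" "is_L2_fourier g G"
  shows "(\<integral>u. F u * g u \<partial>lborel) = (\<integral>x. f x * G x \<partial>lborel)"
proof -
  obtain fn where fn: "\<And>n. integrable lborel (fn n)" "\<And>n. square_integrable (fn n)"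
    "(\<lambda>n. L2sq (\<lambda>x. fn n x - f x)) \<longlonglongrightarrow> 0" "(\<lambda>n. L2sq (\<lambda>u. fourier (fn n) u - F u)) \<longlonglongrightarrow> 0"
    by (rule is_L2_fourierE[OF assms(1)]) (rule that)
  obtain gn where gn: "\<And>n. integrable lborel (gn n)" "\<And>n. square_integrable (gn n)"
    "(\<lambda>n. L2sq (\<lambda>x. gn n x - g x)) \<longlonglongrightarrow> 0" "(\<lambda>n. L2sq (\<lambda>u. fourier (gn n) u - G u)) \<longlonglongrightarrow> 0"
    by (rule is_L2_fourierE[OF assms(2)]) (rule that)
  note sq = is_L2_fourier_square_integrable[OF assms(1)] is_L2_fourier_square_integrable[OF assms(2)]
  have "(\<lambda>n. \<integral>u. fourier (fn n) u * gn n u \<partial>lborel) \<longlonglongrightarrow> (\<integral>u. F u * g u \<partial>lborel)"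
    by (rule tendsto_L2_product[OF Plancherel_L1_L2(1)[OF fn(1,2)] sq(2) fn(4) gn(2) sq(3) gn(3)])
  moreover have "(\<lambda>n. \<integral>u. fourier (fn n) u * gn n u \<partial>lborel) \<longlonglongrightarrow> (\<integral>x. f x * G x \<partial>lborel)"
    unfolding fourier_multiplication_formula[OF fn(1) gn(1)]
    by (rule tendsto_L2_product[OF fn(2) sq(1) fn(3) Plancherel_L1_L2(1)[OF gn(1,2)] sq(4) gn(4)])
  ultimately show ?thesis by (rule LIMSEQ_unique)
qed

lemma L2sq_affine: "c \<noteq> 0 \<Longrightarrow> L2sq (\<lambda>x. f (t + c * x)) = L2sq f / \<bar>c\<bar>"
  using lborel_integral_real_affine[of c "\<lambda>x. (cmod (f x))\<^sup>2" t] by (simp add: L2sq_def)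

lemma L2sq_cmult: "L2sq (\<lambda>x. c * f x) = (cmod c)\<^sup>2 * L2sq f"
  by (simp add: L2sq_def norm_mult power_mult_distrib)

lemma is_L2_fourier_cnj:
  assumes "is_L2_fourier f F"
  shows "is_L2_fourier (\<lambda>x. cnj (f x)) (\<lambda>u. cnj (F (- u)))"
proof -
  obtain fn where fn: "\<And>n. integrable lborel (fn n)" "\<And>n. square_integrable (fn n)"
    "(\<lambda>n. L2sq (\<lambda>x. fn n x - f x)) \<longlonglongrightarrow> 0" "(\<lambda>n. L2sq (\<lambda>u. fourier (fn n) u - F u)) \<longlonglongrightarrow> 0"
    by (rule is_L2_fourierE[OF assms]) (rule that)
  note sq = is_L2_fourier_square_integrable[OF assms]
  have cn: "fourier (\<lambda>x. cnj (g x)) u = cnj (fourier g (- u))" for g u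
  proof -
    have "fourier (\<lambda>x. cnj (g x)) u = (\<integral>x. cnj (iexp (- u * x) * g x) \<partial>lborel)"
      unfolding fourier_def by (rule Bochner_Integration.integral_cong) (auto simp: exp_cnj)
    then show ?thesis
      unfolding fourier_def Bochner_Integration.integral_cnj[of lborel "\<lambda>x. iexp (- u * x) * g x"] .
  qed
  show ?thesis
  proof (rule is_L2_fourierI[where fn = "\<lambda>n x. cnj (fn n x)"])
    show "(\<lambda>n. L2sq (\<lambda>x. cnj (fn n x) - cnj (f x))) \<longlonglongrightarrow> 0"
      using fn(3) unfolding L2sq_def by (simp flip: complex_cnj_diff)
    have "L2sq (\<lambda>u. fourier (\<lambda>x. cnj (fn n x)) u - cnj (F (- u))) = L2sq (\<lambda>u. fourier (fn n) u - F u)" for n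
    proof -
      have "L2sq (\<lambda>u. fourier (\<lambda>x. cnj (fn n x)) u - cnj (F (- u))) = L2sq (\<lambda>u. fourier (fn n) (-u) - F (-u))"
        unfolding cn L2sq_def by (simp flip: complex_cnj_diff)
      also have "\<dots> = L2sq (\<lambda>u. fourier (fn n) u - F u)"
        using L2sq_affine[of "-1" "\<lambda>u. fourier (fn n) u - F u" 0] by simp
      finally show ?thesis .
    qed
    then show "(\<lambda>n. L2sq (\<lambda>u. fourier (\<lambda>x. cnj (fn n x)) u - cnj (F (- u)))) \<longlonglongrightarrow> 0" using fn(4) by simp
    show "square_integrable (\<lambda>u. cnj (F (- u)))"
      using square_integrable_cnj[OF square_integrable_affine[OF sq(2), of "-1" 0]] by simp
  qed (use fn sq in \<open>auto intro: square_integrable_cnj\<close>)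
qed

(* An isometry that is symmetric for the bilinear pairing is surjective: if F' is the transform of
   the candidate f, then |F' - F|^2 = |F'|^2 + |F|^2 - 2 Re <F', F> = 0. *)
theorem is_L2_fourier_inversion:
  assumes "is_L2_fourier F K"
  shows "is_L2_fourier (\<lambda>x. K (- x) / (2 * pi)) F"
proof -
  note sq = is_L2_fourier_square_integrable[OF assms]
  define f where "f x = K (- x) / (2 * pi)" for x
  have sqf: "square_integrable f"
    using square_integrable_cmult[OF square_integrable_affine[OF sq(2), of "-1" 0], of "1 / (2 * pi)"]
    by (simp add: f_def[abs_def])
  obtain F' where F': "is_L2_fourier f F'" using is_L2_fourier_ex[OF sqf] by blast
  note sq' = is_L2_fourier_square_integrable[OF F']
  have nf: "L2sq f = L2sq K / (2 * pi)\<^sup>2"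
    using L2sq_cmult[of "1 / (2 * pi)" "\<lambda>x. K (- x)"] L2sq_affine[of "-1" K 0]
    by (simp add: f_def[abs_def] norm_divide norm_mult power_divide power_mult_distrib)
  have nK: "L2sq K = 2 * pi * L2sq F" by (rule is_L2_fourier_isometry[OF assms])
  have nF': "L2sq F' = L2sq F"
    using is_L2_fourier_isometry[OF F'] nf nK by (simp add: field_simps power2_eq_square)
  have nF: "L2sq F = 2 * pi * L2sq f" using is_L2_fourier_isometry[OF F'] nF' by simp
  have "(\<integral>u. F' u * cnj (F u) \<partial>lborel) = (\<integral>x. f x * cnj (K (- x)) \<partial>lborel)"
    by (rule is_L2_fourier_multiplication_formula[OF F' is_L2_fourier_cnj[OF assms]])
  also have "\<dots> = (\<integral>x. 2 * pi * (f x * cnj (f x)) \<partial>lborel)"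
    by (simp add: f_def)
  also have "\<dots> = complex_of_real (L2sq F)"
    unfolding nF using L2sq_eq_product[OF sqf] by simp
  finally have in1: "(\<integral>u. F' u * cnj (F u) \<partial>lborel) = complex_of_real (L2sq F)" .
  have in2: "(\<integral>u. F u * cnj (F' u) \<partial>lborel) = complex_of_real (L2sq F)"
  proof -
    have "(\<integral>u. F u * cnj (F' u) \<partial>lborel) = (\<integral>u. cnj (F' u * cnj (F u)) \<partial>lborel)" by (simp add: mult.commute)
    also have "\<dots> = cnj (\<integral>u. F' u * cnj (F u) \<partial>lborel)" by (rule Bochner_Integration.integral_cnj)
    finally show ?thesis unfolding in1 by simp
  qed
  note pr = L2_product_integrable(1)
  have "complex_of_real (L2sq (\<lambda>u. F' u - F u)) = (\<integral>u. (F' u * cnj (F' u) + F u * cnj (F u)) - (F' u * cnj (F u) + F u * cnj (F' u)) \<partial>lborel)"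
    unfolding L2sq_eq_product[OF square_integrable_diff[OF sq'(2) sq(1)]]
    by (rule Bochner_Integration.integral_cong) (auto simp: algebra_simps)
  also have "\<dots> = 0"
    using pr[OF sq'(2) square_integrable_cnj[OF sq'(2)]] pr[OF sq(1) square_integrable_cnj[OF sq(1)]]
      pr[OF sq'(2) square_integrable_cnj[OF sq(1)]] pr[OF sq(1) square_integrable_cnj[OF sq'(2)]] in1 in2 nF'
    by (simp add: L2sq_eq_product[OF sq(1), symmetric] L2sq_eq_product[OF sq'(2), symmetric])
  finally have "L2sq (\<lambda>u. F' u - F u) = 0" by simp
  then have "AE u in lborel. F' u = F u"
    by (rule L2sq_eq_0_AE[OF square_integrable_diff[OF sq'(2) sq(1)]])
  then have "AE u in lborel. F u = F' u" by eventually_elim simp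
  then have "is_L2_fourier f F"
    using square_integrableD(1)[OF sqf] square_integrableD(1)[OF sq(1)]
    by (intro is_L2_fourier_cong_AE[OF F']) auto
  then show ?thesis by (simp add: f_def[abs_def])
qed

lemma is_L2_fourier_inverse_ex:
  assumes "square_integrable F" shows "\<exists>f. is_L2_fourier f F"
  using is_L2_fourier_ex[OF assms] is_L2_fourier_inversion by blast

lemma L2_fourier: "square_integrable f \<Longrightarrow> is_L2_fourier f (L2_fourier f)"
  unfolding L2_fourier_def using is_L2_fourier_ex by (rule someI_ex)

lemma L2_fourier_inv: "square_integrable F \<Longrightarrow> is_L2_fourier (L2_fourier_inv F) F"
  unfolding L2_fourier_inv_def using is_L2_fourier_inverse_ex by (rule someI_ex)

section \<open>Inversion almost everywhere by truncated integrals\<close>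

lemma L2sq_AE_subseq:
  assumes "\<And>n. square_integrable (fn n)" "square_integrable f" "(\<lambda>n. L2sq (\<lambda>x. fn n x - f x)) \<longlonglongrightarrow> 0"
  shows "\<exists>r. strict_mono r \<and> (AE x in lborel. (\<lambda>n. fn (r n) x) \<longlonglongrightarrow> f x)"
proof -
  have "\<exists>r. strict_mono r \<and> (AE x in lborel. (\<lambda>n. (cmod (fn (r n) x - f x))\<^sup>2) \<longlonglongrightarrow> 0)"
    by (rule tendsto_L1_AE_subseq)
       (use assms square_integrableD[OF square_integrable_diff[OF assms(1,2)]] in \<open>auto simp: L2sq_def\<close>)
  then obtain r where r: "strict_mono r" "AE x in lborel. (\<lambda>n. (cmod (fn (r n) x - f x))\<^sup>2) \<longlonglongrightarrow> 0" by blast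
  from r(2) have "AE x in lborel. (\<lambda>n. fn (r n) x) \<longlonglongrightarrow> f x"
  proof eventually_elim
    case (elim x)
    have "(\<lambda>n. fn (r n) x - f x) \<longlonglongrightarrow> 0" by (rule tendsto_of_sq_tendsto_0[OF order_refl elim])
    then show ?case by (simp add: LIM_zero_cancel)
  qed
  with r(1) show ?thesis by blast
qed

text \<open>The inversion integral over the frequencies in [-a, a]. Unlike the inverse transform,
  which is an arbitrary representative of a class, it is an honest function of x, so identities
  between inverse transforms are first proved for it and then passed to the limit.\<close>

definition trunc_inv :: "real \<Rightarrow> (real \<Rightarrow> complex) \<Rightarrow> real \<Rightarrow> complex" where
  "trunc_inv a F x = (\<integral>u. indicator {-a..a} u * (iexp (- (u * x)) * F u) \<partial>lborel) / (2 * pi)"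

lemma trunc_inv_eq: "trunc_inv a F x = fourier (cutoff a F) (- x) / (2 * pi)"
  unfolding trunc_inv_def fourier_def cutoff_def by (simp add: ac_simps)

lemma is_L2_fourier_trunc_inv:
  assumes "square_integrable F"
  shows "is_L2_fourier (trunc_inv a F) (cutoff a F)"
  using is_L2_fourier_inversion[OF is_L2_fourier_L1[OF integrable_cutoff[OF assms] square_integrable_cutoff[OF assms]], of a]
  unfolding trunc_inv_eq[abs_def] .

text \<open>The sequence of cutoffs is left free so that subsequences can be extracted one after the
  other and several transforms converge along a common one.\<close>

lemma is_L2_fourier_trunc_inv_AE:
  assumes "is_L2_fourier f F" and a: "filterlim a at_top sequentially"
  shows "\<exists>r. strict_mono r \<and> (AE x in lborel. (\<lambda>n. trunc_inv (a (r n)) F x) \<longlonglongrightarrow> f x)"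
proof (rule L2sq_AE_subseq)
  note sq = is_L2_fourier_square_integrable[OF assms(1)]
  show "square_integrable (trunc_inv (a n) F)" for n
    by (rule is_L2_fourier_square_integrable[OF is_L2_fourier_trunc_inv[OF sq(2)]])
  show "square_integrable f" by (rule sq)
  have "L2sq (\<lambda>u. cutoff (a n) F u - F u) / (2 * pi) = L2sq (\<lambda>x. trunc_inv (a n) F x - f x)" for n
    using is_L2_fourier_isometry[OF is_L2_fourier_diff[OF is_L2_fourier_trunc_inv[OF sq(2)] assms(1)], of "a n"]
    by (simp add: field_simps)
  moreover have "(\<lambda>n. L2sq (\<lambda>u. cutoff (a n) F u - F u) / (2 * pi)) \<longlonglongrightarrow> 0"
    by (rule tendsto_divide_zero[OF cutoff_tendsto_L2[OF sq(2) a]])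
  ultimately show "(\<lambda>n. L2sq (\<lambda>x. trunc_inv (a n) F x - f x)) \<longlonglongrightarrow> 0" by simp
qed

section \<open>Gaussian processes with Hoelder continuous variance\<close>

definition dyadic_floor :: "nat \<Rightarrow> real \<Rightarrow> real" where
  "dyadic_floor n t = real (nat \<lfloor>2 ^ n * t\<rfloor>) / 2 ^ n"

lemma dyadic_floor_bounds:
  assumes "0 \<le> t" shows "dyadic_floor n t \<le> t" "t < dyadic_floor n t + 1 / 2 ^ n" "0 \<le> dyadic_floor n t"
proof -
  have "0 \<le> 2 ^ n * t" using assms by simp
  then have "real (nat \<lfloor>2 ^ n * t\<rfloor>) = of_int \<lfloor>2 ^ n * t\<rfloor>" by simp
  then have "real (nat \<lfloor>2 ^ n * t\<rfloor>) \<le> 2 ^ n * t" "2 ^ n * t < real (nat \<lfloor>2 ^ n * t\<rfloor>) + 1" by linarith+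
  then show "dyadic_floor n t \<le> t" "t < dyadic_floor n t + 1 / 2 ^ n" "0 \<le> dyadic_floor n t"
    by (auto simp: dyadic_floor_def field_simps)
qed

lemma dyadic_increments:
  fixes x :: "real \<Rightarrow> real"
  assumes inc: "\<And>k. k < (2::nat) ^ n \<Longrightarrow> \<bar>x (real (Suc k) / 2 ^ n) - x (real k / 2 ^ n)\<bar> \<le> c"
    and c: "0 \<le> c" and ij: "i \<le> 2 ^ n" "j \<le> 2 ^ n" "i \<le> Suc j" "j \<le> Suc i"
  shows "\<bar>x (real i / 2 ^ n) - x (real j / 2 ^ n)\<bar> \<le> c"
proof -
  consider "i = j" | "i = Suc j" | "j = Suc i" using ij by linarith
  then show ?thesis
  proof cases
    case 2 with inc[of j] ij show ?thesis by simp
  next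
    case 3 with inc[of i] ij show ?thesis by (simp add: abs_minus_commute)
  qed (use c in simp)
qed

text \<open>Passing to the next level moves the dyadic approximation of t by at most one step of the
  finer grid, so the values at these approximations form a series dominated by a geometric one,
  uniformly in t. Defining the path directly as their limit gives a value at every t, not only at
  dyadic points.\<close>

lemma dyadic_path_limit:
  fixes x :: "real \<Rightarrow> real"
  assumes r: "0 < r" "r < 1"
    and inc: "\<And>n k. n \<ge> N \<Longrightarrow> k < (2::nat) ^ n \<Longrightarrow> \<bar>x (real (Suc k) / 2 ^ n) - x (real k / 2 ^ n)\<bar> \<le> r ^ n"
  shows "\<And>t. t \<in> {0..1} \<Longrightarrow> convergent (\<lambda>n. x (dyadic_floor n t))"
    and "uniformly_continuous_on {0..1} (\<lambda>t. lim (\<lambda>n. x (dyadic_floor n t)))"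
proof -
  have fl: "nat \<lfloor>2 ^ n * t\<rfloor> \<le> 2 ^ n" if "t \<in> {0..1}" for n and t :: real
  proof -
    have "2 ^ n * t \<le> 2 ^ n" using that by simp
    then have "\<lfloor>2 ^ n * t\<rfloor> \<le> \<lfloor>2 ^ n :: real\<rfloor>" by (rule floor_mono)
    then show ?thesis by simp
  qed
  have step: "\<bar>x (dyadic_floor (Suc n) t) - x (dyadic_floor n t)\<bar> \<le> r ^ Suc n" if t: "t \<in> {0..1}" and n: "n \<ge> N" for n t
  proof -
    define i where "i = nat \<lfloor>2 ^ Suc n * t\<rfloor>"
    define j where "j = 2 * nat \<lfloor>2 ^ n * t\<rfloor>"
    have j: "j \<le> 2 ^ Suc n" using fl[OF t, of n] by (simp add: j_def)
    \<comment> \<open>The floor of a doubled number is twice the floor or one more, hence the two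
      approximations coincide or are neighbours on the grid of level n + 1.\<close>
    have "\<lfloor>2 ^ Suc n * t\<rfloor> \<le> 2 * \<lfloor>2 ^ n * t\<rfloor> + 1" "2 * \<lfloor>2 ^ n * t\<rfloor> \<le> \<lfloor>2 ^ Suc n * t\<rfloor>" "0 \<le> \<lfloor>2 ^ n * t\<rfloor>"
      using t by (simp_all add: mult.assoc) linarith+
    then have ij: "i \<le> Suc j" "j \<le> Suc i" unfolding i_def j_def by linarith+
    have "\<bar>x (real i / 2 ^ Suc n) - x (real j / 2 ^ Suc n)\<bar> \<le> r ^ Suc n"
    proof (rule dyadic_increments[OF inc])
      show "i \<le> 2 ^ Suc n" unfolding i_def by (rule fl[OF t])
    qed (use n r j ij in auto)
    then show ?thesis unfolding dyadic_floor_def i_def j_def by simp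
  qed
  have close: "\<bar>x (dyadic_floor n s) - x (dyadic_floor n t)\<bar> \<le> r ^ n"
    if st: "s \<in> {0..1}" "t \<in> {0..1}" "\<bar>s - t\<bar> \<le> 1 / 2 ^ n" and n: "n \<ge> N" for n s t
  proof -
    have "\<bar>2 ^ n * s - 2 ^ n * t\<bar> \<le> 1"
      using st(3) by (simp add: abs_le_iff field_simps)
    then have "\<lfloor>2 ^ n * s\<rfloor> \<le> \<lfloor>2 ^ n * t\<rfloor> + 1" "\<lfloor>2 ^ n * t\<rfloor> \<le> \<lfloor>2 ^ n * s\<rfloor> + 1" by linarith+
    moreover have "0 \<le> \<lfloor>2 ^ n * s\<rfloor>" "0 \<le> \<lfloor>2 ^ n * t\<rfloor>" using st by auto
    ultimately have ij: "nat \<lfloor>2 ^ n * s\<rfloor> \<le> Suc (nat \<lfloor>2 ^ n * t\<rfloor>)" "nat \<lfloor>2 ^ n * t\<rfloor> \<le> Suc (nat \<lfloor>2 ^ n * s\<rfloor>)" by linarith+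
    show ?thesis unfolding dyadic_floor_def
      by (rule dyadic_increments[OF inc[OF n] _ fl[OF st(1)] fl[OF st(2)] ij]) (use r in auto)
  qed
  define c where "c = 1 / (1 - r)"
  have tail: "\<bar>x (dyadic_floor (n + k) t) - x (dyadic_floor n t)\<bar> \<le> c * r ^ n" if t: "t \<in> {0..1}" and n: "n \<ge> N" for n k t
  proof -
    have "\<bar>x (dyadic_floor (n + k) t) - x (dyadic_floor n t)\<bar> \<le> r ^ n * (\<Sum>j<k. r ^ j)"
    proof (induction k)
      case (Suc k)
      have "\<bar>x (dyadic_floor (Suc (n + k)) t) - x (dyadic_floor (n + k) t)\<bar> \<le> r ^ Suc (n + k)"
        using step[OF t, of "n + k"] n by simp
      also have "\<dots> \<le> r ^ (n + k)" using r by (simp add: mult_left_le_one_le)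
      finally show ?case using Suc by (simp add: power_add algebra_simps)
    qed simp
    also have "\<dots> \<le> r ^ n * c"
      using r sum_le_suminf[of "\<lambda>j. r ^ j" "{..<k}"] by (intro mult_left_mono) (auto simp: c_def suminf_geometric)
    finally show ?thesis by (simp add: mult.commute)
  qed
  have c0: "0 < c" using r by (simp add: c_def)
  have rz: "(\<lambda>n. K * r ^ n) \<longlonglongrightarrow> 0" for K
    using tendsto_mult[OF tendsto_const LIMSEQ_power_zero[of r], of K] r by simp
  show conv: "convergent (\<lambda>n. x (dyadic_floor n t))" if t: "t \<in> {0..1}" for t
  proof (rule Cauchy_convergent, rule metric_CauchyI)
    fix e :: real assume e: "e > 0"
    have "eventually (\<lambda>n. 2 * c * r ^ n < e) sequentially"
      by (rule order_tendstoD(2)[OF rz e])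
    then obtain M where M: "\<And>n. n \<ge> M \<Longrightarrow> 2 * c * r ^ n < e" by (auto simp: eventually_sequentially)
    define m0 where "m0 = max M N"
    have "dist (x (dyadic_floor m t)) (x (dyadic_floor n t)) < e" if "m \<ge> m0" "n \<ge> m0" for m n
      using tail[OF t, of m0 "m - m0"] tail[OF t, of m0 "n - m0"] M[of m0] that
      by (simp add: dist_real_def m0_def)
    then show "\<exists>M. \<forall>m\<ge>M. \<forall>n\<ge>M. dist (x (dyadic_floor m t)) (x (dyadic_floor n t)) < e" by blast
  qed
  have lim_tail: "\<bar>lim (\<lambda>n. x (dyadic_floor n t)) - x (dyadic_floor n t)\<bar> \<le> c * r ^ n" if t: "t \<in> {0..1}" and n: "n \<ge> N" for n t
  proof (rule tendsto_upperbound)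
    have "(\<lambda>k. x (dyadic_floor k t)) \<longlonglongrightarrow> lim (\<lambda>n. x (dyadic_floor n t))"
      using conv[OF t] by (simp add: convergent_LIMSEQ_iff)
    from LIMSEQ_ignore_initial_segment[OF this, of n]
    show "(\<lambda>k. \<bar>x (dyadic_floor (k + n) t) - x (dyadic_floor n t)\<bar>) \<longlonglongrightarrow> \<bar>lim (\<lambda>n. x (dyadic_floor n t)) - x (dyadic_floor n t)\<bar>"
      by (intro tendsto_intros)
    show "\<forall>\<^sub>F k in sequentially. \<bar>x (dyadic_floor (k + n) t) - x (dyadic_floor n t)\<bar> \<le> c * r ^ n"
      using tail[OF t n] by (simp add: add.commute)
  qed simp
  show "uniformly_continuous_on {0..1} (\<lambda>t. lim (\<lambda>n. x (dyadic_floor n t)))"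
    unfolding uniformly_continuous_on_def
  proof (intro allI impI)
    fix e :: real assume e: "e > 0"
    \<comment> \<open>One tail c r^n at each of the two points, and one increment r^n between their
      approximations, which are neighbours once the points are within 2^-n.\<close>
    have "eventually (\<lambda>n. (2 * c + 1) * r ^ n < e) sequentially"
      by (rule order_tendstoD(2)[OF rz e])
    then obtain M where M: "\<And>n. n \<ge> M \<Longrightarrow> (2 * c + 1) * r ^ n < e" by (auto simp: eventually_sequentially)
    define m where "m = max M N"
    have "dist (lim (\<lambda>n. x (dyadic_floor n s))) (lim (\<lambda>n. x (dyadic_floor n t))) < e"
      if st: "s \<in> {0..1}" "t \<in> {0..1}" "dist s t < 1 / 2 ^ m" for s t
    proof -
      have "m \<ge> N" "\<bar>s - t\<bar> \<le> 1 / 2 ^ m" using st(3) by (auto simp: m_def dist_real_def)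
      note b = lim_tail[OF st(1) this(1)] lim_tail[OF st(2) this(1)] close[OF st(1,2) this(2,1)]
      have "(2 * c + 1) * r ^ m < e" by (rule M) (simp add: m_def)
      then have "c * r ^ m + c * r ^ m + r ^ m < e" by (simp add: algebra_simps)
      with b show ?thesis unfolding dist_real_def by linarith
    qed
    then show "\<exists>d>0. \<forall>t\<in>{0..1}. \<forall>s\<in>{0..1}. dist s t < d \<longrightarrow>
        dist (lim (\<lambda>n. x (dyadic_floor n s))) (lim (\<lambda>n. x (dyadic_floor n t))) < e"
      by (intro exI[of _ "1 / 2 ^ m"]) auto
  qed
qed

text \<open>The exponent 3 pays for two losses. An increment of level n has moment of order 8^-n;
  Markov's inequality at threshold 2^-n costs a factor 2^n, and the union over the 2^n increments
  costs another, which leaves the summable 2^-n.\<close>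

theorem (in prob_space) Kolmogorov_continuity:
  fixes X :: "real \<Rightarrow> 'a \<Rightarrow> real"
  assumes X [measurable]: "\<And>t. t \<in> {0..1} \<Longrightarrow> X t \<in> borel_measurable M"
    and p: "p > 0" and K: "K \<ge> 0"
    and int: "\<And>s t. s \<in> {0..1} \<Longrightarrow> t \<in> {0..1} \<Longrightarrow> integrable M (\<lambda>\<omega>. (X s \<omega> - X t \<omega>) ^ (2 * p))"
    and mom: "\<And>s t. s \<in> {0..1} \<Longrightarrow> t \<in> {0..1} \<Longrightarrow> (\<integral>\<omega>. (X s \<omega> - X t \<omega>) ^ (2 * p) \<partial>M) \<le> K * \<bar>s - t\<bar> ^ 3"
  shows "\<exists>Z. (\<forall>t\<in>{0..1}. Z t \<in> borel_measurable M \<and> (AE \<omega> in M. Z t \<omega> = X t \<omega>)) \<and>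
    (AE \<omega> in M. uniformly_continuous_on {0..1} (\<lambda>t. Z t \<omega>))"
proof -
  \<comment> \<open>Chosen so that an increment exceeds r^n in modulus exactly when its power 2p
    exceeds 2^-n, while r < 1 keeps the chain summable.\<close>
  define r where "r = root (2 * p) (1 / 2)"
  have r: "0 < r" "r < 1" using p by (auto simp: r_def)
  have rp: "r ^ (2 * p) = 1 / 2" unfolding r_def using p by (intro real_root_pow_pos2) auto
  have df: "dyadic_floor n t \<in> {0..1}" if "t \<in> {0..1}" for n t
    using dyadic_floor_bounds[of t n] that by auto
  define B where "B n k = {\<omega> \<in> space M. r ^ n \<le> \<bar>X (real (Suc k) / 2 ^ n) \<omega> - X (real k / 2 ^ n) \<omega>\<bar>}" for n k
  have dk: "real k / 2 ^ n \<in> {0..1}" if "k \<le> (2::nat) ^ n" for k n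
    using of_nat_mono[OF that, where 'a = real] by simp
  have Bm: "B n k \<in> sets M" if "k < 2 ^ n" for n k
  proof -
    have [measurable]: "X (real k / 2 ^ n) \<in> borel_measurable M" "X (real (Suc k) / 2 ^ n) \<in> borel_measurable M"
      by (rule X[OF dk], use that in simp)+
    show ?thesis unfolding B_def by measurable
  qed
  have Bp: "prob (B n k) \<le> K * (1 / 4) ^ n" if k: "k < 2 ^ n" for n k
  proof -
    have k': "real (Suc k) / 2 ^ n \<in> {0..1}" "real k / 2 ^ n \<in> {0..1}"
      using dk[of k n] dk[of "Suc k" n] k by auto
    have "B n k \<subseteq> {\<omega> \<in> space M. (1 / 2) ^ n \<le> (X (real (Suc k) / 2 ^ n) \<omega> - X (real k / 2 ^ n) \<omega>) ^ (2 * p)}"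
    proof
      fix \<omega> assume w: "\<omega> \<in> B n k"
      have "(1 / 2) ^ n = (r ^ n) ^ (2 * p)" unfolding rp[symmetric] by (simp add: mult.commute flip: power_mult)
      also have "\<dots> \<le> \<bar>X (real (Suc k) / 2 ^ n) \<omega> - X (real k / 2 ^ n) \<omega>\<bar> ^ (2 * p)"
        using w r by (intro power_mono) (auto simp: B_def)
      also have "\<dots> = (X (real (Suc k) / 2 ^ n) \<omega> - X (real k / 2 ^ n) \<omega>) ^ (2 * p)"
        by (rule power_even_abs) simp
      finally show "\<omega> \<in> {\<omega> \<in> space M. (1 / 2) ^ n \<le> (X (real (Suc k) / 2 ^ n) \<omega> - X (real k / 2 ^ n) \<omega>) ^ (2 * p)}"
        using w by (simp add: B_def)
    qed
    then have "prob (B n k) \<le> prob {\<omega> \<in> space M. (1 / 2) ^ n \<le> (X (real (Suc k) / 2 ^ n) \<omega> - X (real k / 2 ^ n) \<omega>) ^ (2 * p)}"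
      using X[OF k'(1)] X[OF k'(2)] by (intro finite_measure_mono) auto
    also have "\<dots> \<le> (\<integral>\<omega>. (X (real (Suc k) / 2 ^ n) \<omega> - X (real k / 2 ^ n) \<omega>) ^ (2 * p) \<partial>M) / (1 / 2) ^ n"
      by (rule integral_Markov_inequality_measure[OF int[OF k']]) auto
    also have "\<dots> \<le> (K * \<bar>real (Suc k) / 2 ^ n - real k / 2 ^ n\<bar> ^ 3) / (1 / 2) ^ n"
      by (intro divide_right_mono mom[OF k']) simp
    also have "real (Suc k) / 2 ^ n - real k / 2 ^ n = (1 / 2) ^ n"
      by (simp add: field_simps power_one_over)
    also have "(K * \<bar>(1 / 2) ^ n\<bar> ^ 3) / (1 / 2) ^ n = K * ((1 / 2) ^ n * (1 / 2) ^ n)"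
      by (simp add: power3_eq_cube)
    also have "(1 / 2 :: real) ^ n * (1 / 2) ^ n = (1 / 4) ^ n" by (subst power_mult_distrib[symmetric]) simp
    finally show ?thesis .
  qed
  define A where "A n = (\<Union>k\<in>{..<2 ^ n}. B n k)" for n
  have Am: "A n \<in> sets M" for n unfolding A_def using Bm by auto
  have Ap: "prob (A n) \<le> K * (1 / 2) ^ n" for n
  proof -
    have "prob (A n) \<le> (\<Sum>k<2 ^ n. prob (B n k))"
      unfolding A_def by (rule finite_measure_subadditive_finite) (use Bm in auto)
    also have "\<dots> \<le> (\<Sum>k<(2::nat) ^ n. K * (1 / 4) ^ n)"
      by (intro sum_mono Bp) auto
    also have "\<dots> = K * (2 ^ n * (1 / 4) ^ n)" by simp
    also have "(2::real) ^ n * (1 / 4) ^ n = (1 / 2) ^ n" by (subst power_mult_distrib[symmetric]) simp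
    finally show ?thesis .
  qed
  have "AE \<omega> in M. eventually (\<lambda>n. \<omega> \<in> space M - A n) sequentially"
  proof (rule borel_cantelli_AE1[OF Am])
    show "summable (\<lambda>n. prob (A n))"
      by (rule summable_comparison_test[of _ "\<lambda>n. K * (1 / 2) ^ n"]) (use Ap in \<open>auto intro!: summable_mult summable_geometric\<close>)
  qed (simp add: less_top[symmetric])
  then have good: "AE \<omega> in M. \<exists>N. \<forall>n\<ge>N. \<forall>k<(2::nat) ^ n. \<bar>X (real (Suc k) / 2 ^ n) \<omega> - X (real k / 2 ^ n) \<omega>\<bar> \<le> r ^ n"
  proof eventually_elim
    case (elim \<omega>)
    then obtain N where N: "\<And>n. n \<ge> N \<Longrightarrow> \<omega> \<in> space M - A n" by (auto simp: eventually_sequentially)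
    have "\<bar>X (real (Suc k) / 2 ^ n) \<omega> - X (real k / 2 ^ n) \<omega>\<bar> \<le> r ^ n" if "n \<ge> N" "k < 2 ^ n" for n k
      using N[OF that(1)] that(2) unfolding A_def B_def by (force simp: not_le intro: less_imp_le)
    then show ?case by blast
  qed
  define Z where "Z t \<omega> = lim (\<lambda>n. X (dyadic_floor n t) \<omega>)" for t \<omega>
  have Zm: "Z t \<in> borel_measurable M" if "t \<in> {0..1}" for t
    unfolding Z_def[abs_def] by (rule borel_measurable_lim_metric) (rule X[OF df[OF that]])
  have ZX: "AE \<omega> in M. Z t \<omega> = X t \<omega>" if t: "t \<in> {0..1}" for t
  proof -
    \<comment> \<open>That the limit exists is the chaining argument; that it equals X t almost
      surely is a separate matter, settled by the moment bound between t and its dyadic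
      approximations and an almost surely convergent subsequence.\<close>
    have "(\<lambda>n. \<integral>\<omega>. norm ((X (dyadic_floor n t) \<omega> - X t \<omega>) ^ (2 * p)) \<partial>M) \<longlonglongrightarrow> 0"
    proof (rule Lim_null_comparison)
      show "(\<lambda>n. K * ((1 / 2) ^ n) ^ 3) \<longlonglongrightarrow> 0"
        by (rule tendsto_eq_intros LIMSEQ_power_zero refl | simp)+
      have "(\<integral>\<omega>. (X (dyadic_floor n t) \<omega> - X t \<omega>) ^ (2 * p) \<partial>M) \<le> K * ((1 / 2) ^ n) ^ 3" for n
      proof (rule order_trans[OF mom[OF df[OF t] t]])
        have "\<bar>dyadic_floor n t - t\<bar> \<le> (1 / 2) ^ n"
          using dyadic_floor_bounds[of t n] t by (simp add: power_one_over)
        then show "K * \<bar>dyadic_floor n t - t\<bar> ^ 3 \<le> K * ((1 / 2) ^ n) ^ 3"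
          using K by (intro mult_left_mono power_mono) auto
      qed
      then show "\<forall>\<^sub>F n in sequentially. norm (\<integral>\<omega>. norm ((X (dyadic_floor n t) \<omega> - X t \<omega>) ^ (2 * p)) \<partial>M) \<le> K * ((1 / 2) ^ n) ^ 3"
        by (simp add: power_even_abs)
    qed
    from tendsto_L1_AE_subseq[OF int[OF df[OF t] t] this]
    obtain q where q: "strict_mono q" "AE \<omega> in M. (\<lambda>n. (X (dyadic_floor (q n) t) \<omega> - X t \<omega>) ^ (2 * p)) \<longlonglongrightarrow> 0"
      by blast
    from q(2) good show ?thesis
    proof eventually_elim
      case (elim \<omega>)
      then obtain N where N: "\<And>n k. n \<ge> N \<Longrightarrow> k < (2::nat) ^ n \<Longrightarrow> \<bar>X (real (Suc k) / 2 ^ n) \<omega> - X (real k / 2 ^ n) \<omega>\<bar> \<le> r ^ n"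
        by blast
      have "(\<lambda>n. X (dyadic_floor n t) \<omega>) \<longlonglongrightarrow> Z t \<omega>"
        using dyadic_path_limit(1)[where x = "\<lambda>t. X t \<omega>", OF r N t] by (simp add: Z_def convergent_LIMSEQ_iff)
      from LIMSEQ_subseq_LIMSEQ[OF this q(1)]
      have "(\<lambda>n. (X (dyadic_floor (q n) t) \<omega> - X t \<omega>) ^ (2 * p)) \<longlonglongrightarrow> (Z t \<omega> - X t \<omega>) ^ (2 * p)"
        unfolding comp_def by (intro tendsto_intros)
      from LIMSEQ_unique[OF this elim(1)] show ?case by simp
    qed
  qed
  have "AE \<omega> in M. uniformly_continuous_on {0..1} (\<lambda>t. Z t \<omega>)"
    using good
  proof eventually_elim
    case (elim \<omega>)
    then obtain N where N: "\<And>n k. n \<ge> N \<Longrightarrow> k < (2::nat) ^ n \<Longrightarrow> \<bar>X (real (Suc k) / 2 ^ n) \<omega> - X (real k / 2 ^ n) \<omega>\<bar> \<le> r ^ n"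
      by blast
    show ?case unfolding Z_def by (rule dyadic_path_limit(2)[where x = "\<lambda>t. X t \<omega>", OF r N])
  qed
  with Zm ZX show ?thesis by blast
qed

section \<open>Moments of Gaussian processes\<close>

lemma gaussian_law_moment:
  assumes "prob_space M" and [measurable]: "Y \<in> borel_measurable M" and law: "distr M borel Y = gaussian_law \<mu> \<sigma>" and s: "0 \<le> \<sigma>"
    and mean: "(\<integral>\<omega>. Y \<omega> \<partial>M) = 0" and p: "p > 0"
  shows "integrable M (\<lambda>\<omega>. Y \<omega> ^ (2 * p))"
    and "(\<integral>\<omega>. Y \<omega> ^ (2 * p) \<partial>M) = fact (2 * p) / (2 ^ p * fact p) * (\<integral>\<omega>. (Y \<omega>)\<^sup>2 \<partial>M) ^ p"
    and "integrable M Y"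
proof -
  interpret prob_space M by fact
  have tr: "(\<integral>\<omega>. h (Y \<omega>) \<partial>M) = (\<integral>x. h x \<partial>gaussian_law \<mu> \<sigma>)"
    if "h \<in> borel_measurable borel" for h :: "real \<Rightarrow> real"
    unfolding law[symmetric] using that by (subst integral_distr) auto
  have ti: "integrable M (\<lambda>\<omega>. h (Y \<omega>)) \<longleftrightarrow> integrable (gaussian_law \<mu> \<sigma>) h"
    if "h \<in> borel_measurable borel" for h :: "real \<Rightarrow> real"
    unfolding law[symmetric] using that by (subst integrable_distr_eq) auto
  show "integrable M (\<lambda>\<omega>. Y \<omega> ^ (2 * p))"
    and "(\<integral>\<omega>. Y \<omega> ^ (2 * p) \<partial>M) = fact (2 * p) / (2 ^ p * fact p) * (\<integral>\<omega>. (Y \<omega>)\<^sup>2 \<partial>M) ^ p"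
    and "integrable M Y"
  proof (atomize (full), cases "\<sigma> = 0")
    case True
    then have g: "gaussian_law \<mu> \<sigma> = return borel \<mu>" by (simp add: gaussian_law_def)
    interpret r: prob_space "return borel \<mu>" by (rule prob_space_return) simp
    have i: "integrable (return borel \<mu>) h" if "h \<in> borel_measurable borel" for h :: "real \<Rightarrow> real"
      by (rule r.integrable_const_bound[of _ "\<bar>h \<mu>\<bar>"]) (use that in \<open>auto simp: AE_return\<close>)
    have r: "(\<integral>\<omega>. h (Y \<omega>) \<partial>M) = h \<mu>" if "h \<in> borel_measurable borel" for h :: "real \<Rightarrow> real"
      unfolding tr[OF that] g using that by (rule integral_return[rotated]) simp
    have "\<mu> = 0" using r[of "\<lambda>x. x"] mean by simp
    moreover have "integrable M (\<lambda>\<omega>. Y \<omega> ^ (2 * p))" "integrable M Y"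
      using ti[of "\<lambda>x. x ^ (2 * p)"] ti[of "\<lambda>x. x"] unfolding g by (simp_all add: i)
    ultimately show "integrable M (\<lambda>\<omega>. Y \<omega> ^ (2 * p)) \<and>
      (\<integral>\<omega>. Y \<omega> ^ (2 * p) \<partial>M) = fact (2 * p) / (2 ^ p * fact p) * (\<integral>\<omega>. (Y \<omega>)\<^sup>2 \<partial>M) ^ p \<and> integrable M Y"
      using r[of "\<lambda>x. x ^ (2 * p)"] r[of "\<lambda>x. x\<^sup>2"] p by (simp add: zero_power)
  next
    case False
    then have s: "\<sigma> > 0" using s by simp
    have g: "gaussian_law \<mu> \<sigma> = density lborel (normal_density \<mu> \<sigma>)" using False by (simp add: gaussian_law_def)
    have tr': "(\<integral>\<omega>. h (Y \<omega>) \<partial>M) = (\<integral>x. normal_density \<mu> \<sigma> x * h x \<partial>lborel)"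
      if [measurable]: "h \<in> borel_measurable borel" for h :: "real \<Rightarrow> real"
      unfolding tr[OF that] g using that by (subst integral_density) (auto simp: normal_density_nonneg)
    have ti': "integrable M (\<lambda>\<omega>. h (Y \<omega>)) \<longleftrightarrow> integrable lborel (\<lambda>x. normal_density \<mu> \<sigma> x * h x)"
      if [measurable]: "h \<in> borel_measurable borel" for h :: "real \<Rightarrow> real"
      unfolding ti[OF that] g using that by (subst integrable_density) (auto simp: normal_density_nonneg)
    have m: "\<mu> = 0" using tr'[of "\<lambda>x. x"] mean integral_normal_moment_nz_1[OF s, of \<mu>] by simp
    have e: "(\<integral>\<omega>. Y \<omega> ^ (2 * k) \<partial>M) = fact (2 * k) / ((2 / \<sigma>\<^sup>2) ^ k * fact k)" for k
      using tr'[of "\<lambda>x. x ^ (2 * k)"] integral_normal_moment_even[OF s, of \<mu> k] m by simp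
    have "(\<integral>\<omega>. (Y \<omega>)\<^sup>2 \<partial>M) = \<sigma>\<^sup>2" using e[of 1] by (simp add: numeral_eq_Suc)
    moreover have "fact (2 * p) / ((2 / \<sigma>\<^sup>2) ^ p * fact p) = fact (2 * p) / (2 ^ p * fact p) * (\<sigma>\<^sup>2) ^ p"
      using s by (simp add: power_divide)
    moreover have "integrable M (\<lambda>\<omega>. Y \<omega> ^ (2 * p))"
      using ti'[of "\<lambda>x. x ^ (2 * p)"] integrable_normal_moment[OF s, of \<mu> "2 * p"] m by simp
    moreover have "integrable M Y"
      using ti'[of "\<lambda>x. x"] integrable_normal_moment_nz_1[OF s, of \<mu>] by simp
    ultimately show "integrable M (\<lambda>\<omega>. Y \<omega> ^ (2 * p)) \<and>
      (\<integral>\<omega>. Y \<omega> ^ (2 * p) \<partial>M) = fact (2 * p) / (2 ^ p * fact p) * (\<integral>\<omega>. (Y \<omega>)\<^sup>2 \<partial>M) ^ p \<and> integrable M Y"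
      using e[of p] by simp
  qed
qed

text \<open>The law of a linear combination is given with an unspecified mean. Its Gaussian
  coordinates are integrable and have mean 0, so the combination has mean 0 as well, and then its
  even moments are powers of its variance up to a constant.\<close>

lemma centered_gaussian_process_moment:
  assumes G: "centered_gaussian_process M T G" and J: "finite J" "J \<subseteq> T" and p: "p > 0"
  shows "integrable M (\<lambda>\<omega>. (\<Sum>j\<in>J. c j * G j \<omega>) ^ (2 * p))"
    and "(\<integral>\<omega>. (\<Sum>j\<in>J. c j * G j \<omega>) ^ (2 * p) \<partial>M) =
      fact (2 * p) / (2 ^ p * fact p) * (\<integral>\<omega>. (\<Sum>j\<in>J. c j * G j \<omega>)\<^sup>2 \<partial>M) ^ p"
proof -
  have M: "prob_space M" and Gm: "\<And>t. t \<in> T \<Longrightarrow> G t \<in> borel_measurable M"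
    and law: "\<And>J c. finite J \<Longrightarrow> J \<subseteq> T \<Longrightarrow> \<exists>\<mu> \<sigma>. 0 \<le> \<sigma> \<and> distr M borel (\<lambda>\<omega>. \<Sum>j\<in>J. c j * G j \<omega>) = gaussian_law \<mu> \<sigma>"
    and mean: "\<And>t. t \<in> T \<Longrightarrow> (\<integral>\<omega>. G t \<omega> \<partial>M) = 0"
    using G unfolding centered_gaussian_process_def by blast+
  have i: "integrable M (G t)" if t: "t \<in> T" for t
  proof -
    obtain \<mu> \<sigma> where "0 \<le> \<sigma>" "distr M borel (\<lambda>\<omega>. \<Sum>j\<in>{t}. 1 * G j \<omega>) = gaussian_law \<mu> \<sigma>"
      using law[of "{t}" "\<lambda>_. 1"] t by auto
    then show ?thesis using gaussian_law_moment(3)[OF M Gm[OF t] _ _ mean[OF t], of \<mu> \<sigma> 1] by simp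
  qed
  obtain \<mu> \<sigma> where ms: "0 \<le> \<sigma>" "distr M borel (\<lambda>\<omega>. \<Sum>j\<in>J. c j * G j \<omega>) = gaussian_law \<mu> \<sigma>"
    using law[OF J] by blast
  have m: "(\<lambda>\<omega>. \<Sum>j\<in>J. c j * G j \<omega>) \<in> borel_measurable M"
    using Gm J by (intro borel_measurable_sum borel_measurable_times) auto
  have "(\<integral>\<omega>. (\<Sum>j\<in>J. c j * G j \<omega>) \<partial>M) = (\<Sum>j\<in>J. (\<integral>\<omega>. c j * G j \<omega> \<partial>M))"
    using i J by (intro Bochner_Integration.integral_sum) auto
  also have "\<dots> = 0" using mean J by (intro sum.neutral) auto
  finally have z: "(\<integral>\<omega>. (\<Sum>j\<in>J. c j * G j \<omega>) \<partial>M) = 0" .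
  show "integrable M (\<lambda>\<omega>. (\<Sum>j\<in>J. c j * G j \<omega>) ^ (2 * p))"
    and "(\<integral>\<omega>. (\<Sum>j\<in>J. c j * G j \<omega>) ^ (2 * p) \<partial>M) =
      fact (2 * p) / (2 ^ p * fact p) * (\<integral>\<omega>. (\<Sum>j\<in>J. c j * G j \<omega>)\<^sup>2 \<partial>M) ^ p"
    by (rule gaussian_law_moment[OF M m ms(2,1) z p])+
qed

(* On a compact index set a continuous function that is constant along the zero set of a continuous
   pseudometric factors through the (compact) quotient, hence is uniformly continuous for it. *)
lemma uniformly_continuous_pseudometric:
  fixes V :: "real \<Rightarrow> real \<Rightarrow> real" and f :: "real \<Rightarrow> real"
  assumes V0: "\<And>s t. s \<in> {0..1} \<Longrightarrow> t \<in> {0..1} \<Longrightarrow> 0 \<le> V s t"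
    and V: "\<And>s t. s \<in> {0..1} \<Longrightarrow> t \<in> {0..1} \<Longrightarrow> V s t \<le> C * \<bar>s - t\<bar> powr b" and b: "b > 0"
    and tri: "\<And>s t u v. s \<in> {0..1} \<Longrightarrow> t \<in> {0..1} \<Longrightarrow> u \<in> {0..1} \<Longrightarrow> v \<in> {0..1} \<Longrightarrow>
       V s t \<le> 3 * (V s u + V u v + V v t)"
    and f: "continuous_on {0..1} f"
    and eq: "\<And>s t. s \<in> {0..1} \<Longrightarrow> t \<in> {0..1} \<Longrightarrow> V s t = 0 \<Longrightarrow> f s = f t"
    and e: "e > 0"
  shows "\<exists>\<delta>>0. \<forall>s\<in>{0..1}. \<forall>t\<in>{0..1}. sqrt (V s t) < \<delta> \<longrightarrow> \<bar>f s - f t\<bar> < e"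
proof (rule ccontr)
  assume "\<not> ?thesis"
  then have neg: "\<And>\<delta>. \<delta> > 0 \<Longrightarrow> \<exists>s\<in>{0..1}. \<exists>t\<in>{0..1}. sqrt (V s t) < \<delta> \<and> \<not> \<bar>f s - f t\<bar> < e" by blast
  \<comment> \<open>A violating sequence of pairs at distance below 1 / (n + 1). At a limit pair V
    vanishes because V is small between nearby points, so f takes equal values there, against the
    gap e. V is a squared distance, whence the factor 3 for chains of three.\<close>
  have "\<exists>st. fst st \<in> {0..1} \<and> snd st \<in> {0..1} \<and> sqrt (V (fst st) (snd st)) < 1 / real (Suc n) \<and> \<not> \<bar>f (fst st) - f (snd st)\<bar> < e" for n
    using neg[of "1 / real (Suc n)"] by force
  then have "\<exists>st. \<forall>n. fst (st n) \<in> {0..1} \<and> snd (st n) \<in> {0..1} \<and> sqrt (V (fst (st n)) (snd (st n))) < 1 / real (Suc n) \<and> \<not> \<bar>f (fst (st n)) - f (snd (st n))\<bar> < e"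
    by (intro choice allI)
  then obtain st where st: "\<And>n. fst (st n) \<in> {0..1}" "\<And>n. snd (st n) \<in> {0..1}"
    "\<And>n. sqrt (V (fst (st n)) (snd (st n))) < 1 / real (Suc n)" "\<And>n. \<not> \<bar>f (fst (st n)) - f (snd (st n))\<bar> < e"
    by blast
  have "compact ({0..1::real} \<times> {0..1::real})" by (intro compact_Times compact_Icc)
  moreover have "\<And>n. st n \<in> {0..1} \<times> {0..1}" using st(1,2) by (simp add: mem_Times_iff)
  ultimately obtain l r where l: "l \<in> {0..1} \<times> {0..1}" and r: "strict_mono (r :: nat \<Rightarrow> nat)" and lim: "(st \<circ> r) \<longlonglongrightarrow> l"
    unfolding compact_def by blast
  obtain s t where lst: "l = (s, t)" by force
  have s: "s \<in> {0..1}" and t: "t \<in> {0..1}" using l lst by auto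
  have ls: "(\<lambda>n. fst (st (r n))) \<longlonglongrightarrow> s" and lt: "(\<lambda>n. snd (st (r n))) \<longlonglongrightarrow> t"
    using tendsto_fst[OF lim] tendsto_snd[OF lim] by (simp_all add: lst comp_def)
  have bnd: "V s t \<le> 3 * (C * \<bar>s - fst (st (r n))\<bar> powr b + (1 / real (Suc n))\<^sup>2 + C * \<bar>snd (st (r n)) - t\<bar> powr b)" for n
  proof -
    have "V (fst (st (r n))) (snd (st (r n))) \<le> (1 / real (Suc n))\<^sup>2"
    proof -
      have "sqrt (V (fst (st (r n))) (snd (st (r n)))) \<le> 1 / real (Suc (r n))" using st(3)[of "r n"] by simp
      also have "\<dots> \<le> 1 / real (Suc n)" using seq_suble[OF r, of n] by (intro divide_left_mono) auto
      finally show ?thesis by (rule sqrt_le_D)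
    qed
    then show ?thesis
      by (intro order_trans[OF tri[OF s t st(1,2)[of "r n"]]] mult_left_mono add_mono V s t st) simp_all
  qed
  have "V s t \<le> 0"
  proof (rule tendsto_lowerbound)
    have z: "(\<lambda>n. C * \<bar>g n\<bar> powr b) \<longlonglongrightarrow> 0" if "g \<longlonglongrightarrow> 0" for g :: "nat \<Rightarrow> real"
    proof -
      have "(\<lambda>n. \<bar>g n\<bar> powr b) \<longlonglongrightarrow> 0"
        by (rule tendsto_zero_powrI[OF tendsto_rabs_zero[OF that] tendsto_const]) (use b in auto)
      then show ?thesis by (rule tendsto_mult_right_zero)
    qed
    have "(\<lambda>n. s - fst (st (r n))) \<longlonglongrightarrow> 0" "(\<lambda>n. snd (st (r n)) - t) \<longlonglongrightarrow> 0"
      using tendsto_diff[OF tendsto_const ls, of s] tendsto_diff[OF lt tendsto_const, of t] by simp_all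
    moreover have "(\<lambda>n. (1 / real (Suc n))\<^sup>2) \<longlonglongrightarrow> 0"
    proof -
      have "(\<lambda>n. 1 / real (Suc n)) \<longlonglongrightarrow> 0" by (rule LIMSEQ_Suc[OF lim_const_over_n])
      from tendsto_power[OF this, of 2] show ?thesis unfolding zero_power2 .
    qed
    ultimately have "(\<lambda>n. 3 * (C * \<bar>s - fst (st (r n))\<bar> powr b + (1 / real (Suc n))\<^sup>2 + C * \<bar>snd (st (r n)) - t\<bar> powr b)) \<longlonglongrightarrow> 3 * (0 + 0 + 0)"
      by (intro tendsto_mult tendsto_const tendsto_add z)
    then show "(\<lambda>n. 3 * (C * \<bar>s - fst (st (r n))\<bar> powr b + (1 / real (Suc n))\<^sup>2 + C * \<bar>snd (st (r n)) - t\<bar> powr b)) \<longlonglongrightarrow> 0" by simp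
    show "\<forall>\<^sub>F n in sequentially. V s t \<le> 3 * (C * \<bar>s - fst (st (r n))\<bar> powr b + (1 / real (Suc n))\<^sup>2 + C * \<bar>snd (st (r n)) - t\<bar> powr b)"
      using bnd by simp
  qed simp
  then have fst: "f s = f t" using V0[OF s t] eq[OF s t] by simp
  have "(\<lambda>n. f (fst (st (r n)))) \<longlonglongrightarrow> f s" "(\<lambda>n. f (snd (st (r n)))) \<longlonglongrightarrow> f t"
    by (rule continuous_on_tendsto_compose[OF f ls s] continuous_on_tendsto_compose[OF f lt t], use st in simp)+
  then have "(\<lambda>n. \<bar>f (fst (st (r n))) - f (snd (st (r n)))\<bar>) \<longlonglongrightarrow> \<bar>f s - f t\<bar>" by (intro tendsto_intros)
  then have "(\<lambda>n. \<bar>f (fst (st (r n))) - f (snd (st (r n)))\<bar>) \<longlonglongrightarrow> 0" using fst by simp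
  from order_tendstoD(2)[OF this e] obtain n where "\<bar>f (fst (st (r n))) - f (snd (st (r n)))\<bar> < e"
    by (auto simp: eventually_sequentially)
  with st(4) show False by blast
qed

lemma square_sum3: "(a + b + c :: real)\<^sup>2 \<le> 3 * (a\<^sup>2 + b\<^sup>2 + c\<^sup>2)"
  using sum_squares_ge_zero[of "a - b" "b - c"] zero_le_power2[of "a - c"]
  by (simp add: power2_eq_square algebra_simps)

(* The point z compactifies the index set: the process is extended there by 0. *)
theorem gaussian_process_continuous_version:
  fixes \<phi> :: "'i \<Rightarrow> real" and G :: "'i \<Rightarrow> 'b \<Rightarrow> real"
  assumes G: "centered_gaussian_process M T G"
    and \<phi>: "inj_on \<phi> T" "\<phi> ` T \<subseteq> {0..1}" "{0..1} - {z} \<subseteq> \<phi> ` T"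
    and b: "b > 0" and C: "C \<ge> 0"
    and var: "\<And>s t. s \<in> T \<Longrightarrow> t \<in> T \<Longrightarrow> (\<integral>\<omega>. (G s \<omega> - G t \<omega>)\<^sup>2 \<partial>M) \<le> C * \<bar>\<phi> s - \<phi> t\<bar> powr b"
    and var0: "\<And>t. t \<in> T \<Longrightarrow> (\<integral>\<omega>. (G t \<omega>)\<^sup>2 \<partial>M) \<le> C * \<bar>\<phi> t - z\<bar> powr b"
  shows "\<exists>G'. version_of M T G G' \<and>
    (AE \<omega> in M. unif_cont_wrt (intrinsic_dist M G') T (\<lambda>t. G' t \<omega>)) \<and>
    (AE \<omega> in M. (SUP t\<in>T. ereal \<bar>G' t \<omega>\<bar>) < \<infinity>)"
proof -
  interpret prob_space M using G by (simp add: centered_gaussian_process_def)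
  have Gm: "t \<in> T \<Longrightarrow> G t \<in> borel_measurable M" for t using G by (simp add: centered_gaussian_process_def)
  define \<psi> where "\<psi> = inv_into T \<phi>"
  have \<psi>: "\<psi> (\<phi> t) = t" if "t \<in> T" for t using that \<phi>(1) by (simp add: \<psi>_def)
  have \<psi>': "\<psi> s \<in> T" "\<phi> (\<psi> s) = s" if "s \<in> \<phi> ` T" for s
    using that by (auto simp: \<psi>_def inv_into_into f_inv_into_f)
  define X where "X s = (if s \<in> \<phi> ` T then G (\<psi> s) else (\<lambda>_. 0))" for s
  have X\<phi>: "X (\<phi> t) = G t" if "t \<in> T" for t using that \<psi> by (simp add: X_def)
  have Xm: "X s \<in> borel_measurable M" for s using Gm \<psi>' by (simp add: X_def)
  \<comment> \<open>Increments of the extended process must be finite combinations of the given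
    variables for the moment identity to apply. Equal indices are treated apart: there the two-point
    set with coefficients 1 and -1 would collapse to one point.\<close>
  have comb: "\<exists>J c. finite J \<and> J \<subseteq> T \<and> (\<forall>\<omega>. X s \<omega> - X t \<omega> = (\<Sum>j\<in>J. c j * G j \<omega>))" for s t
  proof -
    consider "s \<in> \<phi> ` T" "t \<in> \<phi> ` T" "\<psi> s \<noteq> \<psi> t" | "s \<in> \<phi> ` T" "t \<in> \<phi> ` T" "\<psi> s = \<psi> t"
      | "s \<in> \<phi> ` T" "t \<notin> \<phi> ` T" | "s \<notin> \<phi> ` T" "t \<in> \<phi> ` T" | "s \<notin> \<phi> ` T" "t \<notin> \<phi> ` T" by blast
    then show ?thesis
    proof cases
      case 1
      then show ?thesis using \<psi>'
        by (intro exI[of _ "{\<psi> s, \<psi> t}"] exI[of _ "\<lambda>j. if j = \<psi> s then 1 else - 1"]) (auto simp: X_def)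
    next
      case 2
      then show ?thesis by (intro exI[of _ "{}"]) (auto simp: X_def)
    next
      case 3
      then show ?thesis using \<psi>' by (intro exI[of _ "{\<psi> s}"] exI[of _ "\<lambda>_. 1"]) (auto simp: X_def)
    next
      case 4
      then show ?thesis using \<psi>' by (intro exI[of _ "{\<psi> t}"] exI[of _ "\<lambda>_. - 1"]) (auto simp: X_def)
    next
      case 5
      then show ?thesis by (intro exI[of _ "{}"]) (auto simp: X_def)
    qed
  qed
  define c where "c p = (fact (2 * p) / (2 ^ p * fact p) :: real)" for p
  have c0: "0 \<le> c p" for p by (simp add: c_def)
  have mom: "integrable M (\<lambda>\<omega>. (X s \<omega> - X t \<omega>) ^ (2 * p))"
    "(\<integral>\<omega>. (X s \<omega> - X t \<omega>) ^ (2 * p) \<partial>M) = c p * (\<integral>\<omega>. (X s \<omega> - X t \<omega>)\<^sup>2 \<partial>M) ^ p" if "p > 0" for s t p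
  proof -
    obtain J d where J: "finite J" "J \<subseteq> T" "\<And>\<omega>. X s \<omega> - X t \<omega> = (\<Sum>j\<in>J. d j * G j \<omega>)" using comb[of s t] by blast
    show "integrable M (\<lambda>\<omega>. (X s \<omega> - X t \<omega>) ^ (2 * p))"
      "(\<integral>\<omega>. (X s \<omega> - X t \<omega>) ^ (2 * p) \<partial>M) = c p * (\<integral>\<omega>. (X s \<omega> - X t \<omega>)\<^sup>2 \<partial>M) ^ p"
      unfolding J(3) c_def by (rule centered_gaussian_process_moment[OF G J(1,2) that])+
  qed
  define V where "V s t = (\<integral>\<omega>. (X s \<omega> - X t \<omega>)\<^sup>2 \<partial>M)" for s t
  have iV: "integrable M (\<lambda>\<omega>. (X s \<omega> - X t \<omega>)\<^sup>2)" for s t using mom(1)[of 1 s t] by simp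
  have Vb: "V s t \<le> C * \<bar>s - t\<bar> powr b" if st: "s \<in> {0..1}" "t \<in> {0..1}" for s t
  proof -
    have out: "u = z" if "u \<in> {0..1}" "u \<notin> \<phi> ` T" for u using that \<phi>(3) by blast
    consider "s \<in> \<phi> ` T" "t \<in> \<phi> ` T" | "s \<in> \<phi> ` T" "t \<notin> \<phi> ` T" | "s \<notin> \<phi> ` T" "t \<in> \<phi> ` T"
      | "s \<notin> \<phi> ` T" "t \<notin> \<phi> ` T" by blast
    then show ?thesis
    proof cases
      case 1
      then show ?thesis using var[of "\<psi> s" "\<psi> t"] \<psi>' by (simp add: V_def X_def)
    next
      case 2
      then show ?thesis using var0[of "\<psi> s"] \<psi>' out[OF st(2)] by (simp add: V_def X_def)
    next
      case 3
      then show ?thesis using var0[of "\<psi> t"] \<psi>' out[OF st(1)] by (simp add: V_def X_def abs_minus_commute)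
    next
      case 4
      then show ?thesis using C by (simp add: V_def X_def)
    qed
  qed
  have V0: "0 \<le> V s t" for s t by (simp add: V_def)
  have tri: "V s t \<le> 3 * (V s u + V u v + V v t)" for s t u v
  proof -
    have "V s t \<le> (\<integral>\<omega>. 3 * ((X s \<omega> - X u \<omega>)\<^sup>2 + (X u \<omega> - X v \<omega>)\<^sup>2 + (X v \<omega> - X t \<omega>)\<^sup>2) \<partial>M)"
      unfolding V_def
    proof (rule integral_mono[OF iV])
      show "(X s \<omega> - X t \<omega>)\<^sup>2 \<le> 3 * ((X s \<omega> - X u \<omega>)\<^sup>2 + (X u \<omega> - X v \<omega>)\<^sup>2 + (X v \<omega> - X t \<omega>)\<^sup>2)" for \<omega>
        using square_sum3[of "X s \<omega> - X u \<omega>" "X u \<omega> - X v \<omega>" "X v \<omega> - X t \<omega>"] by simp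
    qed (use iV in auto)
    also have "\<dots> = 3 * (V s u + V u v + V v t)" using iV by (simp add: V_def)
    finally show ?thesis .
  qed
  \<comment> \<open>So large that the p-th power of the variance bound has the exponent 3 which the
    continuity criterion asks for.\<close>
  obtain p :: nat where p: "p > 0" "b * real p \<ge> 3"
  proof -
    obtain p :: nat where "3 / b \<le> real p" using real_arch_simple by blast
    then have "3 \<le> b * real p" using b by (simp add: field_simps)
    moreover have "p > 0" using \<open>3 \<le> b * real p\<close> by (cases p) auto
    ultimately show ?thesis using that by blast
  qed
  have "\<exists>Z. (\<forall>t\<in>{0..1}. Z t \<in> borel_measurable M \<and> (AE \<omega> in M. Z t \<omega> = X t \<omega>)) \<and>
    (AE \<omega> in M. uniformly_continuous_on {0..1} (\<lambda>t. Z t \<omega>))"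
  proof (rule Kolmogorov_continuity[OF Xm p(1)])
    show "0 \<le> c p * C ^ p" using c0 C by simp
    fix s t :: real assume st: "s \<in> {0..1}" "t \<in> {0..1}"
    show "integrable M (\<lambda>\<omega>. (X s \<omega> - X t \<omega>) ^ (2 * p))" by (rule mom(1)[OF p(1)])
    have "(\<bar>s - t\<bar> powr b) ^ p \<le> \<bar>s - t\<bar> ^ 3"
    proof (cases "s = t")
      case False
      have "(\<bar>s - t\<bar> powr b) ^ p = \<bar>s - t\<bar> powr (b * real p)" using False by (simp add: powr_powr flip: powr_realpow)
      also have "\<dots> \<le> \<bar>s - t\<bar> powr 3" using p(2) st False by (intro powr_mono') auto
      also have "\<dots> = \<bar>s - t\<bar> ^ 3" using False by (simp add: powr_numeral)
      finally show ?thesis .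
    qed (use p in \<open>auto simp: zero_power\<close>)
    then have "(C * \<bar>s - t\<bar> powr b) ^ p \<le> C ^ p * \<bar>s - t\<bar> ^ 3"
      using C by (simp add: power_mult_distrib mult_left_mono)
    then have "V s t ^ p \<le> C ^ p * \<bar>s - t\<bar> ^ 3"
      using power_mono[OF Vb[OF st] V0, of p] by linarith
    then show "(\<integral>\<omega>. (X s \<omega> - X t \<omega>) ^ (2 * p) \<partial>M) \<le> c p * C ^ p * \<bar>s - t\<bar> ^ 3"
      unfolding mom(2)[OF p(1)] V_def[symmetric] using mult_left_mono[OF _ c0] by (simp add: mult.assoc)
  qed
  then obtain Z where Z: "\<And>t. t \<in> {0..1} \<Longrightarrow> Z t \<in> borel_measurable M" "\<And>t. t \<in> {0..1} \<Longrightarrow> AE \<omega> in M. Z t \<omega> = X t \<omega>"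
    "AE \<omega> in M. uniformly_continuous_on {0..1} (\<lambda>t. Z t \<omega>)" by blast
  define G' where "G' t = Z (\<phi> t)" for t
  have \<phi>I: "\<phi> t \<in> {0..1}" if "t \<in> T" for t using that \<phi>(2) by blast
  have ver: "AE \<omega> in M. G' t \<omega> = G t \<omega>" if "t \<in> T" for t
    using Z(2)[OF \<phi>I[OF that]] by (simp add: G'_def X\<phi>[OF that])
  have G'm: "G' t \<in> borel_measurable M" if "t \<in> T" for t unfolding G'_def by (rule Z(1)[OF \<phi>I[OF that]])
  have dist: "intrinsic_dist M G' s t = sqrt (V (\<phi> s) (\<phi> t))" if "s \<in> T" "t \<in> T" for s t
  proof -
    have "(\<integral>\<omega>. (G' s \<omega> - G' t \<omega>)\<^sup>2 \<partial>M) = (\<integral>\<omega>. (X (\<phi> s) \<omega> - X (\<phi> t) \<omega>)\<^sup>2 \<partial>M)"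
    proof (rule integral_cong_AE)
      show "AE \<omega> in M. (G' s \<omega> - G' t \<omega>)\<^sup>2 = (X (\<phi> s) \<omega> - X (\<phi> t) \<omega>)\<^sup>2"
        using ver[OF that(1)] ver[OF that(2)] by eventually_elim (simp add: X\<phi> that)
    qed (use G'm[OF that(1)] G'm[OF that(2)] Xm in measurable)
    then show ?thesis by (simp add: intrinsic_dist_def V_def)
  qed
  \<comment> \<open>Paths must agree at all pairs of intrinsic distance 0, and there may be
    uncountably many. Almost sure equality is imposed on a countable dense subset of these pairs and
    extended to the others by continuity of the path.\<close>
  define D where "D = {st \<in> {0..1} \<times> {0..1}. V (fst st) (snd st) = 0}"
  obtain Q where Q: "countable Q" "Q \<subseteq> D" "D \<subseteq> closure Q" using separable[of D] by blast
  have "AE \<omega> in M. \<forall>st\<in>Q. Z (fst st) \<omega> = Z (snd st) \<omega>"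
  proof (rule AE_ball_countable'[OF _ Q(1)])
    fix st assume "st \<in> Q"
    then have st: "fst st \<in> {0..1}" "snd st \<in> {0..1}" "V (fst st) (snd st) = 0" using Q(2) by (auto simp: D_def)
    have "AE \<omega> in M. (X (fst st) \<omega> - X (snd st) \<omega>)\<^sup>2 = 0"
      using st(3) integral_nonneg_eq_0_iff_AE[OF iV] by (simp add: V_def)
    with Z(2)[OF st(1)] Z(2)[OF st(2)] show "AE \<omega> in M. Z (fst st) \<omega> = Z (snd st) \<omega>"
      by eventually_elim simp
  qed
  then have uc: "AE \<omega> in M. unif_cont_wrt (intrinsic_dist M G') T (\<lambda>t. G' t \<omega>)"
    using Z(3)
  proof eventually_elim
    case (elim \<omega>)
    have cont: "continuous_on {0..1} (\<lambda>t. Z t \<omega>)" by (rule uniformly_continuous_imp_continuous[OF elim(2)])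
    have ZD: "Z s \<omega> = Z t \<omega>" if st: "s \<in> {0..1}" "t \<in> {0..1}" "V s t = 0" for s t
    proof -
      have "(s, t) \<in> closure Q" using st Q(3) by (auto simp: D_def)
      then obtain q where q: "\<And>n. q n \<in> Q" "q \<longlonglongrightarrow> (s, t)" unfolding closure_sequential by blast
      have qI: "fst (q n) \<in> {0..1}" "snd (q n) \<in> {0..1}" for n using q(1)[of n] Q(2) by (auto simp: D_def)
      have ls: "(\<lambda>n. fst (q n)) \<longlonglongrightarrow> s" and lt: "(\<lambda>n. snd (q n)) \<longlonglongrightarrow> t"
        using tendsto_fst[OF q(2)] tendsto_snd[OF q(2)] by simp_all
      have "(\<lambda>n. Z (fst (q n)) \<omega>) \<longlonglongrightarrow> Z s \<omega>" "(\<lambda>n. Z (snd (q n)) \<omega>) \<longlonglongrightarrow> Z t \<omega>"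
        by (rule continuous_on_tendsto_compose[OF cont ls st(1)] continuous_on_tendsto_compose[OF cont lt st(2)], use qI in simp)+
      moreover have "(\<lambda>n. Z (fst (q n)) \<omega>) = (\<lambda>n. Z (snd (q n)) \<omega>)" using elim(1) q(1) by auto
      ultimately show ?thesis using LIMSEQ_unique by metis
    qed
    show ?case unfolding unif_cont_wrt_def
    proof (intro allI impI)
      fix e :: real assume e: "e > 0"
      obtain \<delta> where d: "\<delta> > 0" "\<And>s t. s \<in> {0..1} \<Longrightarrow> t \<in> {0..1} \<Longrightarrow> sqrt (V s t) < \<delta> \<Longrightarrow> \<bar>Z s \<omega> - Z t \<omega>\<bar> < e"
        using uniformly_continuous_pseudometric[of V C b "\<lambda>t. Z t \<omega>", OF V0 Vb b tri cont ZD e] by blast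
      show "\<exists>\<delta>>0. \<forall>s\<in>T. \<forall>t\<in>T. intrinsic_dist M G' s t < \<delta> \<longrightarrow> \<bar>G' s \<omega> - G' t \<omega>\<bar> < e"
      proof (intro exI[of _ \<delta>] conjI ballI impI d(1))
        fix s t assume st: "s \<in> T" "t \<in> T" "intrinsic_dist M G' s t < \<delta>"
        then have "sqrt (V (\<phi> s) (\<phi> t)) < \<delta>" by (simp add: dist)
        then show "\<bar>G' s \<omega> - G' t \<omega>\<bar> < e"
          unfolding G'_def by (rule d(2)[OF \<phi>I[OF st(1)] \<phi>I[OF st(2)]])
      qed
    qed
  qed
  have bdd: "AE \<omega> in M. (SUP t\<in>T. ereal \<bar>G' t \<omega>\<bar>) < \<infinity>"
    using Z(3)
  proof eventually_elim
    case (elim \<omega>)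
    have "bounded ((\<lambda>t. Z t \<omega>) ` {0..1})"
      by (rule compact_imp_bounded, rule compact_continuous_image[OF uniformly_continuous_imp_continuous[OF elim] compact_Icc])
    then have "\<exists>B. \<forall>t\<in>{0..1}. \<bar>Z t \<omega>\<bar> \<le> B" by (simp add: bounded_iff)
    then obtain B where B: "\<And>t. t \<in> {0..1} \<Longrightarrow> \<bar>Z t \<omega>\<bar> \<le> B" by blast
    have "(SUP t\<in>T. ereal \<bar>G' t \<omega>\<bar>) \<le> ereal B"
      using B \<phi>I by (intro SUP_least) (simp add: G'_def)
    then show ?case by (rule order_le_less_trans) simp
  qed
  show ?thesis
    using uc bdd ver G'm unfolding version_of_def by blast
qed

section \<open>The law of the process from its Levy measure\<close>

definition measure_sum :: "'a measure \<Rightarrow> 'a measure \<Rightarrow> 'a measure" where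
  "measure_sum M N = measure_of (space M) (sets M) (\<lambda>A. emeasure M A + emeasure N A)"

lemma space_measure_sum [simp]: "space (measure_sum M N) = space M"
  by (simp add: measure_sum_def sets.space_closed space_measure_of_conv)

lemma sets_measure_sum [simp, measurable_cong]: "sets (measure_sum M N) = sets M"
  by (simp add: measure_sum_def)

lemma emeasure_measure_sum:
  assumes "sets N = sets M" "A \<in> sets M"
  shows "emeasure (measure_sum M N) A = emeasure M A + emeasure N A"
  unfolding measure_sum_def
proof (rule emeasure_measure_of_sigma)
  show "sigma_algebra (space M) (sets M)" by (rule sets.sigma_algebra_axioms)
  show "positive (sets M) (\<lambda>A. emeasure M A + emeasure N A)" by (simp add: positive_def)
  show "countably_additive (sets M) (\<lambda>A. emeasure M A + emeasure N A)"
    unfolding countably_additive_def using assms(1)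
    by (auto simp: suminf_add[symmetric] suminf_emeasure)
qed fact

lemma finite_measure_measure_sum:
  assumes "finite_measure M" "finite_measure N" "sets N = sets M"
  shows "finite_measure (measure_sum M N)"
proof
  interpret M: finite_measure M by fact
  interpret N: finite_measure N by fact
  have "space N = space M" using assms(3) by (rule sets_eq_imp_space_eq)
  then show "emeasure (measure_sum M N) (space (measure_sum M N)) \<noteq> \<infinity>"
    using M.emeasure_finite N.emeasure_finite by (simp add: emeasure_measure_sum[OF assms(3)])
qed

text \<open>The identity for x P(dx) is one of signed measures. Moving negative parts to the other
  side makes it an identity between sums of positive finite measures, and integrals against such
  sums are needed to compare characteristic functions.\<close>

lemma integral_measure_sum:
  fixes f :: "'a \<Rightarrow> 'b::{banach, second_countable_topology}"
  assumes N: "sets N = sets M" and "integrable (measure_sum M N) f"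
  shows "integrable M f \<and> integrable N f \<and> (\<integral>x. f x \<partial>measure_sum M N) = (\<integral>x. f x \<partial>M) + (\<integral>x. f x \<partial>N)"
  using assms(2)
proof (induction rule: integrable_induct)
  case (base A c)
  then have A: "A \<in> sets M" "A \<in> sets N" and f: "emeasure M A < \<infinity>" "emeasure N A < \<infinity>"
    using N by (auto simp: emeasure_measure_sum[OF N])
  then have "measure (measure_sum M N) A = measure M A + measure N A"
    by (simp add: measure_def emeasure_measure_sum[OF N] enn2real_plus)
  then show ?case using A f base by (simp add: scaleR_add_left)
next
  case (add f g)
  then show ?case by simp
next
  case (lim f s)
  have fm: "f \<in> borel_measurable M" "f \<in> borel_measurable N" "\<And>i. s i \<in> borel_measurable M" "\<And>i. s i \<in> borel_measurable N"
    using borel_measurable_integrable[OF lim.hyps(4)] borel_measurable_integrable[OF lim.hyps(1)] N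
    by (auto simp: measurable_def dest: sets_eq_imp_space_eq)
  have sp: "space N = space M" using N by (rule sets_eq_imp_space_eq)
  \<comment> \<open>Equality is proved by induction over nonnegative functions; the stated
    inequality is what makes f integrable for each summand.\<close>
  have nn: "(\<integral>\<^sup>+x. norm (f x) \<partial>M) + (\<integral>\<^sup>+x. norm (f x) \<partial>N) \<le> (\<integral>\<^sup>+x. norm (f x) \<partial>measure_sum M N)" if "f \<in> borel_measurable M" for f :: "'a \<Rightarrow> 'b"
  proof -
    have "(\<lambda>x. ennreal (norm (f x))) \<in> borel_measurable M" using that by measurable
    then have "(\<integral>\<^sup>+x. norm (f x) \<partial>M) + (\<integral>\<^sup>+x. norm (f x) \<partial>N) = (\<integral>\<^sup>+x. norm (f x) \<partial>measure_sum M N)"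
    proof (induction rule: borel_measurable_induct)
      case (cong f g)
      have "integral\<^sup>N M f = integral\<^sup>N M g" "integral\<^sup>N N f = integral\<^sup>N N g"
        "integral\<^sup>N (measure_sum M N) f = integral\<^sup>N (measure_sum M N) g"
        by (rule nn_integral_cong, use cong(3) sp in simp)+
      then show ?case using cong by simp
    next
      case (set A)
      then show ?case using N by (simp add: emeasure_measure_sum[OF N])
    next
      case (mult u c)
      then have "u \<in> borel_measurable N" using N measurable_cong_sets by blast
      with mult show ?case by (simp add: nn_integral_cmult distrib_left[symmetric])
    next
      case (add u v)
      then have "u \<in> borel_measurable N" "v \<in> borel_measurable N" using N measurable_cong_sets by blast+
      with add show ?case by (simp add: nn_integral_add ac_simps add_mono)
    next
      case (seq U)
      have UN: "\<And>i. U i \<in> borel_measurable N" using seq N measurable_cong_sets by blast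
      have "(\<integral>\<^sup>+x. (SUP i. U i) x \<partial>K) = (SUP i. \<integral>\<^sup>+x. U i x \<partial>K)" if "\<And>i. U i \<in> borel_measurable K" for K :: "'a measure"
        unfolding SUP_apply by (rule nn_integral_monotone_convergence_SUP[OF seq(3) that])
      note this[of M, OF seq(1)] this[of N, OF UN] this[of "measure_sum M N"]
      moreover have "(SUP i. \<integral>\<^sup>+x. U i x \<partial>M) + (SUP i. \<integral>\<^sup>+x. U i x \<partial>N) = (SUP i. (\<integral>\<^sup>+x. U i x \<partial>M) + (\<integral>\<^sup>+x. U i x \<partial>N))"
        using seq(3) by (intro ennreal_SUP_add[symmetric]) (auto simp: incseq_def le_fun_def intro!: nn_integral_mono)
      ultimately show ?case using seq by (simp)
    qed
    then show ?thesis by simp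
  qed
  have intf: "integrable M f" "integrable N f"
    using nn[OF fm(1)] lim.hyps(4) fm
    unfolding integrable_iff_bounded by (auto simp: less_top[symmetric] top_unique)
  have lims: "(\<lambda>i. \<integral>x. s i x \<partial>K) \<longlonglongrightarrow> (\<integral>x. f x \<partial>K)"
    if "f \<in> borel_measurable K" "\<And>i. s i \<in> borel_measurable K" "integrable K f" "space K = space M" for K
    by (rule integral_dominated_convergence[where w = "\<lambda>x. 2 * norm (f x)"])
       (use that lim.hyps(2,3) in auto)
  have "(\<lambda>i. \<integral>x. s i x \<partial>measure_sum M N) \<longlonglongrightarrow> (\<integral>x. f x \<partial>measure_sum M N)"
    by (rule lims) (use lim.hyps in auto)
  moreover have "(\<lambda>i. (\<integral>x. s i x \<partial>M) + (\<integral>x. s i x \<partial>N)) \<longlonglongrightarrow> (\<integral>x. f x \<partial>M) + (\<integral>x. f x \<partial>N)"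
    by (intro tendsto_add lims) (use fm intf sp in auto)
  moreover have "(\<integral>x. s i x \<partial>measure_sum M N) = (\<integral>x. s i x \<partial>M) + (\<integral>x. s i x \<partial>N)" for i
    using lim.IH[of i] by simp
  ultimately show ?case using intf LIMSEQ_unique by auto
qed

text \<open>The value at u = 0 shows that the masses agree, and dividing by the common mass reduces
  the claim to the uniqueness theorem for probability laws. Mass 0 has to be treated apart.\<close>

lemma finite_measure_char_unique:
  fixes M N :: "real measure"
  assumes M: "finite_measure M" "sets M = sets borel" and N: "finite_measure N" "sets N = sets borel"
    and eq: "\<And>u. (\<integral>x. iexp (u * x) \<partial>M) = (\<integral>x. iexp (u * x) \<partial>N)"
  shows "M = N"
proof -
  interpret M: finite_measure M by fact
  interpret N: finite_measure N by fact
  have sp: "space M = UNIV" "space N = UNIV" using M(2) N(2) by (auto dest: sets_eq_imp_space_eq)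
  have mass: "measure M UNIV = measure N UNIV"
  proof -
    have "complex_of_real (measure M UNIV) = complex_of_real (measure N UNIV)"
      using eq[of 0] by (simp add: sp scaleR_conv_of_real)
    then show ?thesis by (simp only: of_real_eq_iff)
  qed
  show ?thesis
  proof (cases "measure M UNIV = 0")
    case True
    then have "emeasure M UNIV = 0" "emeasure N UNIV = 0"
      using mass by (simp_all add: M.emeasure_eq_measure N.emeasure_eq_measure)
    then have "emeasure M A = 0 \<and> emeasure N A = 0" for A
      using emeasure_space[of M A] emeasure_space[of N A] by (simp add: sp)
    then show ?thesis using M(2) N(2) by (intro measure_eqI) auto
  next
    case False
    define c where "c = measure M UNIV"
    have c: "c > 0" using False by (simp add: c_def order_less_le)
    define D where "D K = density K (\<lambda>_. ennreal (1 / c))" for K :: "real measure"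
    have D: "emeasure (D K) A = ennreal (1 / c) * emeasure K A" if "A \<in> sets K" for K A
      unfolding D_def using that by (simp add: emeasure_density nn_integral_cmult)
    have rd: "real_distribution (D K)" if K: "finite_measure K" "sets K = sets borel" "measure K UNIV = c" for K
    proof -
      interpret K: finite_measure K by fact
      have "emeasure (D K) UNIV = ennreal (1 / c) * ennreal c"
        using K(2,3) D[of UNIV K] by (simp add: K.emeasure_eq_measure)
      also have "\<dots> = 1" using c by (simp flip: ennreal_mult)
      finally have "emeasure (D K) (space (D K)) = 1" using K(2) by (simp add: D_def sets_eq_imp_space_eq[OF K(2)])
      then interpret prob_space "D K" by (rule prob_spaceI)
      show ?thesis by unfold_locales (auto simp: D_def K(2) sets_eq_imp_space_eq[OF K(2)])
    qed
    have ch: "char (D K) u = (1 / c) *\<^sub>R (\<integral>x. iexp (u * x) \<partial>K)" if K: "sets K = sets borel" for K u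
    proof -
      have "(\<lambda>x. iexp (u * x)) \<in> borel_measurable K" using K measurable_cong_sets[OF K refl] by (simp)
      then show ?thesis unfolding char_def D_def using c by (subst integral_density) auto
    qed
    have "D M = D N"
      by (rule Levy_uniqueness) (use rd M N mass ch eq in \<open>auto simp: c_def fun_eq_iff\<close>)
    show ?thesis
    proof (rule measure_eqI)
      fix A assume A: "A \<in> sets M"
      have "ennreal (1 / c) * emeasure M A = ennreal (1 / c) * emeasure N A"
        using D[of A M] D[of A N] A M(2) N(2) \<open>D M = D N\<close> by simp
      then show "emeasure M A = emeasure N A"
        using c by (simp add: ennreal_mult_cancel_left)
    qed (use M N in simp)
  qed
qed

section \<open>Exponential integrals and the first two moments\<close>

lemma cmod_iexp_diff_le: "cmod (iexp a - iexp b) \<le> \<bar>a - b\<bar>"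
proof -
  have "iexp a - iexp b = iexp b * (iexp (a - b) - 1)" by (simp add: algebra_simps flip: exp_add)
  then have "cmod (iexp a - iexp b) = cmod (iexp (a - b) - 1)" by (simp add: norm_mult)
  also have "\<dots> \<le> \<bar>a - b\<bar>" using iexp_approx1[of "a - b" 0] by simp
  finally show ?thesis .
qed

lemma cmod_iexp_diff_le_2: "cmod (iexp a - iexp b) \<le> 2"
  by (rule order_trans[OF norm_triangle_ineq4]) simp

context
  fixes \<mu> :: "real measure"
  assumes sets_\<mu> [measurable_cong]: "sets \<mu> = sets borel"
    and m1: "integrable \<mu> (\<lambda>x. \<bar>x\<bar>)"
begin

lemma integrable_iexp_minus_one: "integrable \<mu> (\<lambda>x. iexp (u * x) - 1)"
proof (rule Bochner_Integration.integrable_bound)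
  show "integrable \<mu> (\<lambda>x. \<bar>u\<bar> * \<bar>x\<bar>)" using m1 by simp
  show "AE x in \<mu>. norm (iexp (u * x) - 1) \<le> norm (\<bar>u\<bar> * \<bar>x\<bar>)"
    using cmod_iexp_diff_le[of "u * x" 0 for x] by (simp add: abs_mult)
qed measurable

lemma integrable_iexp_times: "integrable \<mu> (\<lambda>x. iexp (u * x) * complex_of_real x)"
  by (rule Bochner_Integration.integrable_bound[OF m1]) (auto simp: norm_mult)

text \<open>The remainder |e^(i h x) - 1 - i h x| is at most (h x)^2 / 2, so the error is quadratic
  in h with the second moment as constant. The measure may be infinite near 0; the lemma serves the
  Levy measure, the law itself and the measure dx / x on an interval.\<close>

lemma has_vector_derivative_integral_iexp:
  assumes m2: "integrable \<mu> (\<lambda>x. x\<^sup>2)"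
  shows "((\<lambda>u. \<integral>x. (iexp (u * x) - 1) \<partial>\<mu>) has_vector_derivative \<i> * fourier_xnu \<mu> u) (at u)"
  unfolding has_vector_derivative_def has_derivative_iff_norm
proof
  let ?F = "\<lambda>u. \<integral>x. (iexp (u * x) - 1) \<partial>\<mu>"
  let ?D = "\<lambda>h. h *\<^sub>R (\<i> * fourier_xnu \<mu> u)"
  show "bounded_linear ?D" by (rule bounded_linear_scaleR_left)
  have bnd: "norm ((?F y - ?F u) - ?D (y - u)) \<le> (y - u)\<^sup>2 / 2 * (\<integral>x. x\<^sup>2 \<partial>\<mu>)" for y
  proof -
    have i3: "integrable \<mu> (\<lambda>x. (y - u) *\<^sub>R (\<i> * (iexp (u * x) * complex_of_real x)))"
      using integrable_iexp_times by simp
    have "(?F y - ?F u) - ?D (y - u) = (\<integral>x. ((iexp (y * x) - 1) - (iexp (u * x) - 1)) - (y - u) *\<^sub>R (\<i> * (iexp (u * x) * complex_of_real x)) \<partial>\<mu>)"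
    proof -
      have eq3: "(\<integral>x. (y - u) *\<^sub>R (\<i> * (iexp (u * x) * complex_of_real x)) \<partial>\<mu>) = ?D (y - u)"
        by (simp add: fourier_xnu_def)
      then show ?thesis
        by (subst Bochner_Integration.integral_diff[OF Bochner_Integration.integrable_diff[OF integrable_iexp_minus_one integrable_iexp_minus_one] i3],
            subst Bochner_Integration.integral_diff[OF integrable_iexp_minus_one integrable_iexp_minus_one], simp only: eq3)
    qed
    also have "norm \<dots> \<le> (\<integral>x. (y - u)\<^sup>2 / 2 * x\<^sup>2 \<partial>\<mu>)"
    proof (rule Bochner_Integration.integral_norm_bound_integral)
      show "integrable \<mu> (\<lambda>x. iexp (y * x) - 1 - (iexp (u * x) - 1) - (y - u) *\<^sub>R (\<i> * (iexp (u * x) * complex_of_real x)))"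
        by (rule Bochner_Integration.integrable_diff[OF Bochner_Integration.integrable_diff[OF integrable_iexp_minus_one integrable_iexp_minus_one] i3])
      show "integrable \<mu> (\<lambda>x. (y - u)\<^sup>2 / 2 * x\<^sup>2)" using m2 by simp
      fix x
      have "iexp (y * x) - 1 - (iexp (u * x) - 1) - (y - u) *\<^sub>R (\<i> * (iexp (u * x) * complex_of_real x)) =
        iexp (u * x) * (iexp ((y - u) * x) - (1 + \<i> * ((y - u) * x)))"
        by (simp add: algebra_simps scaleR_conv_of_real flip: exp_add)
      then have "norm (iexp (y * x) - 1 - (iexp (u * x) - 1) - (y - u) *\<^sub>R (\<i> * (iexp (u * x) * complex_of_real x))) =
        cmod (iexp ((y - u) * x) - (1 + \<i> * ((y - u) * x)))" by (simp add: norm_mult)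
      also have "\<dots> \<le> \<bar>(y - u) * x\<bar>\<^sup>2 / 2"
        using iexp_approx1[of "(y - u) * x" 1] by (simp add: eval_nat_numeral)
      finally show "norm (iexp (y * x) - 1 - (iexp (u * x) - 1) - (y - u) *\<^sub>R (\<i> * (iexp (u * x) * complex_of_real x))) \<le> (y - u)\<^sup>2 / 2 * x\<^sup>2"
        by (simp add: power_mult_distrib)
    qed
    finally show ?thesis by simp
  qed
  show "((\<lambda>y. norm ((?F y - ?F u) - ?D (y - u)) / norm (y - u)) \<longlongrightarrow> 0) (at u)"
  proof (rule Lim_null_comparison)
    have "((\<lambda>y. \<bar>y - u\<bar> / 2 * (\<integral>x. x\<^sup>2 \<partial>\<mu>)) \<longlongrightarrow> \<bar>u - u\<bar> / 2 * (\<integral>x. x\<^sup>2 \<partial>\<mu>)) (at u)" by (intro tendsto_intros) auto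
    then show "((\<lambda>y. \<bar>y - u\<bar> / 2 * (\<integral>x. x\<^sup>2 \<partial>\<mu>)) \<longlongrightarrow> 0) (at u)" by simp
    have "norm (norm ((?F y - ?F u) - ?D (y - u)) / norm (y - u)) \<le> \<bar>y - u\<bar> / 2 * (\<integral>x. x\<^sup>2 \<partial>\<mu>)" if "y \<noteq> u" for y
    proof -
      have "(y - u)\<^sup>2 = \<bar>y - u\<bar> * \<bar>y - u\<bar>" by (simp add: power2_eq_square)
      with bnd[of y] that show ?thesis by (simp add: divide_le_eq mult.commute mult.left_commute)
    qed
    then show "\<forall>\<^sub>F y in at u. norm (norm ((?F y - ?F u) - ?D (y - u)) / norm (y - u)) \<le> \<bar>y - u\<bar> / 2 * (\<integral>x. x\<^sup>2 \<partial>\<mu>)"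
      by (simp add: eventually_at_filter)
  qed
qed

lemma fourier_xnu_lipschitz:
  assumes m2: "integrable \<mu> (\<lambda>x. x\<^sup>2)"
  shows "cmod (fourier_xnu \<mu> u - fourier_xnu \<mu> v) \<le> \<bar>u - v\<bar> * (\<integral>x. x\<^sup>2 \<partial>\<mu>)"
proof -
  have "fourier_xnu \<mu> u - fourier_xnu \<mu> v = (\<integral>x. iexp (u * x) * complex_of_real x - iexp (v * x) * complex_of_real x \<partial>\<mu>)"
    unfolding fourier_xnu_def by (rule Bochner_Integration.integral_diff[symmetric]) (rule integrable_iexp_times)+
  also have "norm \<dots> \<le> (\<integral>x. \<bar>u - v\<bar> * x\<^sup>2 \<partial>\<mu>)"
  proof (rule Bochner_Integration.integral_norm_bound_integral)
    fix x
    have "norm (iexp (u * x) * complex_of_real x - iexp (v * x) * complex_of_real x) = cmod (iexp (u * x) - iexp (v * x)) * \<bar>x\<bar>"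
      by (simp add: norm_mult flip: left_diff_distrib)
    also have "\<dots> \<le> \<bar>u * x - v * x\<bar> * \<bar>x\<bar>" by (intro mult_right_mono cmod_iexp_diff_le) simp
    also have "\<dots> = \<bar>u - v\<bar> * x\<^sup>2" by (simp add: power2_eq_square abs_mult flip: left_diff_distrib)
    finally show "norm (iexp (u * x) * complex_of_real x - iexp (v * x) * complex_of_real x) \<le> \<bar>u - v\<bar> * x\<^sup>2" .
  qed (use m2 integrable_iexp_times in auto)
  finally show ?thesis by simp
qed

end

text \<open>Here \<open>P\<close> is the translated law, so its exponent has no drift. The bounded
  density of x nu is recorded as an inequality between values on Borel sets, the form in which it is
  compared with Lebesgue measure.\<close>

locale levy_char =
  fixes P \<nu> :: "real measure" and \<Delta> K C :: real
  assumes P: "real_distribution P" and \<Delta>: "\<Delta> > 0"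
    and sets_\<nu> [measurable_cong]: "sets \<nu> = sets borel"
    and m1: "integrable \<nu> (\<lambda>x. \<bar>x\<bar>)" and m2: "integrable \<nu> (\<lambda>x. x\<^sup>2)"
    and char_eq: "\<And>u. char P u = exp (\<Delta> * (\<integral>x. (iexp (u * x) - 1) \<partial>\<nu>))"
    and density_bound: "\<And>A. A \<in> sets borel \<Longrightarrow> emeasure lborel A < \<infinity> \<Longrightarrow> \<bar>\<integral>x\<in>A. x \<partial>\<nu>\<bar> \<le> K * measure lborel A"
    and K: "K > 0" and C: "C \<ge> 0"
    and decay: "\<And>u. cmod (fourier_xnu \<nu> u) \<le> C / (1 + \<bar>u\<bar>)"
begin

sublocale P: real_distribution P by (rule P)

definition \<psi> :: "real \<Rightarrow> complex" where "\<psi> u = (\<integral>x. (iexp (u * x) - 1) \<partial>\<nu>)"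

lemma char_\<psi>: "char P u = exp (\<Delta> * \<psi> u)"
  by (simp add: char_eq \<psi>_def)

lemma \<psi>_0 [simp]: "\<psi> 0 = 0"
  by (simp add: \<psi>_def)

lemma \<psi>_deriv: "(\<psi> has_vector_derivative \<i> * fourier_xnu \<nu> u) (at u)"
  using has_vector_derivative_integral_iexp[OF sets_\<nu> m1 m2] unfolding \<psi>_def[abs_def] .

lemma one_minus_cos_le: "1 - cos b \<le> b\<^sup>2 / (2::real)"
proof -
  have "1 - cos b = 2 * (sin (b / 2))\<^sup>2" using cos_double_sin[of "b / 2"] by simp
  also have "(sin (b / 2))\<^sup>2 \<le> (b / 2)\<^sup>2"
    using abs_sin_x_le_abs_x[of "b / 2"] by (simp only: abs_le_square_iff)
  finally show ?thesis by (simp add: power_divide)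
qed

lemma Re_\<psi>: "Re (\<psi> u) = - (\<integral>x. (1 - cos (u * x)) \<partial>\<nu>)"
proof -
  have "Re (\<psi> u) = (\<integral>x. Re (iexp (u * x) - 1) \<partial>\<nu>)"
    unfolding \<psi>_def by (rule integral_Re[symmetric]) (rule integrable_iexp_minus_one[OF sets_\<nu> m1])
  also have "\<dots> = (\<integral>x. - (1 - cos (u * x)) \<partial>\<nu>)"
    by (rule Bochner_Integration.integral_cong) (auto simp: Re_exp)
  also have "\<dots> = - (\<integral>x. (1 - cos (u * x)) \<partial>\<nu>)" by (rule Bochner_Integration.integral_minus)
  finally show ?thesis .
qed

lemma integrable_one_minus_cos: "integrable \<nu> (\<lambda>x. 1 - cos (u * x))"
  by (rule Bochner_Integration.integrable_bound[of _ "\<lambda>x. u\<^sup>2 / 2 * x\<^sup>2"])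
     (use m2 one_minus_cos_le[of "u * x" for x] in \<open>auto simp: power_mult_distrib abs_mult\<close>)

text \<open>With a + i b the logarithm of the characteristic function, a <= 0, and 1 - e^a cos b is
  at most -a + b^2 / 2. Here -a is of order u^2 by the second moment of nu, and b of order u by the
  first.\<close>

lemma one_minus_Re_char_le:
  "1 - Re (char P u) \<le> u\<^sup>2 * ((\<Delta> * (\<integral>x. x\<^sup>2 \<partial>\<nu>) + (\<Delta> * (\<integral>x. \<bar>x\<bar> \<partial>\<nu>))\<^sup>2) / 2)"
proof -
  define a where "a = \<Delta> * Re (\<psi> u)"
  define b where "b = \<Delta> * Im (\<psi> u)"
  have ch: "Re (char P u) = exp a * cos b"
    unfolding char_\<psi> by (simp add: Re_exp a_def b_def)
  have "(\<integral>x. (1 - cos (u * x)) \<partial>\<nu>) \<le> (\<integral>x. u\<^sup>2 / 2 * x\<^sup>2 \<partial>\<nu>)"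
    using integrable_one_minus_cos m2 one_minus_cos_le[of "u * x" for x]
    by (intro integral_mono) (auto simp: power_mult_distrib)
  then have a1: "- a \<le> \<Delta> * (u\<^sup>2 / 2 * (\<integral>x. x\<^sup>2 \<partial>\<nu>))"
    using \<Delta> unfolding a_def Re_\<psi> by simp
  have a0: "a \<le> 0" unfolding a_def Re_\<psi> using \<Delta> by (auto intro!: mult_nonneg_nonneg integral_nonneg_AE)
  have "cmod (\<psi> u) \<le> (\<integral>x. \<bar>u\<bar> * \<bar>x\<bar> \<partial>\<nu>)"
    unfolding \<psi>_def
    by (rule Bochner_Integration.integral_norm_bound_integral)
       (use integrable_iexp_minus_one[OF sets_\<nu> m1] m1 cmod_iexp_diff_le[of "u * x" 0 for x] in \<open>auto simp: abs_mult\<close>)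
  then have "\<bar>b\<bar> \<le> \<Delta> * (\<bar>u\<bar> * (\<integral>x. \<bar>x\<bar> \<partial>\<nu>))"
    using abs_Im_le_cmod[of "\<psi> u"] \<Delta> by (simp add: b_def abs_mult)
  then have "\<bar>b\<bar>\<^sup>2 \<le> (\<Delta> * (\<bar>u\<bar> * (\<integral>x. \<bar>x\<bar> \<partial>\<nu>)))\<^sup>2" by (rule power_mono) simp
  then have b2: "b\<^sup>2 \<le> u\<^sup>2 * (\<Delta> * (\<integral>x. \<bar>x\<bar> \<partial>\<nu>))\<^sup>2" by (simp add: power_mult_distrib algebra_simps)
  have "1 - exp a * cos b = (1 - exp a) + exp a * (1 - cos b)" by (simp add: algebra_simps)
  also have "\<dots> \<le> - a + 1 * (b\<^sup>2 / 2)"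
  proof (intro add_mono mult_mono)
    show "1 - exp a \<le> - a" using exp_ge_add_one_self[of a] by linarith
  qed (use a0 one_minus_cos_le[of b] in auto)
  also have "\<dots> \<le> \<Delta> * (u\<^sup>2 / 2 * (\<integral>x. x\<^sup>2 \<partial>\<nu>)) + u\<^sup>2 * (\<Delta> * (\<integral>x. \<bar>x\<bar> \<partial>\<nu>))\<^sup>2 / 2" using a1 b2 by simp
  finally show ?thesis unfolding ch by (simp add: algebra_simps add_divide_distrib)
qed

text \<open>The functions 2 N^2 (1 - cos(y / N)) tend to y^2, and their integrals 2 N^2 (1 - Re
  phi(1 / N)) are bounded by the previous estimate, so Fatou's lemma applies. In this way the second
  moment of nu is transferred to \<open>P\<close> through the characteristic function alone.\<close>

lemma P_second_moment: "integrable P (\<lambda>y. y\<^sup>2)"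
proof -
  define L where "L = (\<Delta> * (\<integral>x. x\<^sup>2 \<partial>\<nu>) + (\<Delta> * (\<integral>x. \<bar>x\<bar> \<partial>\<nu>))\<^sup>2) / 2"
  have ic: "integrable P (\<lambda>y. 1 - cos (u * y))" for u
  proof (rule P.integrable_const_bound[of _ 2])
    have "norm (1 - cos t) \<le> 2" for t :: real
      using cos_le_one[of t] cos_ge_minus_one[of t] unfolding real_norm_def by linarith
    then show "AE y in P. norm (1 - cos (u * y)) \<le> 2" by simp
  qed simp
  have Rc: "(\<integral>y. (1 - cos (u * y)) \<partial>P) = 1 - Re (char P u)" for u
  proof -
    have "Re (char P u) = (\<integral>y. Re (iexp (u * y)) \<partial>P)"
      unfolding char_def by (rule integral_Re[symmetric]) (intro P.integrable_iexp; simp)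
    also have "\<dots> = (\<integral>y. 1 - (1 - cos (u * y)) \<partial>P)" by (simp add: Re_exp)
    also have "\<dots> = 1 - (\<integral>y. (1 - cos (u * y)) \<partial>P)"
      using ic[of u] P.prob_space by (subst Bochner_Integration.integral_diff) auto
    finally show ?thesis by simp
  qed
  define h where "h n y = 2 * (real (Suc n))\<^sup>2 * (1 - cos (1 / real (Suc n) * y))" for n y
  have hlim: "(\<lambda>n. h n y) \<longlonglongrightarrow> y\<^sup>2" for y
  proof (rule LIM_zero_cancel, rule Lim_null_comparison)
    have "(\<lambda>n. 1 / real (Suc n)) \<longlonglongrightarrow> 0" by (rule LIMSEQ_Suc[OF lim_const_over_n])
    from tendsto_mult_right_zero[OF this, of "\<bar>y\<bar> ^ 3 / 3"]
    show "(\<lambda>n. \<bar>y\<bar> ^ 3 / 3 * (1 / real (Suc n))) \<longlonglongrightarrow> 0" .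
    have "norm (h n y - y\<^sup>2) \<le> \<bar>y\<bar> ^ 3 / 3 * (1 / real (Suc n))" for n
    proof -
      define N where "N = real (Suc n)"
      have N: "N > 0" by (simp add: N_def)
      define t where "t = 1 / N * y"
      have a1: "\<bar>Re (iexp t - (\<Sum>k\<le>2. (\<i> * t) ^ k / fact k))\<bar> \<le> \<bar>t\<bar> ^ Suc 2 / fact (Suc 2)"
        by (rule order_trans[OF abs_Re_le_cmod iexp_approx1])
      have a2: "\<bar>t\<bar> ^ Suc 2 / fact (Suc 2) = \<bar>t\<bar> ^ 3 / 6" by (simp add: eval_nat_numeral)
      have a3: "Re (iexp t - (\<Sum>k\<le>2. (\<i> * t) ^ k / fact k)) = cos t - 1 + t\<^sup>2 / 2"
        by (simp add: eval_nat_numeral Re_exp power2_eq_square)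
      have "\<bar>cos t - 1 + t\<^sup>2 / 2\<bar> \<le> \<bar>t\<bar> ^ 3 / 6" using a1 unfolding a2 a3 .
      then have b1: "2 * N\<^sup>2 * \<bar>cos t - 1 + t\<^sup>2 / 2\<bar> \<le> 2 * N\<^sup>2 * (\<bar>t\<bar> ^ 3 / 6)" by (rule mult_left_mono) simp
      have b2: "\<bar>h n y - y\<^sup>2\<bar> = 2 * N\<^sup>2 * \<bar>cos t - 1 + t\<^sup>2 / 2\<bar>"
      proof -
        have "h n y - y\<^sup>2 = - (2 * N\<^sup>2 * (cos t - 1 + t\<^sup>2 / 2))"
          using N by (simp add: h_def t_def N_def[symmetric] power_divide field_simps del: of_nat_Suc)
        then show ?thesis by (simp add: abs_mult)
      qed
      have b3: "2 * N\<^sup>2 * (\<bar>t\<bar> ^ 3 / 6) = \<bar>y\<bar> ^ 3 / 3 * (1 / N)"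
        using N by (simp add: t_def abs_mult power_divide power2_eq_square power3_eq_cube)
      show ?thesis using b1 unfolding real_norm_def b2 b3 N_def[symmetric] .
    qed
    then show "\<forall>\<^sub>F n in sequentially. norm (h n y - y\<^sup>2) \<le> \<bar>y\<bar> ^ 3 / 3 * (1 / real (Suc n))" by simp
  qed
  have h0: "0 \<le> h n y" for n y by (simp add: h_def)
  have "(\<integral>\<^sup>+y. ennreal (y\<^sup>2) \<partial>P) = (\<integral>\<^sup>+y. liminf (\<lambda>n. ennreal (h n y)) \<partial>P)"
  proof (rule nn_integral_cong)
    fix y
    show "ennreal (y\<^sup>2) = liminf (\<lambda>n. ennreal (h n y))"
      using lim_imp_Liminf[OF _ tendsto_ennrealI[OF hlim[of y]]] by simp
  qed
  also have "\<dots> \<le> liminf (\<lambda>n. \<integral>\<^sup>+y. ennreal (h n y) \<partial>P)"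
    by (rule nn_integral_liminf) (simp add: h_def)
  also have "\<dots> \<le> liminf (\<lambda>n::nat. ennreal (2 * L))"
  proof (rule Liminf_mono, rule always_eventually, rule allI)
    fix n
    have "(\<integral>\<^sup>+y. ennreal (h n y) \<partial>P) = ennreal (\<integral>y. h n y \<partial>P)"
    proof (rule nn_integral_eq_integral)
      show "integrable P (\<lambda>y. h n y)" unfolding h_def by (intro integrable_mult_right ic)
    qed (use h0 in auto)
    also have "(\<integral>y. h n y \<partial>P) = 2 * (real (Suc n))\<^sup>2 * (1 - Re (char P (1 / real (Suc n))))"
      unfolding h_def by (simp only: integral_mult_right_zero Rc)
    also have "\<dots> \<le> 2 * (real (Suc n))\<^sup>2 * ((1 / real (Suc n))\<^sup>2 * L)"
      unfolding L_def by (intro mult_left_mono one_minus_Re_char_le) simp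
    also have "\<dots> = 2 * L" by (simp add: power_divide del: of_nat_Suc)
    finally show "(\<integral>\<^sup>+y. ennreal (h n y) \<partial>P) \<le> ennreal (2 * L)" using ennreal_leI by simp
  qed
  also have "\<dots> = ennreal (2 * L)" by (simp add: Liminf_const)
  finally show ?thesis by (intro integrableI_bounded) (auto intro: le_less_trans)
qed

lemma P_first_moment: "integrable P (\<lambda>y. \<bar>y\<bar>)"
proof (rule Bochner_Integration.integrable_bound[of _ "\<lambda>y. 1 + y\<^sup>2"])
  show "AE y in P. norm \<bar>y\<bar> \<le> norm (1 + y\<^sup>2)"
  proof (rule AE_I2)
    fix y :: real
    have "2 * \<bar>y\<bar> \<le> 1 + y\<^sup>2" using sum_squares_bound[of 1 "\<bar>y\<bar>"] by simp
    then show "norm \<bar>y\<bar> \<le> norm (1 + y\<^sup>2)" by simp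
  qed
qed (use P_second_moment in auto)

(* Both sides are the derivative of the characteristic function; in terms of measures the identity
   says y P(dy) = Delta (x nu) * P. *)
lemma fourier_xP: "fourier_xnu P u = \<Delta> * fourier_xnu \<nu> u * char P u"
proof -
  have 1: "((\<lambda>u. \<integral>x. (iexp (u * x) - 1) \<partial>P) has_vector_derivative \<i> * fourier_xnu P u) (at u)"
    by (rule has_vector_derivative_integral_iexp[OF _ P_first_moment P_second_moment]) simp
  have "(\<lambda>u. \<integral>x. (iexp (u * x) - 1) \<partial>P) = (\<lambda>u. char P u - 1)"
  proof
    fix u
    have "integrable P (\<lambda>x. iexp (u * x))" by (intro P.integrable_iexp; simp)
    then show "(\<integral>x. (iexp (u * x) - 1) \<partial>P) = char P u - 1"
      unfolding char_def using P.prob_space by (simp add: Bochner_Integration.integral_diff)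
  qed
  with 1 have d1: "((\<lambda>u. char P u - 1) has_vector_derivative \<i> * fourier_xnu P u) (at u)" by simp
  have "((\<lambda>u. exp (\<Delta> * \<psi> u)) has_vector_derivative (\<Delta> * (\<i> * fourier_xnu \<nu> u)) * exp (\<Delta> * \<psi> u)) (at u)"
    using field_vector_diff_chain_at[OF has_vector_derivative_mult_right[OF \<psi>_deriv, of "complex_of_real \<Delta>"] DERIV_exp]
    by (simp add: comp_def)
  then have d2: "((\<lambda>u. char P u - 1) has_vector_derivative (\<Delta> * (\<i> * fourier_xnu \<nu> u)) * char P u) (at u)"
    unfolding char_\<psi> by (auto intro!: derivative_eq_intros)
  from vector_derivative_unique_at[OF d1 d2] show ?thesis by simp
qed

end

section \<open>Domination of the law by Lebesgue measure away from the origin\<close>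

lemma integral_iexp_convolution:
  fixes M N :: "real measure"
  assumes M: "finite_measure M" "sets M = sets borel" and N: "finite_measure N" "sets N = sets borel"
  shows "(\<integral>z. iexp (u * z) \<partial>(M \<star> N)) = (\<integral>x. iexp (u * x) \<partial>M) * (\<integral>x. iexp (u * x) \<partial>N)"
proof -
  interpret M: finite_measure M by fact
  interpret N: finite_measure N by fact
  interpret pair_sigma_finite M N ..
  interpret MN: finite_measure "M \<Otimes>\<^sub>M N" by (rule finite_measure_pair_measure[OF N(1) M(1)])
  note [measurable_cong] = M(2) N(2)
  have "(\<integral>z. iexp (u * z) \<partial>(M \<star> N)) = (\<integral>z. iexp (u * (fst z + snd z)) \<partial>(M \<Otimes>\<^sub>M N))"
    unfolding convolution_def by (subst integral_distr) (auto simp: case_prod_beta')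
  also have "\<dots> = (\<integral>x. (\<integral>y. iexp (u * (x + y)) \<partial>N) \<partial>M)"
    using integral_fst'[of "\<lambda>z. iexp (u * (fst z + snd z))"]
    by (subst integral_fst'[symmetric]) (auto intro!: MN.integrable_const_bound[of _ 1])
  also have "\<dots> = (\<integral>x. (\<integral>y. iexp (u * x) * iexp (u * y) \<partial>N) \<partial>M)"
    by (simp add: distrib_left exp_add)
  also have "\<dots> = (\<integral>x. iexp (u * x) \<partial>M) * (\<integral>x. iexp (u * x) \<partial>N)" by simp
  finally show ?thesis .
qed

lemma finite_measure_density_parts:
  fixes \<mu> :: "real measure" and c :: real
  assumes s [measurable_cong]: "sets \<mu> = sets borel" and m1: "integrable \<mu> (\<lambda>x. \<bar>x\<bar>)" and c: "c \<ge> 0"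
    and p: "\<And>x. 0 \<le> p x" "\<And>x. p x \<le> \<bar>x\<bar>" and [measurable]: "p \<in> borel_measurable borel"
  shows "finite_measure (density \<mu> (\<lambda>x. ennreal (c * p x)))"
    and "(\<integral>x. iexp (u * x) \<partial>density \<mu> (\<lambda>x. ennreal (c * p x))) = c * (\<integral>x. complex_of_real (p x) * iexp (u * x) \<partial>\<mu>)"
    and "integrable \<mu> (\<lambda>x. complex_of_real (p x) * iexp (u * x))"
proof -
  have ip: "integrable \<mu> p"
    by (rule Bochner_Integration.integrable_bound[OF m1]) (use p in auto)
  have "(\<integral>\<^sup>+x. ennreal (c * p x) \<partial>\<mu>) = ennreal (\<integral>x. c * p x \<partial>\<mu>)"
    using ip p c by (intro nn_integral_eq_integral) auto
  then show "finite_measure (density \<mu> (\<lambda>x. ennreal (c * p x)))"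
    by (intro finite_measureI) (simp add: emeasure_density cong: nn_integral_cong)
  have m: "(\<lambda>x. iexp (u * x)) \<in> borel_measurable \<mu>" by measurable
  show "(\<integral>x. iexp (u * x) \<partial>density \<mu> (\<lambda>x. ennreal (c * p x))) = c * (\<integral>x. complex_of_real (p x) * iexp (u * x) \<partial>\<mu>)"
    using p c by (subst integral_density) (auto simp: scaleR_conv_of_real mult.assoc)
  show "integrable \<mu> (\<lambda>x. complex_of_real (p x) * iexp (u * x))"
    by (rule Bochner_Integration.integrable_bound[OF m1]) (use p in \<open>auto simp: norm_mult\<close>)
qed

lemma emeasure_lborel_translate:
  assumes "B \<in> sets borel" shows "emeasure lborel {a::real. a + x \<in> B} = emeasure lborel B"
proof -
  have "emeasure lborel B = emeasure (distr lborel borel ((+) x)) B" by (simp add: lborel_distr_plus)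
  also have "\<dots> = emeasure lborel ((+) x -` B \<inter> space lborel)" using assms by (intro emeasure_distr) auto
  also have "(+) x -` B \<inter> space lborel = {a. a + x \<in> B}" by (auto simp: add.commute)
  finally show ?thesis by simp
qed

context levy_char
begin

definition pos_part :: "real \<Rightarrow> real" where "pos_part x = max 0 x"
definition neg_part :: "real \<Rightarrow> real" where "neg_part x = max 0 (- x)"

lemma parts [measurable]: "pos_part \<in> borel_measurable borel" "neg_part \<in> borel_measurable borel"
  unfolding pos_part_def[abs_def] neg_part_def[abs_def] by measurable

lemma parts_bounds: "0 \<le> pos_part x" "pos_part x \<le> \<bar>x\<bar>" "0 \<le> neg_part x" "neg_part x \<le> \<bar>x\<bar>"
  "pos_part x - neg_part x = x"
  by (auto simp: pos_part_def neg_part_def)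

text \<open>The positive part of x nu on A is the signed measure on A intersected with the positive
  half-line, and likewise for the negative part, so the bound on the signed measure carries over to
  both. The disjunction treats the two parts in one proof.\<close>

lemma density_part_bound:
  assumes p: "(\<forall>x. p x = pos_part x) \<or> (\<forall>x. p x = neg_part x)" and A: "A \<in> sets borel"
  shows "emeasure (density \<nu> (\<lambda>x. ennreal (\<Delta> * p x))) A \<le> ennreal (\<Delta> * K) * emeasure lborel A"
proof (cases "emeasure lborel A < \<infinity>")
  case False
  then have "emeasure lborel A = \<infinity>" by (simp add: less_top[symmetric])
  then show ?thesis using \<Delta> K by (simp add: ennreal_mult_top)
next
  case True
  define S where "S = (if \<forall>x. p x = pos_part x then {0<..} else {..<0::real})"
  have [measurable]: "S \<in> sets borel" by (simp add: S_def)
  have [measurable]: "p \<in> borel_measurable borel" using p parts by (metis ext)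
  have pS: "p x = indicator S x * \<bar>x\<bar>" for x
    using p by (auto simp: S_def pos_part_def neg_part_def indicator_def)
  have p0: "0 \<le> p x" "p x \<le> \<bar>x\<bar>" for x unfolding pS by (auto simp: indicator_def)
  have AS: "A \<inter> S \<in> sets borel" "emeasure lborel (A \<inter> S) < \<infinity>" "measure lborel (A \<inter> S) \<le> measure lborel A"
  proof -
    show "A \<inter> S \<in> sets borel" using A by simp
    show "emeasure lborel (A \<inter> S) < \<infinity>" using emeasure_mono[of "A \<inter> S" A lborel] A True by (auto intro: le_less_trans)
    show "measure lborel (A \<inter> S) \<le> measure lborel A" using A True by (intro measure_mono_fmeasurable) (auto simp: fmeasurable_def)
  qed
  have i: "integrable \<nu> (\<lambda>x. indicator A x * (\<Delta> * p x))"
    by (rule Bochner_Integration.integrable_bound[of _ "\<lambda>x. \<Delta> * \<bar>x\<bar>"])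
       (use m1 A p0 \<Delta> in \<open>auto simp: indicator_def abs_mult\<close>)
  have "emeasure (density \<nu> (\<lambda>x. ennreal (\<Delta> * p x))) A = (\<integral>\<^sup>+x. ennreal (indicator A x * (\<Delta> * p x)) \<partial>\<nu>)"
    using A by (subst emeasure_density) (auto intro!: nn_integral_cong simp: indicator_def)
  also have "\<dots> = ennreal (\<integral>x. indicator A x * (\<Delta> * p x) \<partial>\<nu>)"
    using i p0 \<Delta> by (intro nn_integral_eq_integral) auto
  also have "(\<integral>x. indicator A x * (\<Delta> * p x) \<partial>\<nu>) = \<Delta> * \<bar>\<integral>x\<in>A \<inter> S. x \<partial>\<nu>\<bar>"
  proof -
    have "(\<integral>x. indicator A x * (\<Delta> * p x) \<partial>\<nu>) = (\<integral>x. \<Delta> * (indicator (A \<inter> S) x * \<bar>x\<bar>) \<partial>\<nu>)"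
      by (rule Bochner_Integration.integral_cong) (auto simp: pS indicator_def)
    also have "\<dots> = \<Delta> * (\<integral>x. indicator (A \<inter> S) x * \<bar>x\<bar> \<partial>\<nu>)"
      by (rule integral_mult_right_zero)
    finally have "(\<integral>x. indicator A x * (\<Delta> * p x) \<partial>\<nu>) = \<Delta> * (\<integral>x. indicator (A \<inter> S) x * \<bar>x\<bar> \<partial>\<nu>)" .
    moreover have "(\<integral>x. indicator (A \<inter> S) x * \<bar>x\<bar> \<partial>\<nu>) = \<bar>\<integral>x\<in>A \<inter> S. x \<partial>\<nu>\<bar>"
    proof (cases "\<forall>x. p x = pos_part x")
      case T: True
      then have "(\<integral>x. indicator (A \<inter> S) x * \<bar>x\<bar> \<partial>\<nu>) = (\<integral>x\<in>A \<inter> S. x \<partial>\<nu>)"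
        unfolding set_lebesgue_integral_def by (intro Bochner_Integration.integral_cong) (auto simp: S_def indicator_def)
      moreover have "0 \<le> (\<integral>x. indicator (A \<inter> S) x * \<bar>x\<bar> \<partial>\<nu>)" by simp
      ultimately show ?thesis by simp
    next
      case F: False
      then have "(\<integral>x. indicator (A \<inter> S) x * \<bar>x\<bar> \<partial>\<nu>) = (\<integral>x. - (indicator (A \<inter> S) x *\<^sub>R x) \<partial>\<nu>)"
        by (intro Bochner_Integration.integral_cong) (auto simp: S_def indicator_def)
      also have "\<dots> = - (\<integral>x\<in>A \<inter> S. x \<partial>\<nu>)"
        unfolding set_lebesgue_integral_def by (rule Bochner_Integration.integral_minus)
      finally have "(\<integral>x. indicator (A \<inter> S) x * \<bar>x\<bar> \<partial>\<nu>) = - (\<integral>x\<in>A \<inter> S. x \<partial>\<nu>)" .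
      moreover have "0 \<le> (\<integral>x. indicator (A \<inter> S) x * \<bar>x\<bar> \<partial>\<nu>)" by simp
      ultimately show ?thesis by simp
    qed
    ultimately show ?thesis by simp
  qed
  also have "ennreal \<dots> \<le> ennreal (\<Delta> * (K * measure lborel A))"
    using density_bound[OF AS(1,2)] AS(3) K \<Delta>
    by (intro ennreal_leI mult_left_mono) (auto intro: order_trans mult_left_mono)
  also have "\<dots> = ennreal (\<Delta> * K) * emeasure lborel A"
    using True \<Delta> K by (simp add: emeasure_eq_ennreal_measure ennreal_mult[symmetric] mult.assoc)
  finally show ?thesis .
qed

text \<open>With N1, N2 the parts of y P(dy) and R1, R2 those of Delta x nu(dx), the identity
  \<open>fourier_xP\<close> says that N1 plus the convolution of P and R2 equals N2 plus the
  convolution of P and R1. All four terms are positive, so on each half-line the total variation of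
  y P(dy) is dominated by one convolution.\<close>

lemma xP_dominated:
  assumes A: "A \<in> sets borel"
  shows "emeasure (density P (\<lambda>y. ennreal \<bar>y\<bar>)) A \<le> ennreal (\<Delta> * K) * emeasure lborel A"
proof -
  define N1 N2 where "N1 = density P (\<lambda>y. ennreal (1 * pos_part y))" and "N2 = density P (\<lambda>y. ennreal (1 * neg_part y))"
  define R1 R2 where "R1 = density \<nu> (\<lambda>x. ennreal (\<Delta> * pos_part x))" and "R2 = density \<nu> (\<lambda>x. ennreal (\<Delta> * neg_part x))"
  have fin: "finite_measure N1" "finite_measure N2" "finite_measure R1" "finite_measure R2"
    unfolding N1_def N2_def R1_def R2_def
    using finite_measure_density_parts(1)[OF P.events_eq_borel P_first_moment, of 1 pos_part]
      finite_measure_density_parts(1)[OF P.events_eq_borel P_first_moment, of 1 neg_part]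
      finite_measure_density_parts(1)[OF sets_\<nu> m1, of \<Delta> pos_part] finite_measure_density_parts(1)[OF sets_\<nu> m1, of \<Delta> neg_part]
      \<Delta> parts parts_bounds by auto
  have st [simp]: "sets N1 = sets borel" "sets N2 = sets borel" "sets R1 = sets borel" "sets R2 = sets borel" "sets P = sets borel"
    using sets_\<nu> by (simp_all add: N1_def N2_def R1_def R2_def)
  have fP: "finite_measure P" by (rule P.finite_measure_axioms)
  have cf: "finite_measure (P \<star> R1)" "finite_measure (P \<star> R2)"
    by (rule convolution_finite; simp add: fin fP)+
  have fs: "finite_measure (measure_sum N1 (P \<star> R2))" "finite_measure (measure_sum N2 (P \<star> R1))"
    by (rule finite_measure_measure_sum; simp add: fin cf)+
  have ch: "(\<integral>x. iexp (u * x) \<partial>measure_sum N (P \<star> R)) = (\<integral>x. iexp (u * x) \<partial>N) + char P u * (\<integral>x. iexp (u * x) \<partial>R)"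
    if "finite_measure N" "finite_measure R" "sets N = sets borel" "sets R = sets borel" for N R u
  proof -
    have f: "finite_measure (measure_sum N (P \<star> R))"
      by (rule finite_measure_measure_sum[OF that(1)]) (use that fP in \<open>auto intro!: convolution_finite\<close>)
    have "integrable (measure_sum N (P \<star> R)) (\<lambda>x. iexp (u * x))"
      by (rule finite_measure.integrable_const_bound[OF f, of _ 1]) (auto simp: measurable_cong_sets[OF trans[OF sets_measure_sum that(3)] refl])
    then show ?thesis
      using integral_measure_sum[of "P \<star> R" N "\<lambda>x. iexp (u * x)"] integral_iexp_convolution[OF fP _ that(2), of u] that
      by (simp add: char_def)
  qed
  have diff: "(\<integral>x. complex_of_real (pos_part x) * iexp (u * x) \<partial>\<mu>) - (\<integral>x. complex_of_real (neg_part x) * iexp (u * x) \<partial>\<mu>) = fourier_xnu \<mu> u"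
    if s: "sets \<mu> = sets borel" and m: "integrable \<mu> (\<lambda>x. \<bar>x\<bar>)" for \<mu> :: "real measure" and u
  proof -
    have "(\<integral>x. complex_of_real (pos_part x) * iexp (u * x) \<partial>\<mu>) - (\<integral>x. complex_of_real (neg_part x) * iexp (u * x) \<partial>\<mu>) =
      (\<integral>x. complex_of_real (pos_part x) * iexp (u * x) - complex_of_real (neg_part x) * iexp (u * x) \<partial>\<mu>)"
      by (rule Bochner_Integration.integral_diff[symmetric,
          OF finite_measure_density_parts(3)[OF s m zero_le_one parts_bounds(1,2) parts(1)]
            finite_measure_density_parts(3)[OF s m zero_le_one parts_bounds(3,4) parts(2)]])
    also have "\<dots> = fourier_xnu \<mu> u"
      unfolding fourier_xnu_def
      by (rule Bochner_Integration.integral_cong) (auto simp: parts_bounds mult.commute simp flip: left_diff_distrib of_real_diff)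
    finally show ?thesis .
  qed
  have eq: "measure_sum N1 (P \<star> R2) = measure_sum N2 (P \<star> R1)"
  proof (rule finite_measure_char_unique)
    fix u
    have "(\<integral>x. iexp (u * x) \<partial>N1) - (\<integral>x. iexp (u * x) \<partial>N2) = fourier_xnu P u"
      unfolding N1_def N2_def using diff[OF P.events_eq_borel P_first_moment, of u]
      by (subst (1 2) finite_measure_density_parts(2)[OF P.events_eq_borel P_first_moment]) (auto simp: parts_bounds parts)
    moreover have "(\<integral>x. iexp (u * x) \<partial>R1) - (\<integral>x. iexp (u * x) \<partial>R2) = \<Delta> * fourier_xnu \<nu> u"
      unfolding R1_def R2_def using diff[OF sets_\<nu> m1, of u] \<Delta>
      by (subst (1 2) finite_measure_density_parts(2)[OF sets_\<nu> m1]) (auto simp: parts_bounds parts simp flip: right_diff_distrib)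
    ultimately have "(\<integral>x. iexp (u * x) \<partial>N1) - (\<integral>x. iexp (u * x) \<partial>N2) = ((\<integral>x. iexp (u * x) \<partial>R1) - (\<integral>x. iexp (u * x) \<partial>R2)) * char P u"
      by (simp add: fourier_xP)
    then have "(\<integral>x. iexp (u * x) \<partial>N1) + char P u * (\<integral>x. iexp (u * x) \<partial>R2) = (\<integral>x. iexp (u * x) \<partial>N2) + char P u * (\<integral>x. iexp (u * x) \<partial>R1)"
      by (simp add: algebra_simps)
    then show "(\<integral>x. iexp (u * x) \<partial>measure_sum N1 (P \<star> R2)) = (\<integral>x. iexp (u * x) \<partial>measure_sum N2 (P \<star> R1))"
      by (simp only: ch fin st)
  qed (auto simp: fs)
  \<comment> \<open>Convolution with the probability measure P averages translates, and Lebesgue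
    measure is invariant under these, so the density bound survives.\<close>
  have cb: "emeasure (P \<star> R) B \<le> ennreal (\<Delta> * K) * emeasure lborel B"
    if R: "R = R1 \<or> R = R2" and B: "B \<in> sets borel" for R B
  proof -
    have Rs: "finite_measure R" "sets R = sets borel" using R fin by auto
    have sp: "space P = space R" "space R = space borel" using R by (auto simp: R1_def R2_def sets_eq_imp_space_eq[OF sets_\<nu>])
    have "emeasure (P \<star> R) B = (\<integral>\<^sup>+x. emeasure R {a. a + x \<in> B} \<partial>P)"
      by (rule convolution_emeasure) (use B Rs fP sp in auto)
    also have "\<dots> \<le> (\<integral>\<^sup>+x. ennreal (\<Delta> * K) * emeasure lborel B \<partial>P)"
    proof (rule nn_integral_mono)
      fix x
      have "{a. a + x \<in> B} \<in> sets borel" using B measurable_sets[of "\<lambda>a. a + x" borel borel B] by (simp add: vimage_def)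
      then have "emeasure R {a. a + x \<in> B} \<le> ennreal (\<Delta> * K) * emeasure lborel {a. a + x \<in> B}"
        using R density_part_bound[of pos_part] density_part_bound[of neg_part] by (auto simp: R1_def R2_def)
      then show "emeasure R {a. a + x \<in> B} \<le> ennreal (\<Delta> * K) * emeasure lborel B"
        by (simp add: emeasure_lborel_translate[OF B])
    qed
    also have "\<dots> = ennreal (\<Delta> * K) * emeasure lborel B" using P.emeasure_space_1 by simp
    finally show ?thesis .
  qed
  have em: "emeasure (measure_sum N1 (P \<star> R2)) B = emeasure N1 B + emeasure (P \<star> R2) B"
    "emeasure (measure_sum N2 (P \<star> R1)) B = emeasure N2 B + emeasure (P \<star> R1) B" if "B \<in> sets borel" for B
    using that by (simp_all add: emeasure_measure_sum)
  have dens: "emeasure (density P (\<lambda>y. ennreal (p y))) B = (\<integral>\<^sup>+y. ennreal (p y) * indicator B y \<partial>P)"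
    if "B \<in> sets borel" "p \<in> borel_measurable borel" for B p
    using that by (subst emeasure_density) auto
  \<comment> \<open>On the nonnegative half-line N2 vanishes, so the identity leaves N1 below the
    convolution of P with R1.\<close>
  have B1: "emeasure (density P (\<lambda>y. ennreal \<bar>y\<bar>)) B \<le> ennreal (\<Delta> * K) * emeasure lborel B" if B: "B \<in> sets borel" "B \<subseteq> {0..}" for B
  proof -
    have "emeasure (density P (\<lambda>y. ennreal \<bar>y\<bar>)) B = emeasure N1 B"
      unfolding N1_def using B(2) by (subst (1 2) dens[OF B(1)]) (auto intro!: nn_integral_cong simp: pos_part_def indicator_def)
    also have "\<dots> \<le> emeasure (measure_sum N1 (P \<star> R2)) B" using B by (simp add: em)
    also have "\<dots> = emeasure N2 B + emeasure (P \<star> R1) B" unfolding eq using B by (simp add: em)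
    also have "emeasure N2 B = 0"
    proof -
      have "(\<integral>\<^sup>+y. ennreal (1 * neg_part y) * indicator B y \<partial>P) = (\<integral>\<^sup>+y. 0 \<partial>P)"
        by (rule nn_integral_cong) (use B(2) in \<open>auto simp: neg_part_def indicator_def ennreal_neg dest!: subsetD\<close>)
      then show ?thesis unfolding N2_def by (subst dens[OF B(1)]) auto
    qed
    finally show ?thesis using cb[of R1 B] B by simp
  qed
  have B2: "emeasure (density P (\<lambda>y. ennreal \<bar>y\<bar>)) B \<le> ennreal (\<Delta> * K) * emeasure lborel B" if B: "B \<in> sets borel" "B \<subseteq> {..<0}" for B
  proof -
    have "emeasure (density P (\<lambda>y. ennreal \<bar>y\<bar>)) B = emeasure N2 B"
      unfolding N2_def using B(2) by (subst (1 2) dens[OF B(1)]) (auto intro!: nn_integral_cong simp: neg_part_def indicator_def)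
    also have "\<dots> \<le> emeasure (measure_sum N2 (P \<star> R1)) B" using B by (simp add: em)
    also have "\<dots> = emeasure N1 B + emeasure (P \<star> R2) B" unfolding eq[symmetric] using B by (simp add: em)
    also have "emeasure N1 B = 0"
    proof -
      have "(\<integral>\<^sup>+y. ennreal (1 * pos_part y) * indicator B y \<partial>P) = (\<integral>\<^sup>+y. 0 \<partial>P)"
        by (rule nn_integral_cong) (use B(2) in \<open>auto simp: pos_part_def indicator_def ennreal_neg dest!: subsetD\<close>)
      then show ?thesis unfolding N1_def by (subst dens[OF B(1)]) auto
    qed
    finally show ?thesis using cb[of R2 B] B by simp
  qed
  have split: "emeasure \<mu> A = emeasure \<mu> (A \<inter> {0..}) + emeasure \<mu> (A \<inter> {..<0})" if "sets \<mu> = sets borel" for \<mu> :: "real measure"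
    using A that by (subst plus_emeasure) (auto intro!: arg_cong[where f = "emeasure \<mu>"])
  have A': "A \<inter> {0..} \<in> sets borel" "A \<inter> {..<0} \<in> sets borel" using A by auto
  have "emeasure (density P (\<lambda>y. ennreal \<bar>y\<bar>)) A =
     emeasure (density P (\<lambda>y. ennreal \<bar>y\<bar>)) (A \<inter> {0..}) + emeasure (density P (\<lambda>y. ennreal \<bar>y\<bar>)) (A \<inter> {..<0})"
    by (rule split) simp
  also have "\<dots> \<le> ennreal (\<Delta> * K) * emeasure lborel (A \<inter> {0..}) + ennreal (\<Delta> * K) * emeasure lborel (A \<inter> {..<0})"
    by (intro add_mono B1 B2 A') auto
  also have "\<dots> = ennreal (\<Delta> * K) * emeasure lborel A"
    unfolding split[of lborel, simplified] by (simp add: distrib_left)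
  finally show ?thesis .
qed

text \<open>Where |y| >= r the bound for |y| P(dy) may be divided by r, so there P is dominated by a
  multiple of Lebesgue measure. The constant degenerates at the origin, about which this estimate
  says nothing.\<close>

lemma nn_integral_P_le:
  assumes [measurable]: "f \<in> borel_measurable borel" "S \<in> sets borel" and r: "r > 0" and S: "\<And>y. y \<in> S \<Longrightarrow> r \<le> \<bar>y\<bar>"
  shows "(\<integral>\<^sup>+y. f y * indicator S y \<partial>P) \<le> ennreal (\<Delta> * K / r) * (\<integral>\<^sup>+y. f y \<partial>lborel)"
proof -
  let ?D = "density P (\<lambda>y. ennreal \<bar>y\<bar>)" and ?L = "density lborel (\<lambda>y. ennreal (\<Delta> * K))"
  have "?D \<le> ?L"
    by (rule le_measure[THEN iffD2]) (auto simp: emeasure_density_const xP_dominated)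
  have "(\<integral>\<^sup>+y. f y * indicator S y \<partial>P) \<le> (\<integral>\<^sup>+y. ennreal (1 / r) * (ennreal \<bar>y\<bar> * f y) \<partial>P)"
  proof (rule nn_integral_mono)
    fix y
    show "f y * indicator S y \<le> ennreal (1 / r) * (ennreal \<bar>y\<bar> * f y)"
    proof (cases "y \<in> S")
      case True
      have "1 * f y \<le> ennreal (1 / r * \<bar>y\<bar>) * f y"
        using S[OF True] r by (intro mult_right_mono) (auto simp: field_simps ennreal_ge_1)
      moreover have "ennreal (1 / r * \<bar>y\<bar>) = ennreal (1 / r) * ennreal \<bar>y\<bar>"
        by (rule ennreal_mult) (use r in auto)
      ultimately show ?thesis using True by (simp add: mult.assoc)
    qed simp
  qed
  also have "\<dots> = ennreal (1 / r) * (\<integral>\<^sup>+y. f y \<partial>?D)"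
    by (simp add: nn_integral_cmult nn_integral_density)
  also have "\<dots> \<le> ennreal (1 / r) * (\<integral>\<^sup>+y. f y \<partial>?L)"
    using \<open>?D \<le> ?L\<close> by (intro mult_left_mono nn_integral_mono_measure) auto
  also have "\<dots> = ennreal (1 / r) * (ennreal (\<Delta> * K) * (\<integral>\<^sup>+y. f y \<partial>lborel))"
    by (simp add: nn_integral_density nn_integral_cmult)
  also have "\<dots> = ennreal (\<Delta> * K / r) * (\<integral>\<^sup>+y. f y \<partial>lborel)"
    using r \<Delta> K by (simp add: mult.assoc[symmetric] flip: ennreal_mult)
  finally show ?thesis .
qed

text \<open>The same domination read for null sets: P is absolutely continuous off the
  origin.\<close>

lemma AE_P_of_AE_lborel:
  assumes "AE y in lborel. Q y"
  shows "AE y in P. y \<noteq> 0 \<longrightarrow> Q y"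
proof -
  obtain N where N: "{y \<in> space lborel. \<not> Q y} \<subseteq> N" "emeasure lborel N = 0" "N \<in> sets lborel"
    using AE_E[OF assms] by blast
  then have [measurable]: "N \<in> sets borel" by simp
  have "emeasure (density P (\<lambda>y. ennreal \<bar>y\<bar>)) N = 0" using xP_dominated[of N] N by simp
  then have "(\<integral>\<^sup>+y. ennreal \<bar>y\<bar> * indicator N y \<partial>P) = 0" by (subst (asm) emeasure_density) auto
  then have "AE y in P. ennreal \<bar>y\<bar> * indicator N y = 0" by (subst (asm) nn_integral_0_iff_AE) auto
  then show ?thesis
  proof eventually_elim
    case (elim y)
    then show ?case using N(1) by (auto simp: indicator_def split: if_splits)
  qed
qed

end

section \<open>No atom at the origin when the Levy measure is infinite\<close>

lemma integral_one_minus_cos_ge: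
  assumes u: "u > 0" and x: "\<bar>x\<bar> \<ge> 4 / u"
  shows "ennreal (u / 2) \<le> (\<integral>\<^sup>+w. ennreal (1 - cos (w * x)) * indicator {u..2 * u} w \<partial>lborel)"
proof -
  have x0: "x \<noteq> 0" using u x by (auto simp: not_le divide_le_0_iff)
  have "(\<integral>\<^sup>+w. ennreal (1 - cos (w * x)) * indicator {u..2 * u} w \<partial>lborel) =
    ennreal ((2 * u - sin (2 * u * x) / x) - (u - sin (u * x) / x))"
  proof (rule nn_integral_FTC_Icc)
    fix w assume "w \<in> {u..2 * u}"
    show "((\<lambda>w. w - sin (w * x) / x) has_real_derivative 1 - cos (w * x)) (at w)"
      using x0 by (auto intro!: derivative_eq_intros)
  qed (use u in auto)
  \<comment> \<open>The integral is u minus a difference of sines divided by x, and this difference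
    is at most 2 / |x|, hence at most u / 2 by the choice of the threshold 4 / u.\<close>
  moreover have "u / 2 \<le> (2 * u - sin (2 * u * x) / x) - (u - sin (u * x) / x)"
  proof -
    have "\<bar>(sin (2 * u * x) - sin (u * x)) / x\<bar> \<le> 2 / \<bar>x\<bar>"
      using abs_sin_le_one[of "2 * u * x"] abs_sin_le_one[of "u * x"] x0
      unfolding abs_divide by (intro divide_right_mono) linarith+
    also have "\<dots> \<le> u / 2" using x u x0 by (simp add: field_simps)
    finally have "(sin (2 * u * x) - sin (u * x)) / x \<le> u / 2" by linarith
    then show ?thesis by (simp add: diff_divide_distrib)
  qed
  ultimately show ?thesis by (simp add: ennreal_leI)
qed

context levy_char
begin

text \<open>The decay of F[x nu] is scale invariant: on [u, 2u] the derivative of \<psi> is at most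
  C / u and the interval has length u.\<close>

lemma \<psi>_diff_le:
  assumes "0 < u" "u \<le> v" "v \<le> 2 * u" shows "cmod (\<psi> v - \<psi> u) \<le> C"
proof (cases "u = v")
  case False
  then have uv: "u < v" using assms by simp
  have "continuous_on {u..v} \<psi>"
    by (intro continuous_at_imp_continuous_on ballI) (blast intro: has_vector_derivative_continuous \<psi>_deriv)
  then have "\<exists>x\<in>{u<..<v}. norm (\<psi> v - \<psi> u) \<le> norm ((v - u) *\<^sub>R (\<i> * fourier_xnu \<nu> x))"
    using mvt_general[OF uv, of \<psi> "\<lambda>x h. h *\<^sub>R (\<i> * fourier_xnu \<nu> x)"] \<psi>_deriv
    unfolding has_vector_derivative_def by blast
  then obtain x where x: "u < x" "x < v" "norm (\<psi> v - \<psi> u) \<le> (v - u) * cmod (fourier_xnu \<nu> x)"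
    using uv by (auto simp: norm_mult)
  note x(3)
  also have "(v - u) * cmod (fourier_xnu \<nu> x) \<le> u * (C / u)"
  proof (intro mult_mono)
    have "C / (1 + \<bar>x\<bar>) \<le> C / u" using C x assms by (intro divide_left_mono) auto
    then show "cmod (fourier_xnu \<nu> x) \<le> C / u" using decay[of x] by linarith
  qed (use assms in auto)
  finally show ?thesis using assms by simp
qed (use C in simp)

text \<open>The finite first moment bounds the mass outside every neighbourhood of 0, and 0 itself
  has no mass. This is needed for exchanging integrals over x and over frequencies.\<close>

lemma sigma_finite_\<nu>:
  assumes "emeasure \<nu> {0} = 0"
  shows "sigma_finite_measure \<nu>"
proof
  define A where "A n = {x \<in> space \<nu>. 1 / real (Suc n) \<le> \<bar>x\<bar>}" for n
  have sp: "space \<nu> = UNIV" using sets_eq_imp_space_eq[OF sets_\<nu>] by simp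
  have fin: "emeasure \<nu> (A n) \<noteq> \<infinity>" for n
  proof -
    have "emeasure \<nu> (A n) \<le> ennreal (1 / (1 / real (Suc n)) * (\<integral>x. \<bar>x\<bar> \<partial>\<nu>))"
      using integral_Markov_inequality[OF m1, of "1 / real (Suc n)"] unfolding A_def by simp
    then show ?thesis by (metis ennreal_neq_top infinity_ennreal_def top.extremum_unique)
  qed
  have un: "(\<Union>n. A n) \<union> {0} = UNIV"
  proof -
    have "x \<in> (\<Union>n. A n)" if "x \<noteq> 0" for x
    proof -
      have "\<bar>x\<bar> > 0" using that by simp
      then obtain n where "1 / real (Suc n) < \<bar>x\<bar>" by (rule nat_approx_posE)
      then show ?thesis by (auto simp: A_def sp intro!: exI[of _ n])
    qed
    then show ?thesis by auto
  qed
  have "A n \<in> sets \<nu>" for n unfolding A_def by measurable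
  then show "\<exists>A. countable A \<and> A \<subseteq> sets \<nu> \<and> \<Union> A = space \<nu> \<and> (\<forall>a\<in>A. emeasure \<nu> a \<noteq> \<infinity>)"
    using un fin assms sets_\<nu> by (intro exI[of _ "insert {0} (range A)"]) (auto simp: sp)
qed

(* Re psi varies by at most C on [u, 2u], so its average over [u, 2u] controls its value at u. *)
lemma Re_\<psi>_lower:
  assumes u: "u > 0" and z: "emeasure \<nu> {0} = 0"
  shows "emeasure \<nu> {x. 4 / u \<le> \<bar>x\<bar>} \<le> ennreal (2 * (C - Re (\<psi> u)))"
proof -
  interpret sigma_finite_measure \<nu> by (rule sigma_finite_\<nu>[OF z])
  interpret pair_sigma_finite \<nu> "lborel :: real measure" ..
  have Sm [measurable]: "{x. 4 / u \<le> \<bar>x\<bar>} \<in> sets borel" by measurable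
  have Re0: "0 \<le> - Re (\<psi> w)" for w unfolding Re_\<psi> by simp
  have "ennreal (u / 2) * emeasure \<nu> {x. 4 / u \<le> \<bar>x\<bar>} = (\<integral>\<^sup>+x. ennreal (u / 2) * indicator {x. 4 / u \<le> \<bar>x\<bar>} x \<partial>\<nu>)"
    using Sm sets_\<nu> by (subst nn_integral_cmult_indicator) auto
  also have "\<dots> \<le> (\<integral>\<^sup>+x. (\<integral>\<^sup>+w. ennreal (1 - cos (w * x)) * indicator {u..2 * u} w \<partial>lborel) \<partial>\<nu>)"
    using integral_one_minus_cos_ge[OF u] by (intro nn_integral_mono) (auto simp: indicator_def)
  also have "\<dots> = (\<integral>\<^sup>+w. (\<integral>\<^sup>+x. ennreal (1 - cos (w * x)) * indicator {u..2 * u} w \<partial>\<nu>) \<partial>lborel)"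
    by (rule Fubini'[symmetric]) measurable
  also have "\<dots> \<le> (\<integral>\<^sup>+w. ennreal (C - Re (\<psi> u)) * indicator {u..2 * u} w \<partial>lborel)"
  proof (rule nn_integral_mono)
    fix w
    show "(\<integral>\<^sup>+x. ennreal (1 - cos (w * x)) * indicator {u..2 * u} w \<partial>\<nu>) \<le> ennreal (C - Re (\<psi> u)) * indicator {u..2 * u} w"
    proof (cases "w \<in> {u..2 * u}")
      case True
      have "(\<integral>\<^sup>+x. ennreal (1 - cos (w * x)) \<partial>\<nu>) = ennreal (\<integral>x. (1 - cos (w * x)) \<partial>\<nu>)"
        by (rule nn_integral_eq_integral[OF integrable_one_minus_cos]) simp
      also have "(\<integral>x. (1 - cos (w * x)) \<partial>\<nu>) = - Re (\<psi> w)" by (simp add: Re_\<psi>)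
      also have "\<dots> \<le> C - Re (\<psi> u)"
        using \<psi>_diff_le[of u w] u True abs_Re_le_cmod[of "\<psi> w - \<psi> u"] by simp
      finally show ?thesis using True by (simp add: ennreal_leI)
    qed simp
  qed
  also have "\<dots> = ennreal (C - Re (\<psi> u)) * ennreal u"
    using u by (subst nn_integral_cmult_indicator) auto
  finally have "ennreal (u / 2) * emeasure \<nu> {x. 4 / u \<le> \<bar>x\<bar>} \<le> ennreal (C - Re (\<psi> u)) * ennreal u" .
  then have "ennreal (2 / u) * (ennreal (u / 2) * emeasure \<nu> {x. 4 / u \<le> \<bar>x\<bar>}) \<le> ennreal (2 / u) * (ennreal (C - Re (\<psi> u)) * ennreal u)"
    by (rule mult_left_mono) simp
  also have "ennreal (2 / u) * (ennreal (u / 2) * emeasure \<nu> {x. 4 / u \<le> \<bar>x\<bar>}) = emeasure \<nu> {x. 4 / u \<le> \<bar>x\<bar>}"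
    using u by (simp add: mult.assoc[symmetric] flip: ennreal_mult)
  also have "ennreal (2 / u) * (ennreal (C - Re (\<psi> u)) * ennreal u) = ennreal (2 * (C - Re (\<psi> u)))"
    using u C Re0[of u] by (simp flip: ennreal_mult)
  finally show ?thesis .
qed

text \<open>The mass of |y| >= 4 / u grows to the total mass, which is infinite, and by
  \<open>Re_\<psi>_lower\<close> it is controlled by -Re \<psi>(u). So -Re \<psi> tends to infinity
  along multiples of |x|, and Re \<psi> is even.\<close>

lemma char_tendsto_0:
  assumes z: "emeasure \<nu> {0} = 0" and inf: "emeasure \<nu> UNIV = \<infinity>" and x: "x \<noteq> 0"
  shows "(\<lambda>n. char P (real n * x)) \<longlonglongrightarrow> 0"
proof -
  have sp: "space \<nu> = UNIV" using sets_eq_imp_space_eq[OF sets_\<nu>] by simp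
  have even: "Re (\<psi> (- u)) = Re (\<psi> u)" for u by (simp add: Re_\<psi>)
  have absu: "Re (\<psi> u) = Re (\<psi> \<bar>u\<bar>)" for u using even[of u] by (simp add: abs_if)
  define S where "S n = {y. 4 / (real (Suc n) * \<bar>x\<bar>) \<le> \<bar>y::real\<bar>}" for n
  have Sm: "S n \<in> sets \<nu>" for n unfolding S_def sets_\<nu> by measurable
  have Sinc: "incseq S"
  proof (rule incseq_SucI, rule subsetI)
    fix n y assume y: "y \<in> S n"
    have "4 / (real (Suc (Suc n)) * \<bar>x\<bar>) \<le> 4 / (real (Suc n) * \<bar>x\<bar>)"
      using x by (intro divide_left_mono mult_right_mono) auto
    then show "y \<in> S (Suc n)" using y by (simp add: S_def)
  qed
  have SU: "(\<Union>n. S n) = UNIV - {0}"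
  proof -
    have "y \<in> (\<Union>n. S n)" if "y \<noteq> 0" for y
    proof -
      obtain n where n: "4 / (\<bar>x\<bar> * \<bar>y\<bar>) \<le> real n" using real_arch_simple by blast
      then have "4 \<le> real (Suc n) * \<bar>x\<bar> * \<bar>y\<bar>" using x that
        by (simp add: divide_le_eq algebra_simps) (smt (verit) mult_nonneg_nonneg abs_ge_zero)
      then have "y \<in> S n" using x by (simp add: S_def divide_le_eq mult.commute mult.left_commute del: of_nat_Suc)
      then show ?thesis by blast
    qed
    moreover have "0 \<notin> S n" for n using x by (simp add: S_def not_le)
    ultimately show ?thesis by auto
  qed
  have "(\<lambda>n. emeasure \<nu> (S n)) \<longlonglongrightarrow> emeasure \<nu> (\<Union>n. S n)"
    by (rule Lim_emeasure_incseq) (use Sm Sinc in auto)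
  also have "emeasure \<nu> (\<Union>n. S n) = \<infinity>"
  proof -
    have "emeasure \<nu> UNIV = emeasure \<nu> ((UNIV - {0}) \<union> {0})" by simp
    also have "\<dots> = emeasure \<nu> (UNIV - {0}) + emeasure \<nu> {0}"
      by (rule plus_emeasure[symmetric]) (auto simp: sets_\<nu>)
    finally show ?thesis using inf z SU by simp
  qed
  finally have Slim: "(\<lambda>n. emeasure \<nu> (S n)) \<longlonglongrightarrow> \<infinity>" .
  have "filterlim (\<lambda>n. - Re (\<psi> (real (Suc n) * x))) at_top sequentially"
    unfolding filterlim_at_top
  proof
    fix Z :: real
    have "eventually (\<lambda>n. ennreal (2 * (C + \<bar>Z\<bar>)) < emeasure \<nu> (S n)) sequentially"
      by (rule order_tendstoD(1)[OF Slim]) simp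
    then show "eventually (\<lambda>n. Z \<le> - Re (\<psi> (real (Suc n) * x))) sequentially"
    proof eventually_elim
      case (elim n)
      have "emeasure \<nu> (S n) \<le> ennreal (2 * (C - Re (\<psi> (real (Suc n) * \<bar>x\<bar>))))"
        unfolding S_def by (rule Re_\<psi>_lower[OF _ z]) (use x in simp)
      with elim have "ennreal (2 * (C + \<bar>Z\<bar>)) < ennreal (2 * (C - Re (\<psi> (real (Suc n) * \<bar>x\<bar>))))" by (rule less_le_trans)
      then have "2 * (C + \<bar>Z\<bar>) < 2 * (C - Re (\<psi> (real (Suc n) * \<bar>x\<bar>)))"
        using C by (subst (asm) ennreal_less_iff) auto
      then have "\<bar>Z\<bar> < - Re (\<psi> (real (Suc n) * \<bar>x\<bar>))" by (simp del: of_nat_Suc)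
      then show ?case using absu[of "real (Suc n) * x"] by (simp add: abs_mult)
    qed
  qed
  then have "filterlim (\<lambda>n. \<Delta> * - Re (\<psi> (real (Suc n) * x))) at_top sequentially"
    using \<Delta> by (intro filterlim_tendsto_pos_mult_at_top[OF tendsto_const])
  then have "filterlim (\<lambda>n. - (\<Delta> * - Re (\<psi> (real (Suc n) * x)))) at_bot sequentially"
    by (simp add: filterlim_uminus_at_bot)
  then have "(\<lambda>n. exp (- (\<Delta> * - Re (\<psi> (real (Suc n) * x))))) \<longlonglongrightarrow> 0"
    by (rule filterlim_compose[OF exp_at_bot])
  then have "(\<lambda>n. cmod (char P (real (Suc n) * x))) \<longlonglongrightarrow> 0" by (simp add: char_\<psi>)
  then have "(\<lambda>n. char P (real (Suc n) * x)) \<longlonglongrightarrow> 0" by (rule tendsto_norm_zero_cancel)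
  then show ?thesis by (subst (asm) filterlim_sequentially_Suc)
qed

text \<open>Averaging the characteristic function at n times a Gaussian variable gives the integral
  of exp(-(n y)^2 / 2) against P, which is at least the mass at 0. The average tends to 0 by
  dominated convergence. The origin is the one point that the domination by Lebesgue measure leaves
  open.\<close>

lemma no_atom:
  assumes z: "emeasure \<nu> {0} = 0" and inf: "emeasure \<nu> UNIV = \<infinity>"
  shows "measure P {0} = 0"
proof -
  interpret G: prob_space std_normal_distribution by (rule prob_space_normal_density) simp
  interpret pair_sigma_finite std_normal_distribution P ..
  interpret GP: prob_space "std_normal_distribution \<Otimes>\<^sub>M P"
    by (rule prob_space_pair) (rule G.prob_space_axioms P.prob_space_axioms)+
  let ?N = std_normal_distribution
  have eq: "(\<integral>x. char P (real n * x) \<partial>?N) = complex_of_real (\<integral>y. exp (- (real n * y)\<^sup>2 / 2) \<partial>P)" for n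
  proof -
    have i: "integrable (?N \<Otimes>\<^sub>M P) (\<lambda>(x, y). iexp (real n * x * y))"
      by (rule GP.integrable_const_bound[of _ 1]) auto
    have "(\<integral>x. char P (real n * x) \<partial>?N) = (\<integral>x. (\<integral>y. iexp (real n * x * y) \<partial>P) \<partial>?N)"
      unfolding char_def ..
    also have "\<dots> = (\<integral>y. (\<integral>x. iexp (real n * x * y) \<partial>?N) \<partial>P)"
      using Fubini_integral[OF i] by simp
    also have "\<dots> = (\<integral>y. complex_of_real (exp (- (real n * y)\<^sup>2 / 2)) \<partial>P)"
    proof (rule Bochner_Integration.integral_cong[OF refl])
      fix y
      have "(\<integral>x. iexp (real n * x * y) \<partial>?N) = (\<integral>x. iexp ((real n * y) * x) \<partial>?N)" by (simp only: ac_simps)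
      then show "(\<integral>x. iexp (real n * x * y) \<partial>?N) = complex_of_real (exp (- (real n * y)\<^sup>2 / 2))"
        using integral_std_normal_iexp[of "real n * y"] by simp
    qed
    also have "\<dots> = complex_of_real (\<integral>y. exp (- (real n * y)\<^sup>2 / 2) \<partial>P)"
      by (rule integral_of_real) (rule P.integrable_const_bound[of _ 1], auto)
    finally show ?thesis .
  qed
  have "(\<lambda>n. \<integral>x. char P (real n * x) \<partial>?N) \<longlonglongrightarrow> (\<integral>x. 0 \<partial>?N)"
  proof (rule integral_dominated_convergence[where w = "\<lambda>_. 1"])
    have "AE x in lborel. x \<noteq> (0::real)" by (rule AE_lborel_singleton)
    then have "AE x in ?N. x \<noteq> 0" by (subst AE_density) (auto elim: eventually_mono)
    then show "AE x in ?N. (\<lambda>n. char P (real n * x)) \<longlonglongrightarrow> 0"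
      by eventually_elim (rule char_tendsto_0[OF z inf])
  qed (auto simp: P.cmod_char_le_1)
  then have "(\<lambda>n. complex_of_real (\<integral>y. exp (- (real n * y)\<^sup>2 / 2) \<partial>P)) \<longlonglongrightarrow> 0" unfolding eq by simp
  then have lim: "(\<lambda>n. \<integral>y. exp (- (real n * y)\<^sup>2 / 2) \<partial>P) \<longlonglongrightarrow> 0"
    using tendsto_Re by fastforce
  have "measure P {0} \<le> (\<integral>y. exp (- (real n * y)\<^sup>2 / 2) \<partial>P)" for n
  proof -
    have "measure P {0} = (\<integral>y. indicator {0} y \<partial>P)" by simp
    also have "\<dots> \<le> (\<integral>y. exp (- (real n * y)\<^sup>2 / 2) \<partial>P)"
      by (intro integral_mono P.integrable_const_bound[of _ 1]) (auto simp: indicator_def)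
    finally show ?thesis .
  qed
  then have "measure P {0} \<le> 0" by (intro tendsto_lowerbound[OF lim]) auto
  then show ?thesis by (simp add: measure_le_0_iff)
qed

end

section \<open>The kernel of the deconvolution\<close>

lemma vector_derivative_lipschitz:
  fixes f :: "real \<Rightarrow> 'a::real_normed_vector"
  assumes X: "convex X" and f: "\<And>x. x \<in> X \<Longrightarrow> (f has_vector_derivative f' x) (at x)"
    and B: "\<And>x. x \<in> X \<Longrightarrow> norm (f' x) \<le> B" and xy: "x \<in> X" "y \<in> X"
  shows "norm (f x - f y) \<le> B * \<bar>x - y\<bar>"
proof -
  have "norm (f x - f y) \<le> B * norm (x - y)"
  proof (rule differentiable_bound[OF X _ _ xy])
    show "(f has_derivative (\<lambda>h. h *\<^sub>R f' x)) (at x within X)" if "x \<in> X" for x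
      using f[OF that] unfolding has_vector_derivative_def by (rule has_derivative_at_withinI)
    show "onorm (\<lambda>h. h *\<^sub>R f' x) \<le> B" if "x \<in> X" for x
      using B[OF that] by (intro onorm_le) (simp add: mult.commute[of B] mult_left_mono)
  qed
  then show ?thesis by simp
qed

lemma integrable_one_plus_abs_inverse_sq: "integrable lborel (\<lambda>u::real. (1 / (1 + \<bar>u\<bar>))\<^sup>2)"
proof -
  have "integrable lborel (\<lambda>u::real. inverse (1 + u\<^sup>2))"
  proof -
    have "set_integrable lborel (einterval (-\<infinity>) \<infinity>) (\<lambda>u::real. inverse (1 + u\<^sup>2))"
      by (rule integrable_inverse_1_plus_square)
    then show ?thesis by (simp add: set_integrable_def)
  qed
  then show ?thesis
  proof (rule Bochner_Integration.integrable_bound)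
    show "AE u in lborel. norm ((1 / (1 + \<bar>u\<bar>))\<^sup>2) \<le> norm (inverse (1 + u\<^sup>2 :: real))"
    proof (rule AE_I2)
      fix u :: real
      have "1 + u\<^sup>2 \<le> (1 + \<bar>u\<bar>)\<^sup>2" by (simp add: power2_sum)
      moreover have p: "0 < 1 + u\<^sup>2" by (auto intro: add_pos_nonneg)
      moreover have "0 < (1 + \<bar>u\<bar>)\<^sup>2" by (intro zero_less_power add_pos_nonneg) auto
      ultimately have "1 / (1 + \<bar>u\<bar>)\<^sup>2 \<le> 1 / (1 + u\<^sup>2)" by (intro divide_left_mono mult_pos_pos) auto
      moreover note p
      ultimately show "norm ((1 / (1 + \<bar>u\<bar>))\<^sup>2) \<le> norm (inverse (1 + u\<^sup>2 :: real))"
        by (simp add: power_divide inverse_eq_divide)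
    qed
  qed simp
qed

section \<open>The multiplier m and the kernel q\<close>

locale levy_kernel = levy_char +
  fixes a :: real
  assumes a: "0 < a" "a \<le> 1 / 4"
    and L2_inv_char: "integrable lborel (\<lambda>u. ((1 + \<bar>u\<bar>) powr (a - 1) * cmod (inverse (char P u)))\<^sup>2)"
begin

definition m :: "real \<Rightarrow> complex" where "m u = exp (- (\<Delta> * \<psi> (- u)))"
definition m' :: "real \<Rightarrow> complex" where "m' u = \<i> * \<Delta> * fourier_xnu \<nu> (- u) * m u"

lemma m_eq: "m u = inverse (char P (- u))"
  by (simp add: m_def char_\<psi> exp_minus)

lemma m_0 [simp]: "m 0 = 1"
  by (simp add: m_def)

text \<open>A characteristic function has modulus at most 1. Thanks to this lower bound, quantities
  that are merely bounded near 0 can be absorbed into |m| / (1 + |u|), the common form of all bounds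
  below.\<close>

lemma m_ge_1: "1 \<le> cmod (m u)"
proof -
  have "char P (- u) \<noteq> 0" by (simp add: char_\<psi>)
  moreover have "cmod (char P (- u)) \<le> 1" by (rule P.cmod_char_le_1)
  ultimately show ?thesis by (simp add: m_eq norm_inverse one_le_inverse_iff)
qed

lemma m_deriv: "(m has_vector_derivative m' u) (at u)"
proof -
  have 1: "((\<lambda>u. \<psi> (- u)) has_vector_derivative - (\<i> * fourier_xnu \<nu> (- u))) (at u)"
  proof -
    have "((\<lambda>u::real. - u) has_vector_derivative - 1) (at u)" by (auto intro!: derivative_eq_intros)
    from vector_diff_chain_at[OF this \<psi>_deriv] show ?thesis by (simp add: comp_def)
  qed
  have "((\<lambda>u. - (\<Delta> * \<psi> (- u))) has_vector_derivative - (\<Delta> * - (\<i> * fourier_xnu \<nu> (- u)))) (at u)"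
    by (rule has_vector_derivative_minus[OF has_vector_derivative_mult_right[OF 1]])
  from field_vector_diff_chain_at[OF this DERIV_exp]
  show ?thesis by (simp add: comp_def m_def[abs_def] m'_def ac_simps)
qed

lemma m_cont: "continuous_on S m"
  by (intro continuous_at_imp_continuous_on ballI) (blast intro: has_vector_derivative_continuous m_deriv)

lemma fourier_xnu_cont: "continuous_on S (fourier_xnu \<nu>)"
proof (rule lipschitz_on_continuous_on)
  show "(\<integral>x. x\<^sup>2 \<partial>\<nu>)-lipschitz_on S (fourier_xnu \<nu>)"
    by (rule lipschitz_onI) (use fourier_xnu_lipschitz[OF sets_\<nu> m1 m2] in \<open>auto simp: dist_norm mult.commute\<close>)
qed

lemma m'_cont: "continuous_on S m'"
  unfolding m'_def[abs_def]
  by (intro continuous_intros m_cont continuous_on_compose2[OF fourier_xnu_cont[of UNIV]]) auto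

lemma m_measurable [measurable]: "m \<in> borel_measurable borel" "m' \<in> borel_measurable borel"
  by (rule borel_measurable_continuous_onI, rule m_cont m'_cont)+

lemma m'_bound: "cmod (m' u) \<le> \<Delta> * C * (cmod (m u) / (1 + \<bar>u\<bar>))"
proof -
  have "cmod (m' u) = \<Delta> * (cmod (fourier_xnu \<nu> (- u)) * cmod (m u))"
    using \<Delta> by (simp add: m'_def norm_mult)
  also have "\<dots> \<le> \<Delta> * (C / (1 + \<bar>u\<bar>) * cmod (m u))"
    using decay[of "- u"] \<Delta> by (intro mult_left_mono mult_right_mono) auto
  finally show ?thesis by simp
qed

lemma m_bounded_unit: "\<exists>B\<ge>1. \<forall>u\<in>{-1..1}. cmod (m u) \<le> B"
proof -
  have "bounded (m ` {-1..1})" by (rule compact_imp_bounded[OF compact_continuous_image[OF m_cont compact_Icc]])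
  then obtain B where B: "\<And>u. u \<in> {-1..1} \<Longrightarrow> cmod (m u) \<le> B" unfolding bounded_iff by blast
  have "1 \<le> B" using B[of 0] by simp
  then show ?thesis using B by blast
qed

lemma m'_bounded_unit: "\<exists>B\<ge>0. \<forall>u\<in>{-1..1}. cmod (m' u) \<le> B"
proof -
  obtain B where B: "B \<ge> 1" "\<And>u. u \<in> {-1..1} \<Longrightarrow> cmod (m u) \<le> B" using m_bounded_unit by blast
  have "cmod (m' u) \<le> \<Delta> * C * B" if "u \<in> {-1..1}" for u
  proof (rule order_trans[OF m'_bound])
    have "cmod (m u) / (1 + \<bar>u\<bar>) \<le> cmod (m u) / 1" by (intro divide_left_mono) auto
    also have "\<dots> \<le> B" using B(2)[OF that] by simp
    finally show "\<Delta> * C * (cmod (m u) / (1 + \<bar>u\<bar>)) \<le> \<Delta> * C * B" using \<Delta> C by (intro mult_left_mono) auto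
  qed
  moreover have "0 \<le> \<Delta> * C * B" using \<Delta> C B by simp
  ultimately show ?thesis by blast
qed

text \<open>The factor F[x nu] of m' is Lipschitz because nu has a second moment, and m is Lipschitz
  on the interval because m' is bounded there. This regularity is what makes q' bounded at the
  origin.\<close>

lemma m'_lipschitz_unit: "\<exists>B\<ge>0. \<forall>u\<in>{-1..1}. \<forall>v\<in>{-1..1}. cmod (m' u - m' v) \<le> B * \<bar>u - v\<bar>"
proof -
  obtain B where B: "B \<ge> 1" "\<And>u. u \<in> {-1..1} \<Longrightarrow> cmod (m u) \<le> B" using m_bounded_unit by blast
  obtain B' where B': "B' \<ge> 0" "\<And>u. u \<in> {-1..1} \<Longrightarrow> cmod (m' u) \<le> B'" using m'_bounded_unit by blast
  let ?S = "\<integral>x. x\<^sup>2 \<partial>\<nu>"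
  have "cmod (m' u - m' v) \<le> (\<Delta> * (?S * B + C * B')) * \<bar>u - v\<bar>" if uv: "u \<in> {-1..1}" "v \<in> {-1..1}" for u v
  proof -
    have "m' u - m' v = \<i> * \<Delta> * ((fourier_xnu \<nu> (- u) - fourier_xnu \<nu> (- v)) * m u + fourier_xnu \<nu> (- v) * (m u - m v))"
      by (simp add: m'_def algebra_simps)
    then have "cmod (m' u - m' v) = \<Delta> * cmod ((fourier_xnu \<nu> (- u) - fourier_xnu \<nu> (- v)) * m u + fourier_xnu \<nu> (- v) * (m u - m v))"
      using \<Delta> by (simp add: norm_mult)
    also have "\<dots> \<le> \<Delta> * ((\<bar>u - v\<bar> * ?S) * B + C * (B' * \<bar>u - v\<bar>))"
    proof (intro mult_left_mono order_trans[OF norm_triangle_ineq] add_mono)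
      have "cmod (fourier_xnu \<nu> (- u) - fourier_xnu \<nu> (- v)) \<le> \<bar>- u - - v\<bar> * ?S" by (rule fourier_xnu_lipschitz[OF sets_\<nu> m1 m2])
      then have "cmod (fourier_xnu \<nu> (- u) - fourier_xnu \<nu> (- v)) \<le> \<bar>u - v\<bar> * ?S" by (simp add: abs_minus_commute)
      then show "cmod ((fourier_xnu \<nu> (- u) - fourier_xnu \<nu> (- v)) * m u) \<le> (\<bar>u - v\<bar> * ?S) * B"
        unfolding norm_mult using B(2)[OF uv(1)] by (intro mult_mono) auto
      have "cmod (fourier_xnu \<nu> (- v)) \<le> C / (1 + \<bar>- v\<bar>)" by (rule decay)
      also have "\<dots> \<le> C / 1" using C by (intro divide_left_mono) auto
      finally have "cmod (fourier_xnu \<nu> (- v)) \<le> C" by simp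
      moreover have "cmod (m u - m v) \<le> B' * \<bar>u - v\<bar>"
        by (rule vector_derivative_lipschitz[of "{-1..1}", OF _ m_deriv B'(2) uv]) auto
      ultimately show "cmod (fourier_xnu \<nu> (- v) * (m u - m v)) \<le> C * (B' * \<bar>u - v\<bar>)"
        unfolding norm_mult using C by (intro mult_mono) auto
    qed (use \<Delta> in auto)
    finally show ?thesis by (simp add: algebra_simps)
  qed
  moreover have "0 \<le> \<Delta> * (?S * B + C * B')" using \<Delta> C B B' by simp
  ultimately show ?thesis by blast
qed

text \<open>The derivative of the transform of g_t has a factor 1 / u, and q is what m - 1 becomes
  after taking this factor in. The value at 0 makes q continuous. The quotient \<open>q'\<close> is
  its derivative for nonzero u; at 0 it is 0 by the convention for division.\<close>

definition q :: "real \<Rightarrow> complex" where "q u = (if u = 0 then m' 0 else (m u - 1) / u)"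
definition q' :: "real \<Rightarrow> complex" where "q' u = (u * m' u - (m u - 1)) / (complex_of_real u)\<^sup>2"

lemma q_times: "u * q u = m u - 1"
  by (simp add: q_def)

lemma cmod_m_minus_1: "cmod (m u - 1) \<le> 2 * cmod (m u)"
  using norm_triangle_ineq4[of "m u" 1] m_ge_1[of u] by simp

lemma q_bound: "\<exists>B\<ge>0. \<forall>u. cmod (q u) \<le> B * (cmod (m u) / (1 + \<bar>u\<bar>))"
proof -
  obtain B' where B': "B' \<ge> 0" "\<And>u. u \<in> {-1..1} \<Longrightarrow> cmod (m' u) \<le> B'" using m'_bounded_unit by blast
  have "cmod (q u) \<le> (2 * B' + 4) * (cmod (m u) / (1 + \<bar>u\<bar>))" for u
  proof (cases "\<bar>u\<bar> \<le> 1")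
    case True
    have "cmod (q u) \<le> B'"
    proof (cases "u = 0")
      case False
      have "cmod (m u - m 0) \<le> B' * \<bar>u - 0\<bar>"
        by (rule vector_derivative_lipschitz[of "{-1..1}", OF _ m_deriv B'(2)]) (use True in auto)
      then show ?thesis using False by (simp add: q_def norm_divide divide_le_eq)
    qed (simp add: q_def B'(2))
    also have "\<dots> = 2 * B' * (1 / 2)" by simp
    also have "\<dots> \<le> (2 * B' + 4) * (cmod (m u) / (1 + \<bar>u\<bar>))"
      using B'(1) True m_ge_1[of u] by (intro mult_mono frac_le) auto
    finally show ?thesis .
  next
    case False
    have "cmod (q u) = cmod (m u - 1) / \<bar>u\<bar>" using False by (auto simp: q_def norm_divide)
    also have "\<dots> \<le> 2 * cmod (m u) / ((1 + \<bar>u\<bar>) / 2)"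
      using False cmod_m_minus_1[of u] by (intro frac_le) auto
    also have "\<dots> = 4 * (cmod (m u) / (1 + \<bar>u\<bar>))" by simp
    also have "\<dots> \<le> (2 * B' + 4) * (cmod (m u) / (1 + \<bar>u\<bar>))" using B'(1) by (intro mult_right_mono) auto
    finally show ?thesis .
  qed
  moreover have "0 \<le> 2 * B' + 4" using B'(1) by simp
  ultimately show ?thesis by blast
qed

text \<open>Near 0 the numerator is the remainder of a first order expansion, of order u^2 because
  m' is Lipschitz. Away from 0 both m' / u and (m - 1) / u^2 are of order |m| / (1 + |u|)^2, the
  first because m' already carries one factor 1 / (1 + |u|).\<close>

lemma q'_bound: "\<exists>B\<ge>0. \<forall>u. cmod (q' u) \<le> B * (cmod (m u) / (1 + \<bar>u\<bar>)\<^sup>2)"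
proof -
  obtain L where L: "L \<ge> 0" "\<And>u v. u \<in> {-1..1} \<Longrightarrow> v \<in> {-1..1} \<Longrightarrow> cmod (m' u - m' v) \<le> L * \<bar>u - v\<bar>"
    using m'_lipschitz_unit by blast
  have "cmod (q' u) \<le> (4 * L + (2 * \<Delta> * C + 8)) * (cmod (m u) / (1 + \<bar>u\<bar>)\<^sup>2)" for u
  proof (cases "\<bar>u\<bar> \<le> 1")
    case True
    have "cmod (q' u) \<le> L"
    proof (cases "u = 0")
      case False
      define S where "S = {min 0 u..max 0 u}"
      have SI: "s \<in> {-1..1} \<and> \<bar>u - s\<bar> \<le> \<bar>u\<bar>" if "s \<in> S" for s using that True by (auto simp: S_def)
      \<comment> \<open>Mean value argument for m(s) - s m'(u) as a function of s: its derivative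
        m'(s) - m'(u) is at most L |u| between 0 and u, which gives the second factor |u|.\<close>
      have "cmod ((m u - u *\<^sub>R m' u) - (m 0 - 0 *\<^sub>R m' u)) \<le> L * \<bar>u\<bar> * \<bar>u - 0\<bar>"
      proof (rule vector_derivative_lipschitz[of S "\<lambda>s. m s - s *\<^sub>R m' u" "\<lambda>s. m' s - m' u"])
        show "((\<lambda>s. m s - s *\<^sub>R m' u) has_vector_derivative m' s - m' u) (at s)" for s
          by (rule derivative_eq_intros m_deriv refl | simp)+
        fix s assume s: "s \<in> S"
        have "cmod (m' s - m' u) \<le> L * \<bar>s - u\<bar>" using SI[OF s] True by (intro L(2)) auto
        also have "\<dots> \<le> L * \<bar>u\<bar>" using SI[OF s] L(1) by (intro mult_left_mono) (auto simp: abs_minus_commute)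
        finally show "cmod (m' s - m' u) \<le> L * \<bar>u\<bar>" .
      qed (auto simp: S_def)
      moreover have "u * m' u - (m u - 1) = - ((m u - u *\<^sub>R m' u) - (m 0 - 0 *\<^sub>R m' u))"
        by (simp add: scaleR_conv_of_real)
      ultimately have "cmod (u * m' u - (m u - 1)) \<le> L * u\<^sup>2"
        by (simp only: norm_minus_cancel) (simp add: power2_eq_square mult.assoc)
      then show ?thesis using False by (simp add: q'_def norm_divide norm_power divide_le_eq)
    qed (simp add: q'_def L(1))
    also have "\<dots> = 4 * L * (1 / 4)" by simp
    also have "\<dots> \<le> (4 * L + (2 * \<Delta> * C + 8)) * (cmod (m u) / (1 + \<bar>u\<bar>)\<^sup>2)"
    proof (intro mult_mono frac_le)
      have "(1 + \<bar>u\<bar>)\<^sup>2 \<le> 2\<^sup>2" using True by (intro power_mono) auto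
      then show "(1 + \<bar>u\<bar>)\<^sup>2 \<le> 4" by simp
    qed (use L(1) \<Delta> C m_ge_1[of u] in auto)
    finally show ?thesis .
  next
    case False
    have u: "u \<noteq> 0" "(1 + \<bar>u\<bar>) / 2 \<le> \<bar>u\<bar>" using False by auto
    have sq: "(1 + \<bar>u\<bar>)\<^sup>2 / 4 \<le> \<bar>u\<bar>\<^sup>2" using power_mono[OF u(2), of 2] by (simp add: power_divide)
    have "q' u = m' u / u - (m u - 1) / (complex_of_real u)\<^sup>2"
      using u by (simp add: q'_def field_simps power2_eq_square)
    then have "cmod (q' u) \<le> cmod (m' u / u) + cmod ((m u - 1) / (complex_of_real u)\<^sup>2)"
      by (simp only: norm_triangle_ineq4)
    also have "\<dots> = cmod (m' u) / \<bar>u\<bar> + cmod (m u - 1) / \<bar>u\<bar>\<^sup>2" by (simp add: norm_divide norm_power)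
    also have "\<dots> \<le> \<Delta> * C * (cmod (m u) / (1 + \<bar>u\<bar>)) / ((1 + \<bar>u\<bar>) / 2) + 2 * cmod (m u) / ((1 + \<bar>u\<bar>)\<^sup>2 / 4)"
    proof (intro add_mono frac_le)
      show "cmod (m' u) \<le> \<Delta> * C * (cmod (m u) / (1 + \<bar>u\<bar>))" by (rule m'_bound)
      show "0 < (1 + \<bar>u\<bar>)\<^sup>2 / 4" by (auto intro: zero_less_power)
    qed (use \<Delta> C u sq cmod_m_minus_1[of u] in auto)
    also have "\<dots> = (2 * \<Delta> * C + 8) * (cmod (m u) / (1 + \<bar>u\<bar>)\<^sup>2)"
    proof -
      have "D * (x / A) / (A / 2) + 2 * x / (A\<^sup>2 / 4) = (2 * D + 8) * (x / A\<^sup>2)" if "A > 0" for D x A :: real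
        using that by (simp add: power2_eq_square field_simps)
      from this[of "1 + \<bar>u\<bar>" "\<Delta> * C" "cmod (m u)"] show ?thesis by (simp add: mult.assoc)
    qed
    also have "\<dots> \<le> (4 * L + (2 * \<Delta> * C + 8)) * (cmod (m u) / (1 + \<bar>u\<bar>)\<^sup>2)"
      using L(1) by (intro mult_right_mono) auto
    finally show ?thesis .
  qed
  moreover have "0 \<le> 4 * L + (2 * \<Delta> * C + 8)" using L(1) \<Delta> C by simp
  ultimately show ?thesis by blast
qed

lemma q_deriv:
  assumes "u \<noteq> 0" shows "(q has_vector_derivative q' u) (at u)"
proof -
  have "((\<lambda>u. (1 / u) *\<^sub>R (m u - 1)) has_vector_derivative (1 / u) *\<^sub>R m' u + (- 1 / u\<^sup>2) *\<^sub>R (m u - 1)) (at u)"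
  proof (rule has_vector_derivative_scaleR)
    show "((/) 1 has_real_derivative - 1 / u\<^sup>2) (at u)"
      using assms by (auto intro!: derivative_eq_intros simp: power2_eq_square)
    show "((\<lambda>u. m u - 1) has_vector_derivative m' u) (at u)" using m_deriv by (auto intro!: derivative_eq_intros)
  qed
  also have "(1 / u) *\<^sub>R m' u + (- 1 / u\<^sup>2) *\<^sub>R (m u - 1) = q' u"
    using assms by (simp add: q'_def scaleR_conv_of_real field_simps power2_eq_square)
  finally have "((\<lambda>u. (1 / u) *\<^sub>R (m u - 1)) has_vector_derivative q' u) (at u)" .
  then show ?thesis
    by (rule has_vector_derivative_transform_within_open[of _ _ _ "- {0}"])
       (use assms in \<open>auto simp: q_def scaleR_conv_of_real\<close>)
qed

text \<open>At the origin continuity of q is the differentiability of m.\<close>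

lemma q_cont: "continuous_on S q"
proof (intro continuous_at_imp_continuous_on ballI)
  fix u
  show "isCont q u"
  proof (cases "u = 0")
    case False
    then show ?thesis using q_deriv has_vector_derivative_continuous by blast
  next
    case True
    have lim: "((\<lambda>y. norm (m y - m 0 - (y - 0) *\<^sub>R m' 0) / norm (y - 0)) \<longlongrightarrow> 0) (at 0)"
      using m_deriv[of 0] unfolding has_vector_derivative_def has_derivative_iff_norm by blast
    have "norm (m y - m 0 - (y - 0) *\<^sub>R m' 0) / norm (y - 0) = norm (q y - m' 0)" if "y \<noteq> 0" for y
    proof -
      have "m y - m 0 - (y - 0) *\<^sub>R m' 0 = complex_of_real y * (q y - m' 0)"
        using q_times[of y] by (simp add: scaleR_conv_of_real algebra_simps)
      then show ?thesis using that by (simp add: norm_mult)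
    qed
    then have "((\<lambda>y. norm (q y - m' 0)) \<longlongrightarrow> 0) (at 0)"
      by (intro Lim_transform_eventually[OF lim]) (auto simp: eventually_at_filter)
    then have "(q \<longlongrightarrow> m' 0) (at 0)" by (rule tendsto_norm_zero_cancel[THEN LIM_zero_cancel])
    then show ?thesis using True by (simp add: isCont_def q_def)
  qed
qed

lemma q_measurable [measurable]: "q \<in> borel_measurable borel" "q' \<in> borel_measurable borel"
proof -
  show "q \<in> borel_measurable borel" by (rule borel_measurable_continuous_onI[OF q_cont])
  show "q' \<in> borel_measurable borel" unfolding q'_def[abs_def] by measurable
qed

end

text \<open>Interpolation between the bounds |x - y| and 2. It converts the weight (1 + |u|)^a on
  the frequency side into Hoelder continuity of order a in space.\<close>

lemma cmod_iexp_diff_holder: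
  assumes a: "0 < a" "a \<le> 1"
  shows "cmod (iexp x - iexp y) \<le> 2 * \<bar>x - y\<bar> powr a"
proof (cases "\<bar>x - y\<bar> \<le> 1")
  case True
  have "cmod (iexp x - iexp y) \<le> \<bar>x - y\<bar>" by (rule cmod_iexp_diff_le)
  also have "\<dots> \<le> \<bar>x - y\<bar> powr a"
  proof (cases "x = y")
    case False
    then have "\<bar>x - y\<bar> powr 1 \<le> \<bar>x - y\<bar> powr a" using a True by (intro powr_mono') auto
    then show ?thesis by simp
  qed simp
  finally show ?thesis using powr_ge_zero[of "\<bar>x - y\<bar>" a] by linarith
next
  case False
  have "cmod (iexp x - iexp y) \<le> 2" by (rule cmod_iexp_diff_le_2)
  moreover have "1 \<le> \<bar>x - y\<bar> powr a" using False a by (intro ge_one_powr_ge_zero) auto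
  ultimately show ?thesis by linarith
qed

text \<open>The fundamental theorem with finitely many exceptional points, bridged by continuity.
  Below, the exceptional point is the origin, where a derivative of q has not been
  established.\<close>

lemma integral_FTC_lborel:
  fixes f :: "real \<Rightarrow> complex"
  assumes "a \<le> b" "continuous_on {a..b} f" "finite S"
    and d: "\<And>x. x \<in> {a<..<b} - S \<Longrightarrow> (f has_vector_derivative f' x) (at x)"
    and i: "integrable lborel (\<lambda>x. indicator {a..b} x * f' x)"
  shows "(\<integral>x. indicator {a..b} x * f' x \<partial>lborel) = f b - f a"
proof -
  have eq: "(\<lambda>x. indicator {a..b} x *\<^sub>R f' x) = (\<lambda>x. indicator {a..b} x * f' x)"
    by (auto simp: indicator_def)
  have "set_integrable lborel {a..b} f'" unfolding set_integrable_def eq by (rule i)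
  then have "(LINT x:{a..b}|lborel. f' x) = integral {a..b} f'" by (rule set_borel_integral_eq_integral(2))
  moreover have "(f' has_integral f b - f a) {a..b}"
    using fundamental_theorem_of_calculus_interior_strong[OF assms(3,1) d assms(2)] .
  ultimately show ?thesis unfolding set_lebesgue_integral_def eq by (simp add: integral_unique)
qed

text \<open>A nonnegative integrable function cannot stay above e on an unbounded interval. It
  supplies frequencies at which boundary terms are small.\<close>

lemma integrable_small_value:
  fixes f :: "real \<Rightarrow> real"
  assumes f: "integrable lborel f" "\<And>x. 0 \<le> f x" and e: "e > 0"
  shows "\<exists>x\<ge>N. f x < e"
proof (rule ccontr)
  assume "\<not> ?thesis"
  then have ge: "\<And>x. x \<ge> N \<Longrightarrow> e \<le> f x" by (auto simp: not_less)
  \<comment> \<open>Long enough that e times the length of [N, N + k] exceeds the integral by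
    e.\<close>
  define k where "k = (\<integral>x. f x \<partial>lborel) / e + 1"
  have k: "k \<ge> 0" using f e unfolding k_def by (intro add_nonneg_nonneg divide_nonneg_pos integral_nonneg_AE) auto
  have "ennreal (e * k) = (\<integral>\<^sup>+x. ennreal e * indicator {N..N + k} x \<partial>lborel)"
    using e k by (simp add: nn_integral_cmult_indicator ennreal_mult)
  also have "\<dots> \<le> (\<integral>\<^sup>+x. ennreal (f x) \<partial>lborel)"
    using ge by (intro nn_integral_mono) (auto simp: indicator_def intro: ennreal_leI)
  also have "\<dots> = ennreal (\<integral>x. f x \<partial>lborel)" using f by (simp add: nn_integral_eq_integral)
  finally have "e * k \<le> (\<integral>x. f x \<partial>lborel)" using f by (simp add: ennreal_le_iff)
  then show False using e by (simp add: k_def distrib_left)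
qed

text \<open>The Plancherel bound for the truncated inverses passes to a pointwise limit by Fatou's
  lemma, so norms of a function known by a formula can be estimated without identifying it with the
  chosen inverse transform.\<close>

lemma L2_trunc_inv_Fatou:
  assumes G: "square_integrable G" and H: "AE y in lborel. (\<lambda>k. trunc_inv (U k) G y) \<longlonglongrightarrow> H y"
  shows "(\<integral>\<^sup>+y. ennreal ((cmod (H y))\<^sup>2) \<partial>lborel) \<le> ennreal (L2sq G / (2 * pi))"
proof -
  note T = is_L2_fourier_trunc_inv[OF G]
  note Tsq = is_L2_fourier_square_integrable(1)[OF T]
  have n: "L2sq (trunc_inv (U k) G) \<le> L2sq G / (2 * pi)" for k
  proof -
    have "L2sq (cutoff (U k) G) \<le> L2sq G"
      unfolding L2sq_def using square_integrableD(2)[OF square_integrable_cutoff[OF G]] square_integrableD(2)[OF G]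
      by (intro integral_mono) (auto simp: cutoff_def indicator_def)
    then show ?thesis using is_L2_fourier_isometry[OF T, of "U k"] by (simp add: field_simps)
  qed
  have "(\<integral>\<^sup>+y. ennreal ((cmod (H y))\<^sup>2) \<partial>lborel) = (\<integral>\<^sup>+y. liminf (\<lambda>k. ennreal ((cmod (trunc_inv (U k) G y))\<^sup>2)) \<partial>lborel)"
  proof (rule nn_integral_cong_AE)
    show "AE y in lborel. ennreal ((cmod (H y))\<^sup>2) = liminf (\<lambda>k. ennreal ((cmod (trunc_inv (U k) G y))\<^sup>2))"
      using H
    proof eventually_elim
      case (elim y)
      have "(\<lambda>k. ennreal ((cmod (trunc_inv (U k) G y))\<^sup>2)) \<longlonglongrightarrow> ennreal ((cmod (H y))\<^sup>2)"
        by (intro tendsto_ennrealI tendsto_intros elim)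
      from lim_imp_Liminf[OF _ this] show ?case by simp
    qed
  qed
  also have "\<dots> \<le> liminf (\<lambda>k. \<integral>\<^sup>+y. ennreal ((cmod (trunc_inv (U k) G y))\<^sup>2) \<partial>lborel)"
    by (rule nn_integral_liminf) (use square_integrableD(1)[OF Tsq] in auto)
  also have "\<dots> \<le> liminf (\<lambda>k::nat. ennreal (L2sq G / (2 * pi)))"
  proof (intro Liminf_mono always_eventually allI)
    fix k
    have "(\<integral>\<^sup>+y. ennreal ((cmod (trunc_inv (U k) G y))\<^sup>2) \<partial>lborel) = ennreal (L2sq (trunc_inv (U k) G))"
      unfolding L2sq_def by (rule nn_integral_eq_integral[OF square_integrableD(2)[OF Tsq]]) simp
    then show "(\<integral>\<^sup>+y. ennreal ((cmod (trunc_inv (U k) G y))\<^sup>2) \<partial>lborel) \<le> ennreal (L2sq G / (2 * pi))"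
      using n[of k] by (simp add: ennreal_leI)
  qed
  also have "\<dots> = ennreal (L2sq G / (2 * pi))" by (simp add: Liminf_const)
  finally show ?thesis .
qed

section \<open>The inverse transform Q of q as a function\<close>

context levy_kernel
begin

text \<open>The function of condition (c), reflected and with exponent a: it is square integrable
  and exceeds |m| / (1 + |u|) by exactly the factor (1 + |u|)^a.\<close>

definition w :: "real \<Rightarrow> real" where "w u = (1 + \<bar>u\<bar>) powr (a - 1) * cmod (m u)"

lemma w_nonneg: "0 \<le> w u"
  by (simp add: w_def)

lemma w_measurable [measurable]: "w \<in> borel_measurable borel"
  unfolding w_def[abs_def] by measurable

lemma w_sq_integrable: "integrable lborel (\<lambda>u. (w u)\<^sup>2)"
  using lborel_integrable_real_affine[OF L2_inv_char, of "-1" 0] by (simp add: w_def m_eq)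

lemma weight: "(1 + \<bar>u\<bar>) powr a * (cmod (m u) / (1 + \<bar>u\<bar>)) = w u"
  by (simp add: w_def powr_diff)

lemma weight_ge_1: "1 \<le> (1 + \<bar>u\<bar>) powr a"
  using a by (intro ge_one_powr_ge_zero) auto

lemma m_over_le: "cmod (m u) / (1 + \<bar>u\<bar>) \<le> w u"
  unfolding weight[symmetric] using mult_right_mono[OF weight_ge_1, of "cmod (m u) / (1 + \<bar>u\<bar>)" u] by simp

lemma square_integrable_le_w:
  assumes [measurable]: "F \<in> borel_measurable borel" and "B \<ge> 0" "AE u in lborel. cmod (F u) \<le> B * w u"
  shows "square_integrable F"
  by (rule square_integrable_mono[of "\<lambda>u. complex_of_real (w u)" _ B])
     (use assms w_sq_integrable w_nonneg in \<open>auto simp: square_integrable_def\<close>)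

lemma q_weighted: "integrable lborel (\<lambda>u. ((1 + \<bar>u\<bar>) powr a * cmod (q u))\<^sup>2)"
proof -
  obtain B where B: "B \<ge> 0" "\<And>u. cmod (q u) \<le> B * (cmod (m u) / (1 + \<bar>u\<bar>))" using q_bound by blast
  have b: "(1 + \<bar>u\<bar>) powr a * cmod (q u) \<le> B * w u" for u
    using mult_left_mono[OF B(2)[of u], of "(1 + \<bar>u\<bar>) powr a"] unfolding weight[symmetric] by (simp add: ac_simps)
  show ?thesis
  proof (rule Bochner_Integration.integrable_bound)
    show "integrable lborel (\<lambda>u. B\<^sup>2 * (w u)\<^sup>2)" using w_sq_integrable by simp
    have "((1 + \<bar>u\<bar>) powr a * cmod (q u))\<^sup>2 \<le> B\<^sup>2 * (w u)\<^sup>2" for u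
      using power_mono[OF b[of u], of 2] by (simp add: power_mult_distrib)
    then show "AE u in lborel. norm (((1 + \<bar>u\<bar>) powr a * cmod (q u))\<^sup>2) \<le> norm (B\<^sup>2 * (w u)\<^sup>2)" by simp
  qed measurable
qed

lemma q_square_integrable: "square_integrable q"
proof -
  obtain B where B: "B \<ge> 0" "\<And>u. cmod (q u) \<le> B * (cmod (m u) / (1 + \<bar>u\<bar>))" using q_bound by blast
  have "cmod (q u) \<le> B * w u" for u
    using B(2)[of u] mult_left_mono[OF m_over_le B(1), of u] by linarith
  then show ?thesis by (intro square_integrable_le_w[OF _ B(1)]) auto
qed

text \<open>The bound on q' leaves w(u) / (1 + |u|), a product of two square integrable functions;
  the weight (1 + |u|)^a is still available to be spent on Hoelder continuity.\<close>

lemma q'_weighted: "integrable lborel (\<lambda>u. (1 + \<bar>u\<bar>) powr a * cmod (q' u))"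
proof -
  obtain B where B: "B \<ge> 0" "\<And>u. cmod (q' u) \<le> B * (cmod (m u) / (1 + \<bar>u\<bar>)\<^sup>2)" using q'_bound by blast
  have b: "(1 + \<bar>u\<bar>) powr a * cmod (q' u) \<le> B * ((w u)\<^sup>2 + (1 / (1 + \<bar>u\<bar>))\<^sup>2)" for u
  proof -
    have "(1 + \<bar>u\<bar>) powr a * cmod (q' u) \<le> (1 + \<bar>u\<bar>) powr a * (B * (cmod (m u) / (1 + \<bar>u\<bar>)\<^sup>2))"
      by (intro mult_left_mono B(2)) simp
    also have "\<dots> = B * (w u * (1 / (1 + \<bar>u\<bar>)))"
      unfolding weight[symmetric] by (simp add: power2_eq_square)
    also have "\<dots> \<le> B * ((w u)\<^sup>2 + (1 / (1 + \<bar>u\<bar>))\<^sup>2)"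
    proof (intro mult_left_mono B(1))
      have "2 * (w u * (1 / (1 + \<bar>u\<bar>))) \<le> (w u)\<^sup>2 + (1 / (1 + \<bar>u\<bar>))\<^sup>2"
        using sum_squares_bound[of "w u" "1 / (1 + \<bar>u\<bar>)"] by (simp add: mult.assoc)
      moreover have "0 \<le> w u * (1 / (1 + \<bar>u\<bar>))" using w_nonneg by simp
      ultimately show "w u * (1 / (1 + \<bar>u\<bar>)) \<le> (w u)\<^sup>2 + (1 / (1 + \<bar>u\<bar>))\<^sup>2" by linarith
    qed
    finally show ?thesis .
  qed
  show ?thesis
  proof (rule Bochner_Integration.integrable_bound)
    show "integrable lborel (\<lambda>u. B * ((w u)\<^sup>2 + (1 / (1 + \<bar>u\<bar>))\<^sup>2))"
      using w_sq_integrable integrable_one_plus_abs_inverse_sq by (intro integrable_mult_right Bochner_Integration.integrable_add)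
    show "AE u in lborel. norm ((1 + \<bar>u\<bar>) powr a * cmod (q' u)) \<le> norm (B * ((w u)\<^sup>2 + (1 / (1 + \<bar>u\<bar>))\<^sup>2))"
    proof (rule AE_I2)
      fix u
      have "norm ((1 + \<bar>u\<bar>) powr a * cmod (q' u)) = (1 + \<bar>u\<bar>) powr a * cmod (q' u)" by (simp add: abs_mult)
      also note b[of u]
      also have "B * ((w u)\<^sup>2 + (1 / (1 + \<bar>u\<bar>))\<^sup>2) \<le> norm (B * ((w u)\<^sup>2 + (1 / (1 + \<bar>u\<bar>))\<^sup>2))" by simp
      finally show "norm ((1 + \<bar>u\<bar>) powr a * cmod (q' u)) \<le> norm (B * ((w u)\<^sup>2 + (1 / (1 + \<bar>u\<bar>))\<^sup>2))" .
    qed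
  qed measurable
qed

lemma q'_integrable: "integrable lborel q'"
proof (rule Bochner_Integration.integrable_bound[OF q'_weighted])
  have "cmod (q' u) \<le> (1 + \<bar>u\<bar>) powr a * cmod (q' u)" for u
    using mult_right_mono[OF weight_ge_1, of "cmod (q' u)" u] by simp
  then show "AE u in lborel. norm (q' u) \<le> norm ((1 + \<bar>u\<bar>) powr a * cmod (q' u))" by (simp add: abs_mult)
qed measurable

definition I' :: real where "I' = (\<integral>u. (1 + \<bar>u\<bar>) powr a * cmod (q' u) \<partial>lborel)"

lemma I'_nonneg: "0 \<le> I'"
  unfolding I'_def by simp

lemma integral_q'_le: "(\<integral>u. cmod (q' u) \<partial>lborel) \<le> I'"
  unfolding I'_def
proof (rule integral_mono)
  show "cmod (q' u) \<le> (1 + \<bar>u\<bar>) powr a * cmod (q' u)" for u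
    using mult_right_mono[OF weight_ge_1, of "cmod (q' u)" u] by simp
qed (use q'_integrable q'_weighted in auto)

text \<open>Formally 2 pi i z Q(z): integration by parts moves the factor z onto q as a derivative.
  Since q' is integrable, the integral converges for every z and needs no choice of a
  representative.\<close>

definition R :: "real \<Rightarrow> complex" where "R z = (\<integral>u. iexp (- (u * z)) * q' u \<partial>lborel)"

lemma R_integrable: "integrable lborel (\<lambda>u. iexp (- (u * z)) * q' u)"
  by (rule Bochner_Integration.integrable_bound[OF q'_integrable]) (auto simp: norm_mult)

lemma R_bound: "cmod (R z) \<le> I'"
proof -
  have "cmod (R z) \<le> (\<integral>u. cmod (iexp (- (u * z)) * q' u) \<partial>lborel)" unfolding R_def by (rule integral_norm_bound)
  also have "\<dots> = (\<integral>u. cmod (q' u) \<partial>lborel)" by (simp add: norm_mult)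
  finally show ?thesis using integral_q'_le by linarith
qed

lemma R_holder: "cmod (R y - R z) \<le> 2 * \<bar>y - z\<bar> powr a * I'"
proof -
  have "R y - R z = (\<integral>u. iexp (- (u * y)) * q' u - iexp (- (u * z)) * q' u \<partial>lborel)"
    unfolding R_def by (rule Bochner_Integration.integral_diff[symmetric]) (rule R_integrable)+
  also have "cmod \<dots> \<le> (\<integral>u. 2 * \<bar>y - z\<bar> powr a * ((1 + \<bar>u\<bar>) powr a * cmod (q' u)) \<partial>lborel)"
  proof (rule Bochner_Integration.integral_norm_bound_integral)
    show "integrable lborel (\<lambda>u. iexp (- (u * y)) * q' u - iexp (- (u * z)) * q' u)"
      by (intro Bochner_Integration.integrable_diff R_integrable)
    show "integrable lborel (\<lambda>u. 2 * \<bar>y - z\<bar> powr a * ((1 + \<bar>u\<bar>) powr a * cmod (q' u)))"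
      by (intro integrable_mult_right q'_weighted)
    fix u
    have "cmod (iexp (- (u * y)) * q' u - iexp (- (u * z)) * q' u) = cmod (iexp (- (u * y)) - iexp (- (u * z))) * cmod (q' u)"
      by (simp only: norm_mult[symmetric] left_diff_distrib)
    also have "\<dots> \<le> (2 * \<bar>- (u * y) - - (u * z)\<bar> powr a) * cmod (q' u)"
      using a by (intro mult_right_mono cmod_iexp_diff_holder) auto
    also have "\<bar>- (u * y) - - (u * z)\<bar> = \<bar>y - z\<bar> * \<bar>u\<bar>"
    proof -
      have "- (u * y) - - (u * z) = (z - y) * u" by (simp add: algebra_simps)
      then show ?thesis by (simp only: abs_mult abs_minus_commute)
    qed
    also have "(\<bar>y - z\<bar> * \<bar>u\<bar>) powr a = \<bar>y - z\<bar> powr a * \<bar>u\<bar> powr a" by (simp add: powr_mult)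
    also have "2 * (\<bar>y - z\<bar> powr a * \<bar>u\<bar> powr a) * cmod (q' u) \<le> 2 * (\<bar>y - z\<bar> powr a * (1 + \<bar>u\<bar>) powr a) * cmod (q' u)"
      using a by (intro mult_right_mono mult_left_mono powr_mono2) auto
    finally show "cmod (iexp (- (u * y)) * q' u - iexp (- (u * z)) * q' u) \<le> 2 * \<bar>y - z\<bar> powr a * ((1 + \<bar>u\<bar>) powr a * cmod (q' u))"
      by (simp add: mult.assoc)
  qed
  also have "\<dots> = 2 * \<bar>y - z\<bar> powr a * I'" unfolding I'_def by (rule integral_mult_right_zero)
  finally show ?thesis .
qed

text \<open>Integration by parts on [-U, U], kept in the form multiplied by z so that it holds at z
  = 0 as well. The boundary terms involve only the values of q at U and -U.\<close>

lemma trunc_inv_q: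
  assumes U: "U > 0"
  shows "\<i> * z * (2 * pi * trunc_inv U q z) = (\<integral>u. indicator {-U..U} u * (iexp (- (u * z)) * q' u) \<partial>lborel)
    - (iexp (- (U * z)) * q U - iexp (U * z) * q (- U))"
proof -
  let ?f = "\<lambda>u. iexp (- (u * z)) * q u"
  let ?f' = "\<lambda>u. iexp (- (u * z)) * q' u - \<i> * z * (iexp (- (u * z)) * q u)"
  have i1: "integrable lborel (\<lambda>u. indicator {-U..U} u * (iexp (- (u * z)) * q' u))"
    by (rule Bochner_Integration.integrable_bound[OF q'_integrable]) (auto simp: norm_mult indicator_def)
  have "square_integrable ?f"
    by (rule square_integrable_mono[OF q_square_integrable, of _ 1]) (auto simp: norm_mult)
  from integrable_cutoff[OF this, of U]
  have i2: "integrable lborel (\<lambda>u. indicator {-U..U} u * (iexp (- (u * z)) * q u))" unfolding cutoff_def[abs_def] .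
  have eq: "(\<lambda>u. indicator {-U..U} u * ?f' u) = (\<lambda>u. indicator {-U..U} u * (iexp (- (u * z)) * q' u) - \<i> * z * (indicator {-U..U} u * (iexp (- (u * z)) * q u)))"
    by (auto simp: algebra_simps)
  have "(\<integral>u. indicator {-U..U} u * ?f' u \<partial>lborel) = ?f U - ?f (- U)"
  proof (rule integral_FTC_lborel[of _ _ _ "{0}"])
    show "continuous_on {-U..U} ?f" by (intro continuous_intros q_cont)
    fix u assume "u \<in> {-U<..<U} - {0}"
    then have "(q has_vector_derivative q' u) (at u)" by (intro q_deriv) auto
    moreover have "((\<lambda>u. iexp (- (u * z))) has_vector_derivative (- z) *\<^sub>R (\<i> * iexp (- (u * z)))) (at u)"
    proof -
      have "((\<lambda>u. - (u * z)) has_vector_derivative (- z)) (at u)"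
        by (auto intro!: derivative_eq_intros simp: has_real_derivative_iff_has_vector_derivative[symmetric])
      from vector_diff_chain_at[OF this has_vector_derivative_iexp] show ?thesis by (simp add: comp_def)
    qed
    ultimately have "(?f has_vector_derivative (iexp (- (u * z)) * q' u + ((- z) *\<^sub>R (\<i> * iexp (- (u * z)))) * q u)) (at u)"
      by (intro has_vector_derivative_mult)
    then show "(?f has_vector_derivative ?f' u) (at u)" by (simp add: scaleR_conv_of_real algebra_simps)
  next
    show "integrable lborel (\<lambda>u. indicator {-U..U} u * ?f' u)"
      unfolding eq by (intro Bochner_Integration.integrable_diff integrable_mult_right i1 i2)
  qed (use U in auto)
  also have "(\<integral>u. indicator {-U..U} u * ?f' u \<partial>lborel) = (\<integral>u. indicator {-U..U} u * (iexp (- (u * z)) * q' u) \<partial>lborel)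
      - (\<integral>u. \<i> * z * (indicator {-U..U} u * (iexp (- (u * z)) * q u)) \<partial>lborel)"
    unfolding eq by (rule Bochner_Integration.integral_diff[OF i1 integrable_mult_right[OF i2]])
  also have "(\<integral>u. \<i> * z * (indicator {-U..U} u * (iexp (- (u * z)) * q u)) \<partial>lborel) = \<i> * z * (\<integral>u. indicator {-U..U} u * (iexp (- (u * z)) * q u) \<partial>lborel)"
    by (rule integral_mult_right_zero)
  also have "(\<integral>u. indicator {-U..U} u * (iexp (- (u * z)) * q u) \<partial>lborel) = 2 * pi * trunc_inv U q z"
    unfolding trunc_inv_def by simp
  finally show ?thesis by (simp add: algebra_simps)
qed

lemma trunc_inv_q_bound:
  assumes U: "U > 0" and z: "z \<noteq> 0"
  shows "cmod (trunc_inv U q z) \<le> (I' + cmod (q U) + cmod (q (- U))) / \<bar>z\<bar>"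
proof -
  let ?I = "\<integral>u. indicator {-U..U} u * (iexp (- (u * z)) * q' u) \<partial>lborel"
  have "cmod ?I \<le> (\<integral>u. cmod (q' u) \<partial>lborel)"
    by (rule Bochner_Integration.integral_norm_bound_integral)
       (use q'_integrable in \<open>auto simp: norm_mult indicator_def intro!: Bochner_Integration.integrable_bound[OF q'_integrable]\<close>)
  then have I: "cmod ?I \<le> I'" using integral_q'_le by linarith
  have "1 * (\<bar>z\<bar> * cmod (trunc_inv U q z)) \<le> 2 * pi * (\<bar>z\<bar> * cmod (trunc_inv U q z))"
    using pi_gt3 by (intro mult_right_mono) auto
  also have "\<dots> = cmod (\<i> * z * (2 * pi * trunc_inv U q z))" by (simp add: norm_mult)
  also have "\<dots> \<le> cmod ?I + cmod (iexp (- (U * z)) * q U - iexp (U * z) * q (- U))"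
    unfolding trunc_inv_q[OF U] by (rule norm_triangle_ineq4)
  also have "\<dots> \<le> I' + (cmod (q U) + cmod (q (- U)))"
  proof (intro add_mono I order_trans[OF norm_triangle_ineq4])
  qed (auto simp: norm_mult)
  finally show ?thesis using z by (simp add: field_simps)
qed

text \<open>Frequencies tending to infinity along which the boundary terms of the integration by
  parts vanish; membership of q in L2 is enough to find them. One sequence is fixed because all
  later limits must run along it.\<close>

definition Uq :: "nat \<Rightarrow> real" where
  "Uq = (SOME U. (\<forall>k. U k \<ge> real (Suc k)) \<and> (\<lambda>k. cmod (q (U k)) + cmod (q (- U k))) \<longlonglongrightarrow> 0)"

lemma Uq: "Uq k \<ge> real (Suc k)" "(\<lambda>k. cmod (q (Uq k)) + cmod (q (- Uq k))) \<longlonglongrightarrow> 0"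
proof -
  have i: "integrable lborel (\<lambda>u. (cmod (q u))\<^sup>2 + (cmod (q (- u)))\<^sup>2)"
    using square_integrableD(2)[OF q_square_integrable] lborel_integrable_real_affine[of "\<lambda>u. (cmod (q u))\<^sup>2" "-1" 0] by simp
  have "\<exists>x\<ge>real (Suc k). (cmod (q x))\<^sup>2 + (cmod (q (- x)))\<^sup>2 < (1 / real (Suc k))\<^sup>2" for k
    by (rule integrable_small_value[OF i]) auto
  then have "\<exists>U. \<forall>k. U k \<ge> real (Suc k) \<and> (cmod (q (U k)))\<^sup>2 + (cmod (q (- U k)))\<^sup>2 < (1 / real (Suc k))\<^sup>2"
    by (intro choice allI) blast
  then obtain U where U: "\<And>k. U k \<ge> real (Suc k)" "\<And>k. (cmod (q (U k)))\<^sup>2 + (cmod (q (- U k)))\<^sup>2 < (1 / real (Suc k))\<^sup>2"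
    by blast
  have "cmod (q (U k)) + cmod (q (- U k)) \<le> 1 / real (Suc k) + 1 / real (Suc k)" for k
  proof (intro add_mono)
    have "(cmod (q (U k)))\<^sup>2 \<le> (1 / real (Suc k))\<^sup>2" using U(2)[of k] zero_le_power2[of "cmod (q (- U k))"] by linarith
    then show "cmod (q (U k)) \<le> 1 / real (Suc k)" by (rule power2_le_imp_le) simp
    have "(cmod (q (- U k)))\<^sup>2 \<le> (1 / real (Suc k))\<^sup>2" using U(2)[of k] zero_le_power2[of "cmod (q (U k))"] by linarith
    then show "cmod (q (- U k)) \<le> 1 / real (Suc k)" by (rule power2_le_imp_le) simp
  qed
  moreover have "(\<lambda>k. 1 / real (Suc k)) \<longlonglongrightarrow> 0" by (rule LIMSEQ_Suc[OF lim_const_over_n])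
  then have "(\<lambda>k. 1 / real (Suc k) + 1 / real (Suc k)) \<longlonglongrightarrow> 0" by (rule tendsto_add_zero) fact
  ultimately have "(\<lambda>k. cmod (q (U k)) + cmod (q (- U k))) \<longlonglongrightarrow> 0"
    by (elim Lim_null_comparison[rotated]) simp
  with U(1) have "\<exists>U. (\<forall>k. U k \<ge> real (Suc k)) \<and> (\<lambda>k. cmod (q (U k)) + cmod (q (- U k))) \<longlonglongrightarrow> 0" by blast
  from someI_ex[OF this, folded Uq_def]
  show "Uq k \<ge> real (Suc k)" "(\<lambda>k. cmod (q (Uq k)) + cmod (q (- Uq k))) \<longlonglongrightarrow> 0" by blast+
qed

lemma Uq_pos: "Uq k > 0"
  using Uq(1)[of k] by simp

lemma Uq_at_top: "filterlim Uq at_top sequentially"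
proof (rule filterlim_at_top_mono[OF filterlim_real_sequentially])
  show "\<forall>\<^sub>F k in sequentially. real k \<le> Uq k" using Uq(1) by (intro always_eventually allI) (smt (verit) of_nat_Suc)
qed

text \<open>The function Q of the overview, given by a formula: the limit of the truncated inverses
  at every z other than 0, with default value 0 at z = 0. Having a value at each single point
  matters at the atom, where Q(-t) enters.\<close>

definition Qf :: "real \<Rightarrow> complex" where "Qf z = R z / (2 * pi * \<i> * z)"

lemma trunc_integral_tendsto:
  fixes f :: "real \<Rightarrow> complex"
  assumes "integrable lborel f"
  shows "(\<lambda>k. \<integral>u. indicator {- Uq k..Uq k} u * f u \<partial>lborel) \<longlonglongrightarrow> (\<integral>u. f u \<partial>lborel)"
proof (rule integral_dominated_convergence[OF _ _ integrable_norm[OF assms]])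
  show "AE u in lborel. (\<lambda>k. indicator {- Uq k..Uq k} u * f u) \<longlonglongrightarrow> f u"
  proof (rule AE_I2)
    fix u :: real
    have "eventually (\<lambda>k. \<bar>u\<bar> \<le> Uq k) sequentially" using Uq_at_top unfolding filterlim_at_top by blast
    then have "eventually (\<lambda>k. indicator {- Uq k..Uq k} u * f u = f u) sequentially"
      by eventually_elim (auto simp: indicator_def)
    then show "(\<lambda>k. indicator {- Uq k..Uq k} u * f u) \<longlonglongrightarrow> f u" by (rule tendsto_eventually)
  qed
qed (use assms in \<open>auto simp: indicator_def\<close>)

lemma trunc_inv_q_tendsto:
  assumes z: "z \<noteq> 0"
  shows "(\<lambda>k. trunc_inv (Uq k) q z) \<longlonglongrightarrow> Qf z"
proof -
  have "(\<lambda>k. iexp (- (Uq k * z)) * q (Uq k) - iexp (Uq k * z) * q (- Uq k)) \<longlonglongrightarrow> 0"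
  proof (rule Lim_null_comparison[OF _ Uq(2)], intro always_eventually allI)
    show "norm (iexp (- (Uq k * z)) * q (Uq k) - iexp (Uq k * z) * q (- Uq k)) \<le> cmod (q (Uq k)) + cmod (q (- Uq k))" for k
      by (rule order_trans[OF norm_triangle_ineq4]) (simp add: norm_mult)
  qed
  from tendsto_diff[OF trunc_integral_tendsto[OF R_integrable[of z]] this]
  have "(\<lambda>k. \<i> * z * (2 * pi * trunc_inv (Uq k) q z)) \<longlonglongrightarrow> R z"
    unfolding trunc_inv_q[OF Uq_pos] R_def by simp
  then have "(\<lambda>k. (\<i> * z * (2 * pi * trunc_inv (Uq k) q z)) / (2 * pi * \<i> * z)) \<longlonglongrightarrow> R z / (2 * pi * \<i> * z)"
    by (intro tendsto_divide tendsto_const) (use z in auto)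
  then show ?thesis using z by (simp add: Qf_def field_simps)
qed

lemma R_cont: "continuous_on S R"
proof (rule continuous_on_subset[OF _ subset_UNIV])
  show "continuous_on UNIV R"
    unfolding continuous_on_def
  proof
    fix y
    have "((\<lambda>z. R z - R y) \<longlongrightarrow> 0) (at y)"
    proof (rule Lim_null_comparison)
      show "\<forall>\<^sub>F z in at y. norm (R z - R y) \<le> 2 * \<bar>z - y\<bar> powr a * I'" using R_holder by simp
      have "((\<lambda>z. \<bar>z - y\<bar> powr a) \<longlongrightarrow> 0) (at y)"
        by (rule tendsto_zero_powrI[OF _ tendsto_const]) (use a in \<open>auto intro!: tendsto_eq_intros\<close>)
      then have "((\<lambda>z. 2 * \<bar>z - y\<bar> powr a * I') \<longlongrightarrow> 2 * 0 * I') (at y)" by (intro tendsto_mult tendsto_const)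
      then show "((\<lambda>z. 2 * \<bar>z - y\<bar> powr a * I') \<longlongrightarrow> 0) (at y)" by simp
    qed
    then show "(R \<longlongrightarrow> R y) (at y within UNIV)" by (simp add: LIM_zero_cancel)
  qed
qed

lemma Qf_measurable [measurable]: "Qf \<in> borel_measurable borel"
proof -
  have [measurable]: "R \<in> borel_measurable borel" by (rule borel_measurable_continuous_onI[OF R_cont])
  show ?thesis unfolding Qf_def[abs_def] by measurable
qed

lemma trunc_inv_shift: "trunc_inv U (\<lambda>u. q u * iexp (u * t)) y = trunc_inv U q (y - t)"
proof -
  have "iexp (- (u * y)) * (q u * iexp (u * t)) = iexp (- (u * (y - t))) * q u" for u
    by (simp add: algebra_simps flip: exp_add)
  then show ?thesis unfolding trunc_inv_def by (simp only:)
qed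

definition I2 :: real where "I2 = (\<integral>u. ((1 + \<bar>u\<bar>) powr a * cmod (q u))\<^sup>2 \<partial>lborel)"

lemma I2_nonneg: "0 \<le> I2"
  unfolding I2_def by simp

text \<open>The shift in y is a modulation of q, which leaves moduli on the frequency side
  unchanged, so the bound does not depend on t.\<close>

lemma Qf_L2: "(\<integral>\<^sup>+y. ennreal ((cmod (Qf (y - t)))\<^sup>2) \<partial>lborel) \<le> ennreal I2"
proof -
  let ?G = "\<lambda>u. q u * iexp (u * t)"
  have G: "square_integrable ?G"
    by (rule square_integrable_mono[OF q_square_integrable, of _ 1]) (auto simp: norm_mult)
  have "(\<integral>\<^sup>+y. ennreal ((cmod (Qf (y - t)))\<^sup>2) \<partial>lborel) \<le> ennreal (L2sq ?G / (2 * pi))"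
  proof (rule L2_trunc_inv_Fatou[OF G])
    show "AE y in lborel. (\<lambda>k. trunc_inv (Uq k) ?G y) \<longlonglongrightarrow> Qf (y - t)"
      using AE_lborel_singleton[of t] unfolding trunc_inv_shift
      by eventually_elim (simp add: trunc_inv_q_tendsto)
  qed
  also have "L2sq ?G / (2 * pi) \<le> L2sq ?G / 1" using pi_gt3 by (intro divide_left_mono L2sq_nonneg) auto
  also have "L2sq ?G / 1 \<le> I2"
    unfolding L2sq_def I2_def div_by_1
  proof (rule integral_mono)
    fix u
    have "cmod (q u) \<le> (1 + \<bar>u\<bar>) powr a * cmod (q u)"
      using mult_right_mono[OF weight_ge_1, of "cmod (q u)" u] by simp
    then show "(cmod (?G u))\<^sup>2 \<le> ((1 + \<bar>u\<bar>) powr a * cmod (q u))\<^sup>2" by (intro power_mono) (auto simp: norm_mult)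
  qed (use square_integrableD(2)[OF G] q_weighted in auto)
  finally show ?thesis by (simp add: ennreal_leI)
qed

text \<open>On the frequency side the difference of two translates is q times e^(iut) - e^(ius),
  whose square is at most 4 |t - s|^(2a) |u|^(2a); the weighted norm of q absorbs the power of
  u.\<close>

lemma Qf_diff_L2:
  "(\<integral>\<^sup>+y. ennreal ((cmod (Qf (y - t) - Qf (y - s)))\<^sup>2) \<partial>lborel) \<le> ennreal (4 * \<bar>t - s\<bar> powr (2 * a) * I2)"
proof -
  let ?G = "\<lambda>u. q u * iexp (u * t) - q u * iexp (u * s)"
  have G1: "square_integrable (\<lambda>u. q u * iexp (u * t))" for t
    by (rule square_integrable_mono[OF q_square_integrable, of _ 1]) (auto simp: norm_mult)
  have G: "square_integrable ?G" by (rule square_integrable_diff[OF G1 G1])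
  have tr: "trunc_inv U ?G y = trunc_inv U q (y - t) - trunc_inv U q (y - s)" for U y
  proof -
    have i: "integrable lborel (\<lambda>u. indicator {-U..U} u * (iexp (- (u * y)) * (q u * iexp (u * t))))" for t
    proof -
      have "square_integrable (\<lambda>u. iexp (- (u * y)) * (q u * iexp (u * t)))"
        by (rule square_integrable_mono[OF q_square_integrable, of _ 1]) (auto simp: norm_mult)
      from integrable_cutoff[OF this, of U] show ?thesis unfolding cutoff_def[abs_def] .
    qed
    have "trunc_inv U ?G y = trunc_inv U (\<lambda>u. q u * iexp (u * t)) y - trunc_inv U (\<lambda>u. q u * iexp (u * s)) y"
      unfolding trunc_inv_def diff_divide_distrib[symmetric]
      by (subst Bochner_Integration.integral_diff[OF i i, symmetric]) (simp add: right_diff_distrib)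
    then show ?thesis by (simp only: trunc_inv_shift)
  qed
  have "(\<integral>\<^sup>+y. ennreal ((cmod (Qf (y - t) - Qf (y - s)))\<^sup>2) \<partial>lborel) \<le> ennreal (L2sq ?G / (2 * pi))"
  proof (rule L2_trunc_inv_Fatou[OF G])
    show "AE y in lborel. (\<lambda>k. trunc_inv (Uq k) ?G y) \<longlonglongrightarrow> Qf (y - t) - Qf (y - s)"
      using AE_lborel_singleton[of t] AE_lborel_singleton[of s] unfolding tr
      by eventually_elim (auto intro!: tendsto_diff trunc_inv_q_tendsto)
  qed
  also have "L2sq ?G / (2 * pi) \<le> L2sq ?G / 1" using pi_gt3 by (intro divide_left_mono L2sq_nonneg) auto
  also have "L2sq ?G / 1 \<le> (\<integral>u. 4 * \<bar>t - s\<bar> powr (2 * a) * ((1 + \<bar>u\<bar>) powr a * cmod (q u))\<^sup>2 \<partial>lborel)"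
    unfolding L2sq_def div_by_1
  proof (rule integral_mono)
    fix u
    have "cmod (?G u) = cmod (iexp (u * t) - iexp (u * s)) * cmod (q u)"
      by (simp add: norm_mult[symmetric] algebra_simps del: norm_mult)
    also have "\<dots> \<le> (2 * \<bar>u * t - u * s\<bar> powr a) * cmod (q u)"
      using a by (intro mult_right_mono cmod_iexp_diff_holder) auto
    also have "\<bar>u * t - u * s\<bar> = \<bar>t - s\<bar> * \<bar>u\<bar>"
    proof -
      have "u * t - u * s = (t - s) * u" by (simp add: algebra_simps)
      then show ?thesis by (simp only: abs_mult)
    qed
    also have "(\<bar>t - s\<bar> * \<bar>u\<bar>) powr a = \<bar>t - s\<bar> powr a * \<bar>u\<bar> powr a" by (simp add: powr_mult)
    also have "2 * (\<bar>t - s\<bar> powr a * \<bar>u\<bar> powr a) * cmod (q u) \<le> 2 * (\<bar>t - s\<bar> powr a * (1 + \<bar>u\<bar>) powr a) * cmod (q u)"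
      using a by (intro mult_right_mono mult_left_mono powr_mono2) auto
    finally have "(cmod (?G u))\<^sup>2 \<le> (2 * (\<bar>t - s\<bar> powr a * (1 + \<bar>u\<bar>) powr a) * cmod (q u))\<^sup>2" by (rule power_mono) simp
    also have "\<dots> = 4 * (\<bar>t - s\<bar> powr a)\<^sup>2 * ((1 + \<bar>u\<bar>) powr a * cmod (q u))\<^sup>2"
      by (simp add: power_mult_distrib)
    also have "(\<bar>t - s\<bar> powr a)\<^sup>2 = \<bar>t - s\<bar> powr (2 * a)"
      by (simp add: power2_eq_square flip: powr_add)
    finally show "(cmod (?G u))\<^sup>2 \<le> 4 * \<bar>t - s\<bar> powr (2 * a) * ((1 + \<bar>u\<bar>) powr a * cmod (q u))\<^sup>2" .
  next
    show "integrable lborel (\<lambda>u. 4 * \<bar>t - s\<bar> powr (2 * a) * ((1 + \<bar>u\<bar>) powr a * cmod (q u))\<^sup>2)"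
      by (intro integrable_mult_right q_weighted)
  qed (use square_integrableD(2)[OF G] in auto)
  also have "\<dots> = 4 * \<bar>t - s\<bar> powr (2 * a) * I2" unfolding I2_def by (rule integral_mult_right_zero)
  finally show ?thesis by (simp add: ennreal_leI)
qed

lemma Qf_bound: "cmod (Qf z) \<le> I' / \<bar>z\<bar>"
proof -
  have "cmod (Qf z) = cmod (R z) / (2 * pi * \<bar>z\<bar>)" by (simp add: Qf_def norm_divide norm_mult)
  also have "\<dots> \<le> I' / \<bar>z\<bar>"
  proof (cases "z = 0")
    case False
    have "1 * \<bar>z\<bar> \<le> 2 * pi * \<bar>z\<bar>" using pi_gt3 by (intro mult_right_mono) auto
    then show ?thesis using False R_bound[of z] I'_nonneg by (intro frac_le) auto
  qed simp
  finally show ?thesis .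
qed

text \<open>Away from the origin R / z inherits the Hoelder bound of R. The term from the difference
  of the denominators is Lipschitz and is brought to the power a by |y - z| <= 1.\<close>

lemma Qf_holder:
  assumes d: "d > 0" "\<bar>y\<bar> \<ge> d" "\<bar>z\<bar> \<ge> d" "\<bar>y - z\<bar> \<le> 1"
  shows "cmod (Qf y - Qf z) \<le> (2 / d + 1 / d\<^sup>2) * I' * \<bar>y - z\<bar> powr a"
proof -
  have yz: "y \<noteq> 0" "z \<noteq> 0" using d by auto
  have "Qf y - Qf z = ((R y - R z) / y + R z * (z - y) / (y * z)) / (2 * pi * \<i>)"
    using yz by (simp add: Qf_def field_simps)
  then have "cmod (Qf y - Qf z) = cmod ((R y - R z) / y + R z * (z - y) / (y * z)) / (2 * pi)"
    by (simp add: norm_divide norm_mult)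
  also have "\<dots> \<le> cmod ((R y - R z) / y + R z * (z - y) / (y * z)) / 1"
    using pi_gt3 by (intro divide_left_mono) auto
  also have "\<dots> \<le> cmod (R y - R z) / \<bar>y\<bar> + cmod (R z) * \<bar>z - y\<bar> / (\<bar>y\<bar> * \<bar>z\<bar>)"
  proof -
    have "cmod (complex_of_real z - complex_of_real y) = \<bar>z - y\<bar>" by (metis norm_of_real of_real_diff)
    then show ?thesis using norm_triangle_ineq[of "(R y - R z) / y" "R z * (z - y) / (y * z)"]
      by (simp add: norm_divide norm_mult)
  qed
  also have "\<dots> \<le> (2 * \<bar>y - z\<bar> powr a * I') / d + I' * \<bar>y - z\<bar> powr a / (d * d)"
  proof (intro add_mono frac_le mult_mono)
    show "cmod (R y - R z) \<le> 2 * \<bar>y - z\<bar> powr a * I'" by (rule R_holder)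
    show "cmod (R z) \<le> I'" by (rule R_bound)
    show "\<bar>z - y\<bar> \<le> \<bar>y - z\<bar> powr a"
    proof (cases "y = z")
      case False
      then have "\<bar>y - z\<bar> powr 1 \<le> \<bar>y - z\<bar> powr a" using a d(4) by (intro powr_mono') auto
      then show ?thesis by (simp add: abs_minus_commute)
    qed simp
  qed (use d I'_nonneg in auto)
  also have "\<dots> = (2 / d + 1 / d\<^sup>2) * I' * \<bar>y - z\<bar> powr a"
    by (simp add: power2_eq_square algebra_simps add_divide_distrib)
  finally show ?thesis .
qed

end

section \<open>Identification of the functions in the covariance\<close>

lemma trunc_inv_iexp_shift: "trunc_inv U (\<lambda>u. iexp (u * c) * F u) x = trunc_inv U F (x - c)"
proof -
  have "iexp (- (u * x)) * (iexp (u * c) * F u) = iexp (- (u * (x - c))) * F u" for u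
    by (simp add: algebra_simps flip: exp_add)
  then show ?thesis unfolding trunc_inv_def by (simp only:)
qed

lemma AE_lborel_shift:
  assumes "AE y in lborel. Q (y::real)" shows "AE x in lborel. Q (x - c)"
proof -
  have "AE y in distr lborel borel ((+) (- c)). Q y" using assms unfolding lborel_distr_plus .
  then have "AE x in lborel. Q (- c + x)" by (rule AE_distrD[rotated]) simp
  then show ?thesis by (simp add: add.commute)
qed


text \<open>Up to sign and reflection this is the transform of g_t cut off at n, with \<tau> = |t|.
  The cut makes the function integrable, so that its transform is an honest differentiable
  function.\<close>

definition trunc_e :: "real \<Rightarrow> real \<Rightarrow> real \<Rightarrow> complex" where
  "trunc_e \<tau> n v = (\<integral>x. indicator {\<tau>..n} x * (iexp (v * x) / x) \<partial>lborel)"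

context
  fixes \<tau> n :: real
  assumes tn: "0 < \<tau>" "\<tau> \<le> n"
begin

lemma indicator_Icc_integrable:
  fixes f :: "real \<Rightarrow> complex"
  assumes [measurable]: "f \<in> borel_measurable borel" and b: "\<And>x. x \<in> {\<tau>..n} \<Longrightarrow> cmod (f x) \<le> B"
  shows "integrable lborel (\<lambda>x. indicator {\<tau>..n} x * f x)"
proof (rule Bochner_Integration.integrable_bound)
  show "integrable lborel (\<lambda>x. B * indicator {\<tau>..n} x :: real)"
    by (intro integrable_mult_right integrable_real_indicator) (auto simp: emeasure_lborel_Icc_eq)
  show "AE x in lborel. norm (indicator {\<tau>..n} x * f x) \<le> norm (B * indicator {\<tau>..n} x :: real)"
  proof (rule AE_I2)
    fix x
    show "norm (indicator {\<tau>..n} x * f x) \<le> norm (B * indicator {\<tau>..n} x :: real)"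
    proof (cases "x \<in> {\<tau>..n}")
      case True
      then show ?thesis using b[OF True] by simp
    qed simp
  qed
qed measurable

lemma integral_iexp_Icc:
  assumes v: "v \<noteq> 0"
  shows "(\<integral>x. indicator {\<tau>..n} x * iexp (v * x) \<partial>lborel) = (iexp (v * n) - iexp (v * \<tau>)) / (\<i> * v)"
proof -
  let ?f = "\<lambda>x. iexp (v * x) / (\<i> * v)"
  have "(\<integral>x. indicator {\<tau>..n} x * iexp (v * x) \<partial>lborel) = ?f n - ?f \<tau>"
  proof (rule integral_FTC_lborel[of _ _ _ "{}"])
    show "continuous_on {\<tau>..n} ?f" by (intro continuous_intros) (use v in auto)
    fix x
    have "((\<lambda>x. v * x) has_vector_derivative v) (at x)"
      by (auto intro!: derivative_eq_intros simp: has_real_derivative_iff_has_vector_derivative[symmetric])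
    from vector_diff_chain_at[OF this has_vector_derivative_iexp]
    have "((\<lambda>x. iexp (v * x)) has_vector_derivative v *\<^sub>R (\<i> * iexp (v * x))) (at x)" by (simp add: comp_def)
    from has_vector_derivative_divide[OF this, of "\<i> * v"]
    show "(?f has_vector_derivative iexp (v * x)) (at x)" using v by (simp add: scaleR_conv_of_real)
  next
    show "integrable lborel (\<lambda>x. indicator {\<tau>..n} x * iexp (v * x))"
      by (rule indicator_Icc_integrable[of _ 1]) auto
  qed (use tn in auto)
  then show ?thesis by (simp add: diff_divide_distrib)
qed

text \<open>Seen as an exponential integral against the measure dx / x on [\<tau>, n], the function
  is differentiable by the general lemma on such integrals; the total mass is the added constant.
  Differentiation brings down x, which cancels the density 1 / x and leaves an elementary
  integral.\<close>

lemma trunc_e_deriv: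
  "\<exists>D. (trunc_e \<tau> n has_vector_derivative D) (at v) \<and> (v \<noteq> 0 \<longrightarrow> D = (iexp (v * n) - iexp (v * \<tau>)) / v)"
proof -
  define \<mu> where "\<mu> = density lborel (\<lambda>x. ennreal (indicator {\<tau>..n} x / x))"
  have nn: "0 \<le> indicator {\<tau>..n} x / x" for x :: real using tn by (auto simp: indicator_def)
  have sets: "sets \<mu> = sets borel" by (simp add: \<mu>_def)
  have tr: "(\<integral>x. f x \<partial>\<mu>) = (\<integral>x. indicator {\<tau>..n} x * (f x / x) \<partial>lborel)"
    if "f \<in> borel_measurable borel" for f :: "real \<Rightarrow> complex"
    unfolding \<mu>_def using that nn
    by (subst integral_density) (auto intro!: Bochner_Integration.integral_cong simp: scaleR_conv_of_real indicator_def)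
  have ti: "integrable \<mu> f"
    if f: "f \<in> borel_measurable borel" "\<And>x. x \<in> {\<tau>..n} \<Longrightarrow> cmod (f x / x) \<le> B" for f :: "real \<Rightarrow> complex" and B
  proof -
    have "integrable lborel (\<lambda>x. indicator {\<tau>..n} x * (f x / x))"
      by (rule indicator_Icc_integrable[OF _ f(2)]) (use f(1) in measurable)
    also have "(\<lambda>x. indicator {\<tau>..n} x * (f x / x)) = (\<lambda>x. (indicator {\<tau>..n} x / x) *\<^sub>R f x)"
      by (auto simp: scaleR_conv_of_real indicator_def)
    finally show ?thesis unfolding \<mu>_def using nn f(1) by (subst integrable_density) auto
  qed
  have tir: "integrable \<mu> f" if f: "f \<in> borel_measurable borel" "\<And>x. x \<in> {\<tau>..n} \<Longrightarrow> \<bar>f x / x\<bar> \<le> B" for f :: "real \<Rightarrow> real" and B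
  proof -
    have "integrable \<mu> (\<lambda>x. complex_of_real (f x))" by (rule ti[of _ B]) (use f in \<open>auto simp: norm_divide\<close>)
    then show ?thesis by (simp add: complex_of_real_integrable_eq)
  qed
  have m1: "integrable \<mu> (\<lambda>x. \<bar>x\<bar>)" by (rule tir[of _ 1]) (use tn in auto)
  have m2: "integrable \<mu> (\<lambda>x. x\<^sup>2)" by (rule tir[of _ n]) (use tn in \<open>auto simp: power2_eq_square\<close>)
  have i1: "integrable \<mu> (\<lambda>x. iexp (v * x))" for v
    by (rule ti[of _ "1 / \<tau>"]) (use tn in \<open>auto simp: norm_divide frac_le\<close>)
  have i0: "integrable \<mu> (\<lambda>x. 1 :: complex)"
    by (rule ti[of _ "1 / \<tau>"]) (use tn in \<open>auto simp: norm_divide frac_le\<close>)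
  have eq: "trunc_e \<tau> n v = (\<integral>x. (iexp (v * x) - 1) \<partial>\<mu>) + (\<integral>x. 1 \<partial>\<mu>)" for v
    using Bochner_Integration.integral_diff[OF i1[of v] i0] tr[of "\<lambda>x. iexp (v * x)"] by (simp add: trunc_e_def)
  have "((\<lambda>v. (\<integral>x. (iexp (v * x) - 1) \<partial>\<mu>) + (\<integral>x. 1 \<partial>\<mu>)) has_vector_derivative \<i> * fourier_xnu \<mu> v) (at v)"
    using has_vector_derivative_add[OF has_vector_derivative_integral_iexp[OF sets m1 m2, of v] has_vector_derivative_const] by simp
  then have d: "(trunc_e \<tau> n has_vector_derivative \<i> * fourier_xnu \<mu> v) (at v)" unfolding eq[abs_def] .
  have "\<i> * fourier_xnu \<mu> v = (iexp (v * n) - iexp (v * \<tau>)) / v" if v: "v \<noteq> 0"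
  proof -
    have "fourier_xnu \<mu> v = (\<integral>x. indicator {\<tau>..n} x * (iexp (v * x) * complex_of_real x / x) \<partial>lborel)"
      unfolding fourier_xnu_def by (rule tr) measurable
    also have "\<dots> = (\<integral>x. indicator {\<tau>..n} x * iexp (v * x) \<partial>lborel)"
      by (rule Bochner_Integration.integral_cong) (use tn in \<open>auto simp: indicator_def\<close>)
    finally show ?thesis using integral_iexp_Icc[OF v] v by simp
  qed
  with d show ?thesis by blast
qed

text \<open>Integration by parts in x. The two boundary terms 1 / n and 1 / \<tau> and the remaining
  integral 1 / \<tau> - 1 / n add up to 2 / \<tau>, so the bound is uniform in the cutoff n.\<close>

lemma trunc_e_bound:
  assumes v: "v \<noteq> 0" shows "cmod (trunc_e \<tau> n v) \<le> 2 / (\<tau> * \<bar>v\<bar>)"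
proof -
  let ?f = "\<lambda>x. iexp (v * x) / x"
  let ?f' = "\<lambda>x. \<i> * v * (iexp (v * x) / x) - iexp (v * x) / (complex_of_real x)\<^sup>2"
  have pw: "1 / x \<le> 1 / \<tau>" "1 / x\<^sup>2 \<le> 1 / \<tau>\<^sup>2" if "x \<in> {\<tau>..n}" for x
    using that tn by (auto intro!: frac_le power_mono)
  have i1: "integrable lborel (\<lambda>x. indicator {\<tau>..n} x * (iexp (v * x) / x))"
    by (rule indicator_Icc_integrable[of _ "1 / \<tau>"]) (use pw tn in \<open>auto simp: norm_divide\<close>)
  have i2: "integrable lborel (\<lambda>x. indicator {\<tau>..n} x * (iexp (v * x) / (complex_of_real x)\<^sup>2))"
    by (rule indicator_Icc_integrable[of _ "1 / \<tau>\<^sup>2"]) (use pw tn in \<open>auto simp: norm_divide norm_power\<close>)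
  have eq: "(\<lambda>x. indicator {\<tau>..n} x * ?f' x) = (\<lambda>x. \<i> * v * (indicator {\<tau>..n} x * (iexp (v * x) / x)) - indicator {\<tau>..n} x * (iexp (v * x) / (complex_of_real x)\<^sup>2))"
    by (auto simp: algebra_simps)
  have "(\<integral>x. indicator {\<tau>..n} x * ?f' x \<partial>lborel) = ?f n - ?f \<tau>"
  proof (rule integral_FTC_lborel[of _ _ _ "{}"])
    show "continuous_on {\<tau>..n} ?f" by (intro continuous_intros) (use tn in auto)
    fix x assume "x \<in> {\<tau><..<n} - {}"
    then have x: "x \<noteq> 0" using tn by auto
    have "((\<lambda>x. v * x) has_vector_derivative v) (at x)"
      by (auto intro!: derivative_eq_intros simp: has_real_derivative_iff_has_vector_derivative[symmetric])
    from vector_diff_chain_at[OF this has_vector_derivative_iexp]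
    have e: "((\<lambda>x. iexp (v * x)) has_vector_derivative v *\<^sub>R (\<i> * iexp (v * x))) (at x)" by (simp add: comp_def)
    have "((/) 1 has_real_derivative - 1 / x\<^sup>2) (at x)"
      using x by (auto intro!: derivative_eq_intros simp: power2_eq_square)
    from has_vector_derivative_scaleR[OF this e]
    have "((\<lambda>x. (1 / x) *\<^sub>R iexp (v * x)) has_vector_derivative (1 / x) *\<^sub>R (v *\<^sub>R (\<i> * iexp (v * x))) + (- 1 / x\<^sup>2) *\<^sub>R iexp (v * x)) (at x)" .
    moreover have "(\<lambda>x. (1 / x) *\<^sub>R iexp (v * x)) = ?f" by (auto simp: scaleR_conv_of_real)
    moreover have "(1 / x) *\<^sub>R (v *\<^sub>R (\<i> * iexp (v * x))) + (- 1 / x\<^sup>2) *\<^sub>R iexp (v * x) = ?f' x"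
      using x by (simp add: scaleR_conv_of_real field_simps power2_eq_square)
    ultimately show "(?f has_vector_derivative ?f' x) (at x)" by simp
  next
    show "integrable lborel (\<lambda>x. indicator {\<tau>..n} x * ?f' x)"
      unfolding eq by (intro Bochner_Integration.integrable_diff integrable_mult_right i1 i2)
  qed (use tn in auto)
  also have "(\<integral>x. indicator {\<tau>..n} x * ?f' x \<partial>lborel) = \<i> * v * trunc_e \<tau> n v - (\<integral>x. indicator {\<tau>..n} x * (iexp (v * x) / (complex_of_real x)\<^sup>2) \<partial>lborel)"
    unfolding eq trunc_e_def
    by (subst Bochner_Integration.integral_diff[OF integrable_mult_right[OF i1] i2]) (simp only: integral_mult_right_zero)
  finally have main: "\<i> * v * trunc_e \<tau> n v = ?f n - ?f \<tau> + (\<integral>x. indicator {\<tau>..n} x * (iexp (v * x) / (complex_of_real x)\<^sup>2) \<partial>lborel)"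
    by (simp add: algebra_simps)
  have J: "cmod (\<integral>x. indicator {\<tau>..n} x * (iexp (v * x) / (complex_of_real x)\<^sup>2) \<partial>lborel) \<le> 1 / \<tau> - 1 / n"
  proof -
    have hb: "has_bochner_integral lborel (\<lambda>x. 1 / x\<^sup>2 * indicator {\<tau>..n} x) (- (1 / n) - - (1 / \<tau>))"
      by (rule has_bochner_integral_FTC_Icc_nonneg) (use tn in \<open>auto intro!: derivative_eq_intros simp: power2_eq_square\<close>)
    have "cmod (\<integral>x. indicator {\<tau>..n} x * (iexp (v * x) / (complex_of_real x)\<^sup>2) \<partial>lborel) \<le> (\<integral>x. 1 / x\<^sup>2 * indicator {\<tau>..n} x \<partial>lborel)"
      by (rule Bochner_Integration.integral_norm_bound_integral[OF i2])
         (use hb in \<open>auto simp: norm_divide norm_mult norm_power indicator_def has_bochner_integral_iff\<close>)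
    also have "\<dots> = 1 / \<tau> - 1 / n" using hb by (simp add: has_bochner_integral_iff)
    finally show ?thesis .
  qed
  have "\<bar>v\<bar> * cmod (trunc_e \<tau> n v) = cmod (\<i> * v * trunc_e \<tau> n v)" by (simp add: norm_mult)
  also have "\<dots> \<le> (cmod (?f n) + cmod (?f \<tau>)) + (1 / \<tau> - 1 / n)"
    unfolding main by (intro order_trans[OF norm_triangle_ineq] add_mono norm_triangle_ineq4 J)
  also have "\<dots> = 2 / \<tau>" using tn by (simp add: norm_divide)
  finally show ?thesis using v tn by (simp add: field_simps)
qed

end

lemma g_fun_measurable [measurable]: "g_fun t \<in> borel_measurable borel"
  unfolding g_fun_def[abs_def] by measurable

lemma g_fun_square_integrable:
  assumes t: "t \<noteq> 0" shows "square_integrable (g_fun t)"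
proof (rule square_integrable_mono)
  define B where "B = 1 + 1 / \<bar>t\<bar>"
  show "square_integrable (\<lambda>x. complex_of_real (1 / (1 + \<bar>x\<bar>)))"
    using integrable_one_plus_abs_inverse_sq unfolding square_integrable_def norm_of_real power2_abs
    by simp
  have "cmod (g_fun t x) \<le> B * cmod (complex_of_real (1 / (1 + \<bar>x\<bar>)))" for x
  proof (cases "\<bar>t\<bar> \<le> \<bar>x\<bar>")
    case True
    then have x: "x \<noteq> 0" using t by auto
    have "cmod (g_fun t x) \<le> 1 / \<bar>x\<bar>" by (auto simp: g_fun_def norm_divide indicator_def)
    also have "\<dots> \<le> B * (1 / (1 + \<bar>x\<bar>))"
    proof -
      have le: "\<bar>t\<bar> * (1 + \<bar>x\<bar>) \<le> (\<bar>t\<bar> + 1) * \<bar>x\<bar>" "0 < \<bar>t\<bar>" "0 < \<bar>x\<bar>" "0 < 1 + \<bar>x\<bar>"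
        using True t x by (simp_all add: algebra_simps)
      have "1 / \<bar>x\<bar> = (\<bar>t\<bar> * (1 + \<bar>x\<bar>)) / (\<bar>x\<bar> * \<bar>t\<bar> * (1 + \<bar>x\<bar>))" using le(2-) by simp
      also have "\<dots> \<le> ((\<bar>t\<bar> + 1) * \<bar>x\<bar>) / (\<bar>x\<bar> * \<bar>t\<bar> * (1 + \<bar>x\<bar>))"
        by (rule divide_right_mono[OF le(1)]) simp
      also have "\<dots> = B * (1 / (1 + \<bar>x\<bar>))"
      proof -
        have "(p + 1) * r / (r * p * s) = (1 + 1 / p) * (1 / s)" if "p > 0" "r > 0" "s > 0" for p r s :: real
          using that by (simp add: field_simps)
        from this[OF le(2-4)] show ?thesis unfolding B_def .
      qed
      finally show ?thesis .
    qed
    finally show ?thesis unfolding norm_of_real by simp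
  next
    case False
    then have "g_fun t x = 0" by (auto simp: g_fun_def indicator_def)
    then show ?thesis by (simp add: B_def)
  qed
  then show "AE x in lborel. cmod (g_fun t x) \<le> B * cmod (complex_of_real (1 / (1 + \<bar>x\<bar>)))" by simp
qed measurable

lemma fourier_cutoff_g:
  assumes t: "t \<noteq> 0"
  shows "fourier (cutoff n (g_fun t)) u = complex_of_real (sgn t) * trunc_e \<bar>t\<bar> n (sgn t * u)"
proof (cases "t > 0")
  case True
  then have "fourier (cutoff n (g_fun t)) u = trunc_e \<bar>t\<bar> n u"
    unfolding fourier_def trunc_e_def
    by (intro Bochner_Integration.integral_cong) (auto simp: cutoff_def g_fun_def indicator_def)
  then show ?thesis using True by simp
next
  case False
  then have t: "t < 0" using t by simp
  have "fourier (cutoff n (g_fun t)) u = (\<integral>x. iexp (u * - x) * cutoff n (g_fun t) (- x) \<partial>lborel)"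
    unfolding fourier_def using lborel_integral_real_affine[of "-1" "\<lambda>x. iexp (u * x) * cutoff n (g_fun t) x" 0] by simp
  also have "\<dots> = (\<integral>x. - (indicator {\<bar>t\<bar>..n} x * (iexp (- u * x) / x)) \<partial>lborel)"
    by (rule Bochner_Integration.integral_cong) (use t in \<open>auto simp: cutoff_def g_fun_def indicator_def\<close>)
  also have "\<dots> = - trunc_e \<bar>t\<bar> n (- u)" unfolding trunc_e_def by (rule Bochner_Integration.integral_minus)
  finally show ?thesis using t by simp
qed

section \<open>Integration by parts against the transform of g_t\<close>

context levy_kernel
begin

context
  fixes t :: real and gh :: "real \<Rightarrow> complex"
  assumes t: "t \<noteq> 0" and gh: "is_L2_fourier (g_fun t) gh"
begin

definition \<sigma> :: complex where "\<sigma> = complex_of_real (sgn t)"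

abbreviation "E n \<equiv> fourier (cutoff n (g_fun t))"

lemma \<sigma>_simps: "\<sigma> * \<sigma> = 1" "cmod \<sigma> = 1" "sgn t * sgn t = 1" "\<bar>sgn t\<bar> = 1" "sgn t * \<bar>t\<bar> = t" "sgn t \<noteq> 0"
  using t by (auto simp: \<sigma>_def sgn_if)

lemma E_L2: "is_L2_fourier (cutoff n (g_fun t)) (E n)"
  by (rule is_L2_fourier_L1[OF integrable_cutoff square_integrable_cutoff]; rule g_fun_square_integrable[OF t])

lemma E_sq: "square_integrable (E n)" and gh_sq: "square_integrable gh"
  using is_L2_fourier_square_integrable E_L2 gh by blast+

lemma E_tendsto: "(\<lambda>n. L2sq (\<lambda>u. E (real n) u - gh u)) \<longlonglongrightarrow> 0"
proof -
  have "L2sq (\<lambda>u. E n u - gh u) = 2 * pi * L2sq (\<lambda>x. cutoff n (g_fun t) x - g_fun t x)" for n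
    by (rule is_L2_fourier_isometry[OF is_L2_fourier_diff[OF E_L2 gh]])
  then show ?thesis
    using tendsto_mult_right_zero[OF cutoff_tendsto_L2[OF g_fun_square_integrable[OF t] filterlim_real_sequentially], of "2 * pi"]
    by simp
qed

lemma E_bound: assumes "\<bar>t\<bar> \<le> n" "u \<noteq> 0" shows "cmod (E n u) \<le> 2 / (\<bar>t\<bar> * \<bar>u\<bar>)"
  using trunc_e_bound[of "\<bar>t\<bar>" n "sgn t * u"] assms t
  by (simp add: fourier_cutoff_g[OF t] norm_mult \<sigma>_simps abs_mult)

text \<open>The bounds on the transforms of the cut functions are uniform in n and pass to the L2
  limit along an almost everywhere convergent subsequence.\<close>

lemma gh_bound: "AE u in lborel. cmod (gh u) \<le> 2 / (\<bar>t\<bar> * \<bar>u\<bar>)"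
proof -
  obtain r where r: "strict_mono r" "AE u in lborel. (\<lambda>n. E (real (r n)) u) \<longlonglongrightarrow> gh u"
    using L2sq_AE_subseq[OF E_sq gh_sq E_tendsto] by blast
  from r(2) AE_lborel_singleton[of 0] show ?thesis
  proof eventually_elim
    case (elim u)
    obtain N :: nat where N: "\<bar>t\<bar> \<le> real N" using real_arch_simple by blast
    show ?case
    proof (rule tendsto_upperbound[OF tendsto_norm[OF elim(1)]])
      have "cmod (E (real (r n)) u) \<le> 2 / (\<bar>t\<bar> * \<bar>u\<bar>)" if "n \<ge> N" for n
      proof (rule E_bound)
        have "real N \<le> real (r n)" using that seq_suble[OF r(1), of n] by simp
        then show "\<bar>t\<bar> \<le> real (r n)" using N by linarith
      qed (use elim in simp)
      then show "\<forall>\<^sub>F n in sequentially. cmod (E (real (r n)) u) \<le> 2 / (\<bar>t\<bar> * \<bar>u\<bar>)"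
        by (intro eventually_sequentiallyI[of N])
    qed simp
  qed
qed

text \<open>Multiplied by x the cut function is, up to sign, an interval indicator, so the
  derivative is a difference of two exponentials over u: one frequency from the jump at t, the other
  from the artificial end at n.\<close>

lemma E_deriv:
  assumes n: "\<bar>t\<bar> \<le> n"
  shows "\<exists>D. (E n has_vector_derivative D) (at u) \<and> (u \<noteq> 0 \<longrightarrow> D = - \<sigma> * (iexp (u * t) - iexp (u * (sgn t * n))) / u)"
proof -
  have "0 < \<bar>t\<bar>" using t by simp
  from trunc_e_deriv[OF this n, of "sgn t * u"] obtain D where D: "(trunc_e \<bar>t\<bar> n has_vector_derivative D) (at (sgn t * u))"
    "sgn t * u \<noteq> 0 \<longrightarrow> D = (iexp (sgn t * u * n) - iexp (sgn t * u * \<bar>t\<bar>)) / (sgn t * u)" by blast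
  have "((\<lambda>u. sgn t * u) has_vector_derivative sgn t) (at u)"
    by (auto intro!: derivative_eq_intros simp: has_real_derivative_iff_has_vector_derivative[symmetric])
  note d = has_vector_derivative_mult_right[OF vector_diff_chain_at[OF this D(1)], of \<sigma>]
  have "(E n has_vector_derivative \<sigma> * (sgn t *\<^sub>R D)) (at u)"
  proof -
    have "E n = (\<lambda>u. \<sigma> * trunc_e \<bar>t\<bar> n (sgn t * u))" by (simp add: fun_eq_iff fourier_cutoff_g[OF t] \<sigma>_def)
    with d show ?thesis by (simp add: comp_def)
  qed
  moreover have "\<sigma> * (sgn t *\<^sub>R D) = - \<sigma> * (iexp (u * t) - iexp (u * (sgn t * n))) / u" if u: "u \<noteq> 0"
  proof -
    have ex: "sgn t * u * \<bar>t\<bar> = u * t" "sgn t * u * n = u * (sgn t * n)" using \<sigma>_simps by (simp_all add: ac_simps)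
    have "\<sigma> * (sgn t *\<^sub>R D) = D" using \<sigma>_simps by (simp add: scaleR_conv_of_real \<sigma>_def[symmetric] mult.assoc[symmetric])
    also have "D = (iexp (sgn t * u * n) - iexp (sgn t * u * \<bar>t\<bar>)) / (sgn t * u)" using D(2) u \<sigma>_simps by simp
    also have "\<dots> = (iexp (u * (sgn t * n)) - iexp (u * t)) / (\<sigma> * u)" unfolding ex by (simp add: \<sigma>_def)
    also have "\<dots> = \<sigma> * \<sigma> * ((iexp (u * (sgn t * n)) - iexp (u * t)) / (\<sigma> * u))" by (simp only: \<sigma>_simps mult_1)
    also have "\<dots> = - \<sigma> * (iexp (u * t) - iexp (u * (sgn t * n))) / u"
      using \<sigma>_simps(2) u by (cases "\<sigma> = 0") (simp_all add: field_simps)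
    finally show ?thesis .
  qed
  ultimately show ?thesis by blast
qed

text \<open>A continuous F is bounded on [-U, U], so the truncated inversion integral is an L2
  pairing with a fixed function; hence it is continuous under L2 convergence of the other
  factor.\<close>

lemma cont_times_L2:
  assumes F: "continuous_on UNIV F" and G: "square_integrable G"
  shows "integrable lborel (\<lambda>u. indicator {-U..U} u * (iexp (- (u * y)) * (F u * G u)))"
    "square_integrable (cutoff U (\<lambda>u. iexp (- (u * y)) * F u))"
    "trunc_inv U (\<lambda>u. F u * G u) y = (\<integral>u. cutoff U (\<lambda>u. iexp (- (u * y)) * F u) u * G u \<partial>lborel) / (2 * pi)"
proof -
  have "bounded (F ` {-U..U})"
    by (rule compact_imp_bounded[OF compact_continuous_image[OF continuous_on_subset[OF F] compact_Icc]]) simp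
  then obtain B where B: "\<And>u. u \<in> {-U..U} \<Longrightarrow> cmod (F u) \<le> B" unfolding bounded_iff by blast
  have [measurable]: "F \<in> borel_measurable borel" by (rule borel_measurable_continuous_onI[OF F])
  have one: "square_integrable (\<lambda>u. indicator {-U..U} u)"
  proof -
    have "(\<lambda>x. (cmod (indicator {-U..U} x))\<^sup>2) = (indicator {-U..U} :: real \<Rightarrow> real)"
      by (auto simp: indicator_def fun_eq_iff)
    moreover have "integrable lborel (indicator {-U..U} :: real \<Rightarrow> real)"
      by (intro integrable_real_indicator) (auto simp: emeasure_lborel_Icc_eq)
    ultimately show ?thesis by (simp add: square_integrable_def)
  qed
  show sq: "square_integrable (cutoff U (\<lambda>u. iexp (- (u * y)) * F u))"
    by (rule square_integrable_mono[OF one, of _ B]) (use B in \<open>auto simp: cutoff_def norm_mult indicator_def intro!: AE_I2\<close>)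
  have eq: "(\<lambda>u. indicator {-U..U} u * (iexp (- (u * y)) * (F u * G u))) = (\<lambda>u. cutoff U (\<lambda>u. iexp (- (u * y)) * F u) u * G u)"
    by (simp add: cutoff_def mult.assoc)
  show "integrable lborel (\<lambda>u. indicator {-U..U} u * (iexp (- (u * y)) * (F u * G u)))"
    unfolding eq by (rule L2_product_integrable(1)[OF sq G])
  show "trunc_inv U (\<lambda>u. F u * G u) y = (\<integral>u. cutoff U (\<lambda>u. iexp (- (u * y)) * F u) u * G u \<partial>lborel) / (2 * pi)"
    unfolding trunc_inv_def eq ..
qed

lemma trunc_inv_E_tendsto:
  assumes F: "continuous_on UNIV F"
  shows "(\<lambda>n. trunc_inv U (\<lambda>u. F u * E (real n) u) y) \<longlonglongrightarrow> trunc_inv U (\<lambda>u. F u * gh u) y"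
  unfolding cont_times_L2(3)[OF F E_sq] cont_times_L2(3)[OF F gh_sq]
proof (intro tendsto_divide tendsto_const)
  show "(\<lambda>n. \<integral>u. cutoff U (\<lambda>u. iexp (- (u * y)) * F u) u * E (real n) u \<partial>lborel) \<longlonglongrightarrow> (\<integral>u. cutoff U (\<lambda>u. iexp (- (u * y)) * F u) u * gh u \<partial>lborel)"
    by (rule tendsto_L2_product[OF cont_times_L2(2)[OF F E_sq] cont_times_L2(2)[OF F E_sq] _ E_sq gh_sq E_tendsto])
       (simp add: L2sq_def)
qed simp

lemma m1_cont: "continuous_on S (\<lambda>u. m u - 1)"
  by (intro continuous_intros m_cont)

(* Integration by parts at the truncation levels U (frequency) and n (space). *)
lemma parts_truncated:
  assumes U: "U > 0" and n: "\<bar>t\<bar> \<le> n"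
  shows "cmod (\<i> * y * trunc_inv U (\<lambda>u. (m u - 1) * E n u) y - trunc_inv U (\<lambda>u. m' u * E n u) y
      + \<sigma> * (trunc_inv U q (y - t) - trunc_inv U q (y - sgn t * n)))
    \<le> 2 / \<bar>t\<bar> * (cmod (q U) + cmod (q (- U)))"
proof -
  let ?e = "\<lambda>u. iexp (- (u * y))"
  let ?f = "\<lambda>u. ?e u * ((m u - 1) * E n u)"
  let ?a = "\<lambda>u. ?e u * ((m u - 1) * E n u)" and ?b = "\<lambda>u. ?e u * (m' u * E n u)"
  let ?c = "\<lambda>u. ?e u * (q u * iexp (u * t))" and ?d = "\<lambda>u. ?e u * (q u * iexp (u * (sgn t * n)))"
  let ?f' = "\<lambda>u. ?b u - \<i> * y * ?a u - \<sigma> * (?c u - ?d u)"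
  have qi: "integrable lborel (\<lambda>u. indicator {-U..U} u * (?e u * (q u * iexp (u * s))))" for s
  proof -
    have "square_integrable (\<lambda>u. ?e u * (q u * iexp (u * s)))"
      by (rule square_integrable_mono[OF q_square_integrable, of _ 1]) (auto simp: norm_mult)
    from integrable_cutoff[OF this, of U] show ?thesis unfolding cutoff_def[abs_def] .
  qed
  note ia = cont_times_L2(1)[OF m1_cont E_sq, of U y n] and ib = cont_times_L2(1)[OF m'_cont E_sq, of U y n]
  have eq: "(\<lambda>u. indicator {-U..U} u * ?f' u) = (\<lambda>u. indicator {-U..U} u * ?b u - \<i> * y * (indicator {-U..U} u * ?a u)
     - \<sigma> * (indicator {-U..U} u * ?c u - indicator {-U..U} u * ?d u))"
    by (auto simp: algebra_simps)
  have ii: "integrable lborel (\<lambda>u. indicator {-U..U} u * ?f' u)"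
    unfolding eq by (intro Bochner_Integration.integrable_diff integrable_mult_right ia ib qi)
  have "(\<integral>u. indicator {-U..U} u * ?f' u \<partial>lborel) = ?f U - ?f (- U)"
  proof (rule integral_FTC_lborel[of _ _ _ "{0}"])
    have Ec: "continuous_on {-U..U} (E n)"
      by (intro continuous_at_imp_continuous_on ballI) (use E_deriv[OF n] has_vector_derivative_continuous in blast)
    show "continuous_on {-U..U} ?f" by (intro continuous_intros m1_cont Ec)
    fix u assume "u \<in> {-U<..<U} - {0}"
    then have u: "u \<noteq> 0" by auto
    obtain D where D: "(E n has_vector_derivative D) (at u)" "D = - \<sigma> * (iexp (u * t) - iexp (u * (sgn t * n))) / u"
      using E_deriv[OF n] u by blast
    have e': "(?e has_vector_derivative (- y) *\<^sub>R (\<i> * ?e u)) (at u)"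
    proof -
      have "((\<lambda>u. - (u * y)) has_vector_derivative (- y)) (at u)"
        by (auto intro!: derivative_eq_intros simp: has_real_derivative_iff_has_vector_derivative[symmetric])
      from vector_diff_chain_at[OF this has_vector_derivative_iexp] show ?thesis by (simp add: comp_def)
    qed
    have m1: "((\<lambda>u. m u - 1) has_vector_derivative m' u) (at u)" using m_deriv by (auto intro!: derivative_eq_intros)
    \<comment> \<open>The factor 1 / u of E' meets m - 1 = u q; this is how q arises, once modulated
      by t and once by the artificial end.\<close>
    have PD: "(m u - 1) * D = - \<sigma> * (q u * iexp (u * t) - q u * iexp (u * (sgn t * n)))"
      unfolding D(2) q_times[symmetric] using u by (simp add: field_simps)
    have alg: "X * (P + Q) + ((- y) *\<^sub>R (\<i> * X)) * Z = X * Q - \<i> * y * (X * Z) - \<sigma> * (X * c - X * d)"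
      if "P = - \<sigma> * (c - d)" for X P Q Z c d :: complex
      unfolding that by (simp add: scaleR_conv_of_real algebra_simps)
    have "(?f has_vector_derivative ?e u * ((m u - 1) * D + m' u * E n u) + ((- y) *\<^sub>R (\<i> * ?e u)) * ((m u - 1) * E n u)) (at u)"
      by (intro has_vector_derivative_mult e' m1 D(1))
    then show "(?f has_vector_derivative ?f' u) (at u)" unfolding alg[OF PD] .
  qed (use U ii in auto)
  also have "(\<integral>u. indicator {-U..U} u * ?f' u \<partial>lborel) = (\<integral>u. indicator {-U..U} u * ?b u \<partial>lborel) - \<i> * y * (\<integral>u. indicator {-U..U} u * ?a u \<partial>lborel)
     - \<sigma> * ((\<integral>u. indicator {-U..U} u * ?c u \<partial>lborel) - (\<integral>u. indicator {-U..U} u * ?d u \<partial>lborel))"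
  proof -
    have 1: "(\<integral>u. indicator {-U..U} u * ?b u - \<i> * y * (indicator {-U..U} u * ?a u) \<partial>lborel) =
       (\<integral>u. indicator {-U..U} u * ?b u \<partial>lborel) - \<i> * y * (\<integral>u. indicator {-U..U} u * ?a u \<partial>lborel)"
      by (subst Bochner_Integration.integral_diff[OF ib integrable_mult_right[OF ia]]) (simp only: integral_mult_right_zero)
    have 2: "(\<integral>u. \<sigma> * (indicator {-U..U} u * ?c u - indicator {-U..U} u * ?d u) \<partial>lborel) =
       \<sigma> * ((\<integral>u. indicator {-U..U} u * ?c u \<partial>lborel) - (\<integral>u. indicator {-U..U} u * ?d u \<partial>lborel))"
      by (simp only: integral_mult_right_zero Bochner_Integration.integral_diff[OF qi qi])
    show ?thesis
      unfolding eq 1[symmetric] 2[symmetric]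
      by (rule Bochner_Integration.integral_diff) (intro Bochner_Integration.integrable_diff integrable_mult_right ia ib qi)+
  qed
  finally have I: "(\<integral>u. indicator {-U..U} u * ?b u \<partial>lborel) - \<i> * y * (\<integral>u. indicator {-U..U} u * ?a u \<partial>lborel)
     - \<sigma> * ((\<integral>u. indicator {-U..U} u * ?c u \<partial>lborel) - (\<integral>u. indicator {-U..U} u * ?d u \<partial>lborel)) = ?f U - ?f (- U)" .
  define Ta where "Ta = trunc_inv U (\<lambda>u. (m u - 1) * E n u) y"
  define Tb where "Tb = trunc_inv U (\<lambda>u. m' u * E n u) y"
  define Tc where "Tc = trunc_inv U q (y - t)"
  define Td where "Td = trunc_inv U q (y - sgn t * n)"
  have ints: "(\<integral>u. indicator {-U..U} u * ?a u \<partial>lborel) = 2 * pi * Ta" "(\<integral>u. indicator {-U..U} u * ?b u \<partial>lborel) = 2 * pi * Tb"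
    "(\<integral>u. indicator {-U..U} u * ?c u \<partial>lborel) = 2 * pi * Tc" "(\<integral>u. indicator {-U..U} u * ?d u \<partial>lborel) = 2 * pi * Td"
    unfolding Ta_def Tb_def Tc_def Td_def trunc_inv_shift[symmetric] unfolding trunc_inv_def by simp_all
  have "2 * pi * (\<i> * y * Ta - Tb + \<sigma> * (Tc - Td)) = - (?f U - ?f (- U))"
    using I unfolding ints by (simp add: algebra_simps)
  then have "cmod (2 * pi * (\<i> * y * Ta - Tb + \<sigma> * (Tc - Td))) = cmod (?f U - ?f (- U))"
    by (simp only: norm_minus_cancel)
  also have "\<dots> \<le> cmod (?f U) + cmod (?f (- U))" by (rule norm_triangle_ineq4)
  also have "\<dots> \<le> 2 / \<bar>t\<bar> * cmod (q U) + 2 / \<bar>t\<bar> * cmod (q (- U))"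
  proof (intro add_mono)
    \<comment> \<open>The factor u in m - 1 = u q cancels the decay 1 / |u| of E, so the boundary
      terms are controlled by q alone and vanish along \<open>Uq\<close>.\<close>
    have b: "cmod (?f u) \<le> 2 / \<bar>t\<bar> * cmod (q u)" if u: "u \<noteq> 0" for u
    proof -
      have "cmod (?f u) = \<bar>u\<bar> * cmod (q u) * cmod (E n u)" unfolding q_times[symmetric] by (simp add: norm_mult)
      also have "\<dots> \<le> \<bar>u\<bar> * cmod (q u) * (2 / (\<bar>t\<bar> * \<bar>u\<bar>))" by (intro mult_left_mono E_bound[OF n u]) simp
      finally show ?thesis using u by (simp add: mult.commute)
    qed
    show "cmod (?f U) \<le> 2 / \<bar>t\<bar> * cmod (q U)" "cmod (?f (- U)) \<le> 2 / \<bar>t\<bar> * cmod (q (- U))"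
      by (rule b, use U in simp)+
  qed
  also have "cmod (2 * pi * (\<i> * y * Ta - Tb + \<sigma> * (Tc - Td))) = 2 * pi * cmod (\<i> * y * Ta - Tb + \<sigma> * (Tc - Td))"
  proof -
    have "cmod (2 * pi * Z) = 2 * pi * cmod Z" for Z :: complex by (simp add: norm_mult)
    then show ?thesis .
  qed
  finally have "2 * pi * cmod (\<i> * y * Ta - Tb + \<sigma> * (Tc - Td)) \<le> 2 / \<bar>t\<bar> * (cmod (q U) + cmod (q (- U)))"
    by (simp only: distrib_left)
  moreover have "1 * cmod (\<i> * y * Ta - Tb + \<sigma> * (Tc - Td)) \<le> 2 * pi * cmod (\<i> * y * Ta - Tb + \<sigma> * (Tc - Td))"
    using pi_gt3 by (intro mult_right_mono) auto
  ultimately show ?thesis unfolding Ta_def Tb_def Tc_def Td_def by linarith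
qed

text \<open>With U fixed, the term from the artificial end is a truncated inverse of q evaluated at
  distance about n, and it vanishes by the bound of order 1 / |z|. The remaining terms converge
  because E converges in L2.\<close>

lemma parts_limit:
  assumes U: "U > 0"
  shows "cmod (\<i> * y * trunc_inv U (\<lambda>u. (m u - 1) * gh u) y - trunc_inv U (\<lambda>u. m' u * gh u) y + \<sigma> * trunc_inv U q (y - t))
    \<le> 2 / \<bar>t\<bar> * (cmod (q U) + cmod (q (- U)))"
proof (rule tendsto_upperbound)
  have far: "(\<lambda>n. trunc_inv U q (y - sgn t * real n)) \<longlonglongrightarrow> 0"
  proof (rule Lim_null_comparison)
    let ?B = "I' + cmod (q U) + cmod (q (- U))"
    have B: "?B \<ge> 0" using I'_nonneg by simp
    have yt: "\<bar>y - sgn t * real n\<bar> \<ge> real n - \<bar>y\<bar>" for n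
    proof -
      have "real n = \<bar>sgn t * real n\<bar>" using \<sigma>_simps(4) by (simp add: abs_mult)
      then show ?thesis by linarith
    qed
    obtain N :: nat where N: "\<bar>y\<bar> < real N" using reals_Archimedean2 by blast
    show "\<forall>\<^sub>F n in sequentially. norm (trunc_inv U q (y - sgn t * real n)) \<le> ?B / (real n - \<bar>y\<bar>)"
    proof (rule eventually_sequentiallyI[of N])
      fix n assume "n \<ge> N"
      then have p: "real n - \<bar>y\<bar> > 0" using N by linarith
      then have "y - sgn t * real n \<noteq> 0" using yt[of n] by auto
      from trunc_inv_q_bound[OF U this]
      have "norm (trunc_inv U q (y - sgn t * real n)) \<le> ?B / \<bar>y - sgn t * real n\<bar>" .
      also have "\<dots> \<le> ?B / (real n - \<bar>y\<bar>)" using B p yt[of n] by (intro frac_le) auto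
      finally show "norm (trunc_inv U q (y - sgn t * real n)) \<le> ?B / (real n - \<bar>y\<bar>)" .
    qed
    have "filterlim (\<lambda>n. - \<bar>y\<bar> + real n) at_top sequentially"
      by (rule filterlim_tendsto_add_at_top[OF tendsto_const filterlim_real_sequentially])
    then have "filterlim (\<lambda>n. real n - \<bar>y\<bar>) at_top sequentially" by (simp add: algebra_simps)
    then show "(\<lambda>n. ?B / (real n - \<bar>y\<bar>)) \<longlonglongrightarrow> 0"
      by (rule tendsto_divide_0[OF tendsto_const filterlim_at_top_imp_at_infinity])
  qed
  have "(\<lambda>n. \<i> * y * trunc_inv U (\<lambda>u. (m u - 1) * E (real n) u) y - trunc_inv U (\<lambda>u. m' u * E (real n) u) y
      + \<sigma> * (trunc_inv U q (y - t) - trunc_inv U q (y - sgn t * real n))) \<longlonglongrightarrow>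
     \<i> * y * trunc_inv U (\<lambda>u. (m u - 1) * gh u) y - trunc_inv U (\<lambda>u. m' u * gh u) y + \<sigma> * (trunc_inv U q (y - t) - 0)"
    by (intro tendsto_add tendsto_diff tendsto_mult tendsto_const far trunc_inv_E_tendsto m1_cont m'_cont)
  from tendsto_norm[OF this]
  show "(\<lambda>n. cmod (\<i> * y * trunc_inv U (\<lambda>u. (m u - 1) * E (real n) u) y - trunc_inv U (\<lambda>u. m' u * E (real n) u) y
      + \<sigma> * (trunc_inv U q (y - t) - trunc_inv U q (y - sgn t * real n)))) \<longlonglongrightarrow>
     cmod (\<i> * y * trunc_inv U (\<lambda>u. (m u - 1) * gh u) y - trunc_inv U (\<lambda>u. m' u * gh u) y + \<sigma> * trunc_inv U q (y - t))" by simp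
  obtain N :: nat where N: "\<bar>t\<bar> \<le> real N" using real_arch_simple by blast
  show "\<forall>\<^sub>F n in sequentially. cmod (\<i> * y * trunc_inv U (\<lambda>u. (m u - 1) * E (real n) u) y - trunc_inv U (\<lambda>u. m' u * E (real n) u) y
      + \<sigma> * (trunc_inv U q (y - t) - trunc_inv U q (y - sgn t * real n))) \<le> 2 / \<bar>t\<bar> * (cmod (q U) + cmod (q (- U)))"
    by (rule eventually_sequentiallyI[of N], rule parts_truncated[OF U]) (use N in linarith)
qed simp

text \<open>Only the combination is shown to converge at every y other than t; its two terms are not
  treated separately. Convergence of the combination at single points is what the value at the atom
  needs.\<close>

lemma parts_tendsto:
  assumes y: "y \<noteq> t"
  shows "(\<lambda>k. \<i> * y * trunc_inv (Uq k) (\<lambda>u. (m u - 1) * gh u) y - trunc_inv (Uq k) (\<lambda>u. m' u * gh u) y)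
    \<longlonglongrightarrow> - \<sigma> * Qf (y - t)"
proof -
  have "(\<lambda>k. \<i> * y * trunc_inv (Uq k) (\<lambda>u. (m u - 1) * gh u) y - trunc_inv (Uq k) (\<lambda>u. m' u * gh u) y
      + \<sigma> * trunc_inv (Uq k) q (y - t)) \<longlonglongrightarrow> 0"
  proof (rule Lim_null_comparison)
    show "\<forall>\<^sub>F k in sequentially. norm (\<i> * y * trunc_inv (Uq k) (\<lambda>u. (m u - 1) * gh u) y - trunc_inv (Uq k) (\<lambda>u. m' u * gh u) y
      + \<sigma> * trunc_inv (Uq k) q (y - t)) \<le> 2 / \<bar>t\<bar> * (cmod (q (Uq k)) + cmod (q (- Uq k)))"
      by (intro always_eventually allI parts_limit Uq_pos)
    show "(\<lambda>k. 2 / \<bar>t\<bar> * (cmod (q (Uq k)) + cmod (q (- Uq k)))) \<longlonglongrightarrow> 0"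
      by (rule tendsto_mult_right_zero[OF Uq(2)])
  qed
  moreover have "(\<lambda>k. \<sigma> * trunc_inv (Uq k) q (y - t)) \<longlonglongrightarrow> \<sigma> * Qf (y - t)"
    using y by (intro tendsto_mult tendsto_const trunc_inv_q_tendsto) simp
  ultimately show ?thesis using tendsto_diff by fastforce
qed

end

end

section \<open>The formula for h_t\<close>

lemma trunc_integrable:
  assumes F: "square_integrable F"
  shows "integrable lborel (\<lambda>u. indicator {-U..U} u * (iexp (- (u * y)) * F u))"
proof -
  have m: "F \<in> borel_measurable borel" by (rule square_integrableD[OF F])
  have "square_integrable (\<lambda>u. iexp (- (u * y)) * F u)"
    by (rule square_integrable_mono[OF F, of _ 1]) (use m in \<open>auto simp: norm_mult\<close>)
  from integrable_cutoff[OF this, of U] show ?thesis unfolding cutoff_def[abs_def] .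
qed

lemma trunc_inv_add:
  fixes \<alpha> \<beta> :: complex
  assumes "square_integrable F" "square_integrable G"
  shows "trunc_inv U (\<lambda>u. \<alpha> * F u + \<beta> * G u) y = \<alpha> * trunc_inv U F y + \<beta> * trunc_inv U G y"
proof -
  note i = trunc_integrable[OF assms(1), of U y] trunc_integrable[OF assms(2), of U y]
  have "(\<integral>u. indicator {-U..U} u * (iexp (- (u * y)) * (\<alpha> * F u + \<beta> * G u)) \<partial>lborel) =
     (\<integral>u. \<alpha> * (indicator {-U..U} u * (iexp (- (u * y)) * F u)) + \<beta> * (indicator {-U..U} u * (iexp (- (u * y)) * G u)) \<partial>lborel)"
    by (rule Bochner_Integration.integral_cong) (auto simp: algebra_simps)
  also have "\<dots> = \<alpha> * (\<integral>u. indicator {-U..U} u * (iexp (- (u * y)) * F u) \<partial>lborel) + \<beta> * (\<integral>u. indicator {-U..U} u * (iexp (- (u * y)) * G u) \<partial>lborel)"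
    by (subst Bochner_Integration.integral_add[OF integrable_mult_right[OF i(1)] integrable_mult_right[OF i(2)]]) (simp only: integral_mult_right_zero)
  finally show ?thesis unfolding trunc_inv_def by (simp add: add_divide_distrib)
qed

lemma ennreal_double_add:
  "0 \<le> x \<Longrightarrow> 0 \<le> y \<Longrightarrow> 2 * ennreal x + 2 * ennreal y = ennreal (2 * x + 2 * y)"
  by (simp add: ennreal_mult)

lemma cmod_add_sq_ennreal:
  assumes "cmod z \<le> x + y" "0 \<le> x" "0 \<le> y"
  shows "ennreal ((cmod z)\<^sup>2) \<le> 2 * ennreal (x\<^sup>2) + 2 * ennreal (y\<^sup>2)"
proof -
  have "(cmod z)\<^sup>2 \<le> (x + y)\<^sup>2" using assms by (intro power_mono) auto
  also have "\<dots> \<le> 2 * x\<^sup>2 + 2 * y\<^sup>2" using sum_squares_bound[of x y] by (simp add: power2_sum)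
  finally have "ennreal ((cmod z)\<^sup>2) \<le> ennreal (2 * x\<^sup>2 + 2 * y\<^sup>2)" by (rule ennreal_leI)
  also have "\<dots> = 2 * ennreal (x\<^sup>2) + 2 * ennreal (y\<^sup>2)" by (simp add: ennreal_mult)
  finally show ?thesis .
qed

context levy_kernel
begin

text \<open>The explicit form of h_t in the coordinate y = x - \<gamma> \<Delta>. It has a definite
  value at y = 0, namely the one prescribed at the atom.\<close>

definition H :: "real \<Rightarrow> real \<Rightarrow> complex" where
  "H t y = \<i> * y * g_fun t y - complex_of_real (sgn t) * Qf (y - t)"

lemma H_measurable [measurable]: "H t \<in> borel_measurable borel"
  unfolding H_def[abs_def] by measurable

context
  fixes t :: real and gh :: "real \<Rightarrow> complex"
  assumes t: "t \<noteq> 0" and gh: "is_L2_fourier (g_fun t) gh"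
begin

lemma gh_measurable: "gh \<in> borel_measurable borel"
  using square_integrableD(1) is_L2_fourier_square_integrable(2)[OF gh] by blast

text \<open>Near 0 only square integrability of the transform is known, but m is bounded there. Away
  from 0 the bound 2 / (|t| |u|) turns the product into a multiple of w.\<close>

lemma m_gh_square_integrable: "square_integrable (\<lambda>u. m u * gh u)"
proof -
  note [measurable] = gh_measurable
  obtain B where B: "B \<ge> 1" "\<And>u. u \<in> {-1..1} \<Longrightarrow> cmod (m u) \<le> B" using m_bounded_unit by blast
  have g1: "square_integrable (\<lambda>u. complex_of_real (B * cmod (gh u)))"
    by (rule square_integrable_mono[OF is_L2_fourier_square_integrable(2)[OF gh], of _ B]) (use B in \<open>auto simp: norm_mult\<close>)
  have g2: "square_integrable (\<lambda>u. complex_of_real (4 / \<bar>t\<bar> * w u))"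
    by (rule square_integrable_le_w[of _ "4 / \<bar>t\<bar>"]) (use w_nonneg in \<open>auto simp: norm_mult norm_divide\<close>)
  show ?thesis
  proof (rule square_integrable_mono[OF square_integrable_add[OF g1 g2], of _ 1])
    show "AE u in lborel. cmod (m u * gh u) \<le> 1 * cmod (complex_of_real (B * cmod (gh u)) + complex_of_real (4 / \<bar>t\<bar> * w u))"
      using gh_bound[OF t gh]
    proof eventually_elim
      case (elim u)
      have p: "0 \<le> B * cmod (gh u)" "0 \<le> 4 / \<bar>t\<bar> * w u" using B w_nonneg[of u] by auto
      have "cmod (m u * gh u) \<le> B * cmod (gh u) + 4 / \<bar>t\<bar> * w u"
      proof (cases "\<bar>u\<bar> \<le> 1")
        case True
        have "cmod (m u * gh u) \<le> B * cmod (gh u)"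
          unfolding norm_mult using True by (intro mult_right_mono B(2)) auto
        with p show ?thesis by linarith
      next
        case False
        have "cmod (m u * gh u) \<le> cmod (m u) * (2 / (\<bar>t\<bar> * \<bar>u\<bar>))"
          unfolding norm_mult by (intro mult_left_mono elim) auto
        also have "\<dots> \<le> cmod (m u) * (2 / (\<bar>t\<bar> * ((1 + \<bar>u\<bar>) / 2)))"
          using False t by (intro mult_left_mono divide_left_mono mult_pos_pos) auto
        also have "\<dots> = 4 / \<bar>t\<bar> * (cmod (m u) / (1 + \<bar>u\<bar>))" by simp
        also have "\<dots> \<le> 4 / \<bar>t\<bar> * w u" by (intro mult_left_mono m_over_le) simp
        finally show ?thesis using p by linarith
      qed
      also have "\<dots> = cmod (complex_of_real (B * cmod (gh u) + 4 / \<bar>t\<bar> * w u))" using p by (simp only: norm_of_real abs_of_nonneg add_nonneg_nonneg)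
      finally show ?case by (simp only: of_real_add mult_1)
    qed
  qed measurable
qed

lemma m'_gh_le: "cmod (m' u * gh u) \<le> \<Delta> * C * cmod (complex_of_real (1 / (1 + \<bar>u\<bar>)) * (m u * gh u))"
proof -
  have "cmod (m' u * gh u) \<le> \<Delta> * C * (cmod (m u) / (1 + \<bar>u\<bar>)) * cmod (gh u)"
    unfolding norm_mult[of "m' u"] by (intro mult_right_mono m'_bound) simp
  also have "\<dots> = \<Delta> * C * cmod (complex_of_real (1 / (1 + \<bar>u\<bar>)) * (m u * gh u))"
    unfolding norm_mult norm_of_real by simp
  finally show ?thesis .
qed

lemma m'_gh_square_integrable: "square_integrable (\<lambda>u. m' u * gh u)"
proof (rule square_integrable_mono[OF m_gh_square_integrable, of _ "\<Delta> * C"])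
  note [measurable] = gh_measurable
  show "(\<lambda>u. m' u * gh u) \<in> borel_measurable borel" by measurable
  have "cmod (m' u * gh u) \<le> \<Delta> * C * cmod (m u * gh u)" for u
  proof (rule order_trans[OF m'_gh_le mult_left_mono])
    have "1 / (1 + \<bar>u\<bar>) * cmod (m u * gh u) \<le> 1 * cmod (m u * gh u)" by (intro mult_right_mono) auto
    then show "cmod (complex_of_real (1 / (1 + \<bar>u\<bar>)) * (m u * gh u)) \<le> cmod (m u * gh u)"
      unfolding norm_mult[of "complex_of_real (1 / (1 + \<bar>u\<bar>))"] norm_of_real by simp
  qed (use \<Delta> C in simp)
  then show "AE u in lborel. cmod (m' u * gh u) \<le> \<Delta> * C * cmod (m u * gh u)" by simp
qed

text \<open>The decay of m' contributes one more factor 1 / (1 + |u|), so the function is dominated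
  by a product of two square integrable ones. This gives the integral defining h_t at the atom a
  meaning.\<close>

lemma m'_gh_integrable: "integrable lborel (\<lambda>u. m' u * gh u)"
proof -
  note [measurable] = gh_measurable
  have "square_integrable (\<lambda>x. complex_of_real (1 / (1 + \<bar>x\<bar>)))"
    using integrable_one_plus_abs_inverse_sq unfolding square_integrable_def norm_of_real power2_abs by simp
  from L2_product_integrable(1)[OF this m_gh_square_integrable]
  have "integrable lborel (\<lambda>u. complex_of_real (\<Delta> * C) * (complex_of_real (1 / (1 + \<bar>u\<bar>)) * (m u * gh u)))"
    by (rule integrable_mult_right)
  then show ?thesis
  proof (rule Bochner_Integration.integrable_bound)
    show "AE u in lborel. norm (m' u * gh u) \<le> norm (complex_of_real (\<Delta> * C) * (complex_of_real (1 / (1 + \<bar>u\<bar>)) * (m u * gh u)))"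
      using m'_gh_le \<Delta> C unfolding norm_mult[of "complex_of_real (\<Delta> * C)"] norm_of_real by (simp add: abs_of_nonneg)
  qed measurable
qed

text \<open>Convergence almost everywhere of the truncated inverses of both parts, along one common
  subsequence, reduces the claim to an identity between truncated integrals, where splitting m as 1
  + (m - 1) separates g_t from the part handled by integration by parts.\<close>

theorem h_identification:
  assumes A: "is_L2_fourier A (\<lambda>u. iexp (u * c) * m u * gh u)"
    and B: "is_L2_fourier B (\<lambda>u. - (iexp (u * c) * (\<i> * c * m u + m' u)) * gh u)"
  shows "AE x in lborel. A x * (\<i> * x) + B x = H t (x - c)"
proof -
  note gsq = is_L2_fourier_square_integrable(2)[OF gh]
  \<comment> \<open>Three inversions hold along three subsequences. Each is extracted from the
    previous one and all of them from \<open>Uq\<close>, so the boundary terms still vanish along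
    the last.\<close>
  obtain r1 where r1: "strict_mono r1" "AE y in lborel. (\<lambda>k. trunc_inv (Uq (r1 k)) gh y) \<longlonglongrightarrow> g_fun t y"
    using is_L2_fourier_trunc_inv_AE[OF gh Uq_at_top] by blast
  have top1: "filterlim (\<lambda>k. Uq (r1 k)) at_top sequentially"
    by (rule filterlim_compose[OF Uq_at_top filterlim_subseq[OF r1(1)]])
  obtain r2 where r2: "strict_mono r2" "AE x in lborel. (\<lambda>k. trunc_inv (Uq (r1 (r2 k))) (\<lambda>u. iexp (u * c) * m u * gh u) x) \<longlonglongrightarrow> A x"
    using is_L2_fourier_trunc_inv_AE[OF A top1] by blast
  have top2: "filterlim (\<lambda>k. Uq (r1 (r2 k))) at_top sequentially"
    by (rule filterlim_compose[OF top1 filterlim_subseq[OF r2(1)]])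
  obtain r3 where r3: "strict_mono r3" "AE x in lborel. (\<lambda>k. trunc_inv (Uq (r1 (r2 (r3 k)))) (\<lambda>u. - (iexp (u * c) * (\<i> * c * m u + m' u)) * gh u) x) \<longlonglongrightarrow> B x"
    using is_L2_fourier_trunc_inv_AE[OF B top2] by blast
  define r where "r k = r1 (r2 (r3 k))" for k
  have rm: "strict_mono r" using r1(1) r2(1) r3(1) by (simp add: r_def strict_mono_def)
  have trA: "trunc_inv U (\<lambda>u. iexp (u * c) * m u * gh u) x = trunc_inv U gh (x - c) + trunc_inv U (\<lambda>u. (m u - 1) * gh u) (x - c)" for U x
  proof -
    have s: "square_integrable (\<lambda>u. (m u - 1) * gh u)"
      using square_integrable_diff[OF m_gh_square_integrable gsq] by (simp add: algebra_simps)
    have "trunc_inv U (\<lambda>u. iexp (u * c) * m u * gh u) x = trunc_inv U (\<lambda>u. m u * gh u) (x - c)"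
      unfolding mult.assoc by (rule trunc_inv_iexp_shift)
    also have "(\<lambda>u. m u * gh u) = (\<lambda>u. 1 * gh u + 1 * ((m u - 1) * gh u))" by (auto simp: algebra_simps)
    also have "trunc_inv U \<dots> (x - c) = 1 * trunc_inv U gh (x - c) + 1 * trunc_inv U (\<lambda>u. (m u - 1) * gh u) (x - c)"
      by (rule trunc_inv_add[OF gsq s])
    finally show ?thesis by simp
  qed
  \<comment> \<open>The drift part of the derivative is -i c times the first transform, so it
    cancels i c in i x = i (y + c) when the two contributions are added.\<close>
  have trB: "trunc_inv U (\<lambda>u. - (iexp (u * c) * (\<i> * c * m u + m' u)) * gh u) x =
     - \<i> * c * trunc_inv U (\<lambda>u. iexp (u * c) * m u * gh u) x - trunc_inv U (\<lambda>u. m' u * gh u) (x - c)" for U x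
  proof -
    have "(\<lambda>u. - (iexp (u * c) * (\<i> * c * m u + m' u)) * gh u) = (\<lambda>u. iexp (u * c) * ((- \<i> * c) * (m u * gh u) + (- 1) * (m' u * gh u)))"
      by (auto simp: algebra_simps)
    then have "trunc_inv U (\<lambda>u. - (iexp (u * c) * (\<i> * c * m u + m' u)) * gh u) x = trunc_inv U (\<lambda>u. (- \<i> * c) * (m u * gh u) + (- 1) * (m' u * gh u)) (x - c)"
      by (simp only: trunc_inv_iexp_shift)
    also have "\<dots> = (- \<i> * c) * trunc_inv U (\<lambda>u. m u * gh u) (x - c) + (- 1) * trunc_inv U (\<lambda>u. m' u * gh u) (x - c)"
      by (rule trunc_inv_add[OF m_gh_square_integrable m'_gh_square_integrable])
    also have "trunc_inv U (\<lambda>u. m u * gh u) (x - c) = trunc_inv U (\<lambda>u. iexp (u * c) * m u * gh u) x"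
      unfolding mult.assoc by (rule trunc_inv_iexp_shift[symmetric])
    finally show ?thesis by simp
  qed
  have "AE x in lborel. (\<lambda>k. trunc_inv (Uq (r1 k)) gh (x - c)) \<longlonglongrightarrow> g_fun t (x - c)"
    by (rule AE_lborel_shift[OF r1(2)])
  with r2(2) r3(2) AE_lborel_singleton[of "t + c"] show ?thesis
  proof eventually_elim
    case (elim x)
    define y where "y = x - c"
    have y: "y \<noteq> t" using elim(3) by (auto simp: y_def)
    have lA: "(\<lambda>k. trunc_inv (Uq (r k)) (\<lambda>u. iexp (u * c) * m u * gh u) x) \<longlonglongrightarrow> A x"
      using LIMSEQ_subseq_LIMSEQ[OF elim(1) r3(1)] by (simp add: comp_def r_def)
    have lB: "(\<lambda>k. trunc_inv (Uq (r k)) (\<lambda>u. - (iexp (u * c) * (\<i> * c * m u + m' u)) * gh u) x) \<longlonglongrightarrow> B x"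
      using elim(2) by (simp add: r_def)
    have lg: "(\<lambda>k. trunc_inv (Uq (r k)) gh y) \<longlonglongrightarrow> g_fun t y"
      using LIMSEQ_subseq_LIMSEQ[OF LIMSEQ_subseq_LIMSEQ[OF elim(4) r2(1)] r3(1)] by (simp add: comp_def r_def y_def)
    have lp: "(\<lambda>k. \<i> * y * trunc_inv (Uq (r k)) (\<lambda>u. (m u - 1) * gh u) y - trunc_inv (Uq (r k)) (\<lambda>u. m' u * gh u) y) \<longlonglongrightarrow> - complex_of_real (sgn t) * Qf (y - t)"
      using LIMSEQ_subseq_LIMSEQ[OF parts_tendsto[OF t gh y] rm] by (simp add: comp_def \<sigma>_def[OF t gh])
    have "(\<lambda>k. trunc_inv (Uq (r k)) (\<lambda>u. iexp (u * c) * m u * gh u) x * (\<i> * x) + trunc_inv (Uq (r k)) (\<lambda>u. - (iexp (u * c) * (\<i> * c * m u + m' u)) * gh u) x) \<longlonglongrightarrow> A x * (\<i> * x) + B x"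
      by (intro tendsto_add tendsto_mult tendsto_const lA lB)
    moreover have "trunc_inv U (\<lambda>u. iexp (u * c) * m u * gh u) x * (\<i> * x) + trunc_inv U (\<lambda>u. - (iexp (u * c) * (\<i> * c * m u + m' u)) * gh u) x =
      \<i> * y * trunc_inv U gh y + (\<i> * y * trunc_inv U (\<lambda>u. (m u - 1) * gh u) y - trunc_inv U (\<lambda>u. m' u * gh u) y)" for U
      unfolding trB unfolding trA y_def[symmetric] by (simp add: y_def algebra_simps)
    ultimately have "(\<lambda>k. \<i> * y * trunc_inv (Uq (r k)) gh y + (\<i> * y * trunc_inv (Uq (r k)) (\<lambda>u. (m u - 1) * gh u) y - trunc_inv (Uq (r k)) (\<lambda>u. m' u * gh u) y)) \<longlonglongrightarrow> A x * (\<i> * x) + B x"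
      by simp
    moreover have "(\<lambda>k. \<i> * y * trunc_inv (Uq (r k)) gh y + (\<i> * y * trunc_inv (Uq (r k)) (\<lambda>u. (m u - 1) * gh u) y - trunc_inv (Uq (r k)) (\<lambda>u. m' u * gh u) y)) \<longlonglongrightarrow> \<i> * y * g_fun t y + - complex_of_real (sgn t) * Qf (y - t)"
      by (intro tendsto_add[OF tendsto_mult[OF tendsto_const lg] lp])
    ultimately have "A x * (\<i> * x) + B x = \<i> * y * g_fun t y + - complex_of_real (sgn t) * Qf (y - t)"
      by (rule LIMSEQ_unique)
    then show ?case by (simp add: H_def y_def)
  qed
qed

text \<open>At y = 0 the first term of the combination disappears, and the truncated integrals of m'
  times the transform converge to the full integral. So the prescribed value is the limit of the
  integration by parts at that very point.\<close>

lemma h_atom: "1 / (2 * pi) * (\<integral>u. - m' u * gh u \<partial>lborel) = H t 0"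
proof -
  have "(\<lambda>k. trunc_inv (Uq k) (\<lambda>u. m' u * gh u) 0) \<longlonglongrightarrow> (\<integral>u. m' u * gh u \<partial>lborel) / (2 * pi)"
    unfolding trunc_inv_def using trunc_integral_tendsto[OF m'_gh_integrable] by (intro tendsto_divide tendsto_const) simp_all
  from tendsto_minus[OF this]
  have "(\<lambda>k. - trunc_inv (Uq k) (\<lambda>u. m' u * gh u) 0) \<longlonglongrightarrow> - ((\<integral>u. m' u * gh u \<partial>lborel) / (2 * pi))" .
  moreover have "(\<lambda>k. - trunc_inv (Uq k) (\<lambda>u. m' u * gh u) 0) \<longlonglongrightarrow> - complex_of_real (sgn t) * Qf (0 - t)"
    using parts_tendsto[OF t gh, of 0] t by (simp add: \<sigma>_def[OF t gh])
  ultimately have "- ((\<integral>u. m' u * gh u \<partial>lborel) / (2 * pi)) = - complex_of_real (sgn t) * Qf (0 - t)" by (rule LIMSEQ_unique)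
  then show ?thesis by (simp add: H_def)
qed

end

section \<open>Variance bounds for the explicit functions\<close>

lemma nn_integral_P_split:
  assumes [measurable]: "f \<in> borel_measurable borel" and r: "r > 0" and b: "b \<ge> 0" and c: "c \<ge> 0"
    and small: "\<And>y. \<bar>y\<bar> < r \<Longrightarrow> f y \<le> ennreal b" and L: "(\<integral>\<^sup>+y. f y \<partial>lborel) \<le> ennreal c"
  shows "(\<integral>\<^sup>+y. f y \<partial>P) \<le> ennreal (\<Delta> * K / r * c + b)"
proof -
  let ?S = "{y. r \<le> \<bar>y::real\<bar>}"
  have [measurable]: "?S \<in> sets borel" by measurable
  \<comment> \<open>Outside radius r the law is dominated by Lebesgue measure; inside, where nothing
    is known about its shape, the pointwise bound b is paid with total mass 1.\<close>
  have "(\<integral>\<^sup>+y. f y \<partial>P) \<le> (\<integral>\<^sup>+y. f y * indicator ?S y + ennreal b \<partial>P)"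
    using small by (intro nn_integral_mono) (auto simp: indicator_def not_le)
  also have "\<dots> = (\<integral>\<^sup>+y. f y * indicator ?S y \<partial>P) + ennreal b"
    using P.emeasure_space_1 by (subst nn_integral_add) auto
  also have "\<dots> \<le> ennreal (\<Delta> * K / r) * ennreal c + ennreal b"
    by (intro add_mono order_trans[OF nn_integral_P_le[OF _ _ r] mult_left_mono[OF L]]) auto
  also have "\<dots> = ennreal (\<Delta> * K / r * c + b)"
    using \<Delta> K r b c by (simp add: ennreal_mult[symmetric])
  finally show ?thesis .
qed

text \<open>The jump part is the indicator of |y| >= |t|, of probability at most the first absolute
  moment over |t|. For the part with Q both the bound on the law far out and the decay of Q near the
  origin supply at least a factor 1 / |t|.\<close>

lemma H_L2_decay:
  assumes z: "\<zeta> > 0"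
  shows "\<exists>A\<ge>0. \<forall>t. \<bar>t\<bar> \<ge> \<zeta> \<longrightarrow> (\<integral>\<^sup>+y. ennreal ((cmod (H t y))\<^sup>2) \<partial>P) \<le> ennreal (A / \<bar>t\<bar>)"
proof -
  define M1 where "M1 = (\<integral>y. \<bar>y\<bar> \<partial>P)"
  have M1: "0 \<le> M1" by (simp add: M1_def)
  define A where "A = 2 * M1 + 2 * (\<Delta> * K * 2 * I2 + 4 * I'\<^sup>2 / \<zeta>)"
  have A: "A \<ge> 0" unfolding A_def using M1 \<Delta> K I2_nonneg z by (intro add_nonneg_nonneg mult_nonneg_nonneg divide_nonneg_pos) auto
  have "(\<integral>\<^sup>+y. ennreal ((cmod (H t y))\<^sup>2) \<partial>P) \<le> ennreal (A / \<bar>t\<bar>)" if t: "\<bar>t\<bar> \<ge> \<zeta>" for t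
  proof -
    have t0: "t \<noteq> 0" "\<bar>t\<bar> > 0" using t z by auto
    let ?J = "\<lambda>y. indicator {y. \<bar>t\<bar> \<le> \<bar>y\<bar>} y :: real"
    have g: "cmod (\<i> * y * g_fun t y) \<le> ?J y" for y by (auto simp: g_fun_def indicator_def norm_mult norm_divide)
    have H: "cmod (H t y) \<le> ?J y + cmod (Qf (y - t))" for y
    proof -
      have "cmod (H t y) \<le> cmod (\<i> * y * g_fun t y) + cmod (complex_of_real (sgn t) * Qf (y - t))"
        unfolding H_def by (rule norm_triangle_ineq4)
      also have "cmod (complex_of_real (sgn t) * Qf (y - t)) = cmod (Qf (y - t))" using t0 by (simp add: norm_mult abs_sgn_eq)
      finally show ?thesis using g[of y] by linarith
    qed
    have I: "(\<integral>\<^sup>+y. ennreal ((?J y)\<^sup>2) \<partial>P) \<le> ennreal (M1 / \<bar>t\<bar>)"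
    proof -
      have "(\<integral>\<^sup>+y. ennreal ((?J y)\<^sup>2) \<partial>P) \<le> (\<integral>\<^sup>+y. ennreal (\<bar>y\<bar> / \<bar>t\<bar>) \<partial>P)"
        using t0 by (intro nn_integral_mono ennreal_leI) (auto simp: indicator_def)
      also have "\<dots> = ennreal (\<integral>y. \<bar>y\<bar> / \<bar>t\<bar> \<partial>P)"
        by (rule nn_integral_eq_integral) (use P_first_moment in auto)
      finally show ?thesis by (simp add: M1_def)
    qed
    \<comment> \<open>The radius |t| / 2 grows with t, so that the constant of the density bound
      decays like 1 / |t|, and inside this radius the distance of y to t is at least |t| /
      2.\<close>
    have Q: "(\<integral>\<^sup>+y. ennreal ((cmod (Qf (y - t)))\<^sup>2) \<partial>P) \<le> ennreal (\<Delta> * K / (\<bar>t\<bar> / 2) * I2 + (2 * I' / \<bar>t\<bar>)\<^sup>2)"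
    proof (rule nn_integral_P_split[OF _ _ _ I2_nonneg _ Qf_L2])
      fix y assume y: "\<bar>y\<bar> < \<bar>t\<bar> / 2"
      have "cmod (Qf (y - t)) \<le> I' / \<bar>y - t\<bar>" by (rule Qf_bound)
      also have "\<dots> \<le> I' / (\<bar>t\<bar> / 2)"
      proof (rule frac_le[OF I'_nonneg order_refl])
        show "\<bar>t\<bar> / 2 \<le> \<bar>y - t\<bar>" using y by arith
      qed (use t0 in simp)
      finally have "cmod (Qf (y - t)) \<le> 2 * I' / \<bar>t\<bar>" by (simp add: mult.commute)
      then show "ennreal ((cmod (Qf (y - t)))\<^sup>2) \<le> ennreal ((2 * I' / \<bar>t\<bar>)\<^sup>2)" by (intro ennreal_leI power_mono) auto
    qed (use t0 in auto)
    have "(\<integral>\<^sup>+y. ennreal ((cmod (H t y))\<^sup>2) \<partial>P) \<le> (\<integral>\<^sup>+y. 2 * ennreal ((?J y)\<^sup>2) + 2 * ennreal ((cmod (Qf (y - t)))\<^sup>2) \<partial>P)"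
      using H by (intro nn_integral_mono cmod_add_sq_ennreal) auto
    also have "\<dots> = 2 * (\<integral>\<^sup>+y. ennreal ((?J y)\<^sup>2) \<partial>P) + 2 * (\<integral>\<^sup>+y. ennreal ((cmod (Qf (y - t)))\<^sup>2) \<partial>P)"
      by (subst nn_integral_add) (auto simp: nn_integral_cmult)
    also have "\<dots> \<le> 2 * ennreal (M1 / \<bar>t\<bar>) + 2 * ennreal (\<Delta> * K / (\<bar>t\<bar> / 2) * I2 + (2 * I' / \<bar>t\<bar>)\<^sup>2)"
      by (intro add_mono mult_left_mono I Q) auto
    also have "\<dots> = ennreal (2 * (M1 / \<bar>t\<bar>) + 2 * (\<Delta> * K / (\<bar>t\<bar> / 2) * I2 + (2 * I' / \<bar>t\<bar>)\<^sup>2))"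
      by (rule ennreal_double_add) (use M1 \<Delta> K I2_nonneg in auto)
    also have "\<dots> \<le> ennreal (A / \<bar>t\<bar>)"
    proof (rule ennreal_leI)
      \<comment> \<open>One of the two factors 1 / |t| is given up through |t| >= \<zeta>.\<close>
      have "(2 * I' / \<bar>t\<bar>)\<^sup>2 = (4 * I'\<^sup>2 / \<bar>t\<bar>) / \<bar>t\<bar>" by (simp add: power_divide power_mult_distrib power2_eq_square)
      also have "\<dots> \<le> (4 * I'\<^sup>2 / \<zeta>) / \<bar>t\<bar>" using t z by (intro divide_right_mono divide_left_mono) auto
      finally have "2 * (M1 / \<bar>t\<bar>) + 2 * (\<Delta> * K / (\<bar>t\<bar> / 2) * I2 + (2 * I' / \<bar>t\<bar>)\<^sup>2) \<le>
        2 * (M1 / \<bar>t\<bar>) + 2 * (\<Delta> * K / (\<bar>t\<bar> / 2) * I2 + (4 * I'\<^sup>2 / \<zeta>) / \<bar>t\<bar>)" by simp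
      also have "\<dots> = A / \<bar>t\<bar>" by (simp add: A_def add_divide_distrib)
      finally show "2 * (M1 / \<bar>t\<bar>) + 2 * (\<Delta> * K / (\<bar>t\<bar> / 2) * I2 + (2 * I' / \<bar>t\<bar>)\<^sup>2) \<le> A / \<bar>t\<bar>" .
    qed
    finally show ?thesis .
  qed
  with A show ?thesis by blast
qed

text \<open>For t and s of equal sign the jump parts differ by the indicator of an interval which
  stays away from the origin, hence of probability of order |t - s|. With different signs the two
  indicators sit on opposite half-lines, which excludes such a bound.\<close>

lemma H_L2_holder:
  assumes z: "\<zeta> > 0"
  shows "\<exists>A\<ge>0. \<forall>t s. \<bar>t\<bar> \<ge> \<zeta> \<longrightarrow> \<bar>s\<bar> \<ge> \<zeta> \<longrightarrow> sgn t = sgn s \<longrightarrow> \<bar>t - s\<bar> \<le> 1 \<longrightarrow>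
     (\<integral>\<^sup>+y. ennreal ((cmod (H t y - H s y))\<^sup>2) \<partial>P) \<le> ennreal (A * \<bar>t - s\<bar> powr (2 * a))"
proof -
  \<comment> \<open>For |y| < \<zeta> / 2 the points y - t and y - s keep the distance \<zeta> / 2
    from the singularity of Q at 0.\<close>
  define d where "d = \<zeta> / 2"
  have d: "d > 0" using z by (simp add: d_def)
  define c0 where "c0 = (2 / d + 1 / d\<^sup>2) * I'"
  have c0: "0 \<le> c0" unfolding c0_def using d I'_nonneg by (intro mult_nonneg_nonneg add_nonneg_nonneg) auto
  define A where "A = 2 * (\<Delta> * K / \<zeta>) + 2 * (\<Delta> * K / d * (4 * I2) + c0\<^sup>2)"
  have A: "A \<ge> 0" unfolding A_def using \<Delta> K I2_nonneg z d by (intro add_nonneg_nonneg mult_nonneg_nonneg) auto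
  have "(\<integral>\<^sup>+y. ennreal ((cmod (H t y - H s y))\<^sup>2) \<partial>P) \<le> ennreal (A * \<bar>t - s\<bar> powr (2 * a))"
    if ts: "\<bar>t\<bar> \<ge> \<zeta>" "\<bar>s\<bar> \<ge> \<zeta>" "sgn t = sgn s" "\<bar>t - s\<bar> \<le> 1" for t s
  proof -
    define x where "x = \<bar>t - s\<bar> powr (2 * a)"
    have x0: "0 \<le> x" by (simp add: x_def)
    have tx: "\<bar>t - s\<bar> \<le> x"
    proof (cases "t = s")
      case False
      then have "\<bar>t - s\<bar> powr 1 \<le> x" unfolding x_def using a ts(4) by (intro powr_mono') auto
      then show ?thesis by simp
    qed (simp add: x_def)
    have same: "(t > 0 \<and> s > 0) \<or> (t < 0 \<and> s < 0)" using ts z by (auto simp: sgn_if split: if_splits)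
    let ?J = "{min t s..max t s}"
    have g: "cmod (\<i> * y * g_fun t y - \<i> * y * g_fun s y) \<le> indicator ?J y" for y
    proof (cases "t > 0")
      case True
      then have "s > 0" using same by auto
      with True show ?thesis by (auto simp: g_fun_def indicator_def)
    next
      case False
      then have "t < 0" "s < 0" using same by auto
      then show ?thesis by (auto simp: g_fun_def indicator_def)
    qed
    have H: "cmod (H t y - H s y) \<le> indicator ?J y + cmod (Qf (y - t) - Qf (y - s))" for y
    proof -
      have "H t y - H s y = (\<i> * y * g_fun t y - \<i> * y * g_fun s y) - complex_of_real (sgn s) * (Qf (y - t) - Qf (y - s))"
        unfolding H_def ts(3) by (simp add: algebra_simps)
      then have "cmod (H t y - H s y) \<le> cmod (\<i> * y * g_fun t y - \<i> * y * g_fun s y) + cmod (complex_of_real (sgn s) * (Qf (y - t) - Qf (y - s)))"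
        by (simp only: norm_triangle_ineq4)
      also have "cmod (complex_of_real (sgn s) * (Qf (y - t) - Qf (y - s))) = cmod (Qf (y - t) - Qf (y - s))"
        using same by (auto simp: norm_mult)
      finally show ?thesis using g[of y] by linarith
    qed
    have I: "(\<integral>\<^sup>+y. ennreal ((indicator ?J y :: real)\<^sup>2) \<partial>P) \<le> ennreal (\<Delta> * K / \<zeta> * x)"
    proof -
      have "(\<integral>\<^sup>+y. ennreal ((indicator ?J y :: real)\<^sup>2) \<partial>P) = (\<integral>\<^sup>+y. indicator ?J y * indicator ?J y \<partial>P)"
        by (rule nn_integral_cong) (auto simp: indicator_def)
      also have "\<dots> \<le> ennreal (\<Delta> * K / \<zeta>) * (\<integral>\<^sup>+y. indicator ?J y \<partial>lborel)"
        by (rule nn_integral_P_le[OF _ _ z]) (use same ts in auto)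
      also have "\<dots> = ennreal (\<Delta> * K / \<zeta>) * ennreal \<bar>t - s\<bar>" by (auto simp: emeasure_lborel_Icc_eq max_def min_def abs_if)
      also have "\<dots> \<le> ennreal (\<Delta> * K / \<zeta>) * ennreal x" by (intro mult_left_mono ennreal_leI tx) simp
      also have "\<dots> = ennreal (\<Delta> * K / \<zeta> * x)" by (rule ennreal_mult[symmetric]) (use \<Delta> K z x0 in auto)
      finally show ?thesis .
    qed
    have Q: "(\<integral>\<^sup>+y. ennreal ((cmod (Qf (y - t) - Qf (y - s)))\<^sup>2) \<partial>P) \<le> ennreal (\<Delta> * K / d * (4 * x * I2) + (c0\<^sup>2 * x))"
    proof (rule nn_integral_P_split[OF _ d])
      show "(\<integral>\<^sup>+y. ennreal ((cmod (Qf (y - t) - Qf (y - s)))\<^sup>2) \<partial>lborel) \<le> ennreal (4 * x * I2)"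
        unfolding x_def by (rule Qf_diff_L2)
      fix y assume y: "\<bar>y\<bar> < d"
      have "cmod (Qf (y - t) - Qf (y - s)) \<le> (2 / d + 1 / d\<^sup>2) * I' * \<bar>(y - t) - (y - s)\<bar> powr a"
        by (rule Qf_holder[OF d]) (use y ts in \<open>auto simp: d_def abs_if split: if_splits\<close>)
      also have "\<dots> = c0 * \<bar>t - s\<bar> powr a" by (simp add: c0_def abs_minus_commute)
      finally have "(cmod (Qf (y - t) - Qf (y - s)))\<^sup>2 \<le> (c0 * \<bar>t - s\<bar> powr a)\<^sup>2" by (rule power_mono) simp
      also have "\<dots> = c0\<^sup>2 * x" unfolding x_def power_mult_distrib by (simp add: power2_eq_square flip: powr_add)
      finally show "ennreal ((cmod (Qf (y - t) - Qf (y - s)))\<^sup>2) \<le> ennreal (c0\<^sup>2 * x)" by (rule ennreal_leI)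
    qed (use x0 I2_nonneg in auto)
    have "(\<integral>\<^sup>+y. ennreal ((cmod (H t y - H s y))\<^sup>2) \<partial>P) \<le> (\<integral>\<^sup>+y. 2 * ennreal ((indicator ?J y :: real)\<^sup>2) + 2 * ennreal ((cmod (Qf (y - t) - Qf (y - s)))\<^sup>2) \<partial>P)"
      using H by (intro nn_integral_mono cmod_add_sq_ennreal) auto
    also have "\<dots> = 2 * (\<integral>\<^sup>+y. ennreal ((indicator ?J y :: real)\<^sup>2) \<partial>P) + 2 * (\<integral>\<^sup>+y. ennreal ((cmod (Qf (y - t) - Qf (y - s)))\<^sup>2) \<partial>P)"
      by (subst nn_integral_add) (auto simp: nn_integral_cmult)
    also have "\<dots> \<le> 2 * ennreal (\<Delta> * K / \<zeta> * x) + 2 * ennreal (\<Delta> * K / d * (4 * x * I2) + (c0\<^sup>2 * x))"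
      by (intro add_mono mult_left_mono I Q) auto
    also have "\<dots> = ennreal (2 * (\<Delta> * K / \<zeta> * x) + 2 * (\<Delta> * K / d * (4 * x * I2) + (c0\<^sup>2 * x)))"
      by (rule ennreal_double_add) (use \<Delta> K I2_nonneg x0 z d in auto)
    also have "2 * (\<Delta> * K / \<zeta> * x) + 2 * (\<Delta> * K / d * (4 * x * I2) + (c0\<^sup>2 * x)) = A * x"
      by (simp add: A_def algebra_simps)
    finally show ?thesis by (simp only: x_def)
  qed
  with A show ?thesis by blast
qed

end

section \<open>The variance of the increments\<close>

text \<open>On [0, X] a larger exponent may be lowered to a at the price of X to the difference of
  exponents, hence of X itself while this difference is at most 1. All exponents below are brought
  to the common value a in this way.\<close>

lemma le_powr_exponent:
  fixes x :: real
  assumes "0 \<le> x" "x \<le> X" "1 \<le> X" "a \<le> e" "e \<le> a + 1" "0 < a"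
  shows "x powr e \<le> X * x powr a"
proof (cases "x = 0")
  case False
  then have "x powr (e - a) \<le> X powr (e - a)" using assms by (intro powr_mono2) auto
  also have "\<dots> \<le> X powr 1" using assms by (intro powr_mono) auto
  finally have "x powr (e - a) * x powr a \<le> X * x powr a" using assms by (intro mult_right_mono) auto
  then show ?thesis by (simp flip: powr_add)
qed simp

text \<open>Near infinity the bound by \<open>1 / \<tau>\<close> beats the Hoelder bound: with \<open>x = 1 / \<tau> - 1 / \<sigma>\<close>
  the two are balanced at \<open>1 / \<tau> = x\<^sup>a\<close>.\<close>
lemma powr_inverse_difference_bound:
  fixes \<tau> \<sigma> :: real
  assumes \<tau>: "0 < \<tau>" "\<tau> \<le> \<sigma>" and a: "0 < a" "a \<le> 1 / 4" and A: "0 \<le> A" "0 \<le> B"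
    and near: "D \<le> B * (\<sigma> - \<tau>) powr (2 * a)" and far: "D \<le> A / \<tau>"
    and X: "1 / \<tau> - 1 / \<sigma> \<le> X" "1 \<le> X"
  shows "D \<le> 2 * (A + B) * X * (1 / \<tau> - 1 / \<sigma>) powr a"
proof -
  define x where "x = 1 / \<tau> - 1 / \<sigma>"
  have x0: "0 \<le> x" unfolding x_def using \<tau> by (simp add: frac_le)
  have pw: "x powr e \<le> X * x powr a" if "a \<le> e" "e \<le> a + 1" for e
    using le_powr_exponent[of x X a e] x0 X a(1) that unfolding x_def by blast
  have X1: "x powr a \<le> X * x powr a" using X(2) by (simp add: mult_le_cancel_right1)
  have st: "\<sigma> - \<tau> = x * (\<tau> * \<sigma>)" unfolding x_def using \<tau> by (simp add: field_simps)
  have T: "2 * A * (X * x powr a) \<ge> 0" "2 * B * (X * x powr a) \<ge> 0" using A X by auto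
  have eq: "2 * (A + B) * X * x powr a = 2 * A * (X * x powr a) + 2 * B * (X * x powr a)" by (simp add: algebra_simps)
  \<comment> \<open>If \<sigma> >= 2 \<tau>, then 1 / \<tau> is at most 2 x and the far bound
    suffices; it also suffices if 1 / \<tau> is at most x^a. In the remaining case \<tau> and
    \<sigma> are comparable and not too large, and the Hoelder bound is used.\<close>
  consider (big) "2 * \<tau> \<le> \<sigma>" | (mid) "1 / \<tau> \<le> x powr a" | (small) "\<sigma> < 2 * \<tau>" "x powr a < 1 / \<tau>" by linarith
  then have "D \<le> 2 * (A + B) * X * x powr a"
  proof cases
    case big
    have "1 / \<sigma> \<le> 1 / (2 * \<tau>)" using big \<tau> by (intro divide_left_mono) auto
    then have "1 / \<tau> \<le> 2 * x" unfolding x_def by simp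
    then have "A * (1 / \<tau>) \<le> A * (2 * x)" by (rule mult_left_mono[OF _ A(1)])
    also have "\<dots> = 2 * A * x powr 1" using x0 by simp
    also have "\<dots> \<le> 2 * A * (X * x powr a)" using A a by (intro mult_left_mono pw) auto
    finally show ?thesis using far T eq by simp
  next
    case mid
    have "A * (1 / \<tau>) \<le> A * (X * x powr a)" using mid X1 A by (intro mult_left_mono) auto
    also have "\<dots> \<le> 2 * A * (X * x powr a)" using T(1) by simp
    finally show ?thesis using far T eq by simp
  next
    case small
    show ?thesis
    proof (cases "x = 0")
      case True
      then show ?thesis using near st by simp
    next
      case False
      then have xp: "x > 0" using x0 by simp
      \<comment> \<open>Here \<tau> is below x^(-a) and \<sigma> below twice that, so \<sigma> -
        \<tau> = x \<tau> \<sigma> is at most 2 x^(1 - 2a).\<close>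
      have "\<tau> * x powr a < 1" using small(2) \<tau> by (simp add: field_simps)
      then have "\<tau> < x powr (- a)" using xp by (simp add: powr_minus field_simps)
      then have "\<tau> * \<sigma> \<le> x powr (- a) * (2 * x powr (- a))" using small \<tau> by (intro mult_mono) auto
      also have "\<dots> = 2 * x powr (- (2 * a))" by (simp flip: powr_add)
      finally have "\<sigma> - \<tau> \<le> x * (2 * x powr (- (2 * a)))" unfolding st using xp by (intro mult_left_mono) auto
      also have "\<dots> = 2 * (x powr 1 * x powr (- (2 * a)))" using xp by simp
      also have "\<dots> = 2 * x powr (1 - 2 * a)" unfolding powr_add[symmetric] by simp
      finally have "(\<sigma> - \<tau>) powr (2 * a) \<le> (2 * x powr (1 - 2 * a)) powr (2 * a)"
        using a \<tau> by (intro powr_mono2) auto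
      also have "\<dots> = 2 powr (2 * a) * x powr ((1 - 2 * a) * (2 * a))" by (simp add: powr_mult powr_powr)
      also have "\<dots> \<le> 2 powr 1 * (X * x powr a)"
      proof (intro mult_mono pw powr_mono)
        \<comment> \<open>The place where a <= 1/4 is used: it makes 2 (1 - 2a) at least 1.\<close>
        have "a * 1 \<le> a * (2 * (1 - 2 * a))" using a by (intro mult_left_mono) auto
        then show "a \<le> (1 - 2 * a) * (2 * a)" by (simp add: algebra_simps)
        have "(1 - 2 * a) * (2 * a) \<le> 1 * (2 * a)" using a by (intro mult_right_mono) auto
        then show "(1 - 2 * a) * (2 * a) \<le> a + 1" using a by linarith
      qed (use a in auto)
      finally have "B * (\<sigma> - \<tau>) powr (2 * a) \<le> B * (2 * (X * x powr a))" using A by (intro mult_left_mono) auto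
      then show ?thesis using near T eq by simp
    qed
  qed
  then show ?thesis by (simp add: x_def)
qed

text \<open>With opposite signs |1/t - 1/s| is the sum of the two reciprocals, so the far bound is
  already a modulus. With equal signs and distance above 1 the far bound is a constant and is
  absorbed in the Hoelder constant, which leaves the balancing argument. The induction is the
  reduction to |t| <= |s|.\<close>

lemma inverse_modulus_bound:
  fixes t s :: real
  assumes z: "0 < \<zeta>" and ts: "\<zeta> \<le> \<bar>t\<bar>" "\<zeta> \<le> \<bar>s\<bar>" and a: "0 < a" "a \<le> 1 / 4" and A: "0 \<le> A" "0 \<le> B"
    and near: "sgn t = sgn s \<Longrightarrow> \<bar>t - s\<bar> \<le> 1 \<Longrightarrow> D \<le> B * \<bar>t - s\<bar> powr (2 * a)"
    and far: "D \<le> A * (1 / \<bar>t\<bar> + 1 / \<bar>s\<bar>)"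
  defines "X \<equiv> 1 + 2 / \<zeta>"
  shows "D \<le> 2 * (2 * A + (B + A * X)) * X * \<bar>1 / t - 1 / s\<bar> powr a"
  using ts near far
proof (induction "\<bar>t\<bar>" "\<bar>s\<bar>" arbitrary: t s rule: linorder_wlog)
  case sym
  then show ?case by (simp add: abs_minus_commute add.commute)
next
  case le
  have X: "1 \<le> X" "0 \<le> X" using z by (auto simp: X_def)
  have t0: "0 < \<bar>t\<bar>" "0 < \<bar>s\<bar>" using le z by auto
  have iz: "1 / \<bar>t\<bar> \<le> 1 / \<zeta>" "1 / \<bar>s\<bar> \<le> 1 / \<zeta>" using le z by (auto intro!: divide_left_mono)
  then have sX: "1 / \<bar>t\<bar> + 1 / \<bar>s\<bar> \<le> X" unfolding X_def by (simp add: field_simps)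
  show ?case
  proof (cases "sgn t = sgn s")
    case True
    have ab: "\<bar>t - s\<bar> = \<bar>s\<bar> - \<bar>t\<bar>" "\<bar>1 / t - 1 / s\<bar> = 1 / \<bar>t\<bar> - 1 / \<bar>s\<bar>"
      using True le t0 by (auto simp: sgn_if abs_if field_simps split: if_splits)
    have "D \<le> (B + A * X) * \<bar>t - s\<bar> powr (2 * a)"
    proof (cases "\<bar>t - s\<bar> \<le> 1")
      case s1: True
      have "D \<le> B * \<bar>t - s\<bar> powr (2 * a)" using le True s1 by blast
      also have "\<dots> \<le> (B + A * X) * \<bar>t - s\<bar> powr (2 * a)" using A X by (intro mult_right_mono) auto
      finally show ?thesis .
    next
      case False
      have "D \<le> A * X" using le(5) mult_left_mono[OF sX A(1)] by linarith
      also have "\<dots> \<le> (B + A * X) * 1" using A by simp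
      also have "\<dots> \<le> (B + A * X) * \<bar>t - s\<bar> powr (2 * a)"
        using False a A X by (intro mult_left_mono ge_one_powr_ge_zero) auto
      finally show ?thesis .
    qed
    moreover have "D \<le> 2 * A / \<bar>t\<bar>"
    proof -
      have "1 / \<bar>s\<bar> \<le> 1 / \<bar>t\<bar>" using le t0 by (intro divide_left_mono) auto
      then have "A * (1 / \<bar>t\<bar> + 1 / \<bar>s\<bar>) \<le> A * (2 / \<bar>t\<bar>)" using A by (intro mult_left_mono) auto
      then show ?thesis using le(5) by simp
    qed
    moreover have "1 / \<bar>t\<bar> - 1 / \<bar>s\<bar> \<le> X" using sX t0 by (smt (verit) divide_pos_pos)
    ultimately show ?thesis
      using powr_inverse_difference_bound[of "\<bar>t\<bar>" "\<bar>s\<bar>" a "2 * A" "B + A * X" D X] le(1) t0 a A X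
      unfolding ab by simp
  next
    case False
    have ab: "\<bar>1 / t - 1 / s\<bar> = 1 / \<bar>t\<bar> + 1 / \<bar>s\<bar>" using False t0 by (auto simp: sgn_if abs_if field_simps split: if_splits)
    define x where "x = \<bar>1 / t - 1 / s\<bar>"
    have x: "0 \<le> x" "x \<le> X" using sX unfolding x_def ab by auto
    have "D \<le> A * x powr 1" using le(5) x unfolding ab[symmetric] x_def[symmetric] by simp
    also have "\<dots> \<le> A * (X * x powr a)" using x X a A by (intro mult_left_mono le_powr_exponent) auto
    also have "\<dots> \<le> 2 * (2 * A + (B + A * X)) * (X * x powr a)" using A X by (intro mult_right_mono) auto
    finally show ?thesis by (simp add: x_def mult.assoc)
  qed
qed

text \<open>The chart sends the positive half of the index set onto (1/2, 1] and the negative half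
  onto [0, 1/2); the missing point 1/2 stands for both infinities, where the process
  vanishes.\<close>

lemma inj_on_reciprocal_chart: "inj_on (\<lambda>t. (1 + \<zeta> / t) / 2) {t. \<bar>t\<bar> \<ge> \<zeta>}" if "\<zeta> > 0" for \<zeta> :: real
  using that by (auto simp: inj_on_def)

lemma reciprocal_chart_range: "(\<lambda>t. (1 + \<zeta> / t) / 2) ` {t. \<bar>t\<bar> \<ge> \<zeta>} \<subseteq> {0..1}" if "\<zeta> > 0" for \<zeta> :: real
proof (intro image_subsetI)
  fix t :: real assume "t \<in> {t. \<bar>t\<bar> \<ge> \<zeta>}"
  then have "\<bar>\<zeta> / t\<bar> \<le> 1" using that by (simp add: abs_divide divide_le_eq)
  then have "- 1 \<le> \<zeta> / t" "\<zeta> / t \<le> 1" by linarith+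
  then show "(1 + \<zeta> / t) / 2 \<in> {0..1}" by simp
qed

lemma reciprocal_chart_onto: "{0..1} - {1 / 2} \<subseteq> (\<lambda>t. (1 + \<zeta> / t) / 2) ` {t. \<bar>t\<bar> \<ge> \<zeta>}" if "\<zeta> > 0" for \<zeta> :: real
proof
  fix x :: real assume x: "x \<in> {0..1} - {1 / 2}"
  let ?t = "\<zeta> / (2 * x - 1)"
  have 0: "0 < \<bar>2 * x - 1\<bar>" "\<bar>2 * x - 1\<bar> \<le> 1" using x by (auto simp: abs_if)
  have "\<zeta> / 1 \<le> \<zeta> / \<bar>2 * x - 1\<bar>" using 0 that by (intro divide_left_mono) auto
  then have "?t \<in> {t. \<bar>t\<bar> \<ge> \<zeta>}" using that by (simp add: abs_divide)
  moreover have "(1 + \<zeta> / ?t) / 2 = x" using that 0 by simp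
  ultimately show "x \<in> (\<lambda>t. (1 + \<zeta> / t) / 2) ` {t. \<bar>t\<bar> \<ge> \<zeta>}" by (metis (no_types, lifting) imageI)
qed

lemma integral_le_of_nn_integral_le:
  fixes f :: "'b \<Rightarrow> real"
  assumes [measurable]: "f \<in> borel_measurable M" and "\<And>x. 0 \<le> f x" "0 \<le> c" "(\<integral>\<^sup>+x. ennreal (f x) \<partial>M) \<le> ennreal c"
  shows "integrable M f" "(\<integral>x. f x \<partial>M) \<le> c"
proof -
  have "(\<integral>\<^sup>+x. ennreal (f x) \<partial>M) < \<infinity>" using assms(4) by (auto intro: le_less_trans)
  then show "integrable M f" using assms(2) by (intro integrableI_nonneg) auto
  show "(\<integral>x. f x \<partial>M) \<le> c" using assms by (subst integral_eq_nn_integral) (auto intro: enn2real_leI)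
qed

context levy_kernel
begin

text \<open>The two regimes, decay in 1 / |t| and Hoelder continuity for nearby indices of equal
  sign, are merged into one modulus in the coordinate 1 / t. Taking 0 as the reciprocal of infinity,
  the bound on the variance is the same modulus against the added point.\<close>

lemma H_L2_modulus:
  assumes z: "\<zeta> > 0"
  shows "\<exists>A\<ge>0. (\<forall>t. \<bar>t\<bar> \<ge> \<zeta> \<longrightarrow> integrable P (\<lambda>y. (cmod (H t y))\<^sup>2) \<and> (\<integral>y. (cmod (H t y))\<^sup>2 \<partial>P) \<le> A * \<bar>1 / t\<bar> powr a) \<and>
     (\<forall>t s. \<bar>t\<bar> \<ge> \<zeta> \<longrightarrow> \<bar>s\<bar> \<ge> \<zeta> \<longrightarrow> (\<integral>y. (cmod (H t y - H s y))\<^sup>2 \<partial>P) \<le> A * \<bar>1 / t - 1 / s\<bar> powr a)"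
proof -
  obtain A where A: "A \<ge> 0" "\<And>t. \<bar>t\<bar> \<ge> \<zeta> \<Longrightarrow> (\<integral>\<^sup>+y. ennreal ((cmod (H t y))\<^sup>2) \<partial>P) \<le> ennreal (A / \<bar>t\<bar>)"
    using H_L2_decay[OF z] by blast
  obtain B where B: "B \<ge> 0" "\<And>t s. \<bar>t\<bar> \<ge> \<zeta> \<Longrightarrow> \<bar>s\<bar> \<ge> \<zeta> \<Longrightarrow> sgn t = sgn s \<Longrightarrow> \<bar>t - s\<bar> \<le> 1 \<Longrightarrow>
     (\<integral>\<^sup>+y. ennreal ((cmod (H t y - H s y))\<^sup>2) \<partial>P) \<le> ennreal (B * \<bar>t - s\<bar> powr (2 * a))"
    using H_L2_holder[OF z] by blast
  note i = integral_le_of_nn_integral_le[of "\<lambda>y. (cmod (H t y))\<^sup>2" P "A / \<bar>t\<bar>" for t]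
  define X where "X = 1 + 2 / \<zeta>"
  have X: "1 \<le> X" using z by (simp add: X_def)
  \<comment> \<open>The constant of \<open>inverse_modulus_bound\<close> with A doubled, since the
    square of a difference costs a factor 2.\<close>
  define E where "E = 2 * (2 * (2 * A) + (B + 2 * A * X)) * X"
  have E: "A * X \<le> E" "0 \<le> E"
  proof -
    have "0 \<le> A * X" "0 \<le> B * X" "0 \<le> A * X * X" using A B X by auto
    moreover have "E = 8 * (A * X) + 2 * (B * X) + 4 * (A * X * X)" by (simp add: E_def algebra_simps)
    ultimately show "A * X \<le> E" "0 \<le> E" by linarith+
  qed
  have 1: "integrable P (\<lambda>y. (cmod (H t y))\<^sup>2) \<and> (\<integral>y. (cmod (H t y))\<^sup>2 \<partial>P) \<le> E * \<bar>1 / t\<bar> powr a" if t: "\<bar>t\<bar> \<ge> \<zeta>" for t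
  proof
    show "integrable P (\<lambda>y. (cmod (H t y))\<^sup>2)" using A t by (intro i) auto
    have "1 / \<bar>t\<bar> \<le> 1 / \<zeta>" using t z by (intro divide_left_mono) auto
    also have "\<dots> \<le> X" using z by (simp add: X_def field_simps)
    finally have tX: "\<bar>1 / t\<bar> \<le> X" by simp
    have "(\<integral>y. (cmod (H t y))\<^sup>2 \<partial>P) \<le> A / \<bar>t\<bar>" using A t by (intro i) auto
    also have "\<dots> = A * \<bar>1 / t\<bar> powr 1" using t z by simp
    also have "\<dots> \<le> A * (X * \<bar>1 / t\<bar> powr a)" using tX X a A by (intro mult_left_mono le_powr_exponent) auto
    also have "\<dots> \<le> E * \<bar>1 / t\<bar> powr a" unfolding mult.assoc[symmetric] using E by (intro mult_right_mono) auto
    finally show "(\<integral>y. (cmod (H t y))\<^sup>2 \<partial>P) \<le> E * \<bar>1 / t\<bar> powr a" .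
  qed
  have 2: "(\<integral>y. (cmod (H t y - H s y))\<^sup>2 \<partial>P) \<le> E * \<bar>1 / t - 1 / s\<bar> powr a" if t: "\<bar>t\<bar> \<ge> \<zeta>" and s: "\<bar>s\<bar> \<ge> \<zeta>" for t s
    unfolding E_def X_def
  proof (rule inverse_modulus_bound[OF z t s a])
    assume "sgn t = sgn s" "\<bar>t - s\<bar> \<le> 1"
    then show "(\<integral>y. (cmod (H t y - H s y))\<^sup>2 \<partial>P) \<le> B * \<bar>t - s\<bar> powr (2 * a)"
      using B t s by (intro integral_le_of_nn_integral_le(2)) auto
  next
    have "(\<integral>\<^sup>+y. ennreal ((cmod (H t y - H s y))\<^sup>2) \<partial>P) \<le> (\<integral>\<^sup>+y. 2 * ennreal ((cmod (H t y))\<^sup>2) + 2 * ennreal ((cmod (H s y))\<^sup>2) \<partial>P)"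
      by (intro nn_integral_mono cmod_add_sq_ennreal norm_triangle_ineq4) auto
    also have "\<dots> = 2 * (\<integral>\<^sup>+y. ennreal ((cmod (H t y))\<^sup>2) \<partial>P) + 2 * (\<integral>\<^sup>+y. ennreal ((cmod (H s y))\<^sup>2) \<partial>P)"
      by (subst nn_integral_add) (auto simp: nn_integral_cmult)
    also have "\<dots> \<le> 2 * ennreal (A / \<bar>t\<bar>) + 2 * ennreal (A / \<bar>s\<bar>)" by (intro add_mono mult_left_mono A t s) auto
    also have "\<dots> = ennreal (2 * (A / \<bar>t\<bar>) + 2 * (A / \<bar>s\<bar>))" by (rule ennreal_double_add) (use A in auto)
    also have "2 * (A / \<bar>t\<bar>) + 2 * (A / \<bar>s\<bar>) = 2 * A * (1 / \<bar>t\<bar> + 1 / \<bar>s\<bar>)" by (simp add: algebra_simps)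
    finally show "(\<integral>y. (cmod (H t y - H s y))\<^sup>2 \<partial>P) \<le> 2 * A * (1 / \<bar>t\<bar> + 1 / \<bar>s\<bar>)"
      using A by (intro integral_le_of_nn_integral_le(2)) auto
  qed (use A B in auto)
  show ?thesis using E(2) 1 2 by blast
qed

end

text \<open>The covariance is bilinear in h, without conjugation, so expanding the square of the
  increment gives k times the integral of (h_s - h_t)^2. This complex number is real and is bounded
  by its modulus, which brings in the L2 norm.\<close>

lemma gaussian_increment_le:
  fixes h :: "'i \<Rightarrow> 'c \<Rightarrow> complex"
  assumes G: "centered_gaussian_process M T G" and T: "s \<in> T" "t \<in> T"
    and m: "\<And>t. t \<in> T \<Longrightarrow> h t \<in> borel_measurable P" and L2: "\<And>t. t \<in> T \<Longrightarrow> integrable P (\<lambda>y. (cmod (h t y))\<^sup>2)"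
    and cov: "\<And>t s. t \<in> T \<Longrightarrow> s \<in> T \<Longrightarrow> complex_of_real (\<integral>\<omega>. G t \<omega> * G s \<omega> \<partial>M) = k * (\<integral>y. h t y * h s y \<partial>P)"
  shows "(\<integral>\<omega>. (G s \<omega> - G t \<omega>)\<^sup>2 \<partial>M) \<le> cmod k * (\<integral>y. (cmod (h s y - h t y))\<^sup>2 \<partial>P)"
    and "(\<integral>\<omega>. (G t \<omega>)\<^sup>2 \<partial>M) \<le> cmod k * (\<integral>y. (cmod (h t y))\<^sup>2 \<partial>P)"
proof -
  have Gm: "G t \<in> borel_measurable M" if "t \<in> T" for t using G that by (simp add: centered_gaussian_process_def)
  have sq: "integrable M (\<lambda>\<omega>. (G t \<omega>)\<^sup>2)" if "t \<in> T" for t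
    using centered_gaussian_process_moment(1)[OF G, of "{t}" 1 "\<lambda>_. 1"] that by simp
  have pr: "integrable M (\<lambda>\<omega>. G t \<omega> * G s \<omega>)" if "t \<in> T" "s \<in> T" for t s
  proof (rule Bochner_Integration.integrable_bound[OF Bochner_Integration.integrable_add[OF sq[OF that(1)] sq[OF that(2)]]])
    show "(\<lambda>\<omega>. G t \<omega> * G s \<omega>) \<in> borel_measurable M" using Gm that by measurable
    have "norm (G t x * G s x) \<le> norm ((G t x)\<^sup>2 + (G s x)\<^sup>2)" for x
    proof -
      have "2 * (\<bar>G t x\<bar> * \<bar>G s x\<bar>) \<le> (G t x)\<^sup>2 + (G s x)\<^sup>2" using sum_squares_bound[of "\<bar>G t x\<bar>" "\<bar>G s x\<bar>"] by simp
      moreover have "0 \<le> \<bar>G t x\<bar> * \<bar>G s x\<bar>" by simp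
      ultimately show ?thesis unfolding real_norm_def abs_mult by linarith
    qed
    then show "AE x in M. norm (G t x * G s x) \<le> norm ((G t x)\<^sup>2 + (G s x)\<^sup>2)" by simp
  qed
  have ph: "integrable P (\<lambda>y. h t y * h s y)" if "t \<in> T" "s \<in> T" for t s
    by (rule Cauchy_Schwarz_integral(1)) (use m L2 that in auto)
  have bd: "x \<le> cmod k * (\<integral>y. (cmod (f y))\<^sup>2 \<partial>P)" if "complex_of_real x = k * (\<integral>y. f y * f y \<partial>P)" for x f
  proof -
    have "x \<le> cmod (complex_of_real x)" by simp
    also have "\<dots> = cmod k * cmod (\<integral>y. f y * f y \<partial>P)" unfolding that by (rule norm_mult)
    also have "cmod (\<integral>y. f y * f y \<partial>P) \<le> (\<integral>y. cmod (f y * f y) \<partial>P)" by (rule integral_norm_bound)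
    finally show ?thesis by (simp add: norm_mult power2_eq_square mult_left_mono)
  qed
  have "(\<integral>\<omega>. (G s \<omega> - G t \<omega>)\<^sup>2 \<partial>M) = (\<integral>\<omega>. (G s \<omega> * G s \<omega> + G t \<omega> * G t \<omega>) - (G s \<omega> * G t \<omega> + G t \<omega> * G s \<omega>) \<partial>M)"
    by (rule Bochner_Integration.integral_cong) (auto simp: power2_eq_square algebra_simps)
  also have "\<dots> = ((\<integral>\<omega>. G s \<omega> * G s \<omega> \<partial>M) + (\<integral>\<omega>. G t \<omega> * G t \<omega> \<partial>M)) - ((\<integral>\<omega>. G s \<omega> * G t \<omega> \<partial>M) + (\<integral>\<omega>. G t \<omega> * G s \<omega> \<partial>M))"
    using pr T by (simp add: Bochner_Integration.integral_diff Bochner_Integration.integral_add mult.commute)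
  finally have eq: "(\<integral>\<omega>. (G s \<omega> - G t \<omega>)\<^sup>2 \<partial>M) =
     ((\<integral>\<omega>. G s \<omega> * G s \<omega> \<partial>M) + (\<integral>\<omega>. G t \<omega> * G t \<omega> \<partial>M)) - ((\<integral>\<omega>. G s \<omega> * G t \<omega> \<partial>M) + (\<integral>\<omega>. G t \<omega> * G s \<omega> \<partial>M))" .
  have "complex_of_real (\<integral>\<omega>. (G s \<omega> - G t \<omega>)\<^sup>2 \<partial>M) =
     k * (((\<integral>y. h s y * h s y \<partial>P) + (\<integral>y. h t y * h t y \<partial>P)) - ((\<integral>y. h s y * h t y \<partial>P) + (\<integral>y. h t y * h s y \<partial>P)))"
    unfolding eq of_real_diff of_real_add by (simp only: cov T ring_distribs)
  also have "((\<integral>y. h s y * h s y \<partial>P) + (\<integral>y. h t y * h t y \<partial>P)) - ((\<integral>y. h s y * h t y \<partial>P) + (\<integral>y. h t y * h s y \<partial>P)) =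
     (\<integral>y. (h s y * h s y + h t y * h t y) - (h s y * h t y + h t y * h s y) \<partial>P)"
    using ph T by (simp add: Bochner_Integration.integral_diff Bochner_Integration.integral_add mult.commute)
  also have "\<dots> = (\<integral>y. (h s y - h t y) * (h s y - h t y) \<partial>P)"
    by (rule Bochner_Integration.integral_cong) (auto simp: algebra_simps)
  finally show "(\<integral>\<omega>. (G s \<omega> - G t \<omega>)\<^sup>2 \<partial>M) \<le> cmod k * (\<integral>y. (cmod (h s y - h t y))\<^sup>2 \<partial>P)" by (rule bd)
  show "(\<integral>\<omega>. (G t \<omega>)\<^sup>2 \<partial>M) \<le> cmod k * (\<integral>y. (cmod (h t y))\<^sup>2 \<partial>P)"
    using cov[OF T(2) T(2)] by (intro bd) (simp add: power2_eq_square)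
qed

section \<open>Return to the law with drift\<close>

context levy_kernel
begin

lemma m_reflected_deriv: "((\<lambda>v. m (- v)) has_vector_derivative - m' u) (at (- u))"
proof -
  have "((\<lambda>v. - v) has_vector_derivative - 1) (at (- u))" by (auto intro!: derivative_eq_intros)
  from vector_diff_chain_at[OF this, of m "m' u"] m_deriv[of u] show ?thesis by (simp add: o_def)
qed

lemma char_shift_eq: "char (distr P borel (\<lambda>y. y + c)) u = iexp (u * c) * char P u"
proof -
  have "char (distr P borel (\<lambda>y. y + c)) u = (\<integral>y. iexp (u * (y + c)) \<partial>P)"
    unfolding char_def by (rule integral_distr) auto
  also have "\<dots> = (\<integral>y. iexp (u * c) * iexp (u * y) \<partial>P)"
    by (rule Bochner_Integration.integral_cong) (auto simp: exp_add[symmetric] algebra_simps)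
  finally show ?thesis unfolding char_def by simp
qed

context
  fixes P' :: "real measure" and c :: real
  assumes P': "P' = distr P borel (\<lambda>y. y + c)"
begin

lemma inv_char_eq: "inv_char P' u = iexp (- (u * c)) * m (- u)"
  by (simp add: inv_char_def P' char_shift_eq m_eq exp_minus)

lemma cderiv_inv_char: "cderiv (inv_char P') (- u) = - (iexp (u * c) * (\<i> * c * m u + m' u))"
proof -
  have 2: "((\<lambda>v. iexp (- (v * c))) has_vector_derivative - (\<i> * c) * iexp (u * c)) (at (- u))"
  proof -
    have "((\<lambda>v. - (v * c)) has_vector_derivative - c) (at (- u))"
      by (auto intro!: derivative_eq_intros simp: has_real_derivative_iff_has_vector_derivative[symmetric])
    from vector_diff_chain_at[OF this has_vector_derivative_iexp] show ?thesis
      by (simp add: comp_def scaleR_conv_of_real mult_ac)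
  qed
  have "((\<lambda>v. iexp (- (v * c)) * m (- v)) has_vector_derivative iexp (u * c) * (- m' u) + (- (\<i> * c) * iexp (u * c)) * m u) (at (- u))"
    using has_vector_derivative_mult[OF 2 m_reflected_deriv] by simp
  then show ?thesis
    unfolding cderiv_def inv_char_eq[abs_def] by (subst vector_derivative_at) (auto simp: algebra_simps)
qed

lemma cderiv_inv_char_shift: "cderiv (inv_char_shift P' c) (- u) = - m' u"
proof -
  have "inv_char_shift P' c = (\<lambda>v. m (- v))"
  proof
    fix v
    have "iexp (- c * v) * iexp (v * c) = 1" unfolding exp_add[symmetric] by (simp add: mult.commute)
    then show "inv_char_shift P' c v = m (- v)"
      unfolding inv_char_shift_def P' char_shift_eq m_eq mult.assoc[symmetric] by simp
  qed
  then show ?thesis unfolding cderiv_def by (simp add: vector_derivative_at m_reflected_deriv)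
qed

text \<open>The identity almost everywhere for Lebesgue measure passes to the law off the atom
  position c. At c the value is the prescribed one when nu is finite, and when nu is infinite the
  law has no mass there.\<close>

lemma
  assumes t: "t \<noteq> 0" and c: "c = \<gamma> * \<Delta>" and nu0: "emeasure \<nu> {0} = 0"
  shows h_fun_measurable: "h_fun P' \<Delta> \<gamma> \<nu> t \<in> borel_measurable borel"
    and h_fun_AE: "AE x in P'. h_fun P' \<Delta> \<gamma> \<nu> t x = H t (x - c)"
proof -
  define gh where "gh = L2_fourier (g_fun t)"
  have gh: "is_L2_fourier (g_fun t) gh" unfolding gh_def by (rule L2_fourier[OF g_fun_square_integrable[OF t]])
  define A where "A = L2_fourier_inv (\<lambda>u. inv_char P' (- u) * gh u)"
  define B where "B = L2_fourier_inv (\<lambda>u. cderiv (inv_char P') (- u) * gh u)"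
  have ge: "(\<lambda>u. inv_char P' (- u) * gh u) = (\<lambda>u. iexp (u * c) * m u * gh u)" by (rule ext) (simp add: inv_char_eq)
  have de: "(\<lambda>u. cderiv (inv_char P') (- u) * gh u) = (\<lambda>u. - (iexp (u * c) * (\<i> * c * m u + m' u)) * gh u)"
    by (rule ext) (simp add: cderiv_inv_char)
  have mi: "(\<lambda>u. iexp (u * c)) \<in> borel_measurable borel" by measurable
  note sm = m_gh_square_integrable[OF t gh] m'_gh_square_integrable[OF t gh]
  note ms = square_integrableD(1)[OF sm(1)] square_integrableD(1)[OF sm(2)]
  have s1: "square_integrable (\<lambda>u. iexp (u * c) * m u * gh u)"
    by (rule square_integrable_mono[OF sm(1), of _ 1])
      (use borel_measurable_times[OF mi ms(1)] in \<open>auto simp: norm_mult mult.assoc\<close>)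
  have s2: "square_integrable (\<lambda>u. - (iexp (u * c) * (\<i> * c * m u + m' u)) * gh u)"
  proof -
    have s3: "square_integrable (\<lambda>u. iexp (u * c) * (m' u * gh u))"
      by (rule square_integrable_mono[OF sm(2), of _ 1])
        (use borel_measurable_times[OF mi ms(2)] in \<open>auto simp: norm_mult\<close>)
    have eq: "(\<lambda>u. - (iexp (u * c) * (\<i> * c * m u + m' u)) * gh u) =
      (\<lambda>u. (- \<i> * c) * (iexp (u * c) * m u * gh u) - iexp (u * c) * (m' u * gh u))"
      by (rule ext) (simp add: algebra_simps)
    show ?thesis unfolding eq by (rule square_integrable_diff[OF square_integrable_cmult[OF s1] s3])
  qed
  have A: "is_L2_fourier A (\<lambda>u. iexp (u * c) * m u * gh u)" unfolding A_def ge by (rule L2_fourier_inv[OF s1])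
  have B: "is_L2_fourier B (\<lambda>u. - (iexp (u * c) * (\<i> * c * m u + m' u)) * gh u)" unfolding B_def de by (rule L2_fourier_inv[OF s2])
  have [measurable]: "A \<in> borel_measurable borel" "B \<in> borel_measurable borel"
    using square_integrableD(1)[OF is_L2_fourier_square_integrable(1)[OF A]] square_integrableD(1)[OF is_L2_fourier_square_integrable(1)[OF B]] .
  have h: "h_fun P' \<Delta> \<gamma> \<nu> t x = (if emeasure \<nu> UNIV < \<infinity> \<and> x = c then H t 0 else A x * (\<i> * x) + B x)" for x
    unfolding h_fun_def gh_def[symmetric] A_def[symmetric] B_def[symmetric] c[symmetric] cderiv_inv_char_shift
    by (simp only: h_atom[OF t gh])
  show hm: "h_fun P' \<Delta> \<gamma> \<nu> t \<in> borel_measurable borel" unfolding h[abs_def] by measurable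
  have "AE x in lborel. A (x - - c) * (\<i> * (x - - c)) + B (x - - c) = H t (x - - c - c)"
    by (rule AE_lborel_shift[OF h_identification[OF t gh A B]])
  then have ae1: "AE y in P. y \<noteq> 0 \<longrightarrow> A (y - - c) * (\<i> * (y - - c)) + B (y - - c) = H t (y - - c - c)"
    by (rule AE_P_of_AE_lborel)
  \<comment> \<open>The point 0 has to be considered only for finite nu: for infinite nu it has
    probability 0.\<close>
  have ae2: "AE y in P. y = 0 \<longrightarrow> emeasure \<nu> UNIV < \<infinity>"
  proof (cases "emeasure \<nu> UNIV < \<infinity>")
    case False
    then have "emeasure \<nu> UNIV = \<infinity>" by (simp add: not_less top_unique)
    from no_atom[OF nu0 this] have "emeasure P {0} = 0" by (simp add: P.emeasure_eq_measure)
    then have "{0} \<in> null_sets P" by (auto intro!: null_setsI)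
    from AE_not_in[OF this] show ?thesis by eventually_elim auto
  qed simp
  have pt: "h_fun P' \<Delta> \<gamma> \<nu> t (y + c) = H t (y + c - c)"
    if 1: "y \<noteq> 0 \<longrightarrow> A (y - - c) * (\<i> * (y - - c)) + B (y - - c) = H t (y - - c - c)"
      and 2: "y = 0 \<longrightarrow> emeasure \<nu> UNIV < \<infinity>" for y
  proof (cases "y = 0")
    case True
    then have "emeasure \<nu> UNIV < \<infinity>" using 2 by blast
    then show ?thesis using True h[of c] by simp
  next
    case False
    have e: "y - - c = y + c" by simp
    from False have "h_fun P' \<Delta> \<gamma> \<nu> t (y + c) = A (y + c) * (\<i> * (y + c)) + B (y + c)" using h[of "y + c"] by simp
    also have "\<dots> = H t (y + c - c)" using 1 False unfolding e by blast
    finally show ?thesis .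
  qed
  have AE: "AE y in P. h_fun P' \<Delta> \<gamma> \<nu> t (y + c) = H t (y + c - c)"
    by (rule eventually_mono[OF eventually_conj[OF ae1 ae2]]) (blast intro: pt)
  have "(\<lambda>x. H t (x - c)) \<in> borel_measurable borel" by measurable
  from measurable_equality_set[OF hm this]
  have "{x \<in> space borel. h_fun P' \<Delta> \<gamma> \<nu> t x = H t (x - c)} \<in> sets borel" .
  from AE_distr_iff[of "\<lambda>y. y + c" P, OF _ this] AE
  have "AE x in distr P borel (\<lambda>y. y + c). h_fun P' \<Delta> \<gamma> \<nu> t x = H t (x - c)" by simp
  then show "AE x in P'. h_fun P' \<Delta> \<gamma> \<nu> t x = H t (x - c)" unfolding P'[symmetric] .
qed

lemma Sigma_cov_eq:
  assumes ts: "t \<noteq> 0" "s \<noteq> 0" and c: "c = \<gamma> * \<Delta>" and nu0: "emeasure \<nu> {0} = 0"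
  shows "Sigma_cov P' \<Delta> \<gamma> \<nu> t s = inverse ((\<i> * \<Delta>)\<^sup>2) * (\<integral>y. H t y * H s y \<partial>P)"
proof -
  note [measurable] = h_fun_measurable[OF ts(1) c nu0] h_fun_measurable[OF ts(2) c nu0]
  have [measurable_cong]: "sets P' = sets borel" by (simp add: P')
  have "(\<integral>x. h_fun P' \<Delta> \<gamma> \<nu> t x * h_fun P' \<Delta> \<gamma> \<nu> s x \<partial>P') = (\<integral>x. H t (x - c) * H s (x - c) \<partial>P')"
  proof (rule integral_cong_AE)
    show "AE x in P'. h_fun P' \<Delta> \<gamma> \<nu> t x * h_fun P' \<Delta> \<gamma> \<nu> s x = H t (x - c) * H s (x - c)"
      using h_fun_AE[OF ts(1) c nu0] h_fun_AE[OF ts(2) c nu0] by eventually_elim simp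
  qed measurable
  also have "\<dots> = (\<integral>y. H t (y + c - c) * H s (y + c - c) \<partial>P)"
    unfolding P' by (rule integral_distr) measurable
  finally show ?thesis by (simp add: Sigma_cov_def)
qed

end

end

section \<open>From the hypotheses to the conclusion\<close>

lemma levy_kernel_shifted_law:
  assumes levy: "levy_process \<Omega> L" and Delta: "\<Delta> > 0" and P: "P = distr \<Omega> borel (L \<Delta>)"
    and nu: "levy_measure_fv \<nu>"
    and exponent: "\<And>u. char P u = exp (\<Delta> * levy_exponent \<gamma> \<nu> u)"
    and eps: "\<epsilon> > 0"
    and a: "integrable \<nu> (\<lambda>x. max \<bar>x\<bar> (\<bar>x\<bar> powr (2 + \<epsilon>)))"
    and b1: "\<exists>k. xnu_density \<nu> k \<and> bounded (range k)"
    and b2: "\<exists>C. \<forall>u. cmod (fourier_xnu \<nu> u) \<le> C * (1 + \<bar>u\<bar>) powr (- 1)"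
    and c: "square_integrable (\<lambda>u. (1 + \<bar>u\<bar>) powr (- 1 + \<epsilon>) * inv_char P u)"
  shows "\<exists>K C. levy_kernel (distr P borel (\<lambda>x. x - \<gamma> * \<Delta>)) \<nu> \<Delta> K C (min \<epsilon> (1 / 4))"
proof -
  let ?P = "distr P borel (\<lambda>x. x - \<gamma> * \<Delta>)"
  have sets [measurable_cong]: "sets \<nu> = sets borel" using nu by (simp add: levy_measure_fv_def)
  interpret P: real_distribution P
    unfolding P using levy Delta by (intro prob_space.real_distribution_distr) (auto simp: levy_process_def)
  interpret P0: real_distribution ?P by (rule P.real_distribution_distr) simp
  obtain k where k: "xnu_density \<nu> k" "bounded (range k)" using b1 by blast
  obtain K where K: "\<And>x. \<bar>k x\<bar> \<le> K" using k(2) by (auto simp: bounded_iff)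
  obtain C where C: "\<And>u. cmod (fourier_xnu \<nu> u) \<le> C * (1 + \<bar>u\<bar>) powr (- 1)" using b2 by blast
  have K0: "K \<ge> 0" using K[of 0] by linarith
  have C0: "C \<ge> 0" using order_trans[OF norm_ge_zero C[of 0]] by simp
  have ch: "char ?P u = iexp (- (u * (\<gamma> * \<Delta>))) * char P u" for u
  proof -
    have "char ?P u = (\<integral>x. iexp (u * (x - \<gamma> * \<Delta>)) \<partial>P)" unfolding char_def by (rule integral_distr) auto
    also have "\<dots> = (\<integral>x. iexp (- (u * (\<gamma> * \<Delta>))) * iexp (u * x) \<partial>P)"
      by (rule Bochner_Integration.integral_cong) (auto simp: exp_add[symmetric] algebra_simps)
    finally show ?thesis unfolding char_def by simp
  qed
  \<comment> \<open>The bound on the density is raised by 1 because the locale asks for a positive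
    constant and the density may vanish. Lowering \<epsilon> to at most 1/4 weakens condition (c),
    so it is preserved.\<close>
  have "levy_kernel ?P \<nu> \<Delta> (K + 1) C (min \<epsilon> (1 / 4))"
  proof (intro levy_kernel.intro levy_char.intro levy_kernel_axioms.intro)
    show "real_distribution ?P" by (rule P0.real_distribution_axioms)
    show "integrable \<nu> (\<lambda>x. \<bar>x\<bar>)" by (rule Bochner_Integration.integrable_bound[OF a]) auto
    show "integrable \<nu> (\<lambda>x. x\<^sup>2)"
    proof (rule Bochner_Integration.integrable_bound[OF a])
      have "x\<^sup>2 \<le> max \<bar>x\<bar> (\<bar>x\<bar> powr (2 + \<epsilon>))" for x :: real
      proof (cases "\<bar>x\<bar> \<le> 1")
        case True
        have "x\<^sup>2 = \<bar>x\<bar> * \<bar>x\<bar>" by (simp add: power2_eq_square flip: abs_mult)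
        also have "\<dots> \<le> \<bar>x\<bar> * 1" using True by (intro mult_left_mono) auto
        finally show ?thesis by simp
      next
        case False
        have "x\<^sup>2 = \<bar>x\<bar> powr 2" using False by simp
        also have "\<dots> \<le> \<bar>x\<bar> powr (2 + \<epsilon>)" using False eps by (intro powr_mono) auto
        finally show ?thesis by simp
      qed
      then show "AE x in \<nu>. norm (x\<^sup>2) \<le> norm (max \<bar>x\<bar> (\<bar>x\<bar> powr (2 + \<epsilon>)))"
        by (intro AE_I2) (simp add: order_trans[OF _ abs_ge_self])
    qed measurable
    show "char ?P u = exp (\<Delta> * (\<integral>x. (iexp (u * x) - 1) \<partial>\<nu>))" for u
      unfolding ch exponent levy_exponent_def exp_add[symmetric] by (simp add: algebra_simps)
    show "\<bar>\<integral>x\<in>A. x \<partial>\<nu>\<bar> \<le> (K + 1) * measure lborel A" if A: "A \<in> sets borel" "emeasure lborel A < \<infinity>" for A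
    proof -
      have [measurable]: "A \<in> sets borel" by (rule A)
      have ki: "integrable lborel k" using k(1) by (simp add: xnu_density_def)
      have iA: "integrable lborel (\<lambda>x. indicator A x * K)" using A by (intro integrable_mult_left) (auto simp: integrable_indicator_iff)
      have kA: "integrable lborel (\<lambda>x. indicator A x * k x)"
      proof (rule Bochner_Integration.integrable_bound[OF ki])
        have [measurable]: "k \<in> borel_measurable borel" using borel_measurable_integrable[OF ki] by simp
        show "(\<lambda>x. indicator A x * k x) \<in> borel_measurable lborel" by measurable
      qed (auto simp: indicator_def)
      have "(\<integral>x\<in>A. x \<partial>\<nu>) = (\<integral>x. indicator A x * k x \<partial>lborel)"
        using k(1) A(1) by (simp add: xnu_density_def set_lebesgue_integral_def)
      also have "\<bar>\<dots>\<bar> \<le> (\<integral>x. \<bar>indicator A x * k x\<bar> \<partial>lborel)" by (rule integral_abs_bound)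
      also have "\<dots> \<le> (\<integral>x. indicator A x * K \<partial>lborel)"
        using kA iA K by (intro integral_mono) (auto simp: indicator_def)
      also have "\<dots> = K * measure lborel A" by simp
      also have "\<dots> \<le> (K + 1) * measure lborel A" by (intro mult_right_mono) auto
      finally show ?thesis .
    qed
    show "cmod (fourier_xnu \<nu> u) \<le> C / (1 + \<bar>u\<bar>)" for u
      using C[of u] by (simp add: powr_minus_divide)
    show "integrable lborel (\<lambda>u. ((1 + \<bar>u\<bar>) powr (min \<epsilon> (1 / 4) - 1) * cmod (inverse (char ?P u)))\<^sup>2)"
    proof (rule Bochner_Integration.integrable_bound[OF square_integrableD(2)[OF c]])
      show "(\<lambda>u. ((1 + \<bar>u\<bar>) powr (min \<epsilon> (1 / 4) - 1) * cmod (inverse (char ?P u)))\<^sup>2) \<in> borel_measurable lborel"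
        by measurable
      have "((1 + \<bar>u\<bar>) powr (min \<epsilon> (1 / 4) - 1) * cmod (inverse (char ?P u)))\<^sup>2 \<le> (cmod ((1 + \<bar>u\<bar>) powr (- 1 + \<epsilon>) * inv_char P u))\<^sup>2" for u
      proof (rule power_mono)
        have "cmod (inverse (char ?P u)) = cmod (inv_char P u)"
          by (simp add: ch inv_char_def norm_mult norm_inverse)
        moreover have "(1 + \<bar>u\<bar>) powr (min \<epsilon> (1 / 4) - 1) \<le> (1 + \<bar>u\<bar>) powr (- 1 + \<epsilon>)" by (intro powr_mono) auto
        ultimately show "(1 + \<bar>u\<bar>) powr (min \<epsilon> (1 / 4) - 1) * cmod (inverse (char ?P u)) \<le> cmod ((1 + \<bar>u\<bar>) powr (- 1 + \<epsilon>) * inv_char P u)"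
          by (simp add: norm_mult mult_right_mono)
      qed simp
      then show "AE u in lborel. norm (((1 + \<bar>u\<bar>) powr (min \<epsilon> (1 / 4) - 1) * cmod (inverse (char ?P u)))\<^sup>2) \<le> norm ((cmod ((1 + \<bar>u\<bar>) powr (- 1 + \<epsilon>) * inv_char P u))\<^sup>2)"
        by simp
    qed
  qed (use Delta sets K0 C0 eps in auto)
  then show ?thesis by blast
qed

theorem theorem9:
  fixes \<Omega> :: "'a measure" and L :: "real \<Rightarrow> 'a \<Rightarrow> real"
    and P \<nu> :: "real measure" and \<Delta> \<gamma> \<epsilon> \<zeta> :: real
    and M :: "'b measure" and G :: "real \<Rightarrow> 'b \<Rightarrow> real" and T :: "real set"
  assumes levy: "levy_process \<Omega> L"
    and Delta: "\<Delta> > 0"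
    and P: "P = distr \<Omega> borel (L \<Delta>)"
    and nu: "levy_measure_fv \<nu>"
    and exponent: "\<And>u. char P u = exp (\<Delta> * levy_exponent \<gamma> \<nu> u)"
    and eps: "\<epsilon> > 0"
    and a: "integrable \<nu> (\<lambda>x. max \<bar>x\<bar> (\<bar>x\<bar> powr (2 + \<epsilon>)))"
    and b1: "\<exists>k. xnu_density \<nu> k \<and> bounded (range k)"
    and b2: "\<exists>C. \<forall>u. cmod (fourier_xnu \<nu> u) \<le> C * (1 + \<bar>u\<bar>) powr (- 1)"
    and c: "square_integrable (\<lambda>u. (1 + \<bar>u\<bar>) powr (- 1 + \<epsilon>) * inv_char P u)"
    and zeta: "\<zeta> > 0"
    and T: "T = {t. \<bar>t\<bar> \<ge> \<zeta>}"
    and gauss: "centered_gaussian_process M T G"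
    and cov: "\<And>t s. t \<in> T \<Longrightarrow> s \<in> T \<Longrightarrow>
      complex_of_real (\<integral>\<omega>. G t \<omega> * G s \<omega> \<partial>M) = Sigma_cov P \<Delta> \<gamma> \<nu> t s"
  shows "\<exists>G'. version_of M T G G' \<and>
    (AE \<omega> in M. unif_cont_wrt (intrinsic_dist M G') T (\<lambda>t. G' t \<omega>)) \<and>
    (AE \<omega> in M. (SUP t\<in>T. ereal \<bar>G' t \<omega>\<bar>) < \<infinity>)"
proof -
  note law = P
  define P0 where "P0 = distr P borel (\<lambda>x. x - \<gamma> * \<Delta>)"
  obtain K C where "levy_kernel P0 \<nu> \<Delta> K C (min \<epsilon> (1 / 4))"
    using levy_kernel_shifted_law[OF levy Delta P nu exponent eps a b1 b2 c] unfolding P0_def by blast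
  then interpret levy_kernel P0 \<nu> \<Delta> K C "min \<epsilon> (1 / 4)" .
  let ?a = "min \<epsilon> (1 / 4)"
  have P': "P = distr P0 borel (\<lambda>y. y + \<gamma> * \<Delta>)"
  proof -
    have [measurable_cong]: "sets P = sets borel" by (simp add: law)
    have "distr P0 borel (\<lambda>y. y + \<gamma> * \<Delta>) = distr P borel (\<lambda>x. x)"
      unfolding P0_def by (subst distr_distr) (auto simp: o_def)
    also have "\<dots> = P" by (rule distr_id2) (simp add: law)
    finally show ?thesis by simp
  qed
  have nu0: "emeasure \<nu> {0} = 0" using nu by (simp add: levy_measure_fv_def)
  have T0: "t \<noteq> 0" "\<bar>t\<bar> \<ge> \<zeta>" if "t \<in> T" for t using that zeta by (auto simp: T)
  obtain A where A: "A \<ge> 0" "\<And>t. t \<in> T \<Longrightarrow> integrable P0 (\<lambda>y. (cmod (H t y))\<^sup>2)"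
     "\<And>t. t \<in> T \<Longrightarrow> (\<integral>y. (cmod (H t y))\<^sup>2 \<partial>P0) \<le> A * \<bar>1 / t\<bar> powr ?a"
     "\<And>t s. t \<in> T \<Longrightarrow> s \<in> T \<Longrightarrow> (\<integral>y. (cmod (H t y - H s y))\<^sup>2 \<partial>P0) \<le> A * \<bar>1 / t - 1 / s\<bar> powr ?a"
    using H_L2_modulus[OF zeta] unfolding T by blast
  let ?k = "inverse ((\<i> * complex_of_real \<Delta>)\<^sup>2)"
  note inc = gaussian_increment_le[OF gauss, of _ _ H P0 ?k]
  have Hm: "H t \<in> borel_measurable P0" for t by measurable
  have cv: "complex_of_real (\<integral>\<omega>. G t \<omega> * G s \<omega> \<partial>M) = ?k * (\<integral>y. H t y * H s y \<partial>P0)" if "t \<in> T" "s \<in> T" for t s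
    unfolding cov[OF that] by (rule Sigma_cov_eq[OF P' T0(1)[OF that(1)] T0(1)[OF that(2)] refl nu0])
  let ?\<phi> = "\<lambda>t. (1 + \<zeta> / t) / 2"
  \<comment> \<open>The chart differs from 1 / t by the factor \<zeta> / 2 and a constant; the power
    of 2 / \<zeta> undoes this factor in the modulus.\<close>
  define B where "B = cmod ?k * A * (2 / \<zeta>) powr ?a"
  have scale: "cmod ?k * (A * x powr ?a) = B * (\<zeta> / 2 * x) powr ?a" if "0 \<le> x" for x
  proof -
    have "(2 / \<zeta>) powr ?a * (\<zeta> / 2 * x) powr ?a = (2 / \<zeta> * (\<zeta> / 2 * x)) powr ?a"
      using zeta that by (subst powr_mult) auto
    also have "2 / \<zeta> * (\<zeta> / 2 * x) = x" using zeta by simp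
    finally show ?thesis by (simp add: B_def mult.assoc)
  qed
  show ?thesis
  proof (rule gaussian_process_continuous_version[OF gauss, of ?\<phi> "1 / 2" ?a B])
    show "inj_on ?\<phi> T" unfolding T by (rule inj_on_reciprocal_chart[OF zeta])
    show "?\<phi> ` T \<subseteq> {0..1}" unfolding T by (rule reciprocal_chart_range[OF zeta])
    show "{0..1} - {1 / 2} \<subseteq> ?\<phi> ` T" unfolding T by (rule reciprocal_chart_onto[OF zeta])
    show "?a > 0" using eps by simp
    show "B \<ge> 0" using A(1) by (simp add: B_def)
  next
    fix s t assume st: "s \<in> T" "t \<in> T"
    have "(\<integral>\<omega>. (G s \<omega> - G t \<omega>)\<^sup>2 \<partial>M) \<le> cmod ?k * (\<integral>y. (cmod (H s y - H t y))\<^sup>2 \<partial>P0)"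
      by (rule inc(1)[OF st Hm A(2) cv])
    also have "\<dots> \<le> cmod ?k * (A * \<bar>1 / s - 1 / t\<bar> powr ?a)" by (rule mult_left_mono[OF A(4)[OF st] norm_ge_zero])
    also have "\<dots> = B * (\<zeta> / 2 * \<bar>1 / s - 1 / t\<bar>) powr ?a" by (rule scale) simp
    also have "\<zeta> / 2 * \<bar>1 / s - 1 / t\<bar> = \<bar>\<zeta> / 2 * (1 / s - 1 / t)\<bar>" using zeta by (simp add: abs_mult)
    also have "\<zeta> / 2 * (1 / s - 1 / t) = ?\<phi> s - ?\<phi> t" by (simp add: field_simps)
    finally show "(\<integral>\<omega>. (G s \<omega> - G t \<omega>)\<^sup>2 \<partial>M) \<le> B * \<bar>?\<phi> s - ?\<phi> t\<bar> powr ?a" .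
  next
    fix t assume t: "t \<in> T"
    have "(\<integral>\<omega>. (G t \<omega>)\<^sup>2 \<partial>M) \<le> cmod ?k * (\<integral>y. (cmod (H t y))\<^sup>2 \<partial>P0)"
      by (rule inc(2)[OF t t Hm A(2) cv])
    also have "\<dots> \<le> cmod ?k * (A * \<bar>1 / t\<bar> powr ?a)" by (rule mult_left_mono[OF A(3)[OF t] norm_ge_zero])
    also have "\<dots> = B * (\<zeta> / 2 * \<bar>1 / t\<bar>) powr ?a" by (rule scale) simp
    also have "\<zeta> / 2 * \<bar>1 / t\<bar> = \<bar>\<zeta> / 2 * (1 / t)\<bar>" using zeta by (simp add: abs_mult)
    also have "\<zeta> / 2 * (1 / t) = ?\<phi> t - 1 / 2" by (simp add: field_simps)
    finally show "(\<integral>\<omega>. (G t \<omega>)\<^sup>2 \<partial>M) \<le> B * \<bar>?\<phi> t - 1 / 2\<bar> powr ?a" .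
  qed
qed

end
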